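(* Let $a>0$, $b>0$ and $\nu\ge 0$ be real numbers with $\nu\ne 0,\frac12,1,\frac32,2,\ldots$ and $a\le b$. Then the following convergent expansion holds: $$\sum_{n=1}^\infty \frac{e^{-an}}{(\frac12 bn)^\nu}\,K_\nu(bn)=\frac{\sqrt{\pi}}{2b}\,\Gamma(\tfrac12-\nu)\left(1-\frac{a^2}{b^2}\right)^{\nu-\frac12}+\frac{\pi\csc \pi\nu}{4\,\Gamma(1+\nu)}-\frac{a}{b^2}\,\Gamma(1-\nu)\,{}_2F_1\left(1,1-\nu;\frac32;\frac{a^2}{b^2}\right)$$ $$\qquad-\frac{1}{2\sin \pi\nu}\sum_{m,n\ge0}(-1)^{m+n}\left\{A_{m,n}\left(\frac{a}{2\pi}\right)^{2m+1}\left(\frac{b}{2\pi}\right)^{2n}+B_{m,n}\left(\frac{a}{2\pi}\right)^{m}\left(\frac{b}{2\pi}\right)^{2n-2\nu}\right\},$$ provided $a<2\pi$ and $b<2\pi$. Here $$A_{m,n}=\frac{\Gamma(m+n+1)\,\Gamma(m+n+\frac32)}{m!\,n!\,\Gamma(m+\frac32)\,\Gamma(n+1+\nu)}\,\zeta(2m+2n+2),$$ $$B_{m,n}=\frac{\Gamma(\frac12 m+n+\frac12-\nu)\,\Gamma(\frac12 m+n+1-\nu)}{\Gamma(\frac12 m+\frac12)\,\Gamma(\frac12 m+1)\,n!\,\Gamma(n+1-\nu)}\,\frac{\zeta(m+2n+1-2\nu)}{\csc \pi(\frac12 m-\nu)}.$$ The last term on the right-hand side (the double sum with its prefactor $-\frac{1}{2\sin\pi\nu}$)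 can be written in the alternative (asymptotic) form $$-\frac{1}{2\sin \pi\nu}\sum_{k=0}^\infty(-1)^k D_k\left(\frac{a}{2\pi}\right)^k,$$ where the coefficients $D_k$ are defined by $$D_{2k}=C'_{2k},\qquad D_{2k+1}=C'_{2k+1}+(-1)^{k-1}C_k\qquad (k=0,1,2,\ldots),$$ with $$C_k=\sum_{n=0}^\infty A_{k,n}\left(\frac{b}{2\pi}\right)^{2n},\qquad C'_k=\sum_{n=0}^\infty(-1)^n B_{k,n}\left(\frac{b}{2\pi}\right)^{2n-2\nu}\qquad (b<2\pi).$$
   Context: $K_\nu$ is the modified Bessel function of the second kind of order $\nu$, ${}_2F_1$ is the Gauss hypergeometric function, $\Gamma$ is the gamma function, and $\zeta$ is the Riemann zeta function (analytically continued).
   Formalization: C_k carries a factor (-1)^n missing in print (without it the D_k series has a different sum); for a=b, ν<1/2, where two terms are infinite, their sum is read as the limit a→b−; the double sum is read as both iterated sums converging to the same value. *)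

theory Defs
  imports "HOL-Complex_Analysis.Complex_Analysis"
begin

definition csc :: "real \<Rightarrow> real" where
  "csc x = 1 / sin x"

definition bessel_I :: "real \<Rightarrow> real \<Rightarrow> real" where
  "bessel_I \<nu> x = (\<Sum>k. rGamma (real k + \<nu> + 1) / fact k * (x / 2) powr (2 * real k + \<nu>))"

(* Meant for x > 0. At integer order the quotient is 0/0 and K is its limit in the order. *)
definition bessel_K :: "real \<Rightarrow> real \<Rightarrow> real" where
  "bessel_K \<nu> x =
     (let q = (\<lambda>\<mu>. pi / 2 * ((bessel_I (- \<mu>) x - bessel_I \<mu> x) / sin (pi * \<mu>)))
      in if \<nu> \<in> \<int> then Lim (at \<nu>) q else q \<nu>)"

(* The Gauss series; for real c not a nonpositive integer it converges for |z| < 1, and at z = 1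
   exactly when c - a - b > 0 (apart from terminating cases). *)
definition hyp2F1 :: "real \<Rightarrow> real \<Rightarrow> real \<Rightarrow> real \<Rightarrow> real" where
  "hyp2F1 a b c z = eval_fps (fps_hypergeo [a, b] [c] 1) z"

(* Analytic continuation of the Dirichlet series to the plane without 1; the value 0 at the pole
   is a convention that only serves to make the function unique. *)
definition riemann_zeta :: "complex \<Rightarrow> complex" where
  "riemann_zeta = (THE f. f holomorphic_on (- {1}) \<and> f 1 = 0 \<and>
      (\<forall>s. Re s > 1 \<longrightarrow> f s = (\<Sum>n. 1 / of_nat (Suc n) powr s)))"

(* Convergence of a double series, in the sense that both iterated series converge, to the same
   sum. Unconditional convergence would be too strong: the series below has this property
   only for a + b < 2 * pi. *)
definition double_sums :: "(nat \<Rightarrow> nat \<Rightarrow> real) \<Rightarrow> real \<Rightarrow> bool" where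
  "double_sums f s \<longleftrightarrow>
     (\<forall>m. summable (\<lambda>n. f m n)) \<and> (\<lambda>m. \<Sum>n. f m n) sums s \<and>
     (\<forall>n. summable (\<lambda>m. f m n)) \<and> (\<lambda>n. \<Sum>m. f m n) sums s"

definition coeff_A :: "real \<Rightarrow> nat \<Rightarrow> nat \<Rightarrow> real" where
  "coeff_A \<nu> m n =
     Gamma (real m + real n + 1) * Gamma (real m + real n + 3/2) /
       (fact m * fact n * Gamma (real m + 3/2) * Gamma (real n + 1 + \<nu>)) *
     Re (riemann_zeta (of_real (2 * real m + 2 * real n + 2)))"

definition coeff_B :: "real \<Rightarrow> nat \<Rightarrow> nat \<Rightarrow> real" where
  "coeff_B \<nu> m n =
     Gamma (real m / 2 + real n + 1/2 - \<nu>) * Gamma (real m / 2 + real n + 1 - \<nu>) /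
       (Gamma (real m / 2 + 1/2) * Gamma (real m / 2 + 1) * fact n * Gamma (real n + 1 - \<nu>)) *
     (Re (riemann_zeta (of_real (real m + 2 * real n + 1 - 2 * \<nu>))) / csc (pi * (real m / 2 - \<nu>)))"

definition double_term :: "real \<Rightarrow> real \<Rightarrow> real \<Rightarrow> nat \<Rightarrow> nat \<Rightarrow> real" where
  "double_term \<nu> a b m n = (-1) ^ (m + n) *
     (coeff_A \<nu> m n * (a / (2 * pi)) ^ (2 * m + 1) * (b / (2 * pi)) ^ (2 * n) +
      coeff_B \<nu> m n * (a / (2 * pi)) ^ m * (b / (2 * pi)) powr (2 * real n - 2 * \<nu>))"

(* The factor (-1) ^ n, here as in C_prime_term, is the one carried by the double series; without
   it the regrouped series has a different sum. *)
definition C_term :: "real \<Rightarrow> real \<Rightarrow> nat \<Rightarrow> nat \<Rightarrow> real" where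
  "C_term \<nu> b k n = (-1) ^ n * coeff_A \<nu> k n * (b / (2 * pi)) ^ (2 * n)"

definition C_prime_term :: "real \<Rightarrow> real \<Rightarrow> nat \<Rightarrow> nat \<Rightarrow> real" where
  "C_prime_term \<nu> b k n = (-1) ^ n * coeff_B \<nu> k n * (b / (2 * pi)) powr (2 * real n - 2 * \<nu>)"

definition coeff_C :: "real \<Rightarrow> real \<Rightarrow> nat \<Rightarrow> real" where
  "coeff_C \<nu> b k = (\<Sum>n. C_term \<nu> b k n)"

definition coeff_C_prime :: "real \<Rightarrow> real \<Rightarrow> nat \<Rightarrow> real" where
  "coeff_C_prime \<nu> b k = (\<Sum>n. C_prime_term \<nu> b k n)"

definition coeff_D :: "real \<Rightarrow> real \<Rightarrow> nat \<Rightarrow> real" where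
  "coeff_D \<nu> b j =
     (if even j then coeff_C_prime \<nu> b j
      else coeff_C_prime \<nu> b j + (-1) powi (int (j div 2) - 1) * coeff_C \<nu> b (j div 2))"

definition lhs_term :: "real \<Rightarrow> real \<Rightarrow> real \<Rightarrow> nat \<Rightarrow> real" where
  "lhs_term \<nu> a b n =
     exp (- a * real n) / (b * real n / 2) powr \<nu> * bessel_K \<nu> (b * real n)"

(* The two terms that are singular at a = b when \<nu> < 1/2, where their singularities cancel. *)
definition singular_terms :: "real \<Rightarrow> real \<Rightarrow> real \<Rightarrow> real" where
  "singular_terms \<nu> a b =
     sqrt pi / (2 * b) * Gamma (1/2 - \<nu>) * (1 - a\<^sup>2 / b\<^sup>2) powr (\<nu> - 1/2)
     - a / b\<^sup>2 * Gamma (1 - \<nu>) * hyp2F1 1 (1 - \<nu>) (3/2) (a\<^sup>2 / b\<^sup>2)"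

end

theory Submission
  imports Defs "HOL-Real_Asymp.Real_Asymp"
begin

text \<open>
  Write \<open>K\<^sub>\<nu>\<close> through \<open>I\<^sub>-\<^sub>\<nu> - I\<^sub>\<nu>\<close>. For \<open>a > b\<close> the power series of these functions may be summed over \<open>n\<close> termwise,
  and Lipschitz' formula expands each \<open>\<Sum>n. n\<^sup>p e\<^bsup>-an\<^esup>\<close> into \<open>\<Gamma>(p+1) a\<^bsup>-p-1\<^esup>\<close> and a power series in \<open>a\<close> with
  zeta values as coefficients. The latter make up the double series; the former sum to a function \<open>f\<close> that
  satisfies \<open>(w\<^sup>2 - b\<^sup>2) f' - (2\<nu> - 1) w f = const\<close>. The left-hand side and the double series are holomorphic
  in \<open>a\<close> for \<open>Re a > 0\<close>, \<open>\<bar>a\<bar> < 2\<pi>\<close>, so their combination solves the same equation also for \<open>a < b\<close>.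
  There the general solution is the hypergeometric term plus a multiple of \<open>(1 - a\<^sup>2/b\<^sup>2)\<^bsup>\<nu>-1/2\<^esup>\<close>, and
  regularity at \<open>a = b\<close> determines the multiple.

  For \<open>a + b \<ge> 2\<pi>\<close> the double series does not converge absolutely. Replacing \<open>\<zeta>\<close> by \<open>\<zeta> - 1\<close> gives an absolutely
  convergent series; the rest is the expansion of \<open>2 Re f(a + 2\<pi>i)\<close>, which may be summed in both orders because the
  differential equation continues \<open>f\<close> to the upper half plane.
\<close>

section \<open>Modified Bessel functions of nonintegral order\<close>

text \<open>\<open>bessel_K\<close> is given only as a difference of two exponentially growing power
  series, so even its boundedness, which makes the left-hand side holomorphic in \<open>a\<close>,
  has to be extracted from cancellation: the quotient of the two series is compared with its limit
  1. \<open>riemann_zeta\<close> is a definite description, so zeta must first be constructed; the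
  same lattice sums do this. Lipschitz' formula is established for exponents in (1/2, 1), where an
  integral over inverse squares is easily dominated, and other exponents are reached by continuation
  in the exponent. No separate functional equation is needed: the lattice yields zeta values
  directly in the reflected form, with a cosine and a Gamma function, in which A and B contain them.
  The multiple of (1 - a^2/b^2)^(nu - 1/2) is a Beta integral over (0, b) when nu < 1/2; larger nu
  are lowered in steps of 1 through division by w^2 - b^2, which needs holomorphy at b. The
  condition on nu guards two things: integral nu makes sin(pi nu) vanish, half-integral nu gives
  poles of Gamma in B and in that multiple.\<close>

definition bessel_series :: "real \<Rightarrow> real \<Rightarrow> real" where
  "bessel_series \<mu> q = (\<Sum>k. rGamma (real k + \<mu> + 1) / fact k * q ^ k)"

lemma rGamma_shift_real: "rGamma (z::real) = z * rGamma (z + 1)"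
  by (simp add: rGamma_plus1)

lemma summable_bessel_series: "summable (\<lambda>k. rGamma (real k + \<mu> + 1) / fact k * q ^ k)"
proof -
  let ?a = "\<lambda>k. rGamma (real k + \<mu> + 1) / fact k * q ^ k"
  \<comment> \<open>The ratio of consecutive terms is
    \<open>q / ((k + 1) * (k + \<mu> + 1))\<close>; from this \<open>N\<close> on the second factor
    is positive and at least twice the absolute value of \<open>q\<close>.\<close>
  obtain N :: nat where N: "real N \<ge> \<bar>\<mu>\<bar> + 2 * \<bar>q\<bar> + 1"
    using real_arch_simple by blast
  have "norm (?a (Suc k)) \<le> 1/2 * norm (?a k)" if "k \<ge> N" for k
  proof -
    have k: "real k \<ge> \<bar>\<mu>\<bar> + 2 * \<bar>q\<bar> + 1" using that N by linarith
    hence pos: "real k + \<mu> + 1 \<ge> 2 * \<bar>q\<bar> + 2" by linarith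
    have eq: "rGamma (real k + \<mu> + 1) = (real k + \<mu> + 1) * rGamma (real (Suc k) + \<mu> + 1)"
      using rGamma_shift_real[of "real k + \<mu> + 1"] by (simp add: add_ac)
    have "norm (?a (Suc k)) = \<bar>rGamma (real (Suc k) + \<mu> + 1)\<bar> / fact (Suc k) * \<bar>q\<bar> ^ Suc k"
      by (simp add: abs_mult power_abs)
    also have "\<dots> = \<bar>rGamma (real (Suc k) + \<mu> + 1)\<bar> / fact k * \<bar>q\<bar> ^ k * (\<bar>q\<bar> / real (Suc k))"
      by (simp add: field_simps)
    also have "\<dots> \<le> \<bar>rGamma (real (Suc k) + \<mu> + 1)\<bar> / fact k * \<bar>q\<bar> ^ k * (1/2 * (real k + \<mu> + 1))"
    proof (rule mult_left_mono)
      have "\<bar>q\<bar> / real (Suc k) \<le> \<bar>q\<bar>"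
        by (simp add: divide_le_eq mult_le_cancel_left1)
      moreover have "\<bar>q\<bar> \<le> 1/2 * z" if "z \<ge> 2 * \<bar>q\<bar> + 2" for z using that by linarith
      note this[OF pos]
      ultimately show "\<bar>q\<bar> / real (Suc k) \<le> 1/2 * (real k + \<mu> + 1)" by (rule order_trans)
    qed auto
    also have "\<dots> = 1/2 * norm (?a k)"
      unfolding eq using pos by (simp add: abs_mult power_abs mult_ac)
    finally show ?thesis .
  qed
  thus ?thesis by (intro summable_ratio_test[of "1/2" N]) auto
qed

lemma has_real_derivative_bessel_series:
  "(bessel_series \<mu> has_real_derivative bessel_series (\<mu> + 1) q) (at q)"
proof -
  let ?c = "\<lambda>k. rGamma (real k + \<mu> + 1) / fact k :: real"
  have "((\<lambda>x. \<Sum>n. ?c n * x ^ n) has_field_derivative (\<Sum>n. diffs ?c n * q ^ n)) (at q)"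
    by (rule termdiffs_strong_converges_everywhere) (rule summable_bessel_series)
  moreover have "diffs ?c n = rGamma (real n + (\<mu> + 1) + 1) / fact n" for n
    by (simp add: diffs_def add_ac)
  ultimately show ?thesis
    unfolding bessel_series_def[abs_def] by simp
qed

lemma bessel_series_0: "bessel_series \<mu> 0 = rGamma (\<mu> + 1)"
  unfolding bessel_series_def by (subst suminf_finite[of "{0}"]) auto

lemma sums_bessel_series_mult_index:
  "(\<lambda>k. real k * (rGamma (real k + \<mu> + 1) / fact k * q ^ k)) sums (q * bessel_series (\<mu>+1) q)"
proof -
  have "(\<lambda>k. rGamma (real k + (\<mu> + 1) + 1) / fact k * q ^ k) sums bessel_series (\<mu>+1) q"
    unfolding bessel_series_def by (rule summable_sums, rule summable_bessel_series)
  hence "(\<lambda>k. q * (rGamma (real k + (\<mu> + 1) + 1) / fact k * q ^ k)) sums (q * bessel_series (\<mu>+1) q)"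
    by (rule sums_mult)
  also have "(\<lambda>k. q * (rGamma (real k + (\<mu> + 1) + 1) / fact k * q ^ k)) =
      (\<lambda>k. real (Suc k) * (rGamma (real (Suc k) + \<mu> + 1) / fact (Suc k) * q ^ Suc k))"
    by (rule ext) (simp add: add_ac)
  finally show ?thesis
    by (subst (asm) sums_Suc_iff) simp
qed

text \<open>Splits the factor \<open>k + \<mu>\<close> produced by the shift of
  \<open>rGamma\<close>. For I it is the three-term recurrence I_(mu-1) - I_(mu+1) = (2 mu / x)
  I_mu. Since \<open>rGamma\<close> is entire, no order is exceptional.\<close>

lemma bessel_series_recurrence:
  "bessel_series (\<mu> - 1) q = \<mu> * bessel_series \<mu> q + q * bessel_series (\<mu> + 1) q"
proof -
  have s0: "(\<lambda>k. rGamma (real k + \<mu> + 1) / fact k * q ^ k) sums bessel_series \<mu> q"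
    unfolding bessel_series_def by (rule summable_sums, rule summable_bessel_series)
  note s1 = sums_bessel_series_mult_index[of \<mu> q]
  have "(\<lambda>k. \<mu> * (rGamma (real k + \<mu> + 1) / fact k * q ^ k) + real k * (rGamma (real k + \<mu> + 1) / fact k * q ^ k))
      sums (\<mu> * bessel_series \<mu> q + q * bessel_series (\<mu> + 1) q)"
    by (intro sums_add sums_mult s0 s1)
  also have "(\<lambda>k. \<mu> * (rGamma (real k + \<mu> + 1) / fact k * q ^ k) + real k * (rGamma (real k + \<mu> + 1) / fact k * q ^ k))
      = (\<lambda>k. rGamma (real k + (\<mu> - 1) + 1) / fact k * q ^ k)"
  proof
    fix k
    have "rGamma (real k + \<mu>) = (real k + \<mu>) * rGamma (real k + \<mu> + 1)"
      by (rule rGamma_shift_real)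
    thus "\<mu> * (rGamma (real k + \<mu> + 1) / fact k * q ^ k) + real k * (rGamma (real k + \<mu> + 1) / fact k * q ^ k)
      = rGamma (real k + (\<mu> - 1) + 1) / fact k * q ^ k" by (simp add: field_simps)
  qed
  finally show ?thesis by (simp add: bessel_series_def sums_iff)
qed

lemma bessel_series_pos:
  assumes "\<mu> > -1" "q \<ge> 0"
  shows "bessel_series \<mu> q > 0"
proof -
  have pos: "rGamma (real k + \<mu> + 1) > 0" for k
    using assms by (simp add: rGamma_inverse_Gamma)
  have "0 < rGamma (\<mu> + 1)" using pos[of 0] by simp
  also have "\<dots> \<le> bessel_series \<mu> q"
    unfolding bessel_series_def
    using sum_le_suminf[OF summable_bessel_series[of \<mu> q], of "{0}"] pos assms
    by (simp add: less_imp_le)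
  finally show ?thesis .
qed

text \<open>Weighting index \<open>k\<close> by \<open>q\<^sup>k / (k! \<Gamma>(k + \<mu> + 1))\<close>, the mean of \<open>k (k + \<mu>)\<close> is \<open>q\<close>; the variance
  of \<open>k\<close> being nonnegative, this bounds the logarithmic derivative.\<close>

lemma bessel_series_log_deriv:
  assumes mu: "\<mu> > -1" and q: "q > 0"
  defines "e \<equiv> q * bessel_series (\<mu> + 1) q / bessel_series \<mu> q"
  shows "e\<^sup>2 + \<mu> * e \<le> q"
proof -
  let ?w = "\<lambda>k. rGamma (real k + \<mu> + 1) / fact k * q ^ k"
  let ?p = "bessel_series \<mu> q" and ?p1 = "bessel_series (\<mu>+1) q" and ?p2 = "bessel_series (\<mu>+2) q"
  have p: "?p > 0" using bessel_series_pos[of \<mu> q] mu q by simp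
  have wpos: "?w k \<ge> 0" for k using mu q by (simp add: rGamma_inverse_Gamma)
  have s0: "?w sums ?p"
    unfolding bessel_series_def by (rule summable_sums, rule summable_bessel_series)
  have s1: "(\<lambda>k. real k * ?w k) sums (q * ?p1)" by (rule sums_bessel_series_mult_index)
  have "(\<lambda>k. q * (real k * (rGamma (real k + (\<mu> + 1) + 1) / fact k * q ^ k))) sums (q * (q * bessel_series (\<mu>+1+1) q))"
    by (intro sums_mult sums_bessel_series_mult_index)
  also have "(\<lambda>k. q * (real k * (rGamma (real k + (\<mu> + 1) + 1) / fact k * q ^ k))) =
     (\<lambda>k. real (Suc k) * (real (Suc k) - 1) * ?w (Suc k))"
  proof
    fix k
    have "rGamma (real k + (\<mu> + 1) + 1) = rGamma (real (Suc k) + \<mu> + 1)" by (simp add: add_ac)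
    moreover have "q * (real k * (g / fact k * q ^ k)) = real (Suc k) * (real (Suc k) - 1) * (g / fact (Suc k) * q ^ Suc k)" for g
      by (simp add: divide_simps)
    ultimately show "q * (real k * (rGamma (real k + (\<mu> + 1) + 1) / fact k * q ^ k)) =
     real (Suc k) * (real (Suc k) - 1) * ?w (Suc k)" by simp
  qed
  finally have s2: "(\<lambda>k. real k * (real k - 1) * ?w k) sums (q * (q * ?p2))"
    by (subst (asm) sums_Suc_iff) (simp add: add_ac)
  have "(\<lambda>k. real k * (real k - 1) * ?w k + (1 - 2 * e) * (real k * ?w k) + e\<^sup>2 * ?w k) sums
      (q * (q * ?p2) + (1 - 2 * e) * (q * ?p1) + e\<^sup>2 * ?p)"
    by (intro sums_add sums_mult s0 s1 s2)
  moreover have "real k * (real k - 1) * ?w k + (1 - 2 * e) * (real k * ?w k) + e\<^sup>2 * ?w k = (real k - e)\<^sup>2 * ?w k" for k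
  proof -
    have "real k * (real k - 1) * w + (1 - 2 * e) * (real k * w) + e\<^sup>2 * w = (real k - e)\<^sup>2 * w" for w
      by (simp add: algebra_simps power2_eq_square)
    thus ?thesis .
  qed
  ultimately have sq: "(\<lambda>k. (real k - e)\<^sup>2 * ?w k) sums (q * (q * ?p2) + (1 - 2 * e) * (q * ?p1) + e\<^sup>2 * ?p)"
    by simp
  have ge: "q * (q * ?p2) + (1 - 2 * e) * (q * ?p1) + e\<^sup>2 * ?p \<ge> 0"
    by (rule sums_le[OF _ sums_zero sq]) (intro mult_nonneg_nonneg wpos zero_le_power2)
  \<comment> \<open>The recurrence eliminates the second factorial moment, so that nonnegativity of
    the variance becomes an inequality in \<open>e\<close> alone.\<close>
  have "?p = (\<mu> + 1) * ?p1 + q * ?p2"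
    using bessel_series_recurrence[of "\<mu>+1" q] by (simp add: add_ac)
  hence qp2: "q * ?p2 = ?p - (\<mu> + 1) * ?p1" by simp
  have qp1: "q * ?p1 = e * ?p" using p by (simp add: e_def)
  have "q * (q * ?p2) = q * ?p - (\<mu> + 1) * (q * ?p1)" unfolding qp2 by (simp add: algebra_simps)
  with ge have "(q - (\<mu> * e + e\<^sup>2)) * ?p \<ge> 0" unfolding qp1
    by (simp add: algebra_simps power2_eq_square)
  hence "q - (\<mu> * e + e\<^sup>2) \<ge> 0" using p by (simp add: zero_le_mult_iff)
  thus ?thesis by simp
qed

text \<open>This is \<open>I\<^sub>\<mu>(2 \<surd>q)\<close>.\<close>

definition bessel_I_root :: "real \<Rightarrow> real \<Rightarrow> real" where
  "bessel_I_root \<mu> q = q powr (\<mu>/2) * bessel_series \<mu> q"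

section \<open>Comparison of different orders at infinity\<close>

lemma bessel_I_root_pos: "\<mu> > -1 \<Longrightarrow> q > 0 \<Longrightarrow> bessel_I_root \<mu> q > 0"
  by (simp add: bessel_I_root_def bessel_series_pos)

lemma powr_half_shift: "q > 0 \<Longrightarrow> q powr ((\<mu> + 1)/2) = q powr (\<mu>/2) * sqrt q"
  by (simp add: add_divide_distrib powr_add powr_half_sqrt)

text \<open>The quotient is the logarithmic derivative divided by \<open>sqrt q\<close>, and the
  quadratic inequality for the former bounds it by \<open>sqrt q\<close> plus the absolute value of
  \<open>\<mu>\<close>.\<close>

lemma bessel_I_root_ratio_le:
  assumes mu: "\<mu> > -1" and q: "q > 0"
  shows "bessel_I_root (\<mu> + 1) q / bessel_I_root \<mu> q \<le> 1 + \<bar>\<mu>\<bar> / sqrt q"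
proof -
  let ?e = "q * bessel_series (\<mu> + 1) q / bessel_series \<mu> q"
  have p: "bessel_series \<mu> q > 0" "bessel_series (\<mu>+1) q > 0"
    using bessel_series_pos[of _ q] mu q by auto
  have e0: "?e > 0" using p q by simp
  have le: "?e\<^sup>2 + \<mu> * ?e \<le> q" by (rule bessel_series_log_deriv) fact+
  have "?e \<le> sqrt q + \<bar>\<mu>\<bar>"
  proof (rule ccontr)
    assume "\<not> ?thesis"
    hence "?e - \<bar>\<mu>\<bar> > sqrt q" by simp
    hence "?e * (?e - \<bar>\<mu>\<bar>) > sqrt q * sqrt q"
      using q e0 by (intro mult_strict_mono) auto
    moreover have "\<mu> * ?e \<ge> - (\<bar>\<mu>\<bar> * ?e)" using e0 by (metis abs_ge_minus_self abs_mult abs_of_pos minus_le_iff)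
    ultimately show False using le q by (simp add: algebra_simps power2_eq_square)
  qed
  moreover have "bessel_I_root (\<mu> + 1) q / bessel_I_root \<mu> q = ?e / sqrt q"
    unfolding bessel_I_root_def powr_half_shift[OF q] using p q real_sqrt_mult_self[of q]
    by (simp add: field_simps)
  moreover have "(sqrt q + \<bar>\<mu>\<bar>) / sqrt q = 1 + \<bar>\<mu>\<bar> / sqrt q" using q by (simp add: field_simps)
  ultimately show ?thesis using q by (metis divide_right_mono real_sqrt_ge_zero less_imp_le)
qed

lemma bessel_I_root_recurrence:
  assumes "q > 0"
  shows "bessel_I_root \<mu> q = (\<mu> + 1) / sqrt q * bessel_I_root (\<mu> + 1) q + bessel_I_root (\<mu> + 2) q"
proof -
  have 1: "q powr ((\<mu> + 2)/2) = q powr (\<mu>/2) * q" using assms by (simp add: add_divide_distrib powr_add)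
  have "bessel_series \<mu> q = (\<mu> + 1) * bessel_series (\<mu> + 1) q + q * bessel_series (\<mu> + 2) q"
    using bessel_series_recurrence[of "\<mu>+1" q] by (simp add: add_ac)
  thus ?thesis unfolding bessel_I_root_def 1 powr_half_shift[OF assms] using assms
    by (simp add: field_simps)
qed

text \<open>The recurrence expresses the inverted quotient through the quotient one order higher, to
  which the previous bound applies.\<close>

lemma bessel_I_root_ratio_ge:
  assumes mu: "\<mu> > -1" and q: "q > 0"
  shows "bessel_I_root \<mu> q / bessel_I_root (\<mu> + 1) q \<le> 1 + 2 * (\<mu> + 1) / sqrt q"
proof -
  have p: "bessel_I_root (\<mu> + 1) q > 0" using bessel_I_root_pos mu q by auto
  have "bessel_I_root \<mu> q / bessel_I_root (\<mu> + 1) q = (\<mu> + 1) / sqrt q + bessel_I_root (\<mu> + 1 + 1) q / bessel_I_root (\<mu> + 1) q"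
    using bessel_I_root_recurrence[of q \<mu>] p q by (simp add: field_simps)
  also have "\<dots> \<le> (\<mu> + 1) / sqrt q + (1 + \<bar>\<mu> + 1\<bar> / sqrt q)"
    using bessel_I_root_ratio_le[of "\<mu> + 1" q] mu q by (intro add_left_mono) auto
  also have "\<dots> = 1 + 2 * (\<mu> + 1) / sqrt q" using mu by (simp add: add_divide_distrib)
  finally show ?thesis .
qed

lemma bessel_I_root_ratio_tendsto:
  assumes mu: "\<mu> > -1"
  shows "((\<lambda>q. bessel_I_root (\<mu> + 1) q / bessel_I_root \<mu> q) \<longlongrightarrow> 1) at_top"
proof (rule real_tendsto_sandwich)
  show "((\<lambda>q. 1 / (1 + 2 * (\<mu> + 1) / sqrt q)) \<longlongrightarrow> 1) at_top" by real_asymp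
  show "\<forall>\<^sub>F q in at_top. bessel_I_root (\<mu> + 1) q / bessel_I_root \<mu> q \<le> 1 + \<bar>\<mu>\<bar> / sqrt q"
    using eventually_gt_at_top[of 0] by eventually_elim (rule bessel_I_root_ratio_le[OF mu])
  show "((\<lambda>q. 1 + \<bar>\<mu>\<bar> / sqrt q) \<longlongrightarrow> 1) at_top" by real_asymp
  show "\<forall>\<^sub>F q in at_top. 1 / (1 + 2 * (\<mu> + 1) / sqrt q) \<le> bessel_I_root (\<mu> + 1) q / bessel_I_root \<mu> q"
    using eventually_gt_at_top[of 0]
  proof eventually_elim
    case (elim q)
    have "bessel_I_root \<mu> q > 0" "bessel_I_root (\<mu>+1) q > 0" using bessel_I_root_pos mu elim by auto
    moreover have "1 + 2 * (\<mu> + 1) / sqrt q > 0" using mu elim by (simp add: add_pos_nonneg)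
    ultimately show ?case using bessel_I_root_ratio_ge[OF mu elim]
      by (simp add: field_simps)
  qed
qed

text \<open>Log-convexity of Gamma between \<open>y\<close> and \<open>y + 1\<close>. It serves to
  compare orders that do not differ by an integer.\<close>

lemma Gamma_shift_le:
  fixes y \<theta> :: real
  assumes y: "y > 0" and th: "0 \<le> \<theta>" "\<theta> \<le> 1"
  shows "Gamma (y + \<theta>) \<le> Gamma y * y powr \<theta>"
proof -
  have "(ln \<circ> Gamma) ((1 - \<theta>) *\<^sub>R y + \<theta> *\<^sub>R (y + 1)) \<le> (1 - \<theta>) * (ln \<circ> Gamma) y + \<theta> * (ln \<circ> Gamma) (y + 1)"
    using y th by (intro convex_onD[OF log_convex_Gamma_real]) auto
  also have "(1 - \<theta>) *\<^sub>R y + \<theta> *\<^sub>R (y + 1) = y + \<theta>" by (simp add: algebra_simps)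
  also have "(ln \<circ> Gamma) (y + 1) = ln (Gamma y) + ln y"
  proof -
    have "Gamma (y + 1) = y * Gamma y" using y by (intro Gamma_plus1) auto
    moreover have "Gamma y > 0" using y by (rule Gamma_real_pos)
    ultimately show ?thesis using y by (simp add: ln_mult_pos)
  qed
  finally have "ln (Gamma (y + \<theta>)) \<le> ln (Gamma y) + \<theta> * ln y" by (simp add: algebra_simps)
  also have "\<dots> = ln (Gamma y * y powr \<theta>)"
    using y Gamma_real_pos[OF y] by (simp add: ln_mult_pos ln_powr)
  finally show ?thesis using y th by simp
qed

text \<open>The tangent at \<open>t\<close> lies below the convex function. The bound is affine in
  \<open>y\<close>, so averaging it over the terms of the Bessel series involves only their first
  moment.\<close>

lemma powr_neg_ge_tangent:
  fixes y t \<theta> :: real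
  assumes "y > 0" "t > 0" "0 \<le> \<theta>"
  shows "y powr (-\<theta>) \<ge> t powr (-\<theta>) * (1 + \<theta> - \<theta> * y / t)"
proof -
  have "1 + \<theta> - \<theta> * y / t \<le> 1 - \<theta> * ln (y / t)"
  proof -
    have "ln (y/t) \<le> y/t - 1" using assms by (intro ln_le_minus_one) simp
    hence "\<theta> * ln (y/t) \<le> \<theta> * (y/t - 1)" using assms by (intro mult_left_mono)
    thus ?thesis by (simp add: algebra_simps)
  qed
  also have "\<dots> \<le> exp (- \<theta> * ln (y/t))" using exp_ge_add_one_self[of "-\<theta> * ln (y/t)"] by simp
  also have "\<dots> = (y/t) powr (-\<theta>)" using assms by (simp add: powr_def)
  finally have "t powr (-\<theta>) * (1 + \<theta> - \<theta> * y / t) \<le> t powr (-\<theta>) * (y/t) powr (-\<theta>)"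
    by (intro mult_left_mono) auto
  also have "\<dots> = y powr (-\<theta>)" using assms by (simp flip: powr_mult)
  finally show ?thesis .
qed

text \<open>Termwise, raising the order by \<open>\<theta>\<close> costs at most the factor
  \<open>y powr \<theta>\<close> with \<open>y = k + \<mu> + 1\<close>. The tangent is taken at
  \<open>sqrt q\<close>, around which \<open>y\<close> concentrates for large \<open>q\<close>; the
  prefactor \<open>q powr (\<theta>/2)\<close> cancels the value of the power there.\<close>

lemma bessel_I_root_fractional_shift_ge:
  assumes mu: "\<mu> > -1" and th: "0 \<le> \<theta>" "\<theta> \<le> 1" and q: "q > 0"
  shows "bessel_I_root (\<mu> + \<theta>) q / bessel_I_root \<mu> q \<ge>
           1 + \<theta> - \<theta> * ((\<mu> + 1) / sqrt q + bessel_I_root (\<mu> + 1) q / bessel_I_root \<mu> q)"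
proof -
  let ?t = "sqrt q"
  let ?w = "\<lambda>k. rGamma (real k + \<mu> + 1) / fact k * q ^ k"
  let ?v = "\<lambda>k. rGamma (real k + (\<mu> + \<theta>) + 1) / fact k * q ^ k"
  let ?p = "bessel_series \<mu> q" and ?p1 = "bessel_series (\<mu>+1) q"
  have p: "?p > 0" using bessel_series_pos[of \<mu> q] mu q by simp
  have s0: "?w sums ?p"
    unfolding bessel_series_def by (rule summable_sums, rule summable_bessel_series)
  have s1: "(\<lambda>k. real k * ?w k) sums (q * ?p1)" by (rule sums_bessel_series_mult_index)
  have sv: "?v sums bessel_series (\<mu> + \<theta>) q"
    unfolding bessel_series_def by (rule summable_sums, rule summable_bessel_series)
  have tsum: "(\<lambda>k. ?t powr (-\<theta>) * ((1 + \<theta> - \<theta> * (\<mu> + 1) / ?t) * ?w k + (- \<theta> / ?t) * (real k * ?w k))) sums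
     (?t powr (-\<theta>) * ((1 + \<theta> - \<theta> * (\<mu> + 1) / ?t) * ?p + (- \<theta> / ?t) * (q * ?p1)))"
    by (intro sums_mult sums_add s0 s1)
  have tle: "?t powr (-\<theta>) * ((1 + \<theta> - \<theta> * (\<mu> + 1) / ?t) * ?w k + (- \<theta> / ?t) * (real k * ?w k)) \<le> ?v k" for k
  proof -
    let ?y = "real k + \<mu> + 1"
    have y: "?y > 0" using mu by simp
    have G: "Gamma ?y > 0" "Gamma (?y + \<theta>) > 0" using y th by auto
    have "?t powr (-\<theta>) * (1 + \<theta> - \<theta> * ?y / ?t) \<le> ?y powr (-\<theta>)"
      by (rule powr_neg_ge_tangent) (use y q th in auto)
    hence "?t powr (-\<theta>) * (1 + \<theta> - \<theta> * ?y / ?t) * ?w k \<le> ?y powr (-\<theta>) * ?w k"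
      using y q by (intro mult_right_mono) (auto simp: rGamma_inverse_Gamma)
    also have "\<dots> \<le> ?v k"
    proof -
      have "?y powr (-\<theta>) * rGamma ?y \<le> rGamma (?y + \<theta>)"
        using Gamma_shift_le[OF y th] G y
        by (simp add: rGamma_inverse_Gamma powr_minus field_simps)
      hence "?y powr (-\<theta>) * rGamma ?y * (q ^ k / fact k) \<le> rGamma (?y + \<theta>) * (q ^ k / fact k)"
        using q by (intro mult_right_mono) auto
      thus ?thesis by (simp add: add_ac)
    qed
    finally show ?thesis by (simp add: algebra_simps add_divide_distrib)
  qed
  have le: "?t powr (-\<theta>) * ((1 + \<theta> - \<theta> * (\<mu> + 1) / ?t) * ?p + (- \<theta> / ?t) * (q * ?p1)) \<le> bessel_series (\<mu> + \<theta>) q"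
    by (rule sums_le[OF tle tsum sv])
  have tq: "?t powr (-\<theta>) * q powr (\<theta>/2) = 1"
    using q by (simp add: powr_half_sqrt[symmetric] powr_powr powr_minus field_simps)
  have "bessel_I_root (\<mu> + \<theta>) q / bessel_I_root \<mu> q = q powr (\<theta>/2) * bessel_series (\<mu> + \<theta>) q / ?p"
    using q p by (simp add: bessel_I_root_def add_divide_distrib powr_add)
  moreover have "q powr (\<theta>/2) * bessel_series (\<mu> + \<theta>) q \<ge> (1 + \<theta> - \<theta> * (\<mu> + 1) / ?t) * ?p + (- \<theta> / ?t) * (q * ?p1)"
  proof -
    have "q powr (\<theta>/2) * (?t powr (-\<theta>) * ((1 + \<theta> - \<theta> * (\<mu> + 1) / ?t) * ?p + (- \<theta> / ?t) * (q * ?p1))) \<le> q powr (\<theta>/2) * bessel_series (\<mu> + \<theta>) q"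
      using le by (intro mult_left_mono) auto
    moreover have "q powr (\<theta>/2) * (?t powr (-\<theta>) * z) = z" for z
      using tq by (simp add: mult.left_commute flip: mult.assoc)
    ultimately show ?thesis by simp
  qed
  ultimately have "bessel_I_root (\<mu> + \<theta>) q / bessel_I_root \<mu> q \<ge> ((1 + \<theta> - \<theta> * (\<mu> + 1) / ?t) * ?p + (- \<theta> / ?t) * (q * ?p1)) / ?p"
    using p by (simp add: divide_right_mono)
  moreover have "((1 + \<theta> - \<theta> * (\<mu> + 1) / ?t) * ?p + (- \<theta> / ?t) * (q * ?p1)) / ?p
     = 1 + \<theta> - \<theta> * ((\<mu> + 1) / ?t + (q / ?t) * ?p1 / ?p)"
    using p q by (simp add: field_simps)
  moreover have "(q / ?t) * ?p1 / ?p = bessel_I_root (\<mu> + 1) q / bessel_I_root \<mu> q"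
    using p q by (simp add: bessel_I_root_def powr_half_shift real_div_sqrt)
  ultimately show ?thesis by simp
qed

text \<open>The lower bound is the preceding lemma. The upper bound is the same lemma for the
  complementary step from \<open>\<mu> + \<theta>\<close> to \<open>\<mu> + 1\<close>, since the
  full step is already known to have quotient tending to 1.\<close>

lemma bessel_I_root_fractional_shift_tendsto:
  assumes mu: "\<mu> > -1" and th: "0 \<le> \<theta>" "\<theta> \<le> 1"
  shows "((\<lambda>q. bessel_I_root (\<mu> + \<theta>) q / bessel_I_root \<mu> q) \<longlongrightarrow> 1) at_top"
proof (rule real_tendsto_sandwich)
  define L where "L = (\<lambda>\<mu> \<theta> q. 1 + \<theta> - \<theta> * ((\<mu> + 1) / sqrt q + bessel_I_root (\<mu> + 1) q / bessel_I_root \<mu> q))"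
  have L: "(L m t \<longlongrightarrow> 1) at_top" if "m > -1" for m t
  proof -
    have "((\<lambda>q::real. (m + 1) / sqrt q) \<longlongrightarrow> 0) at_top" by real_asymp
    hence "(L m t \<longlongrightarrow> 1 + t - t * (0 + 1)) at_top"
      unfolding L_def by (intro tendsto_intros bessel_I_root_ratio_tendsto that)
    thus ?thesis by simp
  qed
  show "(L \<mu> \<theta> \<longlongrightarrow> 1) at_top" by (rule L[OF mu])
  have L2: "(L (\<mu> + \<theta>) (1 - \<theta>) \<longlongrightarrow> 1) at_top" using mu th by (intro L) auto
  have "((\<lambda>q. (bessel_I_root (\<mu> + 1) q / bessel_I_root \<mu> q) / L (\<mu> + \<theta>) (1 - \<theta>) q) \<longlongrightarrow> 1 / 1) at_top"
    by (intro tendsto_divide bessel_I_root_ratio_tendsto mu L2) auto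
  thus "((\<lambda>q. (bessel_I_root (\<mu> + 1) q / bessel_I_root \<mu> q) / L (\<mu> + \<theta>) (1 - \<theta>) q) \<longlongrightarrow> 1) at_top" by simp
  show "\<forall>\<^sub>F q in at_top. L \<mu> \<theta> q \<le> bessel_I_root (\<mu> + \<theta>) q / bessel_I_root \<mu> q"
    using eventually_gt_at_top[of 0] unfolding L_def
    by eventually_elim (rule bessel_I_root_fractional_shift_ge[OF mu th])
  have "\<forall>\<^sub>F q in at_top. L (\<mu> + \<theta>) (1 - \<theta>) q > 0"
    using L2 by (rule order_tendstoD) simp
  thus "\<forall>\<^sub>F q in at_top. bessel_I_root (\<mu> + \<theta>) q / bessel_I_root \<mu> q
      \<le> (bessel_I_root (\<mu> + 1) q / bessel_I_root \<mu> q) / L (\<mu> + \<theta>) (1 - \<theta>) q"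
    using eventually_gt_at_top[of 0]
  proof eventually_elim
    case (elim q)
    have "L (\<mu> + \<theta>) (1 - \<theta>) q \<le> bessel_I_root (\<mu> + \<theta> + (1 - \<theta>)) q / bessel_I_root (\<mu> + \<theta>) q"
      unfolding L_def by (rule bessel_I_root_fractional_shift_ge) (use mu th elim in auto)
    hence "L (\<mu> + \<theta>) (1 - \<theta>) q \<le> bessel_I_root (\<mu> + 1) q / bessel_I_root (\<mu> + \<theta>) q" by simp
    moreover have "bessel_I_root \<mu> q > 0" "bessel_I_root (\<mu> + \<theta>) q > 0"
      using mu th elim by (auto intro!: bessel_I_root_pos)
    ultimately show ?case using elim by (simp add: field_simps)
  qed
qed

text \<open>Integral steps bring the order into (-1, 0], from where a fractional step reaches
  0.\<close>

lemma bessel_I_root_asymp_nonneg_shift: "\<mu> > -1 \<Longrightarrow> \<mu> \<le> real n \<Longrightarrow> ((\<lambda>q. bessel_I_root \<mu> q / bessel_I_root 0 q) \<longlongrightarrow> 1) at_top"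
proof (induction n arbitrary: \<mu>)
  case 0
  have "((\<lambda>q. bessel_I_root (\<mu> + (- \<mu>)) q / bessel_I_root \<mu> q) \<longlongrightarrow> 1) at_top"
    using 0 by (intro bessel_I_root_fractional_shift_tendsto) auto
  from tendsto_inverse[OF this] show ?case by simp
next
  case (Suc n)
  show ?case
  proof (cases "\<mu> \<le> n")
    case True
    with Suc show ?thesis by blast
  next
    case False
    have 1: "((\<lambda>q. bessel_I_root (\<mu> - 1) q / bessel_I_root 0 q) \<longlongrightarrow> 1) at_top"
      using Suc False by (intro Suc.IH) auto
    have 2: "((\<lambda>q. bessel_I_root (\<mu> - 1 + 1) q / bessel_I_root (\<mu> - 1) q) \<longlongrightarrow> 1) at_top"
      using False by (intro bessel_I_root_ratio_tendsto) auto
    have "((\<lambda>q. bessel_I_root (\<mu> - 1 + 1) q / bessel_I_root (\<mu> - 1) q * (bessel_I_root (\<mu> - 1) q / bessel_I_root 0 q)) \<longlongrightarrow> 1 * 1) at_top"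
      by (rule tendsto_mult[OF 2 1])
    moreover have "\<forall>\<^sub>F q in at_top. bessel_I_root (\<mu> - 1 + 1) q / bessel_I_root (\<mu> - 1) q * (bessel_I_root (\<mu> - 1) q / bessel_I_root 0 q) = bessel_I_root \<mu> q / bessel_I_root 0 q"
      using eventually_gt_at_top[of 0]
    proof eventually_elim
      case (elim q)
      have "bessel_I_root (\<mu> - 1) q > 0" using False elim by (intro bessel_I_root_pos) auto
      thus ?case by simp
    qed
    ultimately show ?thesis unfolding mult_1 div_by_1 by (rule Lim_transform_eventually)
  qed
qed

text \<open>Below order -1 the terms of the series change sign and the averaging arguments fail. The
  recurrence still works downwards: its term of order \<open>\<mu> + 1\<close> carries a factor that
  tends to 0, so orders \<open>\<mu>\<close> and \<open>\<mu> + 2\<close> behave alike.\<close>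

lemma bessel_I_root_asymp: "((\<lambda>q. bessel_I_root \<mu> q / bessel_I_root 0 q) \<longlongrightarrow> 1) at_top"
proof -
  have "\<mu> > -1 - real n \<Longrightarrow> ((\<lambda>q. bessel_I_root \<mu> q / bessel_I_root 0 q) \<longlongrightarrow> 1) at_top" for n
  proof (induction n arbitrary: \<mu>)
    case 0
    obtain n :: nat where "\<mu> \<le> real n" using real_arch_simple by blast
    with 0 show ?case using bessel_I_root_asymp_nonneg_shift by simp
  next
    case (Suc n)
    have "((\<lambda>q::real. (\<mu> + 1) / sqrt q) \<longlongrightarrow> 0) at_top" by real_asymp
    hence "((\<lambda>q. (\<mu> + 1) / sqrt q * (bessel_I_root (\<mu> + 1) q / bessel_I_root 0 q) + bessel_I_root (\<mu> + 2) q / bessel_I_root 0 q) \<longlongrightarrow> 0 * 1 + 1) at_top"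
      using Suc.prems by (intro tendsto_intros Suc.IH) auto
    moreover have "\<forall>\<^sub>F q in at_top. (\<mu> + 1) / sqrt q * (bessel_I_root (\<mu> + 1) q / bessel_I_root 0 q) + bessel_I_root (\<mu> + 2) q / bessel_I_root 0 q = bessel_I_root \<mu> q / bessel_I_root 0 q"
      using eventually_gt_at_top[of 0]
      by eventually_elim (simp add: bessel_I_root_recurrence[of _ \<mu>] add_divide_distrib)
    ultimately show ?case by (simp add: tendsto_cong)
  qed
  moreover obtain n :: nat where "real n > - \<mu> - 1" using reals_Archimedean2 by blast
  ultimately show ?thesis by (metis diff_less_eq diff_minus_eq_add less_diff_eq minus_diff_commute add.commute uminus_add_conv_diff)
qed

section \<open>Wronskian and boundedness of K\<close>

lemma bessel_wronskian:
  "bessel_series (- \<nu> - 1) q * bessel_series \<nu> q - q * bessel_series (- \<nu>) q * bessel_series (\<nu> + 1) q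
     = rGamma (- \<nu>) * rGamma (\<nu> + 1)"
proof -
  let ?w = "\<lambda>q. bessel_series (- \<nu> - 1) q * bessel_series \<nu> q - q * bessel_series (- \<nu>) q * bessel_series (\<nu> + 1) q"
  \<comment> \<open>The recurrences make the derivative vanish identically, and at
    \<open>q = 0\<close> only the constant coefficients of the series remain.\<close>
  have "(?w has_real_derivative 0) (at q)" for q
  proof -
    have r1: "q * bessel_series (1 - \<nu>) q = bessel_series (- \<nu> - 1) q + \<nu> * bessel_series (- \<nu>) q"
      using bessel_series_recurrence[of "-\<nu>" q] by simp
    have r2: "q * bessel_series (\<nu> + 2) q = bessel_series \<nu> q - (\<nu> + 1) * bessel_series (\<nu> + 1) q"
      using bessel_series_recurrence[of "\<nu> + 1" q] by (simp add: add_ac)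
    have d: "(bessel_series (- \<nu> - 1) has_real_derivative bessel_series (- \<nu>) q) (at q)"
      using has_real_derivative_bessel_series[of "-\<nu> - 1" q] by simp
    have d': "(bessel_series (-\<nu>) has_real_derivative bessel_series (1 - \<nu>) q) (at q)"
      using has_real_derivative_bessel_series[of "-\<nu>" q] by simp
    have d'': "(bessel_series (\<nu> + 1) has_real_derivative bessel_series (\<nu> + 2) q) (at q)"
      using has_real_derivative_bessel_series[of "\<nu>+1" q] unfolding add.assoc one_add_one .
    have "(?w has_real_derivative
       (bessel_series (-\<nu>) q * bessel_series \<nu> q + bessel_series (\<nu> + 1) q * bessel_series (- \<nu> - 1) q
       - ((1 * bessel_series (-\<nu>) q + bessel_series (1 - \<nu>) q * q) * bessel_series (\<nu>+1) q
         + bessel_series (\<nu> + 2) q * (q * bessel_series (-\<nu>) q)))) (at q)"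
    proof (rule DERIV_diff)
      show "((\<lambda>q. bessel_series (- \<nu> - 1) q * bessel_series \<nu> q) has_real_derivative
          bessel_series (-\<nu>) q * bessel_series \<nu> q + bessel_series (\<nu> + 1) q * bessel_series (- \<nu> - 1) q) (at q)"
        by (rule DERIV_mult[OF d has_real_derivative_bessel_series])
      have "((\<lambda>q. q * bessel_series (-\<nu>) q) has_real_derivative 1 * bessel_series (-\<nu>) q + bessel_series (1 - \<nu>) q * q) (at q)"
        by (rule DERIV_mult[OF DERIV_ident d'])
      from DERIV_mult[OF this d'']
      show "((\<lambda>q. q * bessel_series (-\<nu>) q * bessel_series (\<nu> + 1) q) has_real_derivative
         (1 * bessel_series (-\<nu>) q + bessel_series (1 - \<nu>) q * q) * bessel_series (\<nu>+1) q
         + bessel_series (\<nu> + 2) q * (q * bessel_series (-\<nu>) q)) (at q)" .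
    qed
    also have "bessel_series (1 - \<nu>) q * q = q * bessel_series (1 - \<nu>) q" by (rule mult.commute)
    also have "bessel_series (\<nu> + 2) q * (q * bessel_series (-\<nu>) q) = (q * bessel_series (\<nu> + 2) q) * bessel_series (-\<nu>) q" by simp
    finally show ?thesis unfolding r1 r2 by (simp add: algebra_simps)
  qed
  hence "\<forall>x. (?w has_real_derivative 0) (at x)" by blast
  hence "?w q = ?w 0" by (rule DERIV_isconst_all)
  thus ?thesis by (simp add: bessel_series_0)
qed

lemma powr_shift_deriv_eq: "q > (0::real) \<Longrightarrow> q powr (r - 1) = q powr r / q"
  by (simp add: powr_diff)

text \<open>Up to the factor \<open>1 / q\<close> the numerator of the derivative of the quotient is
  the Wronskian, a constant; hence the quotient converges at the rate at which 1 / I_nu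
  decays.\<close>

lemma bessel_I_root_ratio_deriv:
  assumes q: "q > 0" and nu: "\<nu> > 0"
  shows "((\<lambda>q. bessel_I_root (-\<nu>) q / bessel_I_root \<nu> q) has_real_derivative
      rGamma (- \<nu>) * rGamma (\<nu> + 1) / (q * (bessel_I_root \<nu> q)\<^sup>2)) (at q)"
proof -
  let ?a = "bessel_series (-\<nu>)" and ?b = "bessel_series \<nu>"
  have b: "?b q > 0" using bessel_series_pos nu q by auto
  have d: "(?a has_real_derivative bessel_series (1-\<nu>) q) (at q)"
       "(?b has_real_derivative bessel_series (\<nu> + 1) q) (at q)"
    using has_real_derivative_bessel_series[of "-\<nu>" q] has_real_derivative_bessel_series[of \<nu> q]
    by (simp_all add: add_ac)
  have r1: "q * bessel_series (1 - \<nu>) q = bessel_series (- \<nu> - 1) q + \<nu> * bessel_series (- \<nu>) q"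
      using bessel_series_recurrence[of "-\<nu>" q] by simp
  let ?Q = "q powr (-\<nu>)"
  have "((\<lambda>q. q powr (-\<nu>) * ?a q / ?b q) has_real_derivative
     ((- \<nu> * (?Q / q) * ?a q + ?Q * bessel_series (1-\<nu>) q) * ?b q - ?Q * ?a q * bessel_series (\<nu>+1) q) / (?b q * ?b q)) (at q)"
    using b q by (auto intro!: derivative_eq_intros d simp: powr_shift_deriv_eq)
  also have "((- \<nu> * (?Q / q) * ?a q + ?Q * bessel_series (1-\<nu>) q) * ?b q - ?Q * ?a q * bessel_series (\<nu>+1) q)
     = ?Q / q * (((- \<nu> * ?a q + q * bessel_series (1-\<nu>) q)) * ?b q - q * ?a q * bessel_series (\<nu>+1) q)"
    using q by (simp add: field_simps)
  also have "\<dots> = ?Q / q * (rGamma (- \<nu>) * rGamma (\<nu> + 1))"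
    unfolding r1 using bessel_wronskian[of \<nu> q] by simp
  also have "?Q / q * (rGamma (- \<nu>) * rGamma (\<nu> + 1)) / (?b q * ?b q) = rGamma (- \<nu>) * rGamma (\<nu> + 1) / (q * (bessel_I_root \<nu> q)\<^sup>2)"
  proof -
    have "(bessel_I_root \<nu> q)\<^sup>2 = q powr \<nu> * (?b q * ?b q)"
      using q by (simp add: bessel_I_root_def power_mult_distrib power2_eq_square flip: powr_add)
    thus ?thesis using q b by (simp add: powr_minus field_simps)
  qed
  finally show ?thesis
  proof (rule DERIV_cong_ev[THEN iffD1, rotated -1, OF _ refl _ refl])
    have "eventually (\<lambda>x. x > 0) (nhds q)" using q by (intro eventually_nhds_in_open[of "{0<..}", simplified]) auto
    thus "\<forall>\<^sub>F x in nhds q. x powr (-\<nu>) * ?a x / ?b x = bessel_I_root (-\<nu>) x / bessel_I_root \<nu> x"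
      by eventually_elim (simp add: bessel_I_root_def powr_minus field_simps flip: powr_add)
  qed
qed

lemma bessel_I_root_deriv_ge:
  assumes q: "q > 0" and nu: "\<nu> > 0"
  shows "\<exists>d. (bessel_I_root \<nu> has_real_derivative d) (at q) \<and> q * d \<ge> \<nu>/2 * bessel_I_root \<nu> q"
proof -
  let ?b = "bessel_series \<nu>"
  have d: "(?b has_real_derivative bessel_series (\<nu> + 1) q) (at q)"
    by (rule has_real_derivative_bessel_series)
  have "((\<lambda>q. q powr (\<nu>/2) * ?b q) has_real_derivative
     (\<nu>/2 * (q powr (\<nu>/2) / q) * ?b q + q powr (\<nu>/2) * bessel_series (\<nu>+1) q)) (at q)"
    using q by (auto intro!: derivative_eq_intros d simp: powr_shift_deriv_eq)
  moreover have "q * (\<nu>/2 * (q powr (\<nu>/2) / q) * ?b q + q powr (\<nu>/2) * bessel_series (\<nu>+1) q)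
     = \<nu>/2 * bessel_I_root \<nu> q + q * (q powr (\<nu>/2) * bessel_series (\<nu>+1) q)"
    using q by (simp add: bessel_I_root_def field_simps)
  moreover have "q * (q powr (\<nu>/2) * bessel_series (\<nu>+1) q) \<ge> 0"
    using bessel_series_pos[of "\<nu>+1" q] q nu by simp
  ultimately show ?thesis unfolding bessel_I_root_def[abs_def] by (intro exI conjI) (assumption, linarith)
qed

lemma bessel_I_root_ge:
  assumes q: "q > 0" and nu: "\<nu> > 0"
  shows "bessel_I_root \<nu> q \<ge> q powr (\<nu>/2) * rGamma (\<nu> + 1)"
proof -
  have "rGamma (real k + \<nu> + 1) > 0" for k
    using assms by (simp add: rGamma_inverse_Gamma)
  hence "rGamma (\<nu> + 1) \<le> bessel_series \<nu> q"
    unfolding bessel_series_def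
    using sum_le_suminf[OF summable_bessel_series[of \<nu> q], of "{0}"] assms
    by (simp add: less_imp_le)
  thus ?thesis by (simp add: bessel_I_root_def mult_left_mono)
qed

text \<open>The quotient \<open>I\<^sub>-\<^sub>\<nu> / I\<^sub>\<nu>\<close> tends to 1, and its derivative is dominated by that of \<open>1 / I\<^sub>\<nu>\<close>.\<close>

lemma bessel_I_root_diff_bounded:
  assumes nu: "\<nu> > 0"
  shows "\<exists>C. \<forall>q\<ge>1. \<bar>bessel_I_root (-\<nu>) q - bessel_I_root \<nu> q\<bar> \<le> C"
proof -
  let ?R = "\<lambda>q. bessel_I_root (-\<nu>) q / bessel_I_root \<nu> q"
  define w where "w = rGamma (- \<nu>) * rGamma (\<nu> + 1)"
  define c where "c = \<nu>/2 * rGamma (\<nu> + 1)"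
  have c: "c > 0" using nu by (simp add: c_def rGamma_inverse_Gamma)
  \<comment> \<open>For \<open>q >= 1\<close> the derivative of I_nu, times \<open>q\<close>, is at
    least \<open>c\<close>. With this \<open>C\<close> the derivative of \<open>C\<close> / I_nu
    therefore outweighs that of the quotient.\<close>
  define C where "C = \<bar>w\<bar> / c"
  have C: "C \<ge> 0" using c by (simp add: C_def)
  have Jpos: "bessel_I_root \<nu> q > 0" if "q > 0" for q using bessel_I_root_pos that nu by simp
  have lim: "(?R \<longlongrightarrow> 1) at_top"
  proof -
    have "((\<lambda>q. (bessel_I_root (-\<nu>) q / bessel_I_root 0 q) / (bessel_I_root \<nu> q / bessel_I_root 0 q)) \<longlongrightarrow> 1 / 1) at_top"
      by (intro tendsto_divide bessel_I_root_asymp) auto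
    moreover have "\<forall>\<^sub>F q in at_top. (bessel_I_root (-\<nu>) q / bessel_I_root 0 q) / (bessel_I_root \<nu> q / bessel_I_root 0 q) = ?R q"
      using eventually_gt_at_top[of 0]
    proof eventually_elim
      case (elim q)
      have "bessel_I_root 0 q > 0" using elim by (intro bessel_I_root_pos) auto
      thus ?case by simp
    qed
    ultimately show ?thesis unfolding mult_1 div_by_1 by (rule Lim_transform_eventually)
  qed
  have lim0: "((\<lambda>q. 1 / bessel_I_root \<nu> q) \<longlongrightarrow> 0) at_top"
  proof (rule real_tendsto_sandwich)
    show "((\<lambda>q::real. 0) \<longlongrightarrow> 0) at_top" by simp
    show "((\<lambda>q. 1 / (q powr (\<nu>/2) * rGamma (\<nu> + 1))) \<longlongrightarrow> 0) at_top"
    proof -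
      have "((\<lambda>q. q powr (-(\<nu>/2)) * (1 / rGamma (\<nu> + 1))) \<longlongrightarrow> 0 * (1 / rGamma (\<nu> + 1))) at_top"
        using nu by (intro tendsto_mult tendsto_neg_powr filterlim_ident) auto
      thus ?thesis by (simp add: powr_minus_divide)
    qed
    show "\<forall>\<^sub>F q in at_top. 0 \<le> 1 / bessel_I_root \<nu> q"
      using eventually_gt_at_top[of 0] by eventually_elim (use Jpos in \<open>simp add: less_imp_le\<close>)
    show "\<forall>\<^sub>F q in at_top. 1 / bessel_I_root \<nu> q \<le> 1 / (q powr (\<nu>/2) * rGamma (\<nu> + 1))"
      using eventually_gt_at_top[of 0]
      by eventually_elim (use bessel_I_root_ge nu in \<open>intro divide_left_mono mult_pos_pos, auto simp: rGamma_inverse_Gamma Jpos\<close>)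
  qed
  \<comment> \<open>The sign \<open>s\<close> handles the two bounds together: the quotient plus
    \<open>C\<close> / I_nu decreases to 1, the quotient minus \<open>C\<close> / I_nu increases to
    1.\<close>
  have deriv: "\<exists>d. ((\<lambda>q. ?R q + s * C * (1 / bessel_I_root \<nu> q)) has_real_derivative d) (at q) \<and> s * d \<le> 0"
    if q: "q \<ge> 1" and s: "s = 1 \<or> s = -1" for q s
  proof -
    have q0: "q > 0" using q by simp
    obtain d where d: "(bessel_I_root \<nu> has_real_derivative d) (at q)" "q * d \<ge> \<nu>/2 * bessel_I_root \<nu> q"
      using bessel_I_root_deriv_ge[OF q0 nu] by blast
    have J: "bessel_I_root \<nu> q > 0" using Jpos q0 by simp
    have "\<nu>/2 * bessel_I_root \<nu> q \<ge> \<nu>/2 * (q powr (\<nu>/2) * rGamma (\<nu> + 1))"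
      using bessel_I_root_ge[OF q0 nu] nu by (intro mult_left_mono) auto
    moreover have "q powr (\<nu>/2) \<ge> 1" using q nu by (simp add: ge_one_powr_ge_zero)
    hence "q powr (\<nu>/2) * c \<ge> 1 * c" using c by (intro mult_right_mono) auto
    ultimately have qd: "q * d \<ge> c" using d(2) unfolding c_def by (simp add: mult_ac)
    have D: "((\<lambda>q. ?R q + s * C * (1 / bessel_I_root \<nu> q)) has_real_derivative
       (w / (q * (bessel_I_root \<nu> q)\<^sup>2) + s * C * (- d / (bessel_I_root \<nu> q)\<^sup>2))) (at q)"
      unfolding w_def
    proof (rule DERIV_add[OF bessel_I_root_ratio_deriv[OF q0 nu]], rule DERIV_cmult)
      show "((\<lambda>q. 1 / bessel_I_root \<nu> q) has_real_derivative - d / (bessel_I_root \<nu> q)\<^sup>2) (at q)"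
        using J by (auto intro!: derivative_eq_intros d simp: power2_eq_square)
    qed
    have "w / (q * (bessel_I_root \<nu> q)\<^sup>2) + s * C * (- d / (bessel_I_root \<nu> q)\<^sup>2) = (w - s * (C * (q * d))) / (q * (bessel_I_root \<nu> q)\<^sup>2)"
      using q0 J by (simp add: field_simps)
    moreover have "C * (q * d) \<ge> C * c" using qd C by (intro mult_left_mono)
    hence "C * (q * d) \<ge> \<bar>w\<bar>" using c by (simp add: C_def)
    hence "s * (w - s * (C * (q * d))) \<le> 0" using s by (auto simp: algebra_simps)
    hence "s * ((w - s * (C * (q * d))) / (q * (bessel_I_root \<nu> q)\<^sup>2)) \<le> 0"
      using q0 J unfolding times_divide_eq_right by (intro divide_nonpos_pos mult_pos_pos) auto
    ultimately show ?thesis using D by metis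
  qed
  have key: "s * (?R q + s * C * (1 / bessel_I_root \<nu> q)) \<ge> s" if q: "q \<ge> 1" and s: "s = 1 \<or> s = -1" for q s
  proof -
    have mono: "s * (?R y + s * C * (1 / bessel_I_root \<nu> y)) \<le> s * (?R q + s * C * (1 / bessel_I_root \<nu> q))" if "y \<ge> q" for y
    proof (rule DERIV_nonpos_imp_nonincreasing[OF that])
      fix x assume x: "q \<le> x" "x \<le> y"
      with q have "x \<ge> 1" by simp
      from deriv[OF this s] obtain d where d: "((\<lambda>q. ?R q + s * C * (1 / bessel_I_root \<nu> q)) has_real_derivative d) (at x)" "s * d \<le> 0"
        by blast
      show "\<exists>e. ((\<lambda>y. s * (?R y + s * C * (1 / bessel_I_root \<nu> y))) has_real_derivative e) (at x) \<and> e \<le> 0"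
        using DERIV_cmult[OF d(1), of s] d(2) by blast
    qed
    have "((\<lambda>y. s * (?R y + s * C * (1 / bessel_I_root \<nu> y))) \<longlongrightarrow> s * (1 + s * C * 0)) at_top"
      by (intro tendsto_intros lim lim0)
    moreover have "\<forall>\<^sub>F y in at_top. s * (?R y + s * C * (1 / bessel_I_root \<nu> y)) \<le> s * (?R q + s * C * (1 / bessel_I_root \<nu> q))"
      using eventually_ge_at_top[of q] by eventually_elim (rule mono)
    ultimately have "s * (1 + s * C * 0) \<le> s * (?R q + s * C * (1 / bessel_I_root \<nu> q))"
      by (intro tendsto_upperbound) auto
    thus ?thesis by simp
  qed
  show ?thesis
  proof (intro exI allI impI)
    fix q :: real assume q: "1 \<le> q"
    have J: "bessel_I_root \<nu> q > 0" using Jpos q by simp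
    have "\<bar>?R q - 1\<bar> \<le> C * (1 / bessel_I_root \<nu> q)"
      using key[OF q, of 1] key[OF q, of "-1"] by (simp add: abs_le_iff)
    hence "\<bar>?R q - 1\<bar> * bessel_I_root \<nu> q \<le> C" using J by (simp add: field_simps)
    moreover have "\<bar>?R q - 1\<bar> * bessel_I_root \<nu> q = \<bar>(?R q - 1) * bessel_I_root \<nu> q\<bar>" using J by (simp add: abs_mult)
    moreover have "(?R q - 1) * bessel_I_root \<nu> q = bessel_I_root (-\<nu>) q - bessel_I_root \<nu> q" using J by (simp add: field_simps)
    ultimately show "\<bar>bessel_I_root (-\<nu>) q - bessel_I_root \<nu> q\<bar> \<le> C" by simp
  qed
qed

lemma bessel_I_eq_root:
  assumes "x > 0"
  shows "bessel_I \<mu> x = bessel_I_root \<mu> ((x/2)\<^sup>2)"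
proof -
  have "rGamma (real k + \<mu> + 1) / fact k * (x / 2) powr (2 * real k + \<mu>)
     = (x/2) powr \<mu> * (rGamma (real k + \<mu> + 1) / fact k * ((x/2)\<^sup>2) ^ k)" for k
  proof -
    have "(x/2) powr (2 * real k) = ((x/2)\<^sup>2) ^ k"
      using assms powr_realpow[of "x/2" "2 * k"] by (simp add: power_mult)
    thus ?thesis by (simp add: powr_add)
  qed
  hence "bessel_I \<mu> x = (x/2) powr \<mu> * bessel_series \<mu> ((x/2)\<^sup>2)"
    unfolding bessel_I_def bessel_series_def by (simp only: suminf_mult[OF summable_bessel_series])
  also have "(x/2) powr \<mu> = ((x/2)\<^sup>2) powr (\<mu>/2)"
    using assms by (simp add: powr_powr flip: powr_numeral)
  finally show ?thesis by (simp add: bessel_I_root_def)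
qed

lemma bessel_K_nonint:
  assumes "x > 0" "\<nu> \<notin> \<int>"
  shows "bessel_K \<nu> x = pi / 2 * ((bessel_I_root (-\<nu>) ((x/2)\<^sup>2) - bessel_I_root \<nu> ((x/2)\<^sup>2)) / sin (pi * \<nu>))"
  using assms by (simp add: bessel_K_def Let_def bessel_I_eq_root)

text \<open>K decays exponentially, but boundedness is enough, because the factor exp(-an) provides
  the convergence. The restriction \<open>x >= 2\<close> corresponds to
  \<open>q >= 1\<close>.\<close>

lemma bessel_K_bounded:
  assumes nu: "\<nu> > 0" "\<nu> \<notin> \<int>"
  shows "\<exists>C. \<forall>x\<ge>2. \<bar>bessel_K \<nu> x\<bar> \<le> C"
proof -
  obtain C where C: "\<And>q. q \<ge> 1 \<Longrightarrow> \<bar>bessel_I_root (-\<nu>) q - bessel_I_root \<nu> q\<bar> \<le> C"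
    using bessel_I_root_diff_bounded[OF nu(1)] by blast
  have "\<bar>bessel_K \<nu> x\<bar> \<le> \<bar>pi / 2 / sin (pi * \<nu>)\<bar> * C" if x: "x \<ge> 2" for x
  proof -
    have "(x/2)\<^sup>2 \<ge> 1" using x by simp
    moreover have "bessel_K \<nu> x = pi / 2 / sin (pi * \<nu>) * (bessel_I_root (-\<nu>) ((x/2)\<^sup>2) - bessel_I_root \<nu> ((x/2)\<^sup>2))"
      using x nu by (simp add: bessel_K_nonint)
    ultimately show ?thesis using C[of "(x/2)\<^sup>2"] by (simp only: abs_mult) (intro mult_left_mono, auto)
  qed
  thus ?thesis by blast
qed

section \<open>Lipschitz' summation formula\<close>

lemma has_bochner_integral_halfline_iff:
  fixes f :: "real \<Rightarrow> real"
  shows "has_bochner_integral (lebesgue_on {0<..}) f b \<longleftrightarrow>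
    f absolutely_integrable_on {0<..} \<and> integral {0<..} f = b"
proof -
  have 1: "integrable (lebesgue_on {0<..}) f \<longleftrightarrow> f absolutely_integrable_on {0<..}"
    by (simp add: integrable_restrict_space set_integrable_def)
  show ?thesis
    by (auto simp: has_bochner_integral_iff 1[symmetric] lebesgue_integral_eq_integral)
qed

lemma absolutely_integrable_nonneg_interior:
  fixes f :: "real \<Rightarrow> real"
  assumes "(f has_integral b) A" "\<And>x. x \<in> B \<Longrightarrow> f x \<ge> 0" "negligible (sym_diff A B)"
  shows "f absolutely_integrable_on B \<and> integral B f = b"
proof -
  have "(f has_integral b) B"
    using assms has_integral_spike_set_eq[of A B f b]
    by (metis (no_types, lifting) Un_commute negligible_Un_eq Int_Un_distrib has_integral_spike_set_eq mem_Collect_eq negligible_subset subsetI)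
  thus ?thesis using assms(2) by (auto intro!: nonnegative_absolutely_integrable_1 simp: has_integral_iff)
qed

lemma has_bochner_integral_Gamma_scaled:
  fixes s a :: real
  assumes s: "s > 0" and a: "a > 0"
  shows "has_bochner_integral (lebesgue_on {0<..}) (\<lambda>t::real. t powr (s - 1) * exp (- a * t)) (Gamma s * a powr (- s))"
proof -
  let ?f = "\<lambda>u::real. u powr (s - 1) / exp u"
  have img: "(\<lambda>t::real. a * t) ` {0<..} = {0<..}"
  proof (intro equalityI subsetI)
    fix x :: real assume "x \<in> {0<..}"
    hence "x = a * (x / a)" "x / a \<in> {0<..}" using a by auto
    thus "x \<in> (\<lambda>t::real. a * t) ` {0<..}" by blast
  qed (use a in auto)
  have "?f absolutely_integrable_on {0<..} \<and> integral {0<..} ?f = Gamma s"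
    using Gamma_integral_real[OF s] by (rule absolutely_integrable_nonneg_interior)
      (auto intro: negligible_subset[of "{0}"])
  hence "?f absolutely_integrable_on ((\<lambda>t::real. a * t) ` {0<..}) \<and> integral ((\<lambda>t::real. a * t) ` {0<..}) ?f = Gamma s"
    unfolding img .
  hence "(\<lambda>t::real. \<bar>a\<bar> * ?f (a * t)) absolutely_integrable_on {0<..} \<and> integral {0<..} (\<lambda>t::real. \<bar>a\<bar> * ?f (a * t)) = Gamma s"
    by (rule has_absolute_integral_change_of_variables_1'[THEN iffD2, rotated 3])
       (use a in \<open>auto intro!: derivative_eq_intros inj_onI\<close>)
  hence "has_bochner_integral (lebesgue_on {0<..}) (\<lambda>t::real. \<bar>a\<bar> * ?f (a * t)) (Gamma s)"
    unfolding has_bochner_integral_halfline_iff .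
  hence "has_bochner_integral (lebesgue_on {0<..}) (\<lambda>t::real. a powr (-s) * (\<bar>a\<bar> * ?f (a * t))) (a powr (-s) * Gamma s)"
    by (intro has_bochner_integral_mult_right) auto
  also have "?this \<longleftrightarrow> has_bochner_integral (lebesgue_on {0<..}) (\<lambda>t::real. t powr (s - 1) * exp (- a * t)) (Gamma s * a powr (- s))"
  proof (rule has_bochner_integral_cong)
    fix t :: real assume "t \<in> space (lebesgue_on {0<..})"
    hence t: "t > 0" by (simp add: space_restrict_space)
    have "a powr (-s) * a * a powr (s - 1) = 1"
      using a by (simp add: powr_diff powr_minus field_simps)
    thus "a powr (-s) * (\<bar>a\<bar> * ?f (a * t)) = t powr (s - 1) * exp (- a * t)"
      using a t by (simp add: powr_mult exp_minus field_simps)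
  qed auto
  finally show ?thesis .
qed

text \<open>The substitution \<open>u = t / (R + t)\<close> maps the half line onto the unit
  interval of the Beta integral.\<close>

lemma has_bochner_integral_Beta_halfline:
  fixes s q R :: real
  assumes s: "s > 0" and q: "q > 0" and R: "R > 0"
  shows "has_bochner_integral (lebesgue_on {0<..}) (\<lambda>t::real. t powr (s - 1) * (R + t) powr (- (s + q))) (R powr (- q) * Beta s q)"
proof -
  let ?f = "\<lambda>u::real. u powr (s - 1) * (1 - u) powr (q - 1)"
  let ?g = "\<lambda>t::real. t / (R + t)" and ?g' = "\<lambda>t::real. R / (R + t)\<^sup>2"
  have img: "?g ` {0<..} = {0<..<1}"
  proof (intro equalityI subsetI)
    fix x :: real assume x: "x \<in> {0<..<1}"
    hence "x = ?g (R * x / (1 - x))" "R * x / (1 - x) \<in> {0<..}" using R by (auto simp: field_simps)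
    thus "x \<in> ?g ` {0<..}" by blast
  qed (use R in \<open>auto simp: field_simps\<close>)
  have "?f absolutely_integrable_on {0<..<1} \<and> integral {0<..<1} ?f = Beta s q"
    using has_integral_Beta_real[OF s q] by (rule absolutely_integrable_nonneg_interior)
      (auto intro: negligible_subset[of "{0, 1}"])
  hence "?f absolutely_integrable_on (?g ` {0<..}) \<and> integral (?g ` {0<..}) ?f = Beta s q"
    unfolding img .
  hence "(\<lambda>t::real. \<bar>?g' t\<bar> * ?f (?g t)) absolutely_integrable_on {0<..} \<and> integral {0<..} (\<lambda>t::real. \<bar>?g' t\<bar> * ?f (?g t)) = Beta s q"
  proof (rule has_absolute_integral_change_of_variables_1'[THEN iffD2, rotated 3])
    fix x :: real assume "x \<in> {0<..}"
    hence "R + x \<noteq> 0" using R by auto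
    thus "(?g has_real_derivative ?g' x) (at x within {0<..})"
      by (auto intro!: derivative_eq_intros simp: power2_eq_square field_simps)
  next
    show "inj_on ?g {0<..}" using R by (intro inj_onI) (auto simp: field_simps)
  qed auto
  hence "has_bochner_integral (lebesgue_on {0<..}) (\<lambda>t::real. \<bar>?g' t\<bar> * ?f (?g t)) (Beta s q)"
    unfolding has_bochner_integral_halfline_iff .
  hence "has_bochner_integral (lebesgue_on {0<..}) (\<lambda>t::real. R powr (-q) * (\<bar>?g' t\<bar> * ?f (?g t))) (R powr (-q) * Beta s q)"
    by (intro has_bochner_integral_mult_right) auto
  also have "?this \<longleftrightarrow> ?thesis"
  proof (rule has_bochner_integral_cong)
    fix t :: real assume "t \<in> space (lebesgue_on {0<..})"
    hence t: "t > 0" by (simp add: space_restrict_space)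
    have p: "R + t > 0" using R t by simp
    have "1 - t / (R + t) = R / (R + t)" using p by (simp add: field_simps)
    hence "R powr (-q) * (\<bar>?g' t\<bar> * ?f (?g t)) =
       (R powr (-q) * R * R powr (q - 1)) * t powr (s - 1) * ((R + t) powr (-2) * (R + t) powr (-(s - 1)) * (R + t) powr (-(q - 1)))"
    proof -
      have "(R + t) powr (1 - s) = 1 / (R + t) powr (s - 1)" "(R + t) powr (1 - q) = 1 / (R + t) powr (q - 1)"
        using powr_minus_divide[of "R + t" "s - 1"] powr_minus_divide[of "R + t" "q - 1"] by simp_all
      moreover have "a * (b * (a' * b')) = 1" if "a * a' = 1" "b * b' = 1" for a b a' b' :: real
        using that by algebra
      ultimately show ?thesis using R t p by (simp add: powr_divide powr_minus divide_simps powr_numeral)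
    qed
    also have "R powr (-q) * R * R powr (q - 1) = 1"
      using R by (simp add: powr_diff powr_minus field_simps)
    also have "(R + t) powr (-2) * (R + t) powr (-(s - 1)) * (R + t) powr (-(q - 1)) = (R + t) powr (- (s + q))"
      by (simp flip: powr_add)
    finally show "R powr (-q) * (\<bar>?g' t\<bar> * ?f (?g t)) = t powr (s - 1) * (R + t) powr (- (s + q))" by simp
  qed auto
  finally show ?thesis .
qed

lemma Beta_nat_shift:
  fixes s :: real assumes "s > 0" "s < 2"
  shows "real (Suc j) * Beta s (2 + real j - s) = Gamma s * Gamma (2 - s) * (pochhammer (2 - s) j / fact j)"
proof -
  have "Gamma (2 + real j) = fact (Suc j)" using Gamma_fact[of "Suc j", where ?'a = real] by (simp add: add_ac)
  moreover have "pochhammer (2 - s) j = Gamma (2 - s + real j) / Gamma (2 - s)"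
    using assms by (intro pochhammer_Gamma) (auto dest: nonpos_Ints_nonpos)
  moreover have "Gamma (2 - s) > 0" using assms by auto
  ultimately show ?thesis by (simp add: Beta_def add_ac diff_add_eq divide_simps) (simp add: algebra_simps)
qed

lemma sums_neg_binomial_square:
  fixes x :: complex assumes "norm x < 1"
  shows "(\<lambda>j. (-1) ^ j * of_nat (Suc j) * x ^ j) sums (1 / (1 + x)\<^sup>2)"
  using geometric_deriv_sums[of "-x"] assms by (simp add: power_minus[of x] mult_ac)

lemma sums_pochhammer_binomial:
  fixes x :: complex assumes "norm x < 1"
  shows "(\<lambda>j. pochhammer a j / fact j * (- x) ^ j) sums (1 + x) powr (- a)"
proof -
  have "(- a gchoose j) * x ^ j = pochhammer a j / fact j * (- x) ^ j" for j
    by (simp add: gbinomial_pochhammer power_minus[of x])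
  thus ?thesis using gen_binomial_complex[OF assms, of "-a"] by simp
qed

text \<open>In place of a rotation of the contour, the integrand is expanded about a positive real
  \<open>R\<close> in powers of \<open>w - R\<close>. Every term is a Beta integral, and the
  resulting series is the binomial series of the power of \<open>w\<close>.\<close>

lemma has_bochner_integral_Mellin_inverse_square:
  fixes w :: complex
  assumes s: "0 < s" "s < 2" and w: "Re w > 0"
  shows "has_bochner_integral (lebesgue_on {0<..}) (\<lambda>t. of_real (t powr (s - 1)) / (of_real t + w)\<^sup>2)
           (of_real (Gamma s * Gamma (2 - s)) * w powr (of_real (s - 2)))"
proof -
  let ?M = "lebesgue_on {0<..} :: real measure"
  \<comment> \<open>The disc of radius \<open>R\<close> about \<open>R\<close> contains
    \<open>w\<close>, as the squared distance of \<open>w\<close> from \<open>R\<close> equals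
    \<open>R\<^sup>2\<close> minus the square of the norm of \<open>w\<close>. Such a disc exists
    exactly because \<open>Re w > 0\<close>.\<close>
  define R where "R = (norm w)\<^sup>2 / (Re w)"
  have w0: "w \<noteq> 0" using w by auto
  have R: "R > 0" using w w0 by (simp add: R_def)
  define z where "z = w - of_real R"
  have z: "norm z < R"
  proof -
    have "(norm z)\<^sup>2 = (norm w)\<^sup>2 - 2 * R * Re w + R\<^sup>2"
      by (simp add: z_def cmod_power2 power2_diff algebra_simps)
    also have "R * Re w = (norm w)\<^sup>2" using w by (simp add: R_def)
    hence "(norm w)\<^sup>2 - 2 * R * Re w + R\<^sup>2 = R\<^sup>2 - (norm w)\<^sup>2" by simp
    also have "\<dots> < R\<^sup>2" using w0 by simp
    finally show ?thesis using R by (simp add: power2_less_imp_less)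
  qed
  define \<rho> where "\<rho> = norm z / R"
  have rho: "0 \<le> \<rho>" "\<rho> < 1" using z R by (auto simp: \<rho>_def)
  define B where "B = (\<lambda>j. R powr (- (2 + real j - s)) * Beta s (2 + real j - s))"
  define f where "f = (\<lambda>j (t::real). t powr (s - 1) * (R + t) powr (- (2 + real j)))"
  define c where "c = (\<lambda>j. (-1) ^ j * of_nat (Suc j) * z ^ j)"
  have fint: "has_bochner_integral ?M (f j) (B j)" for j
    using has_bochner_integral_Beta_halfline[of s "2 + real j - s" R] s R unfolding f_def B_def by simp
  have int: "has_bochner_integral ?M (\<lambda>t. c j * of_real (f j t)) (c j * of_real (B j))" for j
    by (intro has_bochner_integral_mult_right has_bochner_integral_of_real fint)
  have Beq: "norm z ^ j * real (Suc j) * B j = R powr (s - 2) * Gamma s * Gamma (2 - s) * (pochhammer (2 - s) j / fact j * \<rho> ^ j)" for j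
  proof -
    have "R powr (- (2 + real j - s)) = R powr (s - 2) / R ^ j"
      using R by (simp add: powr_diff powr_add powr_minus powr_realpow divide_simps)
    hence "norm z ^ j * real (Suc j) * B j = norm z ^ j * (R powr (s - 2) / R ^ j) * (real (Suc j) * Beta s (2 + real j - s))"
      by (simp add: B_def)
    thus ?thesis unfolding Beta_nat_shift[OF s, of j] by (simp add: \<rho>_def power_divide mult_ac)
  qed
  have summ: "summable (\<lambda>j. pochhammer (2 - s) j / fact j * \<rho> ^ j)"
  proof -
    have "(\<lambda>j. pochhammer (complex_of_real (2 - s)) j / fact j * (- (of_real (-\<rho>))) ^ j) sums (1 + of_real (- \<rho>)) powr (- of_real (2 - s))"
      using rho by (intro sums_pochhammer_binomial) auto
    hence "summable (\<lambda>j. complex_of_real (pochhammer (2 - s) j / fact j * \<rho> ^ j))"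
      by (simp add: sums_iff flip: pochhammer_of_real)
    thus ?thesis by (simp only: summable_of_real_iff)
  qed
  have pos: "f j t \<ge> 0" for j t by (simp add: f_def)
  have csum: "(\<lambda>j. c j * of_real (f j t)) sums (of_real (t powr (s - 1)) / (of_real t + w)\<^sup>2)"
     and nsum: "summable (\<lambda>j. norm (c j * of_real (f j t)))" if t: "t > 0" for t
  proof -
    define x where "x = z / of_real (R + t)"
    have "norm x = norm z / (R + t)" using R t by (simp add: x_def norm_divide del: of_real_add)
    hence nx: "norm x < 1" using z R t by (simp add: divide_less_eq)
    have eq: "c j * of_real (f j t) = of_real (t powr (s - 1) / (R + t)\<^sup>2) * ((-1) ^ j * of_nat (Suc j) * x ^ j)" for j
    proof -
      have "(R + t) powr (- (2 + real j)) = 1 / (R + t)\<^sup>2 / (R + t) ^ j"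
        using R t by (simp add: powr_diff powr_realpow powr_minus divide_simps powr_numeral)
      thus ?thesis unfolding c_def f_def x_def by (simp add: power_divide)
    qed
    have "1 + x = (of_real t + w) / of_real (R + t)"
      using R t by (simp add: x_def z_def field_simps flip: of_real_add)
    moreover have "of_real (R + t) \<noteq> (0::complex)" using R t by (simp del: of_real_add)
    ultimately have "of_real (t powr (s - 1) / (R + t)\<^sup>2) * (1 / (1 + x)\<^sup>2) = of_real (t powr (s - 1)) / (of_real t + w)\<^sup>2"
      by (simp add: power_divide del: of_real_add)
    thus "(\<lambda>j. c j * of_real (f j t)) sums (of_real (t powr (s - 1)) / (of_real t + w)\<^sup>2)"
      unfolding eq using sums_mult[OF sums_neg_binomial_square[OF nx]] by metis
    have "summable (\<lambda>j. of_nat (Suc j) * (norm x) ^ j)"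
      using geometric_deriv_sums[of "norm x"] nx by (simp add: sums_iff)
    hence "summable (\<lambda>j. (t powr (s - 1) / (R + t)\<^sup>2) * (of_nat (Suc j) * (norm x) ^ j))" by (rule summable_mult)
    moreover have "norm (c j * of_real (f j t)) = (t powr (s - 1) / (R + t)\<^sup>2) * (of_nat (Suc j) * (norm x) ^ j)" for j
      unfolding eq using R t by (simp add: norm_mult norm_power norm_divide del: of_nat_Suc of_real_add)
    ultimately show "summable (\<lambda>j. norm (c j * of_real (f j t)))" by simp
  qed
  have n: "(\<integral>t. norm (c j * of_real (f j t)) \<partial>?M) = R powr (s - 2) * Gamma s * Gamma (2 - s) * (pochhammer (2 - s) j / fact j * \<rho> ^ j)" for j
  proof -
    have "(\<integral>t. norm (c j * of_real (f j t)) \<partial>?M) = (\<integral>t. (norm z ^ j * real (Suc j)) * f j t \<partial>?M)"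
      by (intro Bochner_Integration.integral_cong) (auto simp: c_def norm_mult norm_power pos simp del: of_nat_Suc)
    also have "\<dots> = (norm z ^ j * real (Suc j)) * B j"
      using fint by (simp add: has_bochner_integral_iff)
    finally show ?thesis using Beq by simp
  qed
  have h1: "integrable ?M (\<lambda>t. c j * of_real (f j t))" for j using int has_bochner_integral_iff by blast
  have h2: "AE t in ?M. summable (\<lambda>j. norm (c j * of_real (f j t)))"
    by (rule AE_I2) (use nsum in \<open>simp add: space_restrict_space\<close>)
  have h3: "summable (\<lambda>j. \<integral>t. norm (c j * of_real (f j t)) \<partial>?M)"
    unfolding n by (intro summable_mult summ)
  have "has_bochner_integral ?M (\<lambda>t. \<Sum>j. c j * of_real (f j t)) (\<Sum>j. \<integral>t. c j * of_real (f j t) \<partial>?M)"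
    using integrable_suminf[OF h1 h2 h3] integral_suminf[OF h1 h2 h3] by (simp add: has_bochner_integral_iff)
  also have "(\<Sum>j. \<integral>t. c j * of_real (f j t) \<partial>?M) = of_real (Gamma s * Gamma (2 - s)) * w powr (of_real (s - 2))"
  proof -
    define x where "x = z / of_real R"
    have nx: "norm x < 1" using rho by (simp add: x_def \<rho>_def norm_divide R less_imp_le)
    have "(\<integral>t. c j * of_real (f j t) \<partial>?M) = of_real (R powr (s - 2) * Gamma s * Gamma (2 - s)) * (pochhammer (of_real (2 - s)) j / fact j * (- x) ^ j)" for j
    proof -
      have "(\<integral>t. c j * of_real (f j t) \<partial>?M) = c j * of_real (B j)" using int has_bochner_integral_iff by blast
      also have "\<dots> = (- z) ^ j * of_real (real (Suc j) * B j)"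
        by (simp add: c_def power_minus[of z] mult_ac)
      also have "real (Suc j) * B j = R powr (s - 2) / R ^ j * (Gamma s * Gamma (2 - s) * (pochhammer (2 - s) j / fact j))"
      proof -
        have "R powr (- (2 + real j - s)) = R powr (s - 2) / R ^ j"
          using R by (simp add: powr_diff powr_add powr_minus powr_realpow divide_simps)
        hence "real (Suc j) * B j = (R powr (s - 2) / R ^ j) * (real (Suc j) * Beta s (2 + real j - s))"
          by (simp add: B_def)
        thus ?thesis unfolding Beta_nat_shift[OF s, of j] .
      qed
      finally show ?thesis by (simp add: x_def power_divide power_minus[of z] power_minus[of "z / of_real R"] pochhammer_of_real mult_ac flip: pochhammer_of_real)
    qed
    hence "(\<Sum>j. \<integral>t. c j * of_real (f j t) \<partial>?M) = of_real (R powr (s - 2) * Gamma s * Gamma (2 - s)) * (1 + x) powr (- of_real (2 - s))"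
      using sums_mult[OF sums_pochhammer_binomial[OF nx]] by (simp add: sums_iff)
    also have "1 + x = w / of_real R" using R by (simp add: x_def z_def field_simps)
    also have "(w / of_real R) powr (- of_real (2 - s)) = w powr (of_real (s - 2)) / of_real (R powr (s - 2))"
    proof -
      have "Ln (w / of_real R) = Ln w - of_real (ln R)"
      proof -
        have "Ln (of_real (1 / R) * w) = of_real (ln (1 / R)) + Ln w"
          by (subst Ln_times_of_real) (use R w0 in \<open>auto simp: Ln_of_real simp del: of_real_divide\<close>)
        also have "ln (1 / R) = - ln R" using R by (simp add: ln_div)
        finally show ?thesis by simp
      qed
      hence "(w / of_real R) powr (- of_real (2 - s)) = exp (of_real (s - 2) * Ln w) / exp (of_real ((s - 2) * ln R))"
      proof -
        assume L: "Ln (w / of_real R) = Ln w - of_real (ln R)"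
        have "(w / of_real R) powr (- of_real (2 - s)) = exp (of_real (s - 2) * Ln (w / of_real R))"
          using w0 R by (simp add: powr_def)
        thus ?thesis unfolding L exp_diff[symmetric] by (simp add: algebra_simps)
      qed
      thus ?thesis using w0 R by (simp add: powr_def flip: exp_of_real)
    qed
    finally show ?thesis using R by simp
  qed
  also have "has_bochner_integral ?M (\<lambda>t. \<Sum>j. c j * of_real (f j t)) X \<longleftrightarrow>
     has_bochner_integral ?M (\<lambda>t. of_real (t powr (s - 1)) / (of_real t + w)\<^sup>2) X" for X
    by (rule has_bochner_integral_cong) (use csum in \<open>auto simp: space_restrict_space sums_iff\<close>)
  finally show ?thesis .
qed

section \<open>Partial fractions over the lattice of multiples of 2 pi i\<close>

lemma not_Int_imp:
  fixes z :: complex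
  assumes "z \<notin> \<int>"
  shows "z \<notin> \<int>\<^sub>\<le>\<^sub>0" "1 - z \<notin> \<int>\<^sub>\<le>\<^sub>0"
proof -
  show "z \<notin> \<int>\<^sub>\<le>\<^sub>0" using assms nonpos_Ints_Int by blast
  have "z \<in> \<int>" if "1 - z \<in> \<int>" using Ints_diff[OF Ints_1 that] by simp
  thus "1 - z \<notin> \<int>\<^sub>\<le>\<^sub>0" using assms nonpos_Ints_Int by blast
qed

text \<open>The logarithmic derivative of Euler's reflection formula for Gamma; one more derivative
  gives the trigamma version, whose two series run over the two halves of the integers.\<close>

lemma Digamma_reflection:
  fixes z :: complex
  assumes "z \<notin> \<int>"
  shows "Digamma z - Digamma (1 - z) = - (of_real pi * cos (of_real pi * z) / sin (of_real pi * z))"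
proof -
  have z: "z \<notin> \<int>\<^sub>\<le>\<^sub>0" "1 - z \<notin> \<int>\<^sub>\<le>\<^sub>0"
    using not_Int_imp[OF assms] by auto
  have s0: "sin (of_real pi * z) \<noteq> 0" using assms by (subst mult.commute) (simp add: sin_eq_0 mult.commute Ints_def image_iff) 
  have "((\<lambda>z. Gamma z * Gamma (1 - z)) has_field_derivative Gamma z * Gamma (1 - z) * (Digamma z - Digamma (1 - z))) (at z)"
    using z by (auto intro!: derivative_eq_intros simp: algebra_simps)
  also have "(\<lambda>z. Gamma z * Gamma (1 - z)) = (\<lambda>z::complex. of_real pi / sin (of_real pi * z))"
    by (rule ext) (rule Gamma_reflection_complex)
  finally have "((\<lambda>z. of_real pi / sin (of_real pi * z)) has_field_derivative
      Gamma z * Gamma (1 - z) * (Digamma z - Digamma (1 - z))) (at z)"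
    unfolding Gamma_reflection_complex .
  moreover have "((\<lambda>z. of_real pi / sin (of_real pi * z)) has_field_derivative
      (- (of_real pi * (cos (of_real pi * z) * of_real pi)) / (sin (of_real pi * z))\<^sup>2)) (at z)"
    using s0 by (auto intro!: derivative_eq_intros simp: power2_eq_square)
  ultimately have eq: "Gamma z * Gamma (1 - z) * (Digamma z - Digamma (1 - z)) =
     - (of_real pi * (cos (of_real pi * z) * of_real pi)) / (sin (of_real pi * z))\<^sup>2"
    by (rule DERIV_unique)
  have key: "D = - (p * c / s)" if "p / s * D = - (p * (c * p)) / s\<^sup>2" "p \<noteq> 0" "s \<noteq> 0" for D p c s :: complex
  proof -
    have "p * (D * s + p * c) = 0" using that by (simp add: field_simps power2_eq_square)
    hence "D * s = - (p * c)" using that by (simp add: eq_neg_iff_add_eq_0)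
    hence "D = - (p * c) / s" using \<open>s \<noteq> 0\<close> by (metis nonzero_mult_div_cancel_right)
    thus ?thesis by simp
  qed
  show ?thesis by (rule key[OF eq[unfolded Gamma_reflection_complex] _ s0]) simp
qed

lemma Trigamma_reflection:
  fixes z :: complex
  assumes z: "z \<notin> \<int>"
  shows "Polygamma 1 z + Polygamma 1 (1 - z) = (of_real pi / sin (of_real pi * z))\<^sup>2"
proof -
  have zn: "z \<notin> \<int>\<^sub>\<le>\<^sub>0" "1 - z \<notin> \<int>\<^sub>\<le>\<^sub>0"
    using not_Int_imp[OF assms] by auto
  have s0: "sin (of_real pi * z) \<noteq> 0" using assms by (subst mult.commute) (simp add: sin_eq_0 mult.commute Ints_def image_iff)
  have op: "open (- \<int> :: complex set)" by (simp add: closed_Ints open_Compl)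
  have "((\<lambda>z. Digamma z - Digamma (1 - z)) has_field_derivative Polygamma 1 z + Polygamma 1 (1 - z)) (at z)"
    using zn by (auto intro!: derivative_eq_intros)
  hence "((\<lambda>z. - (of_real pi * cos (of_real pi * z) / sin (of_real pi * z))) has_field_derivative Polygamma 1 z + Polygamma 1 (1 - z)) (at z)"
    by (rule has_field_derivative_transform_within_open[OF _ op]) (use z Digamma_reflection in auto)
  moreover have "((\<lambda>z. - (of_real pi * cos (of_real pi * z) / sin (of_real pi * z))) has_field_derivative (of_real pi / sin (of_real pi * z))\<^sup>2) (at z)"
  proof -
    have "(cos (of_real pi * z))\<^sup>2 = 1 - (sin (of_real pi * z))\<^sup>2" by (simp add: cos_squared_eq)
    thus ?thesis using s0
      by (auto intro!: derivative_eq_intros simp: power2_eq_square divide_simps) algebra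
  qed
  ultimately show ?thesis by (rule DERIV_unique)
qed

text \<open>With \<open>x = 2 pi i z\<close> this is the trigamma reflection formula. The lattice
  point 0 is left out of the series, which accounts for the term \<open>1 / x\<^sup>2\<close> on the
  right.\<close>

lemma sums_lattice_inverse_square:
  fixes x :: real
  assumes x: "x > 0"
  defines "\<tau> \<equiv> \<lambda>k::nat. 2 * of_real pi * \<i> * of_nat (Suc k) :: complex"
  shows "(\<lambda>k. 1 / (of_real x + \<tau> k)\<^sup>2 + 1 / (of_real x - \<tau> k)\<^sup>2) sums
    (of_real (exp (-x) / (1 - exp (-x))\<^sup>2) - 1 / (of_real x)\<^sup>2)"
proof -
  define z where "z = - \<i> * of_real x / (2 * of_real pi)"
  have zZ: "z \<notin> \<int>" 
  proof
    assume "z \<in> \<int>"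
    then obtain n where "z = of_int n" by (auto elim: Ints_cases)
    hence "Im z = 0" by simp
    thus False using x by (simp add: z_def)
  qed
  have z0: "z \<noteq> 0" "1 - z \<noteq> 0" using zZ by auto
  have "(\<lambda>k. inverse ((z + of_nat k) ^ Suc 1)) sums ((-1) ^ Suc 1 * Polygamma 1 z / fact 1)"
    by (rule Polygamma_LIMSEQ) (use z0 in auto)
  hence "(\<lambda>k. inverse ((z + of_nat k)\<^sup>2)) sums Polygamma 1 z" by (simp add: numeral_2_eq_2)
  hence s1: "(\<lambda>k. inverse ((z + of_nat (Suc k))\<^sup>2)) sums (Polygamma 1 z - inverse (z\<^sup>2))"
    by (subst sums_Suc_iff) simp
  have "(\<lambda>k. inverse ((1 - z + of_nat k) ^ Suc 1)) sums ((-1) ^ Suc 1 * Polygamma 1 (1 - z) / fact 1)"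
    by (rule Polygamma_LIMSEQ) (use z0 in auto)
  hence "(\<lambda>k. inverse ((1 - z + of_nat k)\<^sup>2)) sums Polygamma 1 (1 - z)" by (simp add: numeral_2_eq_2)
  also have "(\<lambda>k. inverse ((1 - z + of_nat k)\<^sup>2)) = (\<lambda>k. inverse ((z - of_nat (Suc k))\<^sup>2))"
    by (rule ext) (simp add: power2_eq_square algebra_simps)
  finally have s2: "(\<lambda>k. inverse ((z - of_nat (Suc k))\<^sup>2)) sums Polygamma 1 (1 - z)" .
  let ?c = "- 1 / (4 * (of_real pi)\<^sup>2) :: complex"
  have "(\<lambda>k. ?c * (inverse ((z + of_nat (Suc k))\<^sup>2) + inverse ((z - of_nat (Suc k))\<^sup>2))) sums
     (?c * (Polygamma 1 z - inverse (z\<^sup>2) + Polygamma 1 (1 - z)))"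
    by (intro sums_mult sums_add s1 s2)
  moreover have "?c * (inverse ((z + of_nat (Suc k))\<^sup>2) + inverse ((z - of_nat (Suc k))\<^sup>2)) = 1 / (of_real x + \<tau> k)\<^sup>2 + 1 / (of_real x - \<tau> k)\<^sup>2" for k
  proof -
    have "of_real x = 2 * of_real pi * \<i> * z" by (simp add: z_def)
    hence "of_real x + \<tau> k = 2 * of_real pi * \<i> * (z + of_nat (Suc k))" "of_real x - \<tau> k = 2 * of_real pi * \<i> * (z - of_nat (Suc k))"
      by (simp_all add: \<tau>_def algebra_simps)
    thus ?thesis by (simp add: power_mult_distrib divide_simps del: of_nat_Suc) (simp add: algebra_simps)?
  qed
  moreover have "?c * (Polygamma 1 z - inverse (z\<^sup>2) + Polygamma 1 (1 - z)) = of_real (exp (-x) / (1 - exp (-x))\<^sup>2) - 1 / (of_real x)\<^sup>2"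
  proof -
    have "?c * (Polygamma 1 z - inverse (z\<^sup>2) + Polygamma 1 (1 - z)) = ?c * (Polygamma 1 z + Polygamma 1 (1 - z)) - ?c * inverse (z\<^sup>2)"
      by (simp add: algebra_simps)
    also have "?c * inverse (z\<^sup>2) = 1 / (of_real x)\<^sup>2"
      by (simp add: z_def power_divide power_mult_distrib divide_simps)
    also have "?c * (Polygamma 1 z + Polygamma 1 (1 - z)) = - 1 / (4 * (sin (of_real pi * z))\<^sup>2)"
      unfolding Trigamma_reflection[OF zZ] by (simp add: power_divide)
    also have "of_real pi * z = - \<i> * of_real (x / 2)" by (simp add: z_def)
    also have "sin (- \<i> * of_real (x / 2)) = - \<i> * of_real ((exp (x/2) - exp (-(x/2))) / 2)"
      by (simp add: sin_exp_eq exp_of_real[symmetric] field_simps exp_minus)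
    also have "- 1 / (4 * (- \<i> * of_real ((exp (x/2) - exp (-(x/2))) / 2))\<^sup>2) = complex_of_real (1 / (exp (x/2) - exp (-(x/2)))\<^sup>2)"
      by (simp add: power_mult_distrib power_divide)
    also have "1 / (exp (x/2) - exp (-(x/2)))\<^sup>2 = exp (-x) / (1 - exp (-x))\<^sup>2"
    proof -
      have "1 - exp (-x) = exp (-(x/2)) * (exp (x/2) - exp (-(x/2)))"
        by (simp add: algebra_simps flip: exp_add)
      hence "(1 - exp (-x))\<^sup>2 = (exp (-(x/2)))\<^sup>2 * (exp (x/2) - exp (-(x/2)))\<^sup>2" by (simp add: power_mult_distrib)
      also have "(exp (-(x/2)))\<^sup>2 = exp (-x)" by (simp flip: exp_double)
      finally show ?thesis by simp
    qed
    finally show ?thesis .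
  qed
  ultimately show ?thesis by simp
qed

lemma sums_nat_times_exp:
  fixes x :: real
  assumes "x > 0"
  shows "(\<lambda>n. real (Suc n) * exp (- x * real (Suc n))) sums (exp (-x) / (1 - exp (-x))\<^sup>2)"
proof -
  have "(\<lambda>n. exp (-x) * (real (Suc n) * exp (-x) ^ n)) sums (exp (-x) * (1 / (1 - exp (-x))\<^sup>2))"
    using assms by (intro sums_mult geometric_deriv_sums) auto
  moreover have "exp (-x) * (real (Suc n) * exp (-x) ^ n) = real (Suc n) * exp (- x * real (Suc n))" for n
  proof -
    have "exp (-x) * exp (-x) ^ n = exp (- x * real (Suc n))"
      by (simp add: algebra_simps flip: exp_of_nat_mult exp_add)
    thus ?thesis by (simp add: mult_ac del: of_nat_Suc)
  qed
  ultimately show ?thesis by (simp only: mult_1_right times_divide_eq_right)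
qed

text \<open>The exponents distribute the square between two needs: the power -3/2 of
  \<open>y\<close> is summable over the lattice, and the remaining power -1/2 of \<open>x\<close>
  makes the Mellin integral converge at infinity.\<close>

lemma norm_lattice_shift_ge:
  fixes x y :: real
  assumes "x > 0" "y > 0"
  shows "norm (of_real x + \<i> * of_real y) ^ 2 \<ge> x powr (1/2) * y powr (3/2)"
    and "norm (of_real x - \<i> * of_real y) ^ 2 \<ge> x powr (1/2) * y powr (3/2)"
proof -
  define m where "m = max x y"
  have "x powr (1/2) * y powr (3/2) \<le> m powr (1/2) * m powr (3/2)"
    using assms by (intro mult_mono powr_mono2) (auto simp: m_def)
  also have "\<dots> = m\<^sup>2" using assms by (simp add: m_def flip: powr_add powr_numeral)
  also have "\<dots> \<le> x\<^sup>2 + y\<^sup>2" by (simp add: m_def max_def)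
  finally show "norm (of_real x + \<i> * of_real y) ^ 2 \<ge> x powr (1/2) * y powr (3/2)"
     "norm (of_real x - \<i> * of_real y) ^ 2 \<ge> x powr (1/2) * y powr (3/2)"
    by (simp_all add: cmod_power2)
qed

text \<open>The lattice identity at \<open>l + t\<close> is integrated against
  \<open>t powr (s - 1)\<close>. On the exponential side this inserts \<open>Gamma s\<close> times
  the power -s of the summation index, on the lattice side it turns inverse squares into powers of
  exponent \<open>s - 2\<close>.\<close>

theorem Lipschitz_summation:
  fixes s l :: real
  assumes s: "0 < s" "s < 1/2" and lam: "l > 0"
  defines "\<tau> \<equiv> \<lambda>k::nat. 2 * of_real pi * \<i> * of_nat (Suc k) :: complex"
  shows "summable (\<lambda>n. real (Suc n) powr (1 - s) * exp (- l * real (Suc n)))"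
    and "(\<lambda>k. (of_real l + \<tau> k) powr (of_real (s - 2)) + (of_real l - \<tau> k) powr (of_real (s - 2))) sums
     (of_real ((\<Sum>n. real (Suc n) powr (1 - s) * exp (- l * real (Suc n))) / Gamma (2 - s)) - of_real (l powr (s - 2)))"
proof -
  let ?M = "lebesgue_on {0<..} :: real measure"
  define S where "S = (\<lambda>x::real. exp (-x) / (1 - exp (-x))\<^sup>2)"
  define f where "f = (\<lambda>n t. t powr (s - 1) * (real (Suc n) * exp (- (l + t) * real (Suc n))))"
  define F where "F = (\<lambda>n. real (Suc n) powr (1 - s) * exp (- l * real (Suc n)))"
  have fint: "has_bochner_integral ?M (f n) (Gamma s * F n)" for n
  proof -
    let ?N = "real (Suc n)"
    have "has_bochner_integral ?M (\<lambda>t. (?N * exp (- l * ?N)) * (t powr (s - 1) * exp (- ?N * t)))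
      ((?N * exp (- l * ?N)) * (Gamma s * ?N powr (- s)))"
      by (intro has_bochner_integral_mult_right has_bochner_integral_Gamma_scaled s) auto
    moreover have "(\<lambda>t. (?N * exp (- l * ?N)) * (t powr (s - 1) * exp (- ?N * t))) = f n"
    proof
      fix t
      have "exp (- (l + t) * N) = exp (- l * N) * exp (- N * t)" for N
        by (simp add: algebra_simps flip: exp_add)
      thus "(?N * exp (- l * ?N)) * (t powr (s - 1) * exp (- ?N * t)) = f n t"
        by (simp only: f_def mult_ac)
    qed
    moreover have "?N * ?N powr (- s) = ?N powr (1 - s)"
      by (simp add: powr_diff powr_minus field_simps)
    hence "(?N * exp (- l * ?N)) * (Gamma s * ?N powr (- s)) = Gamma s * F n"
      unfolding F_def by (metis mult.assoc mult.commute)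
    ultimately show ?thesis by (simp only:)
  qed
  have Fsum: "summable F"
  proof (rule summable_comparison_test')
    show "summable (\<lambda>n. real (Suc n) * exp (- l * real (Suc n)))"
      using sums_nat_times_exp[OF lam] by (simp add: sums_iff)
    show "norm (F n) \<le> real (Suc n) * exp (- l * real (Suc n))" for n
    proof -
      have "real (Suc n) powr (1 - s) \<le> real (Suc n) powr 1" using s by (intro powr_mono) auto
      thus ?thesis by (simp add: F_def mult_right_mono del: of_nat_Suc)
    qed
  qed
  thus "summable (\<lambda>n. real (Suc n) powr (1 - s) * exp (- l * real (Suc n)))" by (simp add: F_def)
  have fpos: "f n t \<ge> 0" for n t by (simp add: f_def)
  have fsums: "(\<lambda>n. f n t) sums (t powr (s - 1) * S (l + t))" if "t > 0" for t
    unfolding f_def S_def by (intro sums_mult sums_nat_times_exp) (use lam that in auto)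
  have I1: "has_bochner_integral ?M (\<lambda>t. t powr (s - 1) * S (l + t)) (Gamma s * suminf F)"
  proof -
    have h1: "integrable ?M (f n)" for n using fint has_bochner_integral_iff by blast
    have h2: "AE t in ?M. summable (\<lambda>n. norm (f n t))"
      by (rule AE_I2) (use fsums fpos in \<open>auto simp: space_restrict_space sums_iff\<close>)
    have "(\<integral>t. norm (f n t) \<partial>?M) = Gamma s * F n" for n
      using fint fpos by (simp add: has_bochner_integral_iff)
    hence h3: "summable (\<lambda>n. \<integral>t. norm (f n t) \<partial>?M)" using Fsum by (simp add: summable_mult)
    have "has_bochner_integral ?M (\<lambda>t. \<Sum>n. f n t) (\<Sum>n. \<integral>t. f n t \<partial>?M)"
      using integrable_suminf[OF h1 h2 h3] integral_suminf[OF h1 h2 h3] by (simp add: has_bochner_integral_iff)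
    also have "(\<Sum>n. \<integral>t. f n t \<partial>?M) = Gamma s * suminf F"
      using fint Fsum by (simp add: has_bochner_integral_iff suminf_mult)
    also have "has_bochner_integral ?M (\<lambda>t. \<Sum>n. f n t) X \<longleftrightarrow> has_bochner_integral ?M (\<lambda>t. t powr (s - 1) * S (l + t)) X" for X
      by (rule has_bochner_integral_cong) (use fsums in \<open>auto simp: space_restrict_space sums_iff\<close>)
    finally show ?thesis .
  qed
  define G where "G = complex_of_real (Gamma s * Gamma (2 - s))"
  define h where "h = (\<lambda>k t. complex_of_real (t powr (s - 1)) / (of_real t + (of_real l + \<tau> k))\<^sup>2 + complex_of_real (t powr (s - 1)) / (of_real t + (of_real l - \<tau> k))\<^sup>2)"
  define H where "H = (\<lambda>k. (of_real l + \<tau> k) powr (of_real (s - 2)) + (of_real l - \<tau> k) powr (of_real (s - 2)))"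
  have hint: "has_bochner_integral ?M (h k) (G * H k)" for k
    unfolding h_def H_def G_def distrib_left
    by (intro has_bochner_integral_add has_bochner_integral_Mellin_inverse_square) (use s lam in \<open>auto simp: \<tau>_def\<close>)
  \<comment> \<open>The factor 2 counts the two conjugate lattice points.\<close>
  define D where "D = (\<lambda>k. 2 * (2 * pi * real (Suc k)) powr (-3/2))"
  have hbound: "norm (h k t) \<le> D k * (t powr (s - 1) * (l + t) powr (- 1 / 2))" if t: "t > 0" for k t
  proof -
    define y where "y = 2 * pi * real (Suc k)"
    have y: "y > 0" by (simp add: y_def)
    have tau: "\<tau> k = \<i> * of_real y" by (simp add: \<tau>_def y_def)
    have xx: "l + t > 0" using lam t by simp
    have b: "t powr (s - 1) / z \<le> y powr (-3/2) * (t powr (s - 1) * (l + t) powr (- 1 / 2))"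
      if "z \<ge> (l + t) powr (1/2) * y powr (3/2)" for z
    proof -
      have "t powr (s - 1) / z \<le> t powr (s - 1) / ((l + t) powr (1/2) * y powr (3/2))"
        using xx y that by (intro divide_left_mono) (auto intro!: mult_pos_pos order.strict_trans2[OF _ that])
      also have "\<dots> = y powr (-3/2) * (t powr (s - 1) * (l + t) powr (- 1 / 2))"
        using powr_minus_divide[of y "3/2"] powr_minus_divide[of "l + t" "1/2"] by simp
      finally show ?thesis .
    qed
    have "norm (h k t) \<le> t powr (s - 1) / norm (of_real (l + t) + \<i> * of_real y) ^ 2 + t powr (s - 1) / norm (of_real (l + t) - \<i> * of_real y) ^ 2"
      unfolding h_def by (rule order_trans[OF norm_triangle_ineq]) (simp add: norm_divide norm_power tau add_ac add_diff_eq)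
    also have "\<dots> \<le> y powr (-3/2) * (t powr (s - 1) * (l + t) powr (- 1 / 2)) + y powr (-3/2) * (t powr (s - 1) * (l + t) powr (- 1 / 2))"
      by (intro add_mono b norm_lattice_shift_ge xx y)
    finally show ?thesis by (simp add: D_def y_def mult_ac)
  qed
  \<comment> \<open>The integral of the majorant; its second Beta parameter \<open>1/2 - s\<close>
    is the reason for the condition \<open>s < 1/2\<close>.\<close>
  define B where "B = l powr (- (1/2 - s)) * Beta s (1/2 - s)"
  have Bint: "has_bochner_integral ?M (\<lambda>t. t powr (s - 1) * (l + t) powr (- 1 / 2)) B"
    using has_bochner_integral_Beta_halfline[of s "1/2 - s" l] s lam by (simp add: B_def)
  have hsums: "(\<lambda>k. h k t) sums (of_real (t powr (s - 1) * S (l + t)) - of_real (t powr (s - 1)) / (of_real t + of_real l)\<^sup>2)" if t: "t > 0" for t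
  proof -
    have "(\<lambda>k. of_real (t powr (s - 1)) * (1 / (of_real (l + t) + \<tau> k)\<^sup>2 + 1 / (of_real (l + t) - \<tau> k)\<^sup>2)) sums
        (of_real (t powr (s - 1)) * (of_real (S (l + t)) - 1 / (of_real (l + t))\<^sup>2))"
      unfolding \<tau>_def S_def by (intro sums_mult sums_lattice_inverse_square) (use lam t in auto)
    thus ?thesis by (simp add: h_def algebra_simps)
  qed
  have Dsum: "summable D"
  proof -
    have "summable (\<lambda>k. real (Suc k) powr (-3/2))"
      by (subst summable_Suc_iff) (simp add: summable_real_powr_iff)
    hence "summable (\<lambda>k. 2 * (2 * pi) powr (-3/2) * real (Suc k) powr (-3/2))" by (rule summable_mult)
    thus ?thesis by (simp add: D_def powr_mult mult_ac del: of_nat_Suc)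
  qed
  have I2: "(\<lambda>k. G * H k) sums (\<integral>t. (\<Sum>k. h k t) \<partial>?M)" and I2': "integrable ?M (\<lambda>t. \<Sum>k. h k t)"
  proof -
    have h1: "integrable ?M (h k)" for k using hint has_bochner_integral_iff by blast
    have h2: "AE t in ?M. summable (\<lambda>k. norm (h k t))"
    proof (rule AE_I2)
      fix t :: real assume "t \<in> space ?M"
      hence t: "t > 0" by (simp add: space_restrict_space)
      show "summable (\<lambda>k. norm (h k t))"
        by (rule summable_comparison_test'[OF summable_mult2[OF Dsum]]) (use hbound[OF t] in simp)
    qed
    have h3: "summable (\<lambda>k. \<integral>t. norm (h k t) \<partial>?M)"
    proof (rule summable_comparison_test'[OF summable_mult2[OF Dsum, of B]])
      fix k
      have "(\<integral>t. norm (h k t) \<partial>?M) \<le> (\<integral>t. D k * (t powr (s - 1) * (l + t) powr (- 1 / 2)) \<partial>?M)"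
        using hbound Bint h1 by (intro integral_mono integrable_norm integrable_mult_right)
          (auto simp: space_restrict_space has_bochner_integral_iff)
      also have "\<dots> = D k * B" using Bint by (simp add: has_bochner_integral_iff)
      finally show "norm (\<integral>t. norm (h k t) \<partial>?M) \<le> D k * B" by simp
    qed
    show "(\<lambda>k. G * H k) sums (\<integral>t. (\<Sum>k. h k t) \<partial>?M)"
      using sums_integral[OF h1 h2 h3] hint by (simp add: has_bochner_integral_iff)
    show "integrable ?M (\<lambda>t. \<Sum>k. h k t)" by (rule integrable_suminf[OF h1 h2 h3])
  qed
  have "has_bochner_integral ?M (\<lambda>t. of_real (t powr (s - 1) * S (l + t)) - of_real (t powr (s - 1)) / (of_real t + of_real l)\<^sup>2)
      (of_real (Gamma s * suminf F) - G * of_real l powr (of_real (s - 2)))"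
    unfolding G_def by (intro has_bochner_integral_diff has_bochner_integral_of_real I1 has_bochner_integral_Mellin_inverse_square)
      (use s lam in auto)
  also have "?this \<longleftrightarrow> has_bochner_integral ?M (\<lambda>t. \<Sum>k. h k t) (of_real (Gamma s * suminf F) - G * of_real l powr (of_real (s - 2)))"
    by (rule has_bochner_integral_cong) (use hsums in \<open>auto simp: space_restrict_space sums_iff\<close>)
  finally have "(\<lambda>k. G * H k) sums (of_real (Gamma s * suminf F) - G * of_real l powr (of_real (s - 2)))"
    using I2 by (simp add: has_bochner_integral_iff)
  hence "(\<lambda>k. inverse G * (G * H k)) sums (inverse G * (of_real (Gamma s * suminf F) - G * of_real l powr (of_real (s - 2))))"
    by (rule sums_mult)
  moreover have G0: "Gamma s > 0" "Gamma (2 - s) > 0" using s by auto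
  hence "G \<noteq> 0" by (simp add: G_def)
  moreover have "inverse G * of_real (Gamma s * suminf F) = of_real (suminf F / Gamma (2 - s))"
    using G0 by (simp add: G_def field_simps)
  moreover have "of_real l powr (of_real (s - 2)) = complex_of_real (l powr (s - 2))"
    using lam by (subst powr_of_real) auto
  moreover have "inverse G * (G * x) = x" for x using \<open>G \<noteq> 0\<close> by simp
  ultimately have "H sums (of_real (suminf F / Gamma (2 - s)) - of_real (l powr (s - 2)))"
    by (simp only: right_diff_distrib)
  thus "(\<lambda>k. (of_real l + \<tau> k) powr (of_real (s - 2)) + (of_real l - \<tau> k) powr (of_real (s - 2))) sums
     (of_real ((\<Sum>n. real (Suc n) powr (1 - s) * exp (- l * real (Suc n))) / Gamma (2 - s)) - of_real (l powr (s - 2)))"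
    unfolding H_def F_def .
qed

section \<open>Polylogarithms and the zeta function\<close>

lemma summable_swap:
  fixes f :: "nat \<Rightarrow> nat \<Rightarrow> 'a :: banach"
  assumes row: "\<And>k. summable (\<lambda>j. norm (f k j))"
    and col: "summable (\<lambda>k. \<Sum>j. norm (f k j))"
  shows "summable (\<lambda>k. norm (f k j))"
    and "(\<lambda>j. \<Sum>k. f k j) sums (\<Sum>k. \<Sum>j. f k j)"
    and "summable (\<lambda>k. \<Sum>j. f k j)"
    and "summable (\<lambda>j. norm (\<Sum>k. f k j))"
proof -
  let ?F = "\<lambda>(k, j). f k j"
  have inf: "infsum (\<lambda>j. norm (f k j)) UNIV = (\<Sum>j. norm (f k j))" for k
    using norm_summable_imp_has_sum[of "\<lambda>j. norm (f k j)"] row[of k]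
    by (intro infsumI) (auto simp: summable_sums)
  have row': "(\<lambda>j. norm (f k j)) summable_on UNIV" for k
    by (subst summable_on_UNIV_nonneg_real_iff) (auto simp: row)
  have nn: "(\<Sum>j. norm (f k j)) \<ge> 0" for k by (intro suminf_nonneg row) auto
  have F: "(\<lambda>x. norm (?F x)) summable_on (UNIV \<times> UNIV)"
    unfolding Infinite_Sum.abs_summable_on_Sigma_iff prod.case inf using row' col nn
    by (auto simp: summable_on_UNIV_nonneg_real_iff)
  hence Fs: "?F summable_on (UNIV \<times> UNIV)" by (rule abs_summable_summable)
  have "(\<lambda>(j, k). norm (f k j)) summable_on (UNIV \<times> UNIV)"
    using F by (subst summable_on_swap) (simp add: case_prod_unfold)
  hence F': "(\<lambda>x. norm ((\<lambda>(j, k). f k j) x)) summable_on (UNIV \<times> UNIV)" by (simp add: case_prod_unfold)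
  have "(\<lambda>k. norm (f k j)) summable_on UNIV" for j
    using F'[unfolded Infinite_Sum.abs_summable_on_Sigma_iff] by simp
  thus colj: "summable (\<lambda>k. norm (f k j))" for j by (rule summable_on_imp_summable)
  have Fs': "(\<lambda>(j, k). f k j) summable_on (UNIV \<times> UNIV)" using F' by (rule abs_summable_summable)
  have hrow: "((\<lambda>j. f k j) has_sum (\<Sum>j. f k j)) UNIV" for k
    by (rule norm_summable_imp_has_sum[OF row]) (intro summable_sums summable_norm_cancel[OF row])
  have hcol: "((\<lambda>k. f k j) has_sum (\<Sum>k. f k j)) UNIV" for j
    by (rule norm_summable_imp_has_sum[OF colj]) (intro summable_sums summable_norm_cancel[OF colj])
  define S where "S = infsum ?F (UNIV \<times> UNIV)"
  have irow: "infsum (f k) UNIV = (\<Sum>j. f k j)" for k using hrow by (rule infsumI)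
  have icol: "infsum (\<lambda>k. f k j) UNIV = (\<Sum>k. f k j)" for j using hcol by (rule infsumI)
  have "((\<lambda>k. infsum (f k) UNIV) has_sum infsum (\<lambda>k. infsum (f k) UNIV) UNIV) UNIV"
    by (rule has_sum_infsum, rule summable_on_Sigma_banach[OF Fs])
  hence "((\<lambda>k. \<Sum>j. f k j) has_sum S) UNIV"
    unfolding S_def using infsum_Sigma'_banach[OF Fs] by (simp only: irow)
  hence s1: "(\<lambda>k. \<Sum>j. f k j) sums S" by (rule has_sum_imp_sums)
  have "((\<lambda>j. infsum (\<lambda>k. f k j) UNIV) has_sum infsum (\<lambda>j. infsum (\<lambda>k. f k j) UNIV) UNIV) UNIV"
    by (rule has_sum_infsum, rule summable_on_Sigma_banach[OF Fs'])
  hence "((\<lambda>j. \<Sum>k. f k j) has_sum S) UNIV"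
    unfolding S_def using infsum_Sigma'_banach[OF Fs] infsum_swap_banach[OF Fs] by (simp only: icol)
  hence s2: "(\<lambda>j. \<Sum>k. f k j) sums S" by (rule has_sum_imp_sums)
  show "(\<lambda>j. \<Sum>k. f k j) sums (\<Sum>k. \<Sum>j. f k j)" using s1 s2 by (simp add: sums_iff)
  show "summable (\<lambda>k. \<Sum>j. f k j)" using s1 by (simp add: sums_iff)
  have "(\<lambda>j. norm (infsum (\<lambda>k. norm (f k j)) UNIV)) summable_on UNIV"
    using F'[unfolded Infinite_Sum.abs_summable_on_Sigma_iff] by simp
  moreover have "infsum (\<lambda>k. norm (f k j)) UNIV = (\<Sum>k. norm (f k j))" for j
    using norm_summable_imp_has_sum[of "\<lambda>k. norm (f k j)"] colj[of j]
    by (intro infsumI) (auto simp: summable_sums)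
  ultimately have "summable (\<lambda>j. norm (\<Sum>k. norm (f k j)))"
    by (simp only:) (rule summable_on_imp_summable)
  thus "summable (\<lambda>j. norm (\<Sum>k. f k j))"
    by (rule summable_comparison_test') (use order_trans[OF summable_norm[OF colj] abs_ge_self] in simp)
qed

lemma holomorphic_on_suminf_local:
  fixes f :: "nat \<Rightarrow> complex \<Rightarrow> complex"
  assumes S: "open S" and hol: "\<And>n. f n holomorphic_on S"
    and bd: "\<And>x. x \<in> S \<Longrightarrow> \<exists>d h. 0 < d \<and> summable h \<and> (\<forall>n. \<forall>y\<in>cball x d \<inter> S. norm (f n y) \<le> h n)"
  shows "(\<lambda>x. \<Sum>n. f n x) holomorphic_on S"
proof (rule holomorphic_uniform_sequence[OF S])
  show "(\<lambda>x. \<Sum>i<n. f i x) holomorphic_on S" for n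
    using hol by (intro holomorphic_intros)
next
  fix x assume x: "x \<in> S"
  from bd[OF x] obtain d h where d: "0 < d" "summable h" "\<And>n y. y \<in> cball x d \<inter> S \<Longrightarrow> norm (f n y) \<le> h n" by blast
  obtain e where e: "e > 0" "cball x e \<subseteq> S" using S x open_contains_cball by blast
  have sub: "cball x (min d e) \<subseteq> cball x d \<inter> S" using e by (auto simp: mem_cball)
  have "uniform_limit (cball x (min d e)) (\<lambda>n x. \<Sum>i<n. f i x) (\<lambda>x. suminf (\<lambda>i. f i x)) sequentially"
    by (rule Weierstrass_m_test[OF _ d(2)]) (use d(3) sub in auto)
  thus "\<exists>d>0. cball x d \<subseteq> S \<and> uniform_limit (cball x d) (\<lambda>n x. \<Sum>i<n. f i x) (\<lambda>x. \<Sum>n. f n x) sequentially"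
    using d e sub by (intro exI[of _ "min d e"]) auto
qed

lemma norm_of_nat_powr: "norm ((of_nat (Suc n) :: complex) powr z) = real (Suc n) powr Re z"
proof -
  have "(of_nat (Suc n) :: complex) = of_real (real (Suc n))" by simp
  thus ?thesis by (simp only:) (subst norm_powr_real_powr, auto)
qed

definition zeta_series :: "complex \<Rightarrow> complex" where
  "zeta_series s = (\<Sum>n. 1 / of_nat (Suc n) powr s)"

lemma norm_zeta_term: "norm (1 / (of_nat (Suc n) :: complex) powr s) = real (Suc n) powr (- Re s)"
  unfolding norm_divide norm_of_nat_powr by (simp add: powr_minus_divide)

lemma summable_Suc_powr: "c > 1 \<Longrightarrow> summable (\<lambda>n. real (Suc n) powr (- c))"
  by (subst summable_Suc_iff) (simp add: summable_real_powr_iff)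

lemma summable_zeta_term:
  assumes "Re s > 1"
  shows "summable (\<lambda>n. norm (1 / (of_nat (Suc n) :: complex) powr s))"
  unfolding norm_zeta_term by (rule summable_Suc_powr[OF assms])

lemma zeta_series_sums: "Re s > 1 \<Longrightarrow> (\<lambda>n. 1 / of_nat (Suc n) powr s) sums zeta_series s"
  unfolding zeta_series_def by (rule summable_sums, rule summable_norm_cancel, rule summable_zeta_term)

lemma norm_zeta_series_le:
  assumes "Re s \<ge> c" "c > 1"
  shows "norm (zeta_series s) \<le> (\<Sum>n. real (Suc n) powr (- c))"
proof -
  have "norm (zeta_series s) \<le> (\<Sum>n. norm (1 / (of_nat (Suc n) :: complex) powr s))"
    unfolding zeta_series_def by (rule summable_norm) (use assms in \<open>intro summable_zeta_term, simp\<close>)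
  also have "\<dots> \<le> (\<Sum>n. real (Suc n) powr (- c))"
  proof (rule suminf_le)
    show "norm (1 / (of_nat (Suc n) :: complex) powr s) \<le> real (Suc n) powr (- c)" for n
      unfolding norm_zeta_term using assms by (intro powr_mono) auto
    show "summable (\<lambda>n. norm (1 / (of_nat (Suc n) :: complex) powr s))" using assms by (intro summable_zeta_term) simp
  qed (rule summable_Suc_powr[OF assms(2)])
  finally show ?thesis .
qed

lemma holomorphic_zeta_series: "zeta_series holomorphic_on {s. Re s > 1}"
  unfolding zeta_series_def[abs_def]
proof (rule holomorphic_on_suminf_local)
  show "open {s. Re s > 1}" by (rule open_halfspace_Re_gt)
  show "(\<lambda>s. 1 / of_nat (Suc n) powr s) holomorphic_on {s. 1 < Re s}" for n
    by (intro holomorphic_intros) auto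
  fix s assume s: "s \<in> {s. 1 < Re s}"
  define d where "d = (Re s - 1) / 2"
  have d: "d > 0" "1 + d = Re s - d" using s by (auto simp: d_def field_simps)
  have "norm (1 / of_nat (Suc n) powr y) \<le> real (Suc n) powr (- (1 + d))" if "y \<in> cball s d" for n y
  proof -
    have "Re s - Re y \<le> d" using that abs_Re_le_cmod[of "s - y"] by (auto simp: dist_norm)
    hence "1 + d \<le> Re y" using d by linarith
    thus ?thesis unfolding norm_zeta_term by (intro powr_mono) auto
  qed
  moreover have "summable (\<lambda>n. real (Suc n) powr (- (1 + d)))" using d(1) by (intro summable_Suc_powr) simp
  ultimately show "\<exists>d h. 0 < d \<and> summable h \<and> (\<forall>n. \<forall>y\<in>cball s d \<inter> {s. 1 < Re s}. norm (1 / of_nat (Suc n) powr y) \<le> h n)"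
    using d(1) by blast
qed

section \<open>The polylogarithm and its expansion for exponents with positive real part\<close>

definition polylog_exp :: "complex \<Rightarrow> real \<Rightarrow> complex" where
  "polylog_exp p l = (\<Sum>n. of_nat (Suc n) powr p * of_real (exp (- l * real (Suc n))))"

lemma summable_powr_exp:
  fixes c l :: real
  assumes "l > 0"
  shows "summable (\<lambda>n. real (Suc n) powr c * exp (- l * real (Suc n)))"
proof (rule summable_comparison_test_ev)
  have "((\<lambda>n. real (Suc n) powr c * exp (- (l/2) * real (Suc n))) \<longlongrightarrow> 0) sequentially"
    using assms by real_asymp
  hence "\<forall>\<^sub>F n in sequentially. real (Suc n) powr c * exp (- (l/2) * real (Suc n)) < 1"
    by (rule order_tendstoD) simp
  thus "\<forall>\<^sub>F n in sequentially. norm (real (Suc n) powr c * exp (- l * real (Suc n))) \<le> exp (- (l/2)) ^ Suc n"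
  proof eventually_elim
    case (elim n)
    have "exp (- l * real (Suc n)) = exp (- (l/2) * real (Suc n)) * exp (- (l/2)) ^ Suc n"
    proof -
      have "exp (- (l/2)) ^ Suc n = exp (- (l/2) * real (Suc n))"
        by (metis exp_of_nat_mult mult.commute)
      thus ?thesis by (simp only: flip: exp_add) (simp add: algebra_simps)
    qed
    hence "real (Suc n) powr c * exp (- l * real (Suc n)) = (real (Suc n) powr c * exp (- (l/2) * real (Suc n))) * exp (- (l/2)) ^ Suc n"
      by simp
    also have "\<dots> \<le> 1 * exp (- (l/2)) ^ Suc n" using elim by (intro mult_right_mono) auto
    finally show ?case by (simp del: of_nat_Suc)
  qed
  show "summable (\<lambda>n. exp (- (l/2)) ^ Suc n)" using assms
    by (subst summable_Suc_iff) (simp add: summable_geometric)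
qed

lemma norm_polylog_term: "norm (of_nat (Suc n) powr p * complex_of_real (exp (- l * real (Suc n)))) = real (Suc n) powr Re p * exp (- l * real (Suc n))"
  unfolding norm_mult norm_of_nat_powr by simp

lemma holomorphic_polylog_exp:
  assumes "l > 0"
  shows "(\<lambda>p. polylog_exp p l) holomorphic_on A"
proof -
  have "(\<lambda>p. polylog_exp p l) holomorphic_on UNIV"
    unfolding polylog_exp_def[abs_def]
  proof (rule holomorphic_on_suminf_local)
    show "open UNIV" by simp
    show "(\<lambda>p. of_nat (Suc n) powr p * complex_of_real (exp (- l * real (Suc n)))) holomorphic_on UNIV" for n
      by (intro holomorphic_intros)
    fix p :: complex
    have "norm (of_nat (Suc n) powr y * complex_of_real (exp (- l * real (Suc n)))) \<le> real (Suc n) powr (Re p + 1) * exp (- l * real (Suc n))"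
      if "y \<in> cball p 1" for n y
    proof -
      have "Re y \<le> Re p + 1" using that abs_Re_le_cmod[of "p - y"] by (auto simp: dist_norm)
      thus ?thesis unfolding norm_polylog_term by (intro mult_right_mono powr_mono) auto
    qed
    thus "\<exists>d h. 0 < d \<and> summable h \<and> (\<forall>n. \<forall>y\<in>cball p d \<inter> UNIV. norm (of_nat (Suc n) powr y * complex_of_real (exp (- l * real (Suc n)))) \<le> h n)"
      using summable_powr_exp[OF assms] by (intro exI[of _ 1] exI[of _ "\<lambda>n. real (Suc n) powr (Re p + 1) * exp (- l * real (Suc n))"]) auto
  qed
  thus ?thesis by (rule holomorphic_on_subset) auto
qed

lemma polylog_exp_of_real:
  assumes "l > 0"
  shows "polylog_exp (of_real p) l = of_real (\<Sum>n. real (Suc n) powr p * exp (- l * real (Suc n)))"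
proof -
  have "of_nat (Suc n) powr (of_real p) * complex_of_real (exp (- l * real (Suc n))) = of_real (real (Suc n) powr p * exp (- l * real (Suc n)))" for n
  proof -
    have "(of_nat (Suc n) :: complex) = of_real (real (Suc n))" by simp
    thus ?thesis by (simp only: powr_of_real of_nat_0_le_iff of_real_mult)
  qed
  thus ?thesis unfolding polylog_exp_def
    by (simp only:) (rule suminf_of_real[OF summable_powr_exp[OF assms, of p], symmetric])
qed

text \<open>The principal branch is multiplicative here: the argument of \<open>w\<close> is at most
  pi/2 in absolute value and that of \<open>1 + z / w\<close> is less, so they add up without
  leaving (-pi, pi). The case \<open>Re w = 0\<close> matters, since the lattice points are purely
  imaginary.\<close>

lemma powr_add_sums:
  fixes w z :: complex
  assumes w: "Re w \<ge> 0" "w \<noteq> 0" and z: "norm z < norm w"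
  shows "(\<lambda>j. (a gchoose j) * z ^ j * w powr (a - of_nat j)) sums ((w + z) powr a)"
proof -
  define x where "x = z / w"
  have x: "norm x < 1" using w z by (simp add: x_def norm_divide divide_less_eq)
  have re: "Re (1 + x) > 0" using x abs_Re_le_cmod[of x] by simp
  hence x0: "1 + x \<noteq> 0" by (metis less_irrefl zero_complex.sel(1))
  have 1: "\<bar>Im (Ln w)\<bar> \<le> pi/2" using w Re_Ln_pos_le by blast
  have 2: "\<bar>Im (Ln (1 + x))\<bar> < pi/2" using re by (rule Re_Ln_pos_lt_imp)
  have "Ln (w * (1 + x)) = Ln w + Ln (1 + x)"
    by (rule Ln_times_simple) (use w x0 1 2 in \<open>auto simp: abs_le_iff abs_less_iff\<close>)
  moreover have "w * (1 + x) = w + z" using w by (simp add: x_def field_simps)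
  ultimately have eq: "(w + z) powr a = w powr a * (1 + x) powr a"
    using w x0 mult_eq_0_iff[of w "1 + x"] by (simp add: powr_def exp_add[symmetric] distrib_left)
  have "(\<lambda>j. w powr a * ((a gchoose j) * x ^ j)) sums (w powr a * (1 + x) powr a)"
    by (intro sums_mult gen_binomial_complex x)
  moreover have "w powr a * ((a gchoose j) * x ^ j) = (a gchoose j) * z ^ j * w powr (a - of_nat j)" for j
    using w by (simp add: x_def powr_diff power_divide powr_nat')
  ultimately show ?thesis using eq by simp
qed

text \<open>Conjugate lattice points contribute opposite phases; their sum is the cosine of the
  functional equation.\<close>

lemma imaginary_powr_add:
  fixes y :: real
  assumes "y > 0"
  shows "(\<i> * of_real y) powr (- s) + (- \<i> * of_real y) powr (- s) = of_real y powr (- s) * 2 * cos (of_real pi * s / 2)"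
proof -
  have 1: "Ln (\<i> * of_real y) = of_real (ln y) + \<i> * of_real pi / 2"
  proof -
    have "Ln (of_real y * \<i>) = of_real (ln y) + Ln \<i>"
      using assms by (subst Ln_times_of_real) (auto simp: Ln_of_real)
    thus ?thesis by (simp add: mult.commute)
  qed
  have 2: "Ln (- \<i> * of_real y) = of_real (ln y) - \<i> * of_real pi / 2"
  proof -
    have "Ln (of_real y * (-\<i>)) = of_real (ln y) + Ln (-\<i>)"
      using assms by (subst Ln_times_of_real) (auto simp: Ln_of_real)
    thus ?thesis by (simp add: mult.commute)
  qed
  have "(\<i> * of_real y) powr (- s) = of_real y powr (- s) * exp (- (\<i> * (of_real pi * s / 2)))"
    using assms 1 by (simp add: powr_def Ln_of_real algebra_simps flip: exp_add)
  moreover have "(- \<i> * of_real y) powr (- s) = of_real y powr (- s) * exp (\<i> * (of_real pi * s / 2))"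
  proof -
    have "Ln (- (\<i> * of_real y)) = of_real (ln y) - \<i> * of_real pi / 2" using 2 by simp
    thus ?thesis using assms by (simp add: powr_def Ln_of_real ring_distribs mult_ac flip: exp_add)
  qed
  moreover have "exp (- (\<i> * (of_real pi * s / 2))) + exp (\<i> * (of_real pi * s / 2)) = 2 * cos (of_real pi * s / 2)"
    by (simp add: cos_exp_eq)
  ultimately show ?thesis by (simp only: distrib_left[symmetric] mult.assoc)
qed

text \<open>The value at \<open>-p\<close> that the functional equation assigns to zeta.\<close>

definition zeta_refl :: "complex \<Rightarrow> complex" where
  "zeta_refl p = 2 * of_real (2 * pi) powr (- p - 1) * cos (of_real pi * (p + 1) / 2) * Gamma (p + 1) * zeta_series (p + 1)"

text \<open>The terms of order at least \<open>J\<close> in the expansion for the exponent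
  \<open>q - J\<close>. Using \<open>q\<close> as parameter keeps every argument of
  \<open>zeta_refl\<close> in the right half plane even when \<open>q - J\<close> is not
  there.\<close>

definition zeta_refl_tail :: "nat \<Rightarrow> complex \<Rightarrow> real \<Rightarrow> complex" where
  "zeta_refl_tail J q l = (\<Sum>i. of_real ((- l) ^ (i + J) / fact (i + J)) * zeta_refl (q + of_nat i))"

lemma summable_pochhammer:
  fixes a \<rho> :: real
  assumes "0 \<le> \<rho>" "\<rho> < 1"
  shows "summable (\<lambda>j. pochhammer a j / fact j * \<rho> ^ j)"
proof -
  have "(\<lambda>j. pochhammer (complex_of_real a) j / fact j * (- (of_real (-\<rho>))) ^ j) sums (1 + of_real (- \<rho>)) powr (- of_real a)"
    using assms by (intro sums_pochhammer_binomial) auto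
  hence "summable (\<lambda>j. complex_of_real (pochhammer a j / fact j * \<rho> ^ j))"
    by (simp add: sums_iff flip: pochhammer_of_real)
  thus ?thesis by (simp only: summable_of_real_iff)
qed

lemma norm_pochhammer_le:
  fixes z :: complex
  assumes "norm z \<le> M"
  shows "norm (pochhammer (z + 1) j) \<le> pochhammer (M + 1) j"
proof -
  have "norm (pochhammer (z + 1) j) = (\<Prod>i<j. norm (z + 1 + of_nat i))"
    by (simp add: pochhammer_prod prod_norm atLeast0LessThan)
  also have "\<dots> \<le> (\<Prod>i<j. M + 1 + of_nat i)"
  proof (intro prod_mono conjI)
    fix i assume "i \<in> {..<j}"
    have "norm (z + (1 + of_nat i)) \<le> norm z + norm (1 + of_nat i :: complex)" by (rule norm_triangle_ineq)
    moreover have "norm (1 + of_nat i :: complex) = 1 + real i"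
      using norm_of_nat[of "Suc i", where ?'a = complex] by simp
    ultimately show "norm (z + 1 + of_nat i) \<le> M + 1 + of_nat i" using assms by (simp add: add_ac)
  qed auto
  also have "\<dots> = pochhammer (M + 1) j" by (simp add: pochhammer_prod atLeast0LessThan)
  finally show ?thesis .
qed

lemma Re_pos_not_nonpos_Int: "Re z > 0 \<Longrightarrow> z \<notin> \<int>\<^sub>\<le>\<^sub>0"
  by (auto elim!: nonpos_Ints_cases)

text \<open>A majorant that is uniform near \<open>q0\<close>: shifting Gamma by \<open>i\<close>
  gives a Pochhammer symbol of size at most \<open>pochhammer (M + 1) i\<close>, the power of
  \<open>2 * pi\<close> gives \<open>1 / (2 * pi) ^ i\<close>, and the rest is bounded. What remains
  is a binomial series in \<open>l / (2 * pi)\<close>.\<close>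

lemma zeta_refl_bound:
  assumes q0: "Re q0 > 0" and l: "0 < l" "l < 2 * pi"
  shows "\<exists>d>0. \<exists>h. summable h \<and> (\<forall>i. \<forall>q\<in>cball q0 d. Re q > 0 \<and> l ^ i / fact i * norm (zeta_refl (q + of_nat i)) \<le> h i)"
proof -
  define d where "d = Re q0 / 2"
  have d: "d > 0" using q0 by (simp add: d_def)
  define M where "M = norm q0 + d"
  have M: "M \<ge> 0" using d by (simp add: M_def)
  have qb: "Re q \<ge> d" "norm q \<le> M" if "q \<in> cball q0 d" for q
  proof -
    have "Re q0 - Re q \<le> d" using that abs_Re_le_cmod[of "q0 - q"] by (auto simp: dist_norm)
    thus "Re q \<ge> d" by (simp add: d_def)
    have "norm q \<le> norm q0 + norm (q - q0)" by (metis add.commute diff_add_cancel norm_triangle_ineq)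
    thus "norm q \<le> M" using that by (simp add: M_def dist_norm norm_minus_commute)
  qed
  have "continuous_on (cball q0 d) (\<lambda>q. Gamma (q + 1))"
  proof (intro holomorphic_on_imp_continuous_on holomorphic_intros)
    fix q assume "q \<in> cball q0 d"
    hence "Re (q + 1) > 0" using qb[of q] d by auto
    thus "q + 1 \<notin> \<int>\<^sub>\<le>\<^sub>0" by (rule Re_pos_not_nonpos_Int)
  qed
  hence "bounded ((\<lambda>q. Gamma (q + 1)) ` cball q0 d)"
    by (intro compact_imp_bounded compact_continuous_image) auto
  then obtain G where G: "G > 0" "\<And>q. q \<in> cball q0 d \<Longrightarrow> norm (Gamma (q + 1)) \<le> G"
    unfolding bounded_pos by auto
  define C where "C = (\<Sum>n. real (Suc n) powr (- (1 + d)))"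
  define K where "K = 2 * exp (pi * (M + 1)) * G * C"
  define h where "h = (\<lambda>i. K * (pochhammer (M + 1) i / fact i * (l / (2 * pi)) ^ i))"
  have "summable h" unfolding h_def using l by (intro summable_mult summable_pochhammer) auto
  moreover have "l ^ i / fact i * norm (zeta_refl (q + of_nat i)) \<le> h i" if q: "q \<in> cball q0 d" for i q
  proof -
    have 1: "norm (of_real (2 * pi) powr (- (q + of_nat i) - 1)) \<le> 1 / (2 * pi) ^ i"
    proof -
      have "norm (of_real (2 * pi) powr (- (q + of_nat i) - 1)) = (2 * pi) powr (- Re q - real i - 1)"
        by (subst norm_powr_real_powr) (auto simp: algebra_simps)
      also have "\<dots> \<le> (2 * pi) powr (- real i)"
        using qb[OF q] d pi_gt3 by (intro powr_mono) auto
      also have "\<dots> = 1 / (2 * pi) ^ i" by (simp add: powr_minus_divide powr_realpow)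
      finally show ?thesis .
    qed
    have 2: "norm (cos (of_real pi * (q + of_nat i + 1) / 2)) \<le> exp (pi * (M + 1))"
    proof -
      have "norm (cos (1 *\<^sub>R (of_real pi * (q + of_nat i + 1) / 2))) \<le> exp \<bar>Im (of_real pi * (q + of_nat i + 1) / 2)\<bar>"
        by (rule cmod_cos_le_exp) auto
      also have "Im (of_real pi * (q + of_nat i + 1) / 2) = pi * (Im q / 2)" by simp
      also have "\<bar>pi * (Im q / 2)\<bar> \<le> pi * (M + 1)"
        using abs_Im_le_cmod[of q] qb[OF q] by (auto simp: abs_mult)
      finally show ?thesis by simp
    qed
    have 3: "norm (Gamma (q + of_nat i + 1)) \<le> pochhammer (M + 1) i * G"
    proof -
      have ni: "q + 1 \<notin> \<int>\<^sub>\<le>\<^sub>0" using qb[OF q] d by (intro Re_pos_not_nonpos_Int) auto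
      hence "Gamma (q + 1) \<noteq> 0" by (simp add: Gamma_eq_zero_iff)
      hence "Gamma (q + of_nat i + 1) = pochhammer (q + 1) i * Gamma (q + 1)"
        using pochhammer_Gamma[OF ni, of i] by (simp add: add_ac)
      thus ?thesis using norm_pochhammer_le[OF qb(2)[OF q], of i] G(2)[OF q]
        by (simp add: norm_mult mult_mono')
    qed
    have 4: "norm (zeta_series (q + of_nat i + 1)) \<le> C"
      unfolding C_def using qb[OF q] d by (intro norm_zeta_series_le) auto
    have pm: "pochhammer (M + 1) i \<ge> 0" using M by (intro pochhammer_nonneg) auto
    have C0: "C \<ge> 0" unfolding C_def using d by (intro suminf_nonneg summable_Suc_powr) auto
    have "norm (zeta_refl (q + of_nat i)) \<le> 2 * (1 / (2 * pi) ^ i) * exp (pi * (M + 1)) * (pochhammer (M + 1) i * G) * C"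
      unfolding zeta_refl_def norm_mult using 1 2 3 4 pm G C0
      by (intro mult_mono mult_nonneg_nonneg) auto
    hence "l ^ i / fact i * norm (zeta_refl (q + of_nat i)) \<le> l ^ i / fact i * (2 * (1 / (2 * pi) ^ i) * exp (pi * (M + 1)) * (pochhammer (M + 1) i * G) * C)"
      using l by (intro mult_left_mono) auto
    also have "\<dots> = h i" by (simp add: h_def K_def power_divide mult_ac)
    finally show ?thesis .
  qed
  moreover have "Re q > 0" if "q \<in> cball q0 d" for q using qb(1)[OF that] d by simp
  ultimately show ?thesis using d by blast
qed

lemma zeta_refl_tail_term_le:
  assumes "l > 0"
  shows "norm (of_real ((- l) ^ (i + J) / fact (i + J)) * zeta_refl z) \<le> l ^ J * (l ^ i / fact i * norm (zeta_refl z))"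
proof -
  have "norm (of_real ((- l) ^ (i + J) / fact (i + J)) * zeta_refl z) = l ^ (i + J) / fact (i + J) * norm (zeta_refl z)"
    using assms by (simp add: norm_mult norm_divide norm_power abs_mult power_abs)
  also have "\<dots> \<le> l ^ (i + J) / fact i * norm (zeta_refl z)"
    using assms by (intro mult_right_mono divide_left_mono fact_mono) auto
  also have "\<dots> = l ^ J * (l ^ i / fact i * norm (zeta_refl z))" by (simp add: power_add)
  finally show ?thesis .
qed

lemma summable_zeta_refl:
  assumes q: "Re q > 0" and l: "0 < l" "l < 2 * pi"
  shows "summable (\<lambda>i. l ^ i / fact i * norm (zeta_refl (q + of_nat i)))"
proof -
  obtain d h where *: "d > 0" "summable h" "\<And>i z. z \<in> cball q d \<Longrightarrow> l ^ i / fact i * norm (zeta_refl (z + of_nat i)) \<le> h i"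
    using zeta_refl_bound[OF q l] by blast
  show ?thesis
    by (rule summable_comparison_test'[OF *(2)]) (use *(3)[of q] *(1) l in auto)
qed

lemma zeta_refl_tail_sums:
  assumes q: "Re q > 0" and l: "0 < l" "l < 2 * pi"
  shows "(\<lambda>i. of_real ((- l) ^ (i + J) / fact (i + J)) * zeta_refl (q + of_nat i)) sums zeta_refl_tail J q l"
  unfolding zeta_refl_tail_def
  by (rule summable_sums, rule summable_norm_cancel,
      rule summable_comparison_test'[OF summable_mult[OF summable_zeta_refl[OF q l], of "l ^ J"]])
     (use zeta_refl_tail_term_le[OF l(1)] in simp)

lemma zeta_refl_tail_split:
  assumes q: "Re q > 0" and l: "0 < l" "l < 2 * pi"
  shows "zeta_refl_tail J q l = of_real ((- l) ^ J / fact J) * zeta_refl q + zeta_refl_tail (Suc J) (q + 1) l"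
proof -
  have "(\<lambda>i. of_real ((- l) ^ (Suc i + J) / fact (Suc i + J)) * zeta_refl (q + of_nat (Suc i))) sums
     (zeta_refl_tail J q l - of_real ((- l) ^ (0 + J) / fact (0 + J)) * zeta_refl (q + of_nat 0))"
    using zeta_refl_tail_sums[OF q l, of J] by (subst sums_Suc_iff) (simp only: diff_add_cancel)
  moreover have "(\<lambda>i. of_real ((- l) ^ (i + Suc J) / fact (i + Suc J)) * zeta_refl (q + 1 + of_nat i)) sums zeta_refl_tail (Suc J) (q + 1) l"
    using q l by (intro zeta_refl_tail_sums) auto
  ultimately have "zeta_refl_tail J q l - of_real ((- l) ^ (0 + J) / fact (0 + J)) * zeta_refl (q + of_nat 0) = zeta_refl_tail (Suc J) (q + 1) l"
    by (intro sums_unique2) (simp_all add: add_ac)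
  thus ?thesis by (simp add: algebra_simps)
qed

lemma holomorphic_zeta_refl: "zeta_refl holomorphic_on {p. Re p > 0}"
proof -
  have "(\<lambda>p. zeta_series (p + 1)) holomorphic_on {p. Re p > 0}"
    by (rule holomorphic_on_compose_gen[OF _ holomorphic_zeta_series, unfolded o_def]) (auto intro!: holomorphic_intros)
  moreover have "p + 1 \<notin> \<int>\<^sub>\<le>\<^sub>0" if "Re p > 0" for p :: complex using that by (intro Re_pos_not_nonpos_Int) auto
  ultimately show ?thesis unfolding zeta_refl_def[abs_def]
    by (intro holomorphic_intros) auto
qed

lemma holomorphic_zeta_refl_tail:
  assumes l: "0 < l" "l < 2 * pi"
  shows "(\<lambda>q. zeta_refl_tail J q l) holomorphic_on {q. Re q > 0}"
  unfolding zeta_refl_tail_def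
proof (rule holomorphic_on_suminf_local)
  show "open {q. Re q > 0}" by (rule open_halfspace_Re_gt)
  fix i
  have "(\<lambda>q. zeta_refl (q + of_nat i)) holomorphic_on {p. Re p > 0}"
    by (rule holomorphic_on_compose_gen[OF _ holomorphic_zeta_refl, unfolded o_def]) (auto intro!: holomorphic_intros)
  thus "(\<lambda>q. of_real ((- l) ^ (i + J) / fact (i + J)) * zeta_refl (q + of_nat i)) holomorphic_on {q. Re q > 0}"
    by (intro holomorphic_intros)
next
  fix x :: complex assume "x \<in> {q. 0 < Re q}"
  then obtain d h where *: "d > 0" "summable h" "\<And>i z. z \<in> cball x d \<Longrightarrow> l ^ i / fact i * norm (zeta_refl (z + of_nat i)) \<le> h i"
    using zeta_refl_bound[OF _ l, of x] by blast
  have "norm (of_real ((- l) ^ (i + J) / fact (i + J)) * zeta_refl (y + of_nat i)) \<le> l ^ J * h i" if "y \<in> cball x d" for i y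
    using order_trans[OF zeta_refl_tail_term_le[OF l(1)] mult_left_mono[OF *(3)[OF that]]] l by simp
  thus "\<exists>d h. 0 < d \<and> summable h \<and> (\<forall>n. \<forall>y\<in>cball x d \<inter> {q. 0 < Re q}. norm (of_real ((- l) ^ (n + J) / fact (n + J)) * zeta_refl (y + of_nat n)) \<le> h n)"
    using *(1) summable_mult[OF *(2), of "l ^ J"] by blast
qed

text \<open>Every term of Lipschitz' formula is expanded in powers of \<open>l\<close> about its
  lattice point, and the double series is summed over the lattice first, which produces
  \<open>zeta_series\<close>. The range of \<open>p\<close> is that of \<open>1 - s\<close> in
  Lipschitz' formula.\<close>

lemma polylog_exp_expansion_real:
  fixes p l :: real
  assumes p: "1/2 < p" "p < 1" and l: "0 < l" "l < 2 * pi"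
  shows "polylog_exp (of_real p) l = Gamma (of_real p + 1) * of_real l powr (- of_real p - 1) + zeta_refl_tail 0 (of_real p) l"
proof -
  define \<tau> where "\<tau> = (\<lambda>k::nat. 2 * of_real pi * \<i> * of_nat (Suc k) :: complex)"
  define q where "q = p + 1"
  have q: "q > 1" using p by (simp add: q_def)
  define c where "c = (\<lambda>j. complex_of_real (pochhammer q j / fact j * (- l) ^ j))"
  define f where "f = (\<lambda>k j. c j * ((\<tau> k) powr (- of_real q - of_nat j) + (- \<tau> k) powr (- of_real q - of_nat j)))"
  define y where "y = (\<lambda>k. 2 * pi * real (Suc k))"
  have y: "y k > 0" "y k \<ge> 2 * pi" for k by (auto simp: y_def)
  have tau: "\<tau> k = \<i> * of_real (y k)" "- \<tau> k = - \<i> * of_real (y k)" for k by (simp_all add: \<tau>_def y_def)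
  have gb: "(- complex_of_real q gchoose j) * of_real l ^ j = c j" for j
    by (simp add: c_def gbinomial_pochhammer pochhammer_of_real power_minus[of "of_real l"] power_minus[of l] flip: pochhammer_of_real)
  have s1: "f k sums ((of_real l + \<tau> k) powr (- of_real q) + (of_real l - \<tau> k) powr (- of_real q))" for k
  proof -
    have n: "norm (complex_of_real l) < norm (\<tau> k)" "\<tau> k \<noteq> 0"
      using y[of k] l by (auto simp: tau norm_mult)
    have "(\<lambda>j. c j * (\<tau> k) powr (- of_real q - of_nat j)) sums ((\<tau> k + of_real l) powr (- of_real q))"
      unfolding gb[symmetric] by (rule powr_add_sums) (use n in \<open>auto simp: \<tau>_def\<close>)
    moreover have "(\<lambda>j. c j * (- \<tau> k) powr (- of_real q - of_nat j)) sums ((- \<tau> k + of_real l) powr (- of_real q))"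
      unfolding gb[symmetric] by (rule powr_add_sums) (use n in \<open>auto simp: \<tau>_def\<close>)
    ultimately show ?thesis unfolding f_def distrib_left
      by (intro sums_add) (simp_all add: add_ac)
  qed
  have feq: "f k j = c j * (of_real (y k) powr (- (of_real q + of_nat j)) * 2 * cos (of_real pi * (of_real q + of_nat j) / 2))" for k j
    using imaginary_powr_add[OF y(1)[of k], of "of_real q + of_nat j"]
    unfolding f_def tau diff_conv_add_uminus minus_add_distrib by (simp only: mult_minus_left)
  have fb: "norm (f k j) \<le> 2 * real (Suc k) powr (- q) * (pochhammer q j / fact j * (l / (2 * pi)) ^ j)" for k j
  proof -
    have pq: "pochhammer q j \<ge> 0" using q by (intro pochhammer_nonneg) auto
    have "cos (of_real pi * (of_real q + of_nat j) / 2) = complex_of_real (cos (pi * (q + real j) / 2))"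
      by (simp flip: cos_of_real)
    hence "norm (cos (of_real pi * (of_real q + of_nat j) / 2) :: complex) \<le> 1" by simp
    moreover have "norm (of_real (y k) powr (- (of_real q + of_nat j)) :: complex) = (2 * pi) powr (- q) * real (Suc k) powr (- q) * (1 / (2 * pi) ^ j) * real (Suc k) powr (- real j)"
      using y(1)[of k] by (subst norm_powr_real_powr)
        (auto simp: y_def powr_mult powr_diff powr_minus powr_realpow divide_simps simp del: of_nat_Suc)
    moreover have "(2 * pi) powr (- q) * real (Suc k) powr (- q) * (1 / (2 * pi) ^ j) * real (Suc k) powr (- real j) \<le> 1 * real (Suc k) powr (- q) * (1 / (2 * pi) ^ j) * 1"
    proof (intro mult_mono)
      show "(2 * pi) powr (- q) \<le> 1" using pi_gt3 q powr_mono[of "- q" 0 "2 * pi"] by auto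
      show "real (Suc k) powr (- real j) \<le> 1" using powr_mono[of "- real j" 0 "real (Suc k)"] by auto
    qed auto
    ultimately have "norm (of_real (y k) powr (- (of_real q + of_nat j)) * 2 * cos (of_real pi * (of_real q + of_nat j) / 2) :: complex) \<le> (1 * real (Suc k) powr (- q) * (1 / (2 * pi) ^ j) * 1) * 2 * 1"
      unfolding norm_mult by (intro mult_mono) auto
    moreover have "norm (c j) = pochhammer q j / fact j * l ^ j"
      using pq l by (simp add: c_def norm_mult norm_divide norm_power abs_mult power_abs)
    ultimately have "norm (f k j) \<le> (pochhammer q j / fact j * l ^ j) * ((1 * real (Suc k) powr (- q) * (1 / (2 * pi) ^ j) * 1) * 2 * 1)"
      unfolding feq norm_mult[of "c j"] using pq l by (intro mult_mono) auto
    thus ?thesis by (simp add: power_divide mult_ac)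
  qed
  have sp: "summable (\<lambda>j. pochhammer q j / fact j * (l / (2 * pi)) ^ j)" using l by (intro summable_pochhammer) auto
  have row: "summable (\<lambda>j. norm (f k j))" for k
    by (rule summable_comparison_test'[OF summable_mult[OF sp, of "2 * real (Suc k) powr (- q)"]]) (use fb in simp)
  have col: "summable (\<lambda>k. \<Sum>j. norm (f k j))"
  proof (rule summable_comparison_test')
    show "summable (\<lambda>k. 2 * real (Suc k) powr (- q) * (\<Sum>j. pochhammer q j / fact j * (l / (2 * pi)) ^ j))"
      by (intro summable_mult summable_mult2 summable_Suc_powr q)
    fix k
    have "(\<Sum>j. norm (f k j)) \<le> (\<Sum>j. 2 * real (Suc k) powr (- q) * (pochhammer q j / fact j * (l / (2 * pi)) ^ j))"
      by (intro suminf_le fb row summable_mult sp)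
    moreover have "(\<Sum>j. norm (f k j)) \<ge> 0" by (intro suminf_nonneg row) auto
    ultimately show "norm (\<Sum>j. norm (f k j)) \<le> 2 * real (Suc k) powr (- q) * (\<Sum>j. pochhammer q j / fact j * (l / (2 * pi)) ^ j)"
      using suminf_mult[OF sp] by simp
  qed
  define Q where "Q = (\<Sum>n. real (Suc n) powr p * exp (- l * real (Suc n)))"
  have "(\<lambda>k. (of_real l + \<tau> k) powr (of_real ((1 - p) - 2)) + (of_real l - \<tau> k) powr (of_real ((1 - p) - 2))) sums
     (of_real (Q / Gamma (2 - (1 - p))) - of_real (l powr ((1 - p) - 2)))"
    using Lipschitz_summation(2)[of "1 - p" l] p l unfolding \<tau>_def Q_def by simp
  moreover have "(1 - p) - 2 = - q" "2 - (1 - p) = q" by (simp_all add: q_def)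
  ultimately have lip: "(\<lambda>k. (of_real l + \<tau> k) powr (- of_real q) + (of_real l - \<tau> k) powr (- of_real q)) sums
     (of_real (Q / Gamma q) - of_real (l powr (- q)))" by simp
  have "(\<lambda>j. \<Sum>k. f k j) sums (\<Sum>k. \<Sum>j. f k j)" by (rule summable_swap(2)[OF row col])
  also have "(\<Sum>k. \<Sum>j. f k j) = of_real (Q / Gamma q) - of_real (l powr (- q))"
    using s1 lip by (simp add: sums_iff)
  finally have s2: "(\<lambda>j. \<Sum>k. f k j) sums (of_real (Q / Gamma q) - of_real (l powr (- q)))" .
  have G: "Gamma q > 0" using q by auto
  \<comment> \<open>Multiplication by \<open>Gamma q\<close> merges the Pochhammer symbol of the
    binomial coefficient into \<open>Gamma (q + j)\<close>, the Gamma factor of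
    \<open>zeta_refl\<close>.\<close>
  have col_eq: "of_real (Gamma q) * (\<Sum>k. f k j) = of_real ((- l) ^ (j + 0) / fact (j + 0)) * zeta_refl (of_real p + of_nat j)" for j
  proof -
    let ?s = "complex_of_real q + of_nat j"
    have re: "Re ?s > 1" using q by simp
    have "f k j = (c j * of_real (2 * pi) powr (- ?s) * 2 * cos (of_real pi * ?s / 2)) * (1 / of_nat (Suc k) powr ?s)" for k
    proof -
      have e: "of_real (y k) powr (- ?s) = of_real (2 * pi) powr (- ?s) * of_real (real (Suc k)) powr (- ?s)"
        unfolding y_def of_real_mult[of "2 * pi"] by (intro powr_times_real_left) auto
      have "complex_of_real (real (Suc k)) powr (- ?s) = 1 / of_nat (Suc k) powr ?s"
        by (simp only: of_real_of_nat_eq powr_minus_divide)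
      thus ?thesis unfolding feq e by (simp only: mult_ac)
    qed
    hence "(\<lambda>k. f k j) = (\<lambda>k. (c j * of_real (2 * pi) powr (- ?s) * 2 * cos (of_real pi * ?s / 2)) * (1 / of_nat (Suc k) powr ?s))"
      by (rule ext)
    hence "(\<Sum>k. f k j) = (c j * of_real (2 * pi) powr (- ?s) * 2 * cos (of_real pi * ?s / 2)) * zeta_series ?s"
      by (simp only:) (rule sums_unique[OF sums_mult[OF zeta_series_sums[OF re]], symmetric])
    moreover have "of_real (Gamma q) * c j = of_real ((- l) ^ j / fact j) * Gamma ?s"
    proof -
      have "pochhammer q j * Gamma q = Gamma (q + real j)"
      proof -
        have "q \<notin> \<int>\<^sub>\<le>\<^sub>0" using q by (auto elim!: nonpos_Ints_cases)
        thus ?thesis using pochhammer_Gamma[of q j] G by simp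
      qed
      hence "Gamma q * (pochhammer q j / fact j * (- l) ^ j) = (- l) ^ j / fact j * Gamma (q + real j)"
        by (simp add: field_simps)
      hence "complex_of_real (Gamma q * (pochhammer q j / fact j * (- l) ^ j)) = complex_of_real ((- l) ^ j / fact j * Gamma (q + real j))"
        by (rule arg_cong)
      thus ?thesis unfolding c_def of_real_mult Gamma_complex_of_real[symmetric] by simp
    qed
    ultimately have "of_real (Gamma q) * (\<Sum>k. f k j) = (of_real ((- l) ^ j / fact j) * Gamma ?s) * of_real (2 * pi) powr (- ?s) * 2 * cos (of_real pi * ?s / 2) * zeta_series ?s"
      by (simp only: mult.assoc[symmetric])
    moreover have "?s = of_real p + of_nat j + 1" by (simp add: q_def)
    ultimately show ?thesis unfolding zeta_refl_def by (simp add: mult_ac)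
  qed
  have "(\<lambda>j. of_real (Gamma q) * (\<Sum>k. f k j)) sums (of_real (Gamma q) * (of_real (Q / Gamma q) - of_real (l powr (- q))))"
    by (rule sums_mult[OF s2])
  hence "zeta_refl_tail 0 (of_real p) l = of_real (Gamma q) * (of_real (Q / Gamma q) - of_real (l powr (- q)))"
    unfolding col_eq zeta_refl_tail_def by (simp add: sums_iff)
  also have "\<dots> = of_real Q - of_real (Gamma q) * of_real (l powr (- q))" using G by (simp add: algebra_simps)
  also have "of_real Q = polylog_exp (of_real p) l" unfolding Q_def by (rule polylog_exp_of_real[OF l(1), symmetric])
  also have "complex_of_real (Gamma q) = Gamma (of_real p + 1)" by (simp add: q_def flip: Gamma_complex_of_real)
  also have "complex_of_real (l powr (- q)) = of_real l powr (- of_real p - 1)"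
    using l by (simp add: q_def flip: powr_of_real)
  finally show ?thesis by simp
qed

text \<open>Both sides are holomorphic in \<open>p\<close> on the right half plane and agree on the
  real segment (1/2, 1).\<close>

lemma polylog_exp_expansion:
  assumes p: "Re p > 0" and l: "0 < l" "l < 2 * pi"
  shows "polylog_exp p l = Gamma (p + 1) * of_real l powr (- p - 1) + zeta_refl_tail 0 p l"
proof -
  let ?f = "\<lambda>p. polylog_exp p l - (Gamma (p + 1) * of_real l powr (- p - 1) + zeta_refl_tail 0 p l)"
  let ?S = "{p. Re p > 0}"
  have ni: "p + 1 \<notin> \<int>\<^sub>\<le>\<^sub>0" if "Re p > 0" for p :: complex using that by (intro Re_pos_not_nonpos_Int) auto
  have "?f p = 0"
  proof (rule analytic_continuation[where f = ?f and S = ?S and U = "complex_of_real ` {1/2<..<1}" and \<xi> = "of_real (3/4)"])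
    show "?f holomorphic_on ?S" using ni l
      by (intro holomorphic_intros holomorphic_polylog_exp holomorphic_zeta_refl_tail) auto
    show "open ?S" by (rule open_halfspace_Re_gt)
    show "connected ?S" by (intro convex_connected convex_halfspace_Re_gt)
    show "of_real (3/4) islimpt complex_of_real ` {1/2<..<1}"
    proof -
      have "(3/4 :: real) islimpt {1/2<..<1}" by (simp add: islimpt_greaterThanLessThan1 open_imp_islimpt)
      moreover have "\<forall>\<^sub>F x in at (3/4). complex_of_real x \<noteq> of_real (3/4)"
        by (rule eventually_mono[OF eventually_neq_at_within[of "3/4"]]) (simp only: of_real_eq_iff not_False_eq_True)
      ultimately show ?thesis by (intro islimpt_isCont_image) auto
    qed
  qed (use polylog_exp_expansion_real l p in auto)
  thus ?thesis by simp
qed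

section \<open>Analytic continuation of zeta\<close>

text \<open>Solving the expansion of the polylogarithm for its term of order \<open>0\<close>, respectively \<open>1\<close>, continues zeta
  to \<open>Re s < 1\<close> and then to \<open>Re s < 2\<close>; neither function depends on \<open>l\<close>.\<close>

definition zeta_left :: "complex \<Rightarrow> real \<Rightarrow> complex" where
  "zeta_left s l = polylog_exp (- s) l - Gamma (1 - s) * of_real l powr (s - 1) - zeta_refl_tail 1 (1 - s) l"

definition zeta_mid :: "complex \<Rightarrow> real \<Rightarrow> complex" where
  "zeta_mid s l = polylog_exp (- s) l - Gamma (1 - s) * of_real l powr (s - 1)
     + of_real l * zeta_left (s - 1) 1 - zeta_refl_tail 2 (2 - s) l"

lemma one_less_two_pi: "0 < (1::real)" "1 < 2 * pi"
  using pi_gt3 by auto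

lemma zeta_left_eq_refl:
  assumes "Re s < 0" "0 < l" "l < 2 * pi"
  shows "zeta_left s l = zeta_refl (- s)"
  using polylog_exp_expansion[of "- s" l] zeta_refl_tail_split[of "- s" l 0] assms
  by (simp add: zeta_left_def add.commute)

lemma holomorphic_polylog_exp_minus:
  assumes "l > 0"
  shows "(\<lambda>s. polylog_exp (- s) l) holomorphic_on A"
  by (rule holomorphic_on_compose_gen[OF _ holomorphic_polylog_exp[OF assms, of UNIV], unfolded o_def])
     (auto intro!: holomorphic_intros)

lemma holomorphic_zeta_refl_tail_minus:
  assumes "0 < l" "l < 2 * pi"
  shows "(\<lambda>s. zeta_refl_tail J (of_real c - s) l) holomorphic_on {s. Re s < c}"
  by (rule holomorphic_on_compose_gen[OF _ holomorphic_zeta_refl_tail[OF assms], unfolded o_def])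
     (auto intro!: holomorphic_intros)

lemma holomorphic_zeta_left:
  assumes l: "0 < l" "l < 2 * pi"
  shows "(\<lambda>s. zeta_left s l) holomorphic_on {s. Re s < 1}"
proof -
  have "1 - s \<notin> \<int>\<^sub>\<le>\<^sub>0" if "Re s < 1" for s :: complex using that by (intro Re_pos_not_nonpos_Int) auto
  moreover have "(\<lambda>s. zeta_refl_tail 1 (1 - s) l) holomorphic_on {s. Re s < 1}"
    using holomorphic_zeta_refl_tail_minus[OF l, of 1 1] by simp
  ultimately show ?thesis unfolding zeta_left_def using l
    by (intro holomorphic_intros holomorphic_polylog_exp_minus) auto
qed

lemma zeta_left_indep:
  assumes s: "Re s < 1" and l: "0 < l" "l < 2 * pi"
  shows "zeta_left s l = zeta_left s 1"
proof (rule analytic_continuation_open[where s = "{s. Re s < 0}" and s' = "{s. Re s < 1}"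
      and f = "\<lambda>s. zeta_left s l" and g = "\<lambda>s. zeta_left s 1"])
  show "{s. Re s < 0} \<noteq> {}" by (rule ex_in_conv[THEN iffD1]) (intro exI[of _ "-1"], simp)
  show "connected {s. Re s < 1}" by (intro convex_connected convex_halfspace_Re_lt)
qed (use s l one_less_two_pi zeta_left_eq_refl in \<open>auto intro!: open_halfspace_Re_lt holomorphic_zeta_left\<close>)

definition strip_two :: "complex set" where "strip_two = {s. Re s < 2} - {1}"

lemma open_strip_two: "open strip_two"
  unfolding strip_two_def by (intro open_Diff open_halfspace_Re_lt) auto

lemma connected_strip_two: "connected strip_two"
  unfolding strip_two_def
  by (intro connected_open_diff_countable convex_connected convex_halfspace_Re_lt open_halfspace_Re_lt) auto

lemma Gamma_pole_strip_two: "s \<in> strip_two \<Longrightarrow> 1 - s \<notin> \<int>\<^sub>\<le>\<^sub>0"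
proof
  assume s: "s \<in> strip_two" and "1 - s \<in> \<int>\<^sub>\<le>\<^sub>0"
  then obtain n where n: "1 - s = of_int n" "n \<le> 0" by (auto elim!: nonpos_Ints_cases)
  hence "s = of_int (1 - n)" by (simp add: algebra_simps)
  moreover have "Re s < 2" using s by (simp add: strip_two_def)
  ultimately have "1 - n < 2" by simp
  with n have "n = 0" by simp
  with n s show False by (simp add: strip_two_def)
qed

lemma holomorphic_zeta_mid:
  assumes l: "0 < l" "l < 2 * pi"
  shows "(\<lambda>s. zeta_mid s l) holomorphic_on strip_two"
proof -
  have "(\<lambda>s. zeta_left (s - 1) 1) holomorphic_on strip_two"
    by (rule holomorphic_on_compose_gen[OF _ holomorphic_zeta_left[OF one_less_two_pi], unfolded o_def])
       (auto intro!: holomorphic_intros simp: strip_two_def)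
  moreover have "(\<lambda>s. zeta_refl_tail 2 (2 - s) l) holomorphic_on strip_two"
    using holomorphic_zeta_refl_tail_minus[OF l, of 2 2]
    by (simp add: strip_two_def) (rule holomorphic_on_subset, auto)
  ultimately show ?thesis unfolding zeta_mid_def using l Gamma_pole_strip_two
    by (intro holomorphic_intros holomorphic_polylog_exp_minus) auto
qed

text \<open>Splitting one more term off the tail of \<open>zeta_left\<close> leaves \<open>l\<close>
  times zeta at \<open>s - 1\<close>; this term is available on \<open>Re s < 2\<close>, and so is
  the shorter tail.\<close>

lemma zeta_mid_eq_left:
  assumes s: "Re s < 1" and l: "0 < l" "l < 2 * pi"
  shows "zeta_mid s l = zeta_left s 1"
proof -
  have "zeta_left (s - 1) 1 = zeta_refl (1 - s)"
    using zeta_left_eq_refl[of "s - 1" 1] s one_less_two_pi by simp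
  moreover have "zeta_refl_tail 1 (1 - s) l = - of_real l * zeta_refl (1 - s) + zeta_refl_tail 2 (2 - s) l"
    using zeta_refl_tail_split[of "1 - s" l 1] s l by (simp add: numeral_2_eq_2[symmetric] add.commute[of _ 1] flip: add_diff_eq) 
  ultimately have "zeta_mid s l = zeta_left s l" by (simp add: zeta_mid_def zeta_left_def)
  thus ?thesis using zeta_left_indep[OF s l] by simp
qed

lemma zeta_mid_indep:
  assumes s: "s \<in> strip_two" and l: "0 < l" "l < 2 * pi"
  shows "zeta_mid s l = zeta_mid s 1"
proof (rule analytic_continuation_open[where s = "{s. Re s < 1}" and s' = strip_two
      and f = "\<lambda>s. zeta_mid s l" and g = "\<lambda>s. zeta_mid s 1"])
  show "{s. Re s < 1} \<noteq> {}" by (rule ex_in_conv[THEN iffD1]) (intro exI[of _ 0], simp)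
  show "{s. Re s < 1} \<subseteq> strip_two" by (auto simp: strip_two_def)
qed (use s l one_less_two_pi zeta_mid_eq_left in
    \<open>auto intro!: open_halfspace_Re_lt holomorphic_zeta_mid open_strip_two connected_strip_two\<close>)

lemma polylog_exp_tendsto_zeta:
  assumes "Re s > 1"
  shows "((\<lambda>l. polylog_exp (- s) l) \<longlongrightarrow> zeta_series s) (at_right 0)"
proof -
  have "eventually (\<lambda>l. summable (\<lambda>k. norm (of_nat (Suc k) powr (- s) * complex_of_real (exp (- l * real (Suc k)))))) (at_right 0) \<and>
     summable (\<lambda>n. norm (of_nat (Suc n) powr (- s) :: complex)) \<and>
     ((\<lambda>l. \<Sum>k. of_nat (Suc k) powr (- s) * complex_of_real (exp (- l * real (Suc k)))) \<longlongrightarrow> (\<Sum>n. of_nat (Suc n) powr (- s))) (at_right 0)"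
  proof (rule tannerys_theorem)
    fix n
    have "((\<lambda>l. exp (- l * real (Suc n))) \<longlongrightarrow> exp (- 0 * real (Suc n))) (at_right 0)" by (intro tendsto_intros)
    hence "((\<lambda>l. of_nat (Suc n) powr (- s) * complex_of_real (exp (- l * real (Suc n)))) \<longlongrightarrow> of_nat (Suc n) powr (- s) * complex_of_real (exp (- 0 * real (Suc n)))) (at_right 0)"
      by (intro tendsto_intros)
    thus "((\<lambda>l. of_nat (Suc n) powr (- s) * complex_of_real (exp (- l * real (Suc n)))) \<longlongrightarrow> of_nat (Suc n) powr (- s)) (at_right 0)"
      by simp
  next
    show "summable (\<lambda>n. real (Suc n) powr (- Re s))" by (rule summable_Suc_powr[OF assms])
    have "\<forall>\<^sub>F (k::nat, l) in at_top \<times>\<^sub>F at_right 0. l > (0::real)"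
      using eventually_prodI[OF always_eventually eventually_at_right_less[of "0::real"], of "\<lambda>_::nat. True" at_top] by (simp add: case_prod_unfold)
    thus "\<forall>\<^sub>F (k, l) in at_top \<times>\<^sub>F at_right 0. norm (of_nat (Suc k) powr (- s) * complex_of_real (exp (- l * real (Suc k)))) \<le> real (Suc k) powr (- Re s)"
    proof eventually_elim
      case (elim x)
      have "norm (of_nat (Suc k) powr (- s) * complex_of_real (exp (- l * real (Suc k)))) \<le> real (Suc k) powr (- Re s)" if "l > 0" for k l
      proof -
        have "real (Suc k) powr (- Re s) * exp (- l * real (Suc k)) \<le> real (Suc k) powr (- Re s) * 1"
          using that by (intro mult_left_mono) auto
        thus ?thesis unfolding norm_polylog_term by (simp del: of_nat_Suc)
      qed
      thus ?case using elim by (auto simp: case_prod_unfold simp del: of_nat_Suc)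
    qed
  qed auto
  thus ?thesis by (simp add: polylog_exp_def zeta_series_def powr_minus_divide)
qed

lemma zeta_refl_tail_tendsto_0:
  assumes q: "Re q > 0" and J: "J > 0"
  shows "((\<lambda>l. zeta_refl_tail J q l) \<longlongrightarrow> 0) (at_right 0)"
proof (rule Lim_null_comparison)
  define C where "C = (\<Sum>i. 1 ^ i / fact i * norm (zeta_refl (q + of_nat i)))"
  have sm: "summable (\<lambda>i. 1 ^ i / fact i * norm (zeta_refl (q + of_nat i)))"
    by (rule summable_zeta_refl[OF q one_less_two_pi])
  have "((\<lambda>l::real. l ^ J * C) \<longlongrightarrow> 0 ^ J * C) (at_right 0)" by (intro tendsto_intros)
  moreover have "(0::real) ^ J * C = 0" using J by simp
  ultimately show "((\<lambda>l::real. l ^ J * C) \<longlongrightarrow> 0) (at_right 0)" by (simp only:)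
  have "\<forall>\<^sub>F l::real in at_right 0. l \<in> {0<..<1}" by (rule eventually_at_right_real) simp
  thus "\<forall>\<^sub>F l in at_right 0. norm (zeta_refl_tail J q l) \<le> l ^ J * C"
  proof eventually_elim
    case (elim l)
    hence l: "0 < l" "l < 1" by auto
    have b: "norm (of_real ((- l) ^ (i + J) / fact (i + J)) * zeta_refl (q + of_nat i)) \<le> l ^ J * (1 ^ i / fact i * norm (zeta_refl (q + of_nat i)))" for i
    proof -
      have "l ^ i \<le> 1 ^ i" using l by (intro power_mono) auto
      hence "l ^ J * (l ^ i / fact i * norm (zeta_refl (q + of_nat i))) \<le> l ^ J * (1 ^ i / fact i * norm (zeta_refl (q + of_nat i)))"
        using l by (intro mult_left_mono mult_right_mono divide_right_mono) auto
      thus ?thesis using zeta_refl_tail_term_le[OF l(1)] by (rule order_trans[rotated])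
    qed
    have "norm (zeta_refl_tail J q l) \<le> (\<Sum>i. l ^ J * (1 ^ i / fact i * norm (zeta_refl (q + of_nat i))))"
      unfolding zeta_refl_tail_def by (rule norm_suminf_le[OF b summable_mult[OF sm]])
    also have "\<dots> = l ^ J * C" unfolding C_def by (rule suminf_mult[OF sm])
    finally show ?case .
  qed
qed

text \<open>Independence of \<open>l\<close> allows \<open>l\<close> to tend to 0. For
  \<open>1 < Re s\<close> the polylogarithm then tends to the Dirichlet series, and the singular
  power of \<open>l\<close> vanishes in the limit.\<close>

lemma zeta_mid_eq_series:
  assumes s: "1 < Re s" "Re s < 2"
  shows "zeta_mid s 1 = zeta_series s"
proof -
  have s2: "s \<in> strip_two" using s by (auto simp: strip_two_def)
  have "((\<lambda>l. zeta_mid s l) \<longlongrightarrow> zeta_series s - Gamma (1 - s) * 0 + of_real 0 * zeta_left (s - 1) 1 - 0) (at_right 0)"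
    unfolding zeta_mid_def
  proof (intro tendsto_intros polylog_exp_tendsto_zeta zeta_refl_tail_tendsto_0)
    show "((\<lambda>l. complex_of_real l powr (s - 1)) \<longlongrightarrow> 0) (at_right 0)"
    proof (rule Lim_null_comparison)
      show "((\<lambda>l. l powr (Re s - 1)) \<longlongrightarrow> 0) (at_right 0)"
      proof -
        have "((\<lambda>l::real. l powr (Re s - 1)) \<longlongrightarrow> 0 powr (Re s - 1)) (at_right 0)"
          using s by (intro tendsto_powr') (auto intro!: tendsto_intros simp: eventually_at_filter)
        thus ?thesis by simp
      qed
      show "\<forall>\<^sub>F l in at_right 0. norm (complex_of_real l powr (s - 1)) \<le> l powr (Re s - 1)"
        using eventually_at_right_less[of "0::real"]
        by eventually_elim (subst norm_powr_real_powr, auto)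
    qed
  qed (use s in auto)
  moreover have "\<forall>\<^sub>F l::real in at_right 0. l \<in> {0<..<1}" by (rule eventually_at_right_real) simp
  hence "\<forall>\<^sub>F l in at_right 0. zeta_mid s l = zeta_mid s 1"
  proof eventually_elim
    case (elim l)
    hence "0 < l" "l < 2 * pi" using one_less_two_pi by auto
    thus ?case by (rule zeta_mid_indep[OF s2])
  qed
  hence "((\<lambda>l. zeta_mid s l) \<longlongrightarrow> zeta_mid s 1) (at_right 0)" by (rule tendsto_eventually)
  ultimately have "zeta_mid s 1 = zeta_series s - Gamma (1 - s) * 0 + of_real 0 * zeta_left (s - 1) 1 - 0"
    by (intro tendsto_unique[where F = "at_right (0::real)"]) auto
  thus ?thesis by simp
qed

text \<open>The definite description is justified by gluing \<open>zeta_mid\<close>, which covers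
  \<open>Re s < 2\<close> without 1, to the Dirichlet series; they agree on the common strip.
  Uniqueness is the identity theorem on the connected punctured plane, with the value at 1
  prescribed.\<close>

lemma riemann_zeta_spec:
  "riemann_zeta holomorphic_on (- {1}) \<and> riemann_zeta 1 = 0 \<and> (\<forall>s. Re s > 1 \<longrightarrow> riemann_zeta s = zeta_series s)"
proof -
  let ?P = "\<lambda>f. f holomorphic_on (- {1}) \<and> f 1 = 0 \<and> (\<forall>s. Re s > 1 \<longrightarrow> f s = (\<Sum>n. 1 / of_nat (Suc n) powr s))"
  define Z where "Z = (\<lambda>s. if s = 1 then 0 else if Re s > 1 then zeta_series s else zeta_mid s 1)"
  have "Z holomorphic_on strip_two"
    by (rule holomorphic_transform[OF holomorphic_zeta_mid[OF one_less_two_pi]])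
       (auto simp: Z_def strip_two_def zeta_mid_eq_series)
  moreover have "Z holomorphic_on {s. Re s > 1}"
    by (rule holomorphic_transform[OF holomorphic_zeta_series]) (auto simp: Z_def)
  ultimately have "Z holomorphic_on (strip_two \<union> {s. Re s > 1})"
    by (intro holomorphic_on_Un open_strip_two open_halfspace_Re_gt)
  also have "strip_two \<union> {s. Re s > 1} = - {1}" by (auto simp: strip_two_def)
  finally have PZ: "?P Z" by (auto simp: Z_def zeta_series_def)
  have "f = Z" if f: "?P f" for f
  proof
    fix s
    show "f s = Z s"
    proof (cases "s = 1")
      case False
      show ?thesis
      proof (rule analytic_continuation_open[where s = "{s. Re s > 1}" and s' = "- {1}" and f = f and g = Z])
        show "{s. Re s > 1} \<noteq> {}" by (rule ex_in_conv[THEN iffD1]) (intro exI[of _ 2], simp)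
        show "connected (- {1::complex})" by (rule connected_punctured_universe) simp
        show "f holomorphic_on - {1}" "Z holomorphic_on - {1}" using f PZ by blast+
        show "f z = Z z" if "z \<in> {s. Re s > 1}" for z using f PZ that by simp
        show "s \<in> - {1}" using False by simp
        show "{s. 1 < Re s} \<subseteq> - {1}" by auto
        show "open (- {1 :: complex})" by (intro open_Compl) auto
      qed (simp_all add: open_halfspace_Re_gt)
    qed (use f PZ in auto)
  qed
  hence "?P (THE f. ?P f)" by (rule theI[where P = ?P and a = Z, OF PZ])
  thus ?thesis unfolding riemann_zeta_def zeta_series_def by blast
qed

section \<open>The expansion for general exponents\<close>

definition zeta_refl' :: "complex \<Rightarrow> complex" where
  "zeta_refl' p = 2 * of_real (2 * pi) powr (- p - 1) * cos (of_real pi * (p + 1) / 2) * Gamma (p + 1) * riemann_zeta (p + 1)"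

lemma zeta_refl'_eq: "Re p > 0 \<Longrightarrow> zeta_refl' p = zeta_refl p"
  using riemann_zeta_spec by (simp add: zeta_refl'_def zeta_refl_def)

lemma holomorphic_zeta_refl': "(\<lambda>p. zeta_refl' (p + of_nat j)) holomorphic_on (- \<int>)"
proof -
  have ni: "p + of_nat j + 1 \<notin> \<int>" if "p \<notin> \<int>" for p :: complex
    using that Ints_diff[of "p + of_nat j + 1" "of_nat j + 1"] by auto
  hence n1: "p + of_nat j + 1 \<noteq> 1" if "p \<notin> \<int>" for p :: complex using that Ints_1 ni by metis
  have "(\<lambda>p. riemann_zeta (p + of_nat j + 1)) holomorphic_on (- \<int>)"
    by (rule holomorphic_on_compose_gen[OF _ conjunct1[OF riemann_zeta_spec], unfolded o_def])
       (auto intro!: holomorphic_intros dest!: n1)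
  thus ?thesis unfolding zeta_refl'_def
    using ni nonpos_Ints_Int by (intro holomorphic_intros) fastforce+
qed

text \<open>The first \<open>J\<close> terms, which involve continued zeta, are separated so that
  the tail has its parameter in the right half plane. The resulting identity then extends from
  \<open>Re p > 0\<close> to \<open>Re p > - J\<close>; removing the integers avoids the poles of
  Gamma and leaves the domain connected.\<close>

theorem polylog_exp_expansion_complex:
  assumes p: "p \<notin> \<int>" and l: "0 < l" "l < 2 * pi"
  shows "(\<lambda>j. of_real ((- l) ^ j / fact j) * zeta_refl' (p + of_nat j)) sums
           (polylog_exp p l - Gamma (p + 1) * of_real l powr (- p - 1))"
proof -
  obtain J :: nat where J: "real J > - Re p" using reals_Archimedean2 by blast
  let ?S = "{p. Re p > - real J} - \<int>"
  let ?h = "\<lambda>p. \<Sum>j<J. of_real ((- l) ^ j / fact j) * zeta_refl' (p + of_nat j)"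
  have eq: "polylog_exp p l - Gamma (p + 1) * of_real l powr (- p - 1) = ?h p + zeta_refl_tail J (p + of_nat J) l"
  proof (rule analytic_continuation_open[where s = "{p. Re p > 0} - \<int>" and s' = ?S
      and f = "\<lambda>p. polylog_exp p l - Gamma (p + 1) * of_real l powr (- p - 1)"
      and g = "\<lambda>p. ?h p + zeta_refl_tail J (p + of_nat J) l"])
    show "open ({p. Re p > 0} - \<int> :: complex set)" "open (?S :: complex set)"
      by (intro open_Diff open_halfspace_Re_gt closed_Ints)+
    have "1 / 2 \<notin> (\<int> :: complex set)" using fraction_not_in_Ints[of 2 1, where 'a = complex] by simp
    thus "{p. Re p > 0} - \<int> \<noteq> ({} :: complex set)" by (intro ex_in_conv[THEN iffD1] exI[of _ "1/2"]) auto
    have "countable (\<int> :: complex set)" by (simp add: Ints_def)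
    thus "connected (?S :: complex set)"
      by (intro connected_open_diff_countable convex_connected convex_halfspace_Re_gt open_halfspace_Re_gt) auto
    have ni: "p + 1 \<notin> \<int>\<^sub>\<le>\<^sub>0" if "p \<notin> \<int>" for p :: complex
      using that Ints_diff[of "p + 1" 1] nonpos_Ints_Int by auto
    show "(\<lambda>p. polylog_exp p l - Gamma (p + 1) * of_real l powr (- p - 1)) holomorphic_on ?S"
      using ni l by (intro holomorphic_intros holomorphic_polylog_exp) auto
    have "(\<lambda>p. zeta_refl_tail J (p + of_nat J) l) holomorphic_on ?S"
      by (rule holomorphic_on_compose_gen[OF _ holomorphic_zeta_refl_tail[OF l], unfolded o_def])
         (auto intro!: holomorphic_intros)
    moreover have "(\<lambda>p. zeta_refl' (p + of_nat j)) holomorphic_on ?S" for j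
      by (rule holomorphic_on_subset[OF holomorphic_zeta_refl']) auto
    ultimately show "(\<lambda>p. ?h p + zeta_refl_tail J (p + of_nat J) l) holomorphic_on ?S"
      by (intro holomorphic_intros) auto
    show "p \<in> ?S" using p J by auto
    fix z :: complex assume "z \<in> {p. Re p > 0} - \<int>"
    hence z: "Re z > 0" by simp
    have "zeta_refl_tail 0 z l = (\<Sum>j<J'. of_real ((- l) ^ j / fact j) * zeta_refl' (z + of_nat j)) + zeta_refl_tail J' (z + of_nat J') l" for J'
    proof (induction J')
      case (Suc J')
      have "zeta_refl_tail J' (z + of_nat J') l = of_real ((- l) ^ J' / fact J') * zeta_refl (z + of_nat J') + zeta_refl_tail (Suc J') (z + of_nat J' + 1) l"
        using z l by (intro zeta_refl_tail_split) auto
      moreover have "zeta_refl (z + of_nat J') = zeta_refl' (z + of_nat J')" using z by (simp add: zeta_refl'_eq)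
      ultimately show ?case using Suc.IH by (simp add: add_ac)
    qed simp
    from this[of J] polylog_exp_expansion[OF z l]
    show "polylog_exp z l - Gamma (z + 1) * of_real l powr (- z - 1) = ?h z + zeta_refl_tail J (z + of_nat J) l" by simp
  qed (auto)
  have "(\<lambda>i. of_real ((- l) ^ (i + J) / fact (i + J)) * zeta_refl (p + of_nat J + of_nat i)) sums zeta_refl_tail J (p + of_nat J) l"
    using J by (intro zeta_refl_tail_sums l) simp
  moreover have "zeta_refl (p + of_nat J + of_nat i) = zeta_refl' (p + of_nat (i + J))" for i
    using zeta_refl'_eq[of "p + of_nat J + of_nat i"] J by (simp add: add_ac)
  ultimately have "(\<lambda>i. of_real ((- l) ^ (i + J) / fact (i + J)) * zeta_refl' (p + of_nat (i + J))) sums zeta_refl_tail J (p + of_nat J) l"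
    by simp
  hence "(\<lambda>j. of_real ((- l) ^ j / fact j) * zeta_refl' (p + of_nat j)) sums (?h p + zeta_refl_tail J (p + of_nat J) l)"
    by (subst (asm) sums_iff_shift) (simp add: add.commute)
  thus ?thesis using eq by simp
qed

definition real_zeta :: "real \<Rightarrow> real" where
  "real_zeta s = Re (riemann_zeta (of_real s))"

text \<open>The functional equation's expression for zeta at \<open>1 - s\<close>. At
  \<open>s = 1\<close> the cosine vanishes and the value is 0, not zeta(0) = -1/2.\<close>

definition lipschitz_coeff :: "real \<Rightarrow> real" where
  "lipschitz_coeff s = 2 * (2 * pi) powr (- s) * cos (pi * s / 2) * Gamma s * real_zeta s"

lemma Re_zeta_refl':
  "Re (of_real ((- l) ^ j / fact j) * zeta_refl' (of_real p + of_nat j)) = (- l) ^ j / fact j * lipschitz_coeff (p + 1 + real j)"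
proof -
  let ?s = "p + 1 + real j"
  have s: "of_real p + of_nat j + 1 = complex_of_real ?s" by simp
  have s': "- (of_real p + of_nat j) - 1 = complex_of_real (- ?s)" by simp
  have "of_real ((- l) ^ j / fact j) * zeta_refl' (of_real p + of_nat j) = of_real ((- l) ^ j / fact j * (2 * (2 * pi) powr (- ?s) * cos (pi * ?s / 2) * Gamma ?s)) * riemann_zeta (of_real ?s)"
  proof -
    have "of_real (2 * pi) powr (of_real (- ?s)) = complex_of_real ((2 * pi) powr (- ?s))" by (rule powr_of_real) simp
    moreover have "cos (of_real pi * of_real ?s / 2) = complex_of_real (cos (pi * ?s / 2))" by (simp flip: cos_of_real)
    ultimately show ?thesis unfolding zeta_refl'_def s s' Gamma_complex_of_real of_real_mult by (simp only: of_real_numeral mult.assoc)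
  qed
  moreover have "Re (of_real x * z) = x * Re z" for x z by simp
  ultimately show ?thesis by (simp only: lipschitz_coeff_def real_zeta_def mult.assoc)
qed

definition real_polylog_exp :: "real \<Rightarrow> real \<Rightarrow> real" where
  "real_polylog_exp p l = (\<Sum>n. real (Suc n) powr p * exp (- l * real (Suc n)))"

theorem real_polylog_exp_expansion:
  assumes p: "p > 0 \<or> p \<notin> \<int>" and l: "0 < l" "l < 2 * pi"
  shows "(\<lambda>j. (- l) ^ j / fact j * lipschitz_coeff (p + 1 + real j)) sums
           (real_polylog_exp p l - Gamma (p + 1) * l powr (- p - 1))"
proof -
  have "(\<lambda>j. of_real ((- l) ^ j / fact j) * zeta_refl' (of_real p + of_nat j)) sums
           (polylog_exp (of_real p) l - Gamma (of_real p + 1) * of_real l powr (- of_real p - 1))"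
  proof (cases "p > 0")
    case True
    have "(\<lambda>i. of_real ((- l) ^ (i + 0) / fact (i + 0)) * zeta_refl (of_real p + of_nat i)) sums zeta_refl_tail 0 (of_real p) l"
      using True by (intro zeta_refl_tail_sums l) simp
    moreover have "zeta_refl (of_real p + of_nat i) = zeta_refl' (of_real p + of_nat i)" for i
      using True by (simp add: zeta_refl'_eq)
    ultimately show ?thesis using polylog_exp_expansion[of "of_real p" l] True l by simp
  next
    case False
    hence "complex_of_real p \<notin> \<int>" using p by (simp add: of_real_in_Ints_iff)
    thus ?thesis by (rule polylog_exp_expansion_complex[OF _ l])
  qed
  hence "(\<lambda>j. Re (of_real ((- l) ^ j / fact j) * zeta_refl' (of_real p + of_nat j))) sums
           Re (polylog_exp (of_real p) l - Gamma (of_real p + 1) * of_real l powr (- of_real p - 1))"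
    by (rule sums_Re)
  moreover have "polylog_exp (of_real p) l = of_real (real_polylog_exp p l)"
    unfolding real_polylog_exp_def by (rule polylog_exp_of_real[OF l(1)])
  moreover have "Gamma (of_real p + 1) = complex_of_real (Gamma (p + 1))" by (simp flip: Gamma_complex_of_real)
  moreover have "of_real l powr (- of_real p - 1) = complex_of_real (l powr (- p - 1))"
    using l by (simp flip: powr_of_real)
  ultimately show ?thesis unfolding Re_zeta_refl' by simp
qed

lemma real_polylog_exp_0:
  assumes "l > 0"
  shows "real_polylog_exp 0 l = 1 / (exp l - 1)"
proof -
  have "(\<lambda>n. exp (-l) * exp (-l) ^ n) sums (exp (-l) * (1 / (1 - exp (-l))))"
    using assms by (intro sums_mult geometric_sums) auto
  moreover have "exp (-l) * exp (-l) ^ n = real (Suc n) powr 0 * exp (- l * real (Suc n))" for n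
    by (simp add: algebra_simps flip: exp_add exp_of_nat_mult)
  ultimately have "real_polylog_exp 0 l = exp (-l) * (1 / (1 - exp (-l)))"
    unfolding real_polylog_exp_def by (simp add: sums_iff)
  also have "\<dots> = 1 / (exp l - 1)" using assms by (simp add: exp_minus field_simps)
  finally show ?thesis .
qed

lemma real_polylog_exp_1:
  assumes "l > 0"
  shows "real_polylog_exp 1 l = exp l / (exp l - 1)\<^sup>2"
proof -
  have "real_polylog_exp 1 l = exp (-l) / (1 - exp (-l))\<^sup>2"
    unfolding real_polylog_exp_def using sums_nat_times_exp[OF assms] by (simp add: sums_iff)
  also have "1 - exp (-l) = exp (-l) * (exp l - 1)" by (simp add: algebra_simps flip: exp_add)
  finally show ?thesis using assms by (simp add: power2_eq_square exp_minus field_simps)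
qed

text \<open>The constant term is the value \<open>-1/2\<close> of zeta at 0; it is obtained by integrating the
  expansion of order 1, so that the pole of zeta at 1 is never met.\<close>

theorem real_polylog_exp_0_expansion:
  assumes l: "0 < l" "l < 2 * pi"
  shows "(\<lambda>j. (- l) ^ j / fact j * lipschitz_coeff (1 + real j)) sums (real_polylog_exp 0 l - 1 / l + 1 / 2)"
proof -
  define d where "d = (\<lambda>j. (- 1) ^ j / fact j * lipschitz_coeff (2 + real j))"
  define c where "c = (\<lambda>j. (- 1) ^ j / fact j * lipschitz_coeff (1 + real j))"
  \<comment> \<open>The cosine of pi/2 is the reason. The missing constant term -1/2 reappears as
    the summand 1/2 on the right-hand side.\<close>
  have c0: "c 0 = 0" by (simp add: c_def lipschitz_coeff_def)
  have cd: "real (Suc j) * c (Suc j) = - d j" for j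
    by (simp add: c_def d_def add_ac field_simps del: of_nat_Suc) (simp add: add_ac)?
  have ds: "(\<lambda>j. d j * x ^ j) sums (real_polylog_exp 1 x - 1 / x\<^sup>2)" if x: "0 < x" "x < 2 * pi" for x
  proof -
    have "(\<lambda>j. (- x) ^ j / fact j * lipschitz_coeff (1 + 1 + real j)) sums (real_polylog_exp 1 x - Gamma (1 + 1) * x powr (- 1 - 1))"
      by (rule real_polylog_exp_expansion[OF _ x]) simp
    moreover have "Gamma (1 + 1) * x powr (- 1 - 1) = 1 / x\<^sup>2"
      using x Gamma_numeral[of "num.Bit0 num.One", where 'a = real] by (simp add: powr_minus_divide powr_numeral)
    moreover have "(- x) ^ j = (- 1) ^ j * x ^ j" for j by (rule power_minus)
    ultimately show ?thesis by (simp add: d_def mult_ac)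
  qed
  have cs: "summable (\<lambda>j. c j * x ^ j)" if x: "\<bar>x\<bar> < 2 * pi" for x
  proof -
    obtain y where y: "\<bar>x\<bar> < y" "y < 2 * pi" using dense[OF x] by blast
    have "summable (\<lambda>j. d j * y ^ j)" using ds[of y] y by (auto simp: sums_iff)
    hence "summable (\<lambda>j. norm (d j * x ^ j))" by (rule powser_insidea) (use y in auto)
    hence "summable (\<lambda>j. \<bar>x\<bar> * norm (d j * x ^ j))" by (rule summable_mult)
    hence "summable (\<lambda>j. c (Suc j) * x ^ Suc j)"
    proof (rule summable_comparison_test')
      fix j
      have "\<bar>c (Suc j)\<bar> \<le> real (Suc j) * \<bar>c (Suc j)\<bar>" by (simp add: mult_le_cancel_right1)
      also have "\<dots> = \<bar>d j\<bar>" using cd[of j] by (metis abs_minus_cancel abs_mult abs_of_nat)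
      finally have "\<bar>c (Suc j)\<bar> * \<bar>x\<bar> ^ Suc j \<le> \<bar>d j\<bar> * \<bar>x\<bar> ^ Suc j" by (intro mult_right_mono) auto
      thus "norm (c (Suc j) * x ^ Suc j) \<le> \<bar>x\<bar> * norm (d j * x ^ j)"
        by (simp add: abs_mult power_abs mult_ac)
    qed
    thus ?thesis by (subst (asm) summable_Suc_iff)
  qed
  define T where "T = (\<lambda>x. \<Sum>j. c j * x ^ j)"
  have dT: "(T has_real_derivative (\<Sum>j. diffs c j * x ^ j)) (at x)" if x: "\<bar>x\<bar> < 2 * pi" for x
  proof -
    obtain y where y: "\<bar>x\<bar> < y" "y < 2 * pi" using dense[OF x] by blast
    show ?thesis unfolding T_def
      by (rule termdiffs_strong[of c y]) (use y cs[of y] in auto)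
  qed
  define g where "g = (\<lambda>x::real. 1 / (exp x - 1) - 1 / x + 1 / 2)"
  have dTg: "((\<lambda>x. T x - g x) has_real_derivative 0) (at x)" if x: "0 < x" "x < 2 * pi" for x
  proof -
    have "diffs c j = - d j" for j unfolding diffs_def using cd[of j] by simp
    hence "(\<Sum>j. diffs c j * x ^ j) = - (real_polylog_exp 1 x - 1 / x\<^sup>2)"
      using sums_minus[OF ds[OF x]] by (simp add: sums_iff)
    moreover have "(g has_real_derivative (- exp x / (exp x - 1)\<^sup>2 + 1 / x\<^sup>2)) (at x)"
      unfolding g_def using x by (auto intro!: derivative_eq_intros simp: power2_eq_square)
    ultimately show ?thesis using DERIV_diff[OF dT[of x], of g "- exp x / (exp x - 1)\<^sup>2 + 1 / x\<^sup>2"] x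
      by (simp add: real_polylog_exp_1)
  qed
  have const: "T x - g x = T l - g l" if x: "0 < x" "x < l" for x
  proof -
    have "(\<lambda>x. T x - g x) l = (\<lambda>x. T x - g x) x"
    proof (rule DERIV_isconst_end[of x l])
      show "continuous_on {x..l} (\<lambda>x. T x - g x)"
      proof (intro continuous_at_imp_continuous_on ballI)
        fix z assume "z \<in> {x..l}"
        thus "isCont (\<lambda>x. T x - g x) z" using x l by (intro DERIV_isCont[OF dTg]) auto
      qed
      show "((\<lambda>x. T x - g x) has_real_derivative 0) (at z)" if "x < z" "z < l" for z
        using dTg[of z] x l that by simp
    qed (rule x)
    thus ?thesis by simp
  qed
  \<comment> \<open>The constant of integration is read off at 0 from the right, where the poles of
    \<open>1 / (exp x - 1)\<close> and \<open>1 / x\<close> cancel and leave -1/2.\<close>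
  have "((\<lambda>x. T x - g x) \<longlongrightarrow> T 0 - 0) (at_right 0)"
  proof (intro tendsto_diff)
    have "isCont T 0" by (rule DERIV_isCont[OF dT]) simp
    thus "(T \<longlongrightarrow> T 0) (at_right 0)" by (simp add: isCont_def filterlim_at_split)
    show "(g \<longlongrightarrow> 0) (at_right 0)" unfolding g_def by real_asymp
  qed
  moreover have "T 0 = 0" unfolding T_def by (simp add: c0)
  moreover have "\<forall>\<^sub>F x in at_right 0. x \<in> {0<..<l}" using l by (intro eventually_at_right_real)
  hence "\<forall>\<^sub>F x in at_right 0. T x - g x = T l - g l" by (rule eventually_mono) (use const in auto)
  hence "((\<lambda>x. T x - g x) \<longlongrightarrow> T l - g l) (at_right 0)" by (rule tendsto_eventually)
  ultimately have "T l - g l = T 0 - 0" and "T 0 = 0"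
    using tendsto_unique[OF trivial_limit_at_right_real, of "\<lambda>x. T x - g x" _ 0] by blast+
  hence "T l = real_polylog_exp 0 l - 1 / l + 1 / 2" using l by (simp add: g_def real_polylog_exp_0)
  moreover have "c j * l ^ j = (- l) ^ j / fact j * lipschitz_coeff (1 + real j)" for j
    by (simp add: c_def power_minus[of l])
  ultimately show ?thesis using cs[of l] l unfolding T_def by (simp add: sums_iff)
qed

section \<open>Conditional convergence of the double series\<close>

text \<open>The recurrence says that \<open>f(w) = \<Sum>n. c n w\<^bsup>-\<tau> n\<^esup>\<close> solves
  \<open>(w\<^sup>2 - b\<^sup>2) f' - 2 \<mu> w f = K\<close>.\<close>

locale lattice_series =
  fixes b \<mu> \<sigma> K :: real and c :: "nat \<Rightarrow> real"
  assumes b: "0 < b" "b < 2 * pi"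
    and rec: "\<And>n. (2 * real n + 2 + \<sigma> + 2 * \<mu>) * c (Suc n) = b\<^sup>2 * (2 * real n + \<sigma>) * c n"
    and K: "\<sigma> + 2 * \<mu> = 0 \<and> K = 0 \<or> \<sigma> = 1 \<and> K = - (\<sigma> + 2 * \<mu>) * c 0"
begin

definition \<tau> :: "nat \<Rightarrow> real" where "\<tau> n = 2 * real n + \<sigma>"

lemma summable_abs_c:
  assumes r: "0 \<le> r" "b\<^sup>2 * r < 1"
  shows "summable (\<lambda>n. \<bar>c n\<bar> * r ^ n)"
proof -
  obtain \<rho> where rho: "b\<^sup>2 * r < \<rho>" "\<rho> < 1" using dense[OF r(2)] by blast
  have "(\<lambda>n. b\<^sup>2 * r * (\<bar>2 * real n + \<sigma>\<bar> / (2 * real n + 2 + \<sigma> + 2 * \<mu>))) \<longlonglongrightarrow> b\<^sup>2 * r * 1"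
    by (intro tendsto_mult tendsto_const) real_asymp
  hence "\<forall>\<^sub>F n in sequentially. b\<^sup>2 * r * (\<bar>2 * real n + \<sigma>\<bar> / (2 * real n + 2 + \<sigma> + 2 * \<mu>)) < \<rho>"
    using rho by (intro order_tendstoD) auto
  moreover have "\<forall>\<^sub>F n in sequentially. 2 * real n + 2 + \<sigma> + 2 * \<mu> > 0" by real_asymp
  ultimately have "\<forall>\<^sub>F n in sequentially. norm (\<bar>c (Suc n)\<bar> * r ^ Suc n) \<le> \<rho> * norm (\<bar>c n\<bar> * r ^ n)"
  proof eventually_elim
    case (elim n)
    let ?D = "2 * real n + 2 + \<sigma> + 2 * \<mu>"
    have "c (Suc n) = b\<^sup>2 * (2 * real n + \<sigma>) * c n / ?D" using rec[of n] elim by (simp add: field_simps)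
    hence "\<bar>c (Suc n)\<bar> = b\<^sup>2 * \<bar>2 * real n + \<sigma>\<bar> * \<bar>c n\<bar> / ?D" using elim by (simp add: abs_mult)
    hence "\<bar>c (Suc n)\<bar> * r ^ Suc n = (b\<^sup>2 * r * (\<bar>2 * real n + \<sigma>\<bar> / ?D)) * (\<bar>c n\<bar> * r ^ n)" by simp
    also have "\<dots> \<le> \<rho> * (\<bar>c n\<bar> * r ^ n)" using elim r by (intro mult_right_mono) auto
    finally show ?case using r by (simp add: abs_mult)
  qed
  then obtain N where "\<And>n. n \<ge> N \<Longrightarrow> norm (\<bar>c (Suc n)\<bar> * r ^ Suc n) \<le> \<rho> * norm (\<bar>c n\<bar> * r ^ n)"
    by (auto simp: eventually_at_top_linorder)
  thus ?thesis by (intro summable_ratio_test[of \<rho> N] rho)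
qed

definition gser :: "complex \<Rightarrow> complex" where "gser z = (\<Sum>n. of_real (c n) * z ^ n)"

lemma summable_gser:
  fixes z :: complex
  assumes "b\<^sup>2 * norm z < 1"
  shows "summable (\<lambda>n. of_real (c n) * z ^ n)"
  by (rule summable_norm_cancel) (use summable_abs_c[of "norm z"] assms in \<open>simp add: norm_mult norm_power\<close>)

text \<open>The recurrence multiplied by a power of \<open>z\<close> and summed. It links index
  \<open>n + 1\<close> to index \<open>n\<close>, so the left side starts at index 1; this is why
  \<open>c 0\<close> is subtracted there and later becomes the inhomogeneity.\<close>

lemma gser_deriv:
  assumes z: "b\<^sup>2 * norm z < 1"
  shows "\<exists>g'. (gser has_field_derivative g') (at z) \<and>
    2 * z * g' + of_real (\<sigma> + 2 * \<mu>) * (gser z - of_real (c 0)) = of_real (b\<^sup>2) * z * (2 * z * g' + of_real \<sigma> * gser z)"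
proof -
  let ?c = "\<lambda>n. complex_of_real (c n)"
  define r where "r = (norm z + 1 / b\<^sup>2) / 2"
  have "norm z < 1 / b\<^sup>2" using z b by (simp add: field_simps)
  hence r: "norm z < r" "r < 1 / b\<^sup>2" by (auto simp: r_def)
  hence r': "b\<^sup>2 * r < 1" "0 \<le> r" using b by (auto simp: field_simps intro: order_trans[OF norm_ge_zero less_imp_le])
  have sr: "summable (\<lambda>n. ?c n * of_real r ^ n)" using r' by (intro summable_gser) simp
  define g' where "g' = (\<Sum>n. diffs ?c n * z ^ n)"
  have d: "(gser has_field_derivative g') (at z)"
    unfolding gser_def[abs_def] g'_def by (rule termdiffs_strong[OF sr]) (use r r' in simp)
  have "summable (\<lambda>n. diffs ?c n * z ^ n)" 
    by (rule termdiff_converges[of z r]) (use r summable_gser[of _] r' in \<open>auto intro!: summable_gser simp: mult_strict_left_mono\<close>, smt (verit) mult_less_cancel_left_pos b zero_less_power)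
  hence s1: "(\<lambda>n. diffs ?c n * z ^ n) sums g'" unfolding g'_def by (rule summable_sums)
  have s0: "(\<lambda>n. ?c n * z ^ n) sums gser z" unfolding gser_def by (intro summable_sums summable_gser z)
  have s0': "(\<lambda>n. ?c (Suc n) * z ^ Suc n) sums (gser z - ?c 0)"
    using s0 by (subst sums_Suc_iff) simp
  have s2: "(\<lambda>n. z * (diffs ?c n * z ^ n)) sums (z * g')" by (rule sums_mult[OF s1])
  have s2': "(\<lambda>n. of_nat (Suc n) * ?c (Suc n) * z ^ Suc n) sums (z * g')"
    using s2 by (simp add: diffs_def mult_ac)
  have s3: "(\<lambda>n. of_nat n * ?c n * z ^ n) sums (z * g')"
    using s2' by (subst (asm) sums_Suc_iff) simp
  have L: "(\<lambda>n. 2 * (of_nat (Suc n) * ?c (Suc n) * z ^ Suc n) + of_real (\<sigma> + 2 * \<mu>) * (?c (Suc n) * z ^ Suc n)) sums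
     (2 * (z * g') + of_real (\<sigma> + 2 * \<mu>) * (gser z - ?c 0))"
    by (intro sums_add sums_mult s2' s0')
  have R: "(\<lambda>n. of_real (b\<^sup>2) * z * (2 * (of_nat n * ?c n * z ^ n) + of_real \<sigma> * (?c n * z ^ n))) sums
     (of_real (b\<^sup>2) * z * (2 * (z * g') + of_real \<sigma> * gser z))"
    by (intro sums_add sums_mult s3 s0)
  have "2 * (of_nat (Suc n) * ?c (Suc n) * z ^ Suc n) + of_real (\<sigma> + 2 * \<mu>) * (?c (Suc n) * z ^ Suc n)
     = of_real (b\<^sup>2) * z * (2 * (of_nat n * ?c n * z ^ n) + of_real \<sigma> * (?c n * z ^ n))" for n
  proof -
    have "2 * (of_nat (Suc n) * ?c (Suc n) * z ^ Suc n) + of_real (\<sigma> + 2 * \<mu>) * (?c (Suc n) * z ^ Suc n)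
      = of_real ((2 * real n + 2 + \<sigma> + 2 * \<mu>) * c (Suc n)) * z ^ Suc n" by (simp add: algebra_simps)
    also have "\<dots> = of_real (b\<^sup>2) * z * (2 * (of_nat n * ?c n * z ^ n) + of_real \<sigma> * (?c n * z ^ n))"
      unfolding rec by (simp add: algebra_simps)
    finally show ?thesis .
  qed
  with L R have "2 * (z * g') + of_real (\<sigma> + 2 * \<mu>) * (gser z - ?c 0) = of_real (b\<^sup>2) * z * (2 * (z * g') + of_real \<sigma> * gser z)"
    by (simp only:) (rule sums_unique2)
  with d show ?thesis by (auto simp: mult_ac)
qed

definition fser :: "complex \<Rightarrow> complex" where "fser w = w powr (- of_real \<sigma>) * gser (1 / w\<^sup>2)"

lemma b_norm_sq:
  fixes w :: complex
  assumes "norm w > b"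
  shows "b\<^sup>2 * norm (1 / w\<^sup>2) < 1" "w \<noteq> 0"
proof -
  have "b\<^sup>2 < (norm w)\<^sup>2" using assms b by (intro power_strict_mono) auto
  moreover show w: "w \<noteq> 0" using assms b by auto
  ultimately show "b\<^sup>2 * norm (1 / w\<^sup>2) < 1" by (simp add: norm_divide norm_power divide_less_eq)
qed

lemma fser_sums:
  assumes w: "norm w > b"
  shows "(\<lambda>n. of_real (c n) * w powr (- of_real (\<tau> n))) sums fser w"
proof -
  have "(\<lambda>n. w powr (- of_real \<sigma>) * (of_real (c n) * (1 / w\<^sup>2) ^ n)) sums (w powr (- of_real \<sigma>) * gser (1 / w\<^sup>2))"
    unfolding gser_def by (intro sums_mult summable_sums summable_gser b_norm_sq w)
  moreover have "w powr (- of_real \<sigma>) * (of_real (c n) * (1 / w\<^sup>2) ^ n) = of_real (c n) * w powr (- of_real (\<tau> n))" for n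
  proof -
    have "- complex_of_real (\<tau> n) = - of_real \<sigma> - of_nat (2 * n)" by (simp add: \<tau>_def)
    hence "w powr (- of_real (\<tau> n)) = w powr (- of_real \<sigma> - of_nat (2 * n))" by simp
    also have "\<dots> = w powr (- of_real \<sigma>) / w ^ (2 * n)"
    proof -
      have "w powr (of_nat (2 * n)) = w ^ (2 * n)" by (rule powr_nat') (use b_norm_sq(2)[OF w] in simp)
      thus ?thesis by (simp only: powr_diff)
    qed
    finally show ?thesis by (simp add: power_divide power_mult)
  qed
  ultimately show ?thesis by (simp add: fser_def)
qed

lemma fser_ode:
  assumes w: "norm w > b" "w \<notin> \<real>\<^sub>\<le>\<^sub>0"
  shows "\<exists>f'. (fser has_field_derivative f') (at w) \<and> (w\<^sup>2 - of_real (b\<^sup>2)) * f' - 2 * of_real \<mu> * w * fser w = of_real K"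
proof -
  define z where "z = 1 / w\<^sup>2"
  have w0: "w \<noteq> 0" by (rule b_norm_sq(2)[OF w(1)])
  obtain g' where g': "(gser has_field_derivative g') (at z)"
    "2 * z * g' + of_real (\<sigma> + 2 * \<mu>) * (gser z - of_real (c 0)) = of_real (b\<^sup>2) * z * (2 * z * g' + of_real \<sigma> * gser z)"
    using gser_deriv[of z] b_norm_sq(1)[OF w(1)] by (auto simp: z_def)
  define P where "P = w powr (- of_real \<sigma>)"
  have dz: "((\<lambda>w. 1 / w\<^sup>2) has_field_derivative (- 2 / w ^ 3)) (at w)"
    using w0 by (auto intro!: derivative_eq_intros simp: power2_eq_square power3_eq_cube field_simps)
  have dg: "((\<lambda>w. gser (1 / w\<^sup>2)) has_field_derivative (g' * (- 2 / w ^ 3))) (at w)"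
    using DERIV_chain2[OF g'(1)[unfolded z_def] dz] .
  have dP: "((\<lambda>w. w powr (- of_real \<sigma>)) has_field_derivative (- of_real \<sigma> * (P / w))) (at w)"
    using w w0 by (auto intro!: derivative_eq_intros simp: P_def powr_diff)
  define f' where "f' = - of_real \<sigma> * (P / w) * gser z + g' * (- 2 / w ^ 3) * P"
  have "(fser has_field_derivative f') (at w)"
    unfolding fser_def[abs_def] f'_def P_def[symmetric] z_def using DERIV_mult[OF dP dg] by (simp add: P_def)
  moreover have "(w\<^sup>2 - of_real (b\<^sup>2)) * f' - 2 * of_real \<mu> * w * fser w = of_real K"
  proof -
    have zw: "z * w\<^sup>2 = 1" using w0 by (simp add: z_def)
    have f'_eq: "f' = - (P / w) * (of_real \<sigma> * gser z + 2 * z * g')"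
      using w0 by (simp add: f'_def z_def power2_eq_square power3_eq_cube field_simps)
    have "(w\<^sup>2 - of_real (b\<^sup>2)) = w\<^sup>2 * (1 - of_real (b\<^sup>2) * z)" using zw by (simp add: algebra_simps)
    hence "(w\<^sup>2 - of_real (b\<^sup>2)) * f' = - (w * P) * ((1 - of_real (b\<^sup>2) * z) * (of_real \<sigma> * gser z + 2 * z * g'))"
      using w0 by (simp add: f'_eq power2_eq_square)
    moreover have "fser w = P * gser z" by (simp add: fser_def P_def z_def)
    ultimately have "(w\<^sup>2 - of_real (b\<^sup>2)) * f' - 2 * of_real \<mu> * w * fser w
       = - (w * P) * ((1 - of_real (b\<^sup>2) * z) * (of_real \<sigma> * gser z + 2 * z * g') + 2 * of_real \<mu> * gser z)"
      by (simp add: algebra_simps)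
    also have "(1 - of_real (b\<^sup>2) * z) * (of_real \<sigma> * gser z + 2 * z * g') + 2 * of_real \<mu> * gser z
       = (2 * z * g' + of_real (\<sigma> + 2 * \<mu>) * gser z) - of_real (b\<^sup>2) * z * (2 * z * g' + of_real \<sigma> * gser z)"
      by (simp add: algebra_simps)
    also have "\<dots> = of_real (\<sigma> + 2 * \<mu>) * of_real (c 0)"
      unfolding g'(2)[symmetric] by (simp add: algebra_simps)
    \<comment> \<open>The two alternatives of the locale: either the coefficient vanishes and the
      equation is homogeneous, or \<open>\<sigma> = 1\<close> makes \<open>w * P\<close> equal to 1
      and the right side constant.\<close>
    also have "- (w * P) * (of_real (\<sigma> + 2 * \<mu>) * of_real (c 0)) = of_real K"
      using K
    proof (elim disjE conjE)
      assume s1: "\<sigma> = 1" and k1: "K = - (\<sigma> + 2 * \<mu>) * c 0"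
      have "w * P = 1" if "\<sigma> = 1" using that w0 by (simp add: P_def powr_minus)
      moreover have "complex_of_real K = - (of_real (\<sigma> + 2 * \<mu>) * of_real (c 0))"
        unfolding k1 by (simp only: of_real_mult of_real_minus mult_minus_left)
      ultimately show ?thesis using s1 by (simp only: mult_minus_left mult_1_left)
    qed simp
    finally show ?thesis .
  qed
  ultimately show ?thesis by blast
qed

text \<open>The differential equation has regular singular points only at \<open>\<plusminus>b\<close>, so the solution continues
  to the whole upper half plane, beyond the domain of convergence of the series.\<close>

lemma fser_extension:
  "\<exists>F. F holomorphic_on {w. Im w > 0} \<and> (\<forall>w. Im w > b \<longrightarrow> F w = fser w)"
proof -
  let ?H = "{w. Im w > 0}" and ?H' = "{w. Im w > b}"
  \<comment> \<open>A solution of the homogeneous equation. The base is taken as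
    \<open>b\<^sup>2 - w\<^sup>2\<close> because in the upper half plane it is real only on the
    imaginary axis, where it is positive; so the principal branch has no cut there.\<close>
  define E where "E = (\<lambda>w. (of_real (b\<^sup>2) - w\<^sup>2) powr (of_real \<mu>) :: complex)"
  have nz: "of_real (b\<^sup>2) - w\<^sup>2 \<notin> \<real>\<^sub>\<le>\<^sub>0" "w\<^sup>2 - of_real (b\<^sup>2) \<noteq> 0" if "Im w > 0" for w
  proof -
    have "Re (of_real (b\<^sup>2) - w\<^sup>2) > 0" if "Im (of_real (b\<^sup>2) - w\<^sup>2) = 0"
    proof -
      have "Re w = 0" using that \<open>Im w > 0\<close> by (simp add: power2_eq_square)
      thus ?thesis using b \<open>Im w > 0\<close> by (simp add: power2_eq_square add_pos_pos)
    qed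
    thus "of_real (b\<^sup>2) - w\<^sup>2 \<notin> \<real>\<^sub>\<le>\<^sub>0" by (auto simp: complex_nonpos_Reals_iff)
    hence "of_real (b\<^sup>2) - w\<^sup>2 \<noteq> 0" by auto
    thus "w\<^sup>2 - of_real (b\<^sup>2) \<noteq> 0" by auto
  qed
  have E0: "E w \<noteq> 0" if "Im w > 0" for w using nz[OF that] by (auto simp: E_def)
  have dE: "\<exists>E'. (E has_field_derivative E') (at w) \<and> (w\<^sup>2 - of_real (b\<^sup>2)) * E' = 2 * of_real \<mu> * w * E w" if "Im w > 0" for w
  proof -
    have "(E has_field_derivative (of_real \<mu> * (E w / (of_real (b\<^sup>2) - w\<^sup>2)) * (- 2 * w))) (at w)"
      unfolding E_def using nz[OF that] by (auto intro!: derivative_eq_intros simp: powr_diff)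
    moreover have "(w\<^sup>2 - of_real (b\<^sup>2)) * (of_real \<mu> * (E w / (of_real (b\<^sup>2) - w\<^sup>2)) * (- 2 * w)) = 2 * of_real \<mu> * w * E w"
    proof -
      define D where "D = of_real (b\<^sup>2) - w\<^sup>2"
      have "D \<noteq> 0" using nz(1)[OF that] by (auto simp: D_def)
      hence "- D * (of_real \<mu> * (E w / D) * (- 2 * w)) = 2 * of_real \<mu> * w * E w" by simp
      thus ?thesis by (simp only: D_def minus_diff_eq)
    qed
    ultimately show ?thesis by blast
  qed
  have holE: "E holomorphic_on ?H" unfolding E_def using nz by (intro holomorphic_intros) auto
  have "(\<lambda>w. of_real K / ((w\<^sup>2 - of_real (b\<^sup>2)) * E w)) holomorphic_on ?H"
    using nz E0 holE by (intro holomorphic_intros) auto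
  then obtain V where V: "\<And>w. w \<in> ?H \<Longrightarrow> (V has_field_derivative of_real K / ((w\<^sup>2 - of_real (b\<^sup>2)) * E w)) (at w within ?H)"
    using holomorphic_convex_primitive'[of ?H] by (auto simp: open_halfspace_Im_gt convex_halfspace_Im_gt)
  have V': "(V has_field_derivative of_real K / ((w\<^sup>2 - of_real (b\<^sup>2)) * E w)) (at w)" if "Im w > 0" for w
    using V[of w] that at_within_open[of w ?H] by (simp add: open_halfspace_Im_gt)
  have big: "norm w > b" "w \<notin> \<real>\<^sub>\<le>\<^sub>0" "Im w > 0" if "Im w > b" for w
    using that abs_Im_le_cmod[of w] b by (auto simp: complex_nonpos_Reals_iff)
  \<comment> \<open>Variation of constants: \<open>V\<close> is a primitive on the whole half plane,
    while the series is known to converge only above height \<open>b\<close>. The constant found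
    there defines the continuation below.\<close>
  have "\<exists>C. \<forall>w\<in>?H'. fser w / E w - V w = C"
  proof (rule has_field_derivative_zero_constant)
    show "convex ?H'" by (rule convex_halfspace_Im_gt)
    fix w assume "w \<in> ?H'"
    hence w: "norm w > b" "w \<notin> \<real>\<^sub>\<le>\<^sub>0" "Im w > 0" using big[of w] by auto
    obtain f' where f': "(fser has_field_derivative f') (at w)" "(w\<^sup>2 - of_real (b\<^sup>2)) * f' - 2 * of_real \<mu> * w * fser w = of_real K"
      using fser_ode[OF w(1,2)] by blast
    obtain E' where E': "(E has_field_derivative E') (at w)" "(w\<^sup>2 - of_real (b\<^sup>2)) * E' = 2 * of_real \<mu> * w * E w"
      using dE[OF w(3)] by blast
    have D: "w\<^sup>2 - of_real (b\<^sup>2) \<noteq> 0" "E w \<noteq> 0" using nz[OF w(3)] E0[OF w(3)] by auto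
    have "((\<lambda>w. fser w / E w - V w) has_field_derivative ((f' * E w - fser w * E') / (E w * E w) - of_real K / ((w\<^sup>2 - of_real (b\<^sup>2)) * E w))) (at w)"
      using D by (intro DERIV_diff DERIV_divide f' E' V' w)
    also have "(f' * E w - fser w * E') / (E w * E w) - of_real K / ((w\<^sup>2 - of_real (b\<^sup>2)) * E w) = 0"
    proof -
      let ?D = "w\<^sup>2 - of_real (b\<^sup>2)"
      have "?D * (f' * E w - fser w * E') = (?D * f') * E w - fser w * (?D * E')" by (simp add: algebra_simps)
      also have "\<dots> = of_real K * E w" unfolding E'(2) f'(2)[symmetric] by (simp add: algebra_simps)
      finally have "f' * E w - fser w * E' = of_real K * E w / ?D" using D by (simp add: field_simps)
      thus ?thesis using D by simp
    qed
    finally show "((\<lambda>w. fser w / E w - V w) has_field_derivative 0) (at w within ?H')" by (rule has_field_derivative_at_within)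
  qed
  then obtain C where C: "\<And>w. Im w > b \<Longrightarrow> fser w / E w - V w = C" by auto
  have "V holomorphic_on ?H" using V' by (intro holomorphic_onI) (auto simp: field_differentiable_def intro: has_field_derivative_at_within)
  hence "(\<lambda>w. E w * (V w + C)) holomorphic_on ?H" using holE by (intro holomorphic_intros)
  moreover have "E w * (V w + C) = fser w" if "Im w > b" for w
    using C[OF that] E0[OF big(3)[OF that]] by (auto simp: field_simps)
  ultimately show ?thesis by (intro exI[of _ "\<lambda>w. E w * (V w + C)"]) auto
qed

end

section \<open>Double sums and the decay of zeta - 1\<close>

lemma double_sums_absI:
  assumes row: "\<And>n. summable (\<lambda>j. \<bar>f j n\<bar>)" and col: "summable (\<lambda>n. \<Sum>j. \<bar>f j n\<bar>)"
  shows "\<exists>s. double_sums f s"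
proof -
  note * = summable_swap[of "\<lambda>n j. f j n", unfolded real_norm_def, OF row col]
  have "summable (\<lambda>j. f j n)" for n using summable_rabs_cancel[OF row] .
  moreover have "summable (\<lambda>n. f j n)" for j using summable_rabs_cancel[OF *(1)] .
  ultimately show ?thesis unfolding double_sums_def using *(2,3)
    by (intro exI[of _ "\<Sum>n. \<Sum>j. f j n"] conjI allI summable_sums)
qed

lemma double_sums_add:
  assumes "double_sums f s" "double_sums g t"
  shows "double_sums (\<lambda>m n. f m n + g m n) (s + t)"
proof -
  have *: "\<And>m. summable (\<lambda>n. f m n)" "\<And>n. summable (\<lambda>m. f m n)" "\<And>m. summable (\<lambda>n. g m n)" "\<And>n. summable (\<lambda>m. g m n)"
     "(\<lambda>m. \<Sum>n. f m n) sums s" "(\<lambda>n. \<Sum>m. f m n) sums s" "(\<lambda>m. \<Sum>n. g m n) sums t" "(\<lambda>n. \<Sum>m. g m n) sums t"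
    using assms by (auto simp: double_sums_def)
  show ?thesis unfolding double_sums_def
    by (auto simp: suminf_add[symmetric] * intro!: summable_add sums_add)
qed

lemma double_sums_cmult:
  fixes k :: real
  assumes "double_sums f s"
  shows "double_sums (\<lambda>m n. k * f m n) (k * s)"
proof -
  have *: "\<And>m. summable (\<lambda>n. f m n)" "\<And>n. summable (\<lambda>m. f m n)"
     "(\<lambda>m. \<Sum>n. f m n) sums s" "(\<lambda>n. \<Sum>m. f m n) sums s"
    using assms by (auto simp: double_sums_def)
  show ?thesis unfolding double_sums_def
    by (auto simp: suminf_mult * intro!: summable_mult sums_mult)
qed

text \<open>Without its first term the Dirichlet series has terms with base n >= 2; writing n as
  (n/2) times 2 extracts the decay, and for \<open>s >= 2\<close> what remains is dominated by the
  inverse squares.\<close>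

lemma real_zeta_minus_1_le:
  assumes s: "s \<ge> 2"
  shows "\<bar>real_zeta s - 1\<bar> \<le> (\<Sum>n. (real (Suc (Suc n)) / 2) powr (- 2)) * 2 powr (- s)"
proof -
  have re: "Re (complex_of_real s) > 1" using s by simp
  let ?t = "\<lambda>n. 1 / (of_nat (Suc n) :: complex) powr (of_real s)"
  have "riemann_zeta (of_real s) = zeta_series (of_real s)" using riemann_zeta_spec re by blast
  hence eq: "real_zeta s - 1 = Re (zeta_series (of_real s) - 1)" by (simp add: real_zeta_def)
  have "(\<lambda>n. ?t (Suc n)) sums (zeta_series (of_real s) - ?t 0)"
    using zeta_series_sums[OF re] by (subst sums_Suc_iff) (simp only: diff_add_cancel)
  hence s1: "(\<lambda>n. ?t (Suc n)) sums (zeta_series (of_real s) - 1)" by simp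
  have sm: "summable (\<lambda>n. (real (Suc (Suc n)) / 2) powr (- 2))"
  proof -
    have "summable (\<lambda>n. real (Suc (Suc n)) powr (- 2))"
      using summable_Suc_powr[of 2] by (subst summable_Suc_iff) simp
    hence "summable (\<lambda>n. real (Suc (Suc n)) powr (- 2) / 2 powr (- 2))" by (rule summable_divide)
    thus ?thesis by (simp add: powr_divide del: of_nat_Suc)
  qed
  have b: "norm (?t (Suc n)) \<le> (real (Suc (Suc n)) / 2) powr (- 2) * 2 powr (- s)" for n
  proof -
    have "norm (?t (Suc n)) = ((real (Suc (Suc n)) / 2) * 2) powr (- s)" unfolding norm_zeta_term by (simp del: of_nat_Suc)
    also have "\<dots> = (real (Suc (Suc n)) / 2) powr (- s) * 2 powr (- s)" by (rule powr_mult)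
    also have "\<dots> \<le> (real (Suc (Suc n)) / 2) powr (- 2) * 2 powr (- s)"
      using s by (intro mult_right_mono powr_mono) auto
    finally show ?thesis .
  qed
  have "\<bar>real_zeta s - 1\<bar> \<le> norm (zeta_series (of_real s) - 1)" unfolding eq by (rule abs_Re_le_cmod)
  also have "\<dots> \<le> (\<Sum>n. (real (Suc (Suc n)) / 2) powr (- 2) * 2 powr (- s))"
    using norm_suminf_le[OF b summable_mult2[OF sm]] s1 by (simp add: sums_iff)
  also have "\<dots> = (\<Sum>n. (real (Suc (Suc n)) / 2) powr (- 2)) * 2 powr (- s)" by (rule suminf_mult2[OF sm, symmetric])
  finally show ?thesis .
qed

lemma real_zeta_minus_1_bound:
  "\<exists>C. \<forall>k::nat. \<bar>real_zeta (\<sigma> + real k) - 1\<bar> \<le> C * 2 powr (- (\<sigma> + real k))"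
proof -
  obtain N :: nat where N: "real N \<ge> 2 - \<sigma>" using real_arch_simple by blast
  define C0 where "C0 = (\<Sum>n. (real (Suc (Suc n)) / 2) powr (- 2))"
  have C00: "C0 \<ge> 0" 
    using order_trans[OF abs_ge_zero real_zeta_minus_1_le[of 2]] by (simp add: zero_le_mult_iff C0_def)
  \<comment> \<open>Finitely many arguments may be less than 2, where zeta is continued and not a
    Dirichlet series; the constant absorbs them.\<close>
  define D where "D = (\<lambda>k. \<bar>real_zeta (\<sigma> + real k) - 1\<bar> / 2 powr (- (\<sigma> + real k)))"
  have D: "D k \<ge> 0" for k by (simp add: D_def)
  have "\<bar>real_zeta (\<sigma> + real k) - 1\<bar> \<le> (C0 + sum D {..<N}) * 2 powr (- (\<sigma> + real k))" for k
  proof (cases "k < N")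
    case True
    have "D k \<le> sum D {..<N}" using True D by (intro member_le_sum) auto
    hence "D k \<le> C0 + sum D {..<N}" using C00 by simp
    hence "D k * 2 powr (- (\<sigma> + real k)) \<le> (C0 + sum D {..<N}) * 2 powr (- (\<sigma> + real k))" by (intro mult_right_mono) auto
    thus ?thesis by (simp add: D_def)
  next
    case False
    hence "\<bar>real_zeta (\<sigma> + real k) - 1\<bar> \<le> C0 * 2 powr (- (\<sigma> + real k))"
      unfolding C0_def using N by (intro real_zeta_minus_1_le) linarith
    also have "\<dots> \<le> (C0 + sum D {..<N}) * 2 powr (- (\<sigma> + real k))"
      using D by (intro mult_right_mono) (auto intro: sum_nonneg)
    finally show ?thesis .
  qed
  thus ?thesis by blast
qed

lemma abs_pochhammer_le: "\<bar>pochhammer t j\<bar> \<le> pochhammer \<bar>t :: real\<bar> j"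
  unfolding pochhammer_prod abs_prod by (intro prod_mono) auto

lemma abs_gchoose: "\<bar>(- t gchoose j :: real)\<bar> = \<bar>pochhammer t j\<bar> / fact j"
  by (simp add: gbinomial_pochhammer abs_mult)

lemma summable_abs_binomial:
  fixes t :: real
  assumes "0 \<le> x" "x < M"
  shows "summable (\<lambda>j. \<bar>- t gchoose j\<bar> * x ^ j * M powr (- t - real j))"
proof (rule summable_comparison_test')
  show "summable (\<lambda>j. M powr (- t) * (pochhammer \<bar>t\<bar> j / fact j * (x / M) ^ j))"
    using assms by (intro summable_mult summable_pochhammer) auto
  fix j
  have "M powr (- t - real j) = M powr (- t) / M ^ j" using assms by (simp add: powr_diff powr_realpow)
  hence "\<bar>- t gchoose j\<bar> * x ^ j * M powr (- t - real j) = M powr (- t) * (\<bar>pochhammer t j\<bar> / fact j * (x / M) ^ j)"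
    by (simp add: abs_gchoose power_divide)
  also have "\<dots> \<le> M powr (- t) * (pochhammer \<bar>t\<bar> j / fact j * (x / M) ^ j)"
    using assms by (intro mult_left_mono mult_right_mono divide_right_mono abs_pochhammer_le) auto
  finally show "norm (\<bar>- t gchoose j\<bar> * x ^ j * M powr (- t - real j)) \<le> M powr (- t) * (pochhammer \<bar>t\<bar> j / fact j * (x / M) ^ j)"
    using assms by (simp add: abs_mult)
qed

text \<open>For \<open>t > 0\<close> the binomial coefficients alternate in sign, so taking absolute
  values amounts to replacing \<open>x\<close> by \<open>- x\<close>.\<close>

lemma abs_binomial_sums:
  fixes t :: real
  assumes "0 \<le> x" "x < M" "t > 0"
  shows "(\<lambda>j. \<bar>- t gchoose j\<bar> * x ^ j * M powr (- t - real j)) sums ((M - x) powr (- t))"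
proof -
  have "(\<lambda>j. (- t gchoose j) * M powr (- t - real j) * (- x) ^ j) sums (M + - x) powr (- t)"
    by (rule gen_binomial_real'') (use assms in auto)
  moreover have "(- t gchoose j) * M powr (- t - real j) * (- x) ^ j = \<bar>- t gchoose j\<bar> * x ^ j * M powr (- t - real j)" for j
  proof -
    have "pochhammer t j \<ge> 0" using assms by (intro pochhammer_nonneg) auto
    thus ?thesis by (cases "even j") (simp_all add: abs_gchoose gbinomial_pochhammer power_minus[of x])
  qed
  ultimately show ?thesis by simp
qed

section \<open>Expansion about the nearest lattice points\<close>

context lattice_series
begin

text \<open>Summing the absolute values over \<open>j\<close> replaces \<open>M\<close> by
  \<open>M - x\<close>, so the condition \<open>M - x > b\<close> is that of convergence of the
  original series at \<open>M - x\<close>. The evaluation needs \<open>\<tau> n > 0\<close>, which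
  may fail for finitely many \<open>n\<close>.\<close>

lemma abs_row_col:
  assumes x: "0 \<le> x" "x < M" "M - x > b"
  shows "summable (\<lambda>j. \<bar>c n\<bar> * (\<bar>- \<tau> n gchoose j\<bar> * x ^ j * M powr (- \<tau> n - real j)))"
    and "summable (\<lambda>n. \<Sum>j. \<bar>c n\<bar> * (\<bar>- \<tau> n gchoose j\<bar> * x ^ j * M powr (- \<tau> n - real j)))"
proof -
  show "summable (\<lambda>j. \<bar>c n\<bar> * (\<bar>- \<tau> n gchoose j\<bar> * x ^ j * M powr (- \<tau> n - real j)))"
    by (intro summable_mult summable_abs_binomial x)
  let ?r = "1 / (M - x)\<^sup>2"
  have "b\<^sup>2 * ?r < 1" 
  proof -
    have "b\<^sup>2 < (M - x)\<^sup>2" using x b by (intro power_strict_mono) auto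
    thus ?thesis using x by (simp add: divide_less_eq)
  qed
  hence "summable (\<lambda>n. (M - x) powr (- \<sigma>) * (\<bar>c n\<bar> * ?r ^ n))"
    by (intro summable_mult summable_abs_c) auto
  moreover have "\<forall>\<^sub>F n in sequentially. (M - x) powr (- \<sigma>) * (\<bar>c n\<bar> * ?r ^ n) = (\<Sum>j. \<bar>c n\<bar> * (\<bar>- \<tau> n gchoose j\<bar> * x ^ j * M powr (- \<tau> n - real j)))"
  proof -
    have "\<forall>\<^sub>F n in sequentially. \<tau> n > 0" unfolding \<tau>_def by real_asymp
    thus ?thesis
    proof eventually_elim
      case (elim n)
      have "(\<Sum>j. \<bar>c n\<bar> * (\<bar>- \<tau> n gchoose j\<bar> * x ^ j * M powr (- \<tau> n - real j))) = \<bar>c n\<bar> * (M - x) powr (- \<tau> n)"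
        using sums_mult[OF abs_binomial_sums[OF x(1,2) elim], of "\<bar>c n\<bar>"] by (simp add: sums_iff)
      also have "(M - x) powr (- \<tau> n) = (M - x) powr (- \<sigma>) * ?r ^ n"
      proof -
        have "- \<tau> n = - \<sigma> - real (2 * n)" by (simp add: \<tau>_def)
        hence "(M - x) powr (- \<tau> n) = (M - x) powr (- \<sigma>) / (M - x) powr real (2 * n)" by (simp only: powr_diff)
        also have "(M - x) powr real (2 * n) = (M - x) ^ (2 * n)" using x by (intro powr_realpow) simp
        finally show ?thesis by (simp add: power_mult power_divide)
      qed
      finally show ?case by simp
    qed
  qed
  ultimately show "summable (\<lambda>n. \<Sum>j. \<bar>c n\<bar> * (\<bar>- \<tau> n gchoose j\<bar> * x ^ j * M powr (- \<tau> n - real j)))"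
    by (subst (asm) summable_cong)
qed

text \<open>The binomial expansion in \<open>a\<close> of the term \<open>c n\<close> times the
  power \<open>- \<tau> n\<close> of \<open>a + 2 pi i\<close>.\<close>

definition cterm :: "complex \<Rightarrow> nat \<Rightarrow> nat \<Rightarrow> complex" where
  "cterm a n j = of_real (c n) * ((of_real (- \<tau> n) gchoose j) * a ^ j * (2 * of_real pi * \<i>) powr (of_real (- \<tau> n) - of_nat j))"

lemma norm_cterm: "norm (cterm a n j) = \<bar>c n\<bar> * (\<bar>- \<tau> n gchoose j\<bar> * norm a ^ j * (2 * pi) powr (- \<tau> n - real j))"
proof -
  have "of_real (- \<tau> n) - of_nat j = complex_of_real (- \<tau> n - real j)" by simp
  hence "norm ((2 * of_real pi * \<i>) powr (of_real (- \<tau> n) - of_nat j)) = (2 * pi) powr (- \<tau> n - real j)"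
    by (simp only:) (subst norm_powr_real_powr', auto simp: norm_mult)
  moreover have "norm (complex_of_real (- \<tau> n) gchoose j) = \<bar>- \<tau> n gchoose j\<bar>"
  proof -
    have "complex_of_real (- \<tau> n) gchoose j = complex_of_real (- \<tau> n gchoose j)"
      by (simp add: gbinomial_pochhammer flip: pochhammer_of_real)
    thus ?thesis by (simp only: norm_of_real)
  qed
  ultimately show ?thesis by (simp only: cterm_def norm_mult norm_power norm_of_real)
qed

lemma cterm_row_sums:
  assumes "norm a < 2 * pi"
  shows "cterm a n sums (of_real (c n) * (a + 2 * of_real pi * \<i>) powr (- of_real (\<tau> n)))"
proof -
  have "(\<lambda>j. (of_real (- \<tau> n) gchoose j) * a ^ j * (2 * of_real pi * \<i>) powr (of_real (- \<tau> n) - of_nat j)) sums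
      ((2 * of_real pi * \<i> + a) powr (of_real (- \<tau> n)))"
    by (rule powr_add_sums) (use assms in \<open>auto simp: norm_mult\<close>)
  hence "(\<lambda>j. cterm a n j) sums (of_real (c n) * (2 * of_real pi * \<i> + a) powr (of_real (- \<tau> n)))"
    unfolding cterm_def by (rule sums_mult)
  thus ?thesis by (simp add: add.commute)
qed

definition dcoeff :: "nat \<Rightarrow> complex" where
  "dcoeff j = (\<Sum>n. cterm 1 n j)"

lemma cterm_eq: "cterm a n j = cterm 1 n j * a ^ j"
  by (simp add: cterm_def)

lemma summable_cterm_col: "summable (\<lambda>n. norm (cterm 1 n j))"
proof -
  \<comment> \<open>Any positive radius below \<open>2 * pi - b\<close> would do: absolute
    convergence of the double series at one such radius gives it for every single column, from which
    the power of \<open>x\<close> can be divided out.\<close>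
  define x where "x = (2 * pi - b) / 2"
  have x: "0 < x" "x < 2 * pi" "2 * pi - x > b" using b by (auto simp: x_def field_simps)
  have "summable (\<lambda>n. norm (cterm (of_real x) n j))"
    by (rule summable_swap(1)) (use abs_row_col[of x "2 * pi"] x in \<open>simp_all add: norm_cterm\<close>)
  hence "summable (\<lambda>n. norm (cterm 1 n j) * x ^ j)"
    using x by (subst (asm) cterm_eq) (simp add: norm_mult norm_power)
  from summable_mult2[OF this, of "1 / x ^ j"] show ?thesis using x by simp
qed

lemma dcoeff_sums_small:
  assumes a: "norm a < 2 * pi - b"
  shows "(\<lambda>j. dcoeff j * a ^ j) sums fser (a + 2 * of_real pi * \<i>)"
proof -
  have x: "0 \<le> norm a" "norm a < 2 * pi" "2 * pi - norm a > b" using a b by auto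
  have "(\<lambda>j. \<Sum>n. cterm a n j) sums (\<Sum>n. \<Sum>j. cterm a n j)"
    by (rule summable_swap(2)) (use abs_row_col[OF x] in \<open>simp_all add: norm_cterm\<close>)
  also have "(\<lambda>j. \<Sum>n. cterm a n j) = (\<lambda>j. dcoeff j * a ^ j)"
    unfolding dcoeff_def using suminf_mult2[OF summable_norm_cancel[OF summable_cterm_col]]
    by (subst cterm_eq) simp
  also have "(\<Sum>n. \<Sum>j. cterm a n j) = fser (a + 2 * of_real pi * \<i>)"
  proof -
    have "norm (a + 2 * of_real pi * \<i>) \<ge> norm (2 * of_real pi * \<i>) - norm a" by (metis add.commute norm_diff_ineq)
    hence "norm (a + 2 * of_real pi * \<i>) > b" using x by (simp add: norm_mult)
    from fser_sums[OF this] show ?thesis using cterm_row_sums[OF x(2)] by (simp add: sums_iff)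
  qed
  finally show ?thesis .
qed

text \<open>For norms below \<open>2 * pi - b\<close> the identity comes from absolute convergence,
  and it identifies the \<open>dcoeff j\<close> as Taylor coefficients. The ball of radius
  \<open>2 * pi\<close> about \<open>2 pi i\<close> lies in the upper half plane, the domain of the
  continuation, so the Taylor series converges to it for all \<open>a < 2 * pi\<close>.\<close>

lemma dcoeff_sums:
  assumes a: "0 < a" "a < 2 * pi"
  shows "(\<lambda>j. dcoeff j * of_real a ^ j) sums fser (of_real a + 2 * of_real pi * \<i>)"
proof -
  obtain F where F: "F holomorphic_on {w. Im w > 0}" "\<And>w. Im w > b \<Longrightarrow> F w = fser w"
    using fser_extension by blast
  define G where "G = (\<lambda>a. F (a + 2 * of_real pi * \<i>))"
  have im: "Im (a + 2 * of_real pi * \<i>) > 2 * pi - r" if "norm a < r" for a r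
    using that abs_Im_le_cmod[of a] by simp
  have holG: "G holomorphic_on ball 0 (2 * pi)"
    unfolding G_def
    by (rule holomorphic_on_compose_gen[OF _ F(1), unfolded o_def])
       (use im[of _ "2 * pi"] in \<open>auto intro!: holomorphic_intros\<close>)
  have small: "(\<lambda>j. dcoeff j * a ^ j) sums G a" if "norm a < 2 * pi - b" for a
    unfolding G_def using dcoeff_sums_small[OF that] F(2) im[OF that] by simp
  define r where "r = 2 * pi - b"
  have r: "r > 0" using b by (simp add: r_def)
  have "G has_fps_expansion Abs_fps dcoeff"
    unfolding has_fps_expansion_def
  proof
    have "summable (\<lambda>j. dcoeff j * of_real (r / 2) ^ j)" 
    proof -
      have "norm (complex_of_real (r / 2)) < r" using r by (simp only: norm_of_real)
      from small[folded r_def, OF this] show ?thesis by (simp only: sums_iff)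
    qed
    hence "conv_radius dcoeff \<ge> norm (complex_of_real (r / 2))" by (rule conv_radius_geI)
    moreover have "0 < ereal (norm (complex_of_real (r / 2)))" using r by simp
    ultimately have "0 < conv_radius dcoeff" by (rule order.strict_trans2[rotated])
    moreover have "fps_nth (Abs_fps dcoeff) = dcoeff" by (rule ext) simp
    ultimately show "0 < fps_conv_radius (Abs_fps dcoeff)" by (simp add: fps_conv_radius_def)
    have "eventually (\<lambda>z. z \<in> ball 0 r) (nhds (0::complex))" using r by (intro eventually_nhds_in_open) auto
    thus "\<forall>\<^sub>F z in nhds 0. eval_fps (Abs_fps dcoeff) z = G z"
      by eventually_elim (use small in \<open>auto simp: eval_fps_def r_def sums_iff\<close>)
  qed
  hence d: "dcoeff j = (deriv ^^ j) G 0 / fact j" for j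
    using fps_nth_fps_expansion[of G "Abs_fps dcoeff" j] by simp
  have "(\<lambda>j. (deriv ^^ j) G 0 / fact j * (of_real a - 0) ^ j) sums G (of_real a)"
    using a by (intro holomorphic_power_series[OF holG]) simp
  hence "(\<lambda>j. dcoeff j * of_real a ^ j) sums G (of_real a)" by (simp add: d)
  moreover have "G (of_real a) = fser (of_real a + 2 * of_real pi * \<i>)"
    unfolding G_def using b by (intro F(2)) simp
  ultimately show ?thesis by simp
qed

text \<open>Twice the real part of \<open>cterm\<close>, the joint contribution of the conjugate
  points \<open>2 pi i\<close> and \<open>- 2 pi i\<close>.\<close>

definition lterm :: "real \<Rightarrow> nat \<Rightarrow> nat \<Rightarrow> real" where
  "lterm a j n = c n * (- \<tau> n gchoose j) * a ^ j * (2 * (2 * pi) powr (- (\<tau> n + real j)) * cos (pi * (\<tau> n + real j) / 2))"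

lemma Re_two_pi_i_powr: "Re ((2 * of_real pi * \<i>) powr (of_real s)) = (2 * pi) powr s * cos (pi * s / 2)"
proof -
  have "Ln (of_real (2 * pi) * \<i>) = of_real (ln (2 * pi)) + Ln \<i>"
    using Ln_times_of_real[of "2 * pi" \<i>] Ln_of_real[of "2 * pi"] by (simp del: of_real_mult)
  hence "(of_real (2 * pi) * \<i>) powr (of_real s) = exp (of_real (s * ln (2 * pi))) * cis (pi * s / 2)"
    by (simp add: powr_def algebra_simps exp_add cis_conv_exp flip: exp_of_real)
  moreover have "exp (complex_of_real (s * ln (2 * pi))) = of_real ((2 * pi) powr s)"
    by (simp add: powr_def exp_of_real flip: of_real_mult)
  ultimately show ?thesis by (simp add: mult_ac)
qed

lemma lterm_eq: "lterm a j n = 2 * Re (cterm (of_real a) n j)"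
proof -
  have 1: "complex_of_real (- \<tau> n) gchoose j = complex_of_real (- \<tau> n gchoose j)"
      by (simp add: gbinomial_pochhammer flip: pochhammer_of_real)
  have 2: "of_real (- \<tau> n) - of_nat j = complex_of_real (- (\<tau> n + real j))" by simp
  have "cterm (of_real a) n j = of_real (c n * (- \<tau> n gchoose j) * a ^ j) * (2 * of_real pi * \<i>) powr (of_real (- (\<tau> n + real j)))"
    unfolding cterm_def 1 2 by (simp only: of_real_mult of_real_power mult_ac)
  moreover have "Re (of_real x * z) = x * Re z" for x z by simp
  ultimately have "Re (cterm (of_real a) n j) = c n * (- \<tau> n gchoose j) * a ^ j * ((2 * pi) powr (- (\<tau> n + real j)) * cos (pi * (- (\<tau> n + real j)) / 2))"
    by (simp only: Re_two_pi_i_powr)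
  moreover have "cos (pi * (- (\<tau> n + real j)) / 2) = cos (pi * (\<tau> n + real j) / 2)"
    by (metis cos_minus minus_divide_left mult_minus_right)
  ultimately show ?thesis by (simp add: lterm_def)
qed

text \<open>With \<open>j\<close> inside, the binomial series is followed by the original series,
  which converges because the point \<open>a + 2 pi i\<close> has norm greater than
  \<open>b\<close>. With \<open>n\<close> inside, the Taylor coefficients \<open>dcoeff\<close>
  appear. Both lead to the same value of \<open>fser\<close>.\<close>

lemma double_sums_lterm:
  assumes a: "0 < a" "a < 2 * pi"
  shows "double_sums (lterm a) (2 * Re (fser (of_real a + 2 * of_real pi * \<i>)))"
  unfolding double_sums_def
proof (intro conjI allI)
  let ?w = "of_real a + 2 * of_real pi * \<i>"
  have col: "(\<lambda>n. cterm (of_real a) n j) sums (dcoeff j * of_real a ^ j)" for j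
    unfolding dcoeff_def by (subst cterm_eq) (intro sums_mult2 summable_sums summable_norm_cancel[OF summable_cterm_col])
  have colr: "(\<lambda>n. lterm a j n) sums (2 * Re (dcoeff j * of_real a ^ j))" for j
    unfolding lterm_eq by (intro sums_mult sums_Re col)
  have row: "(\<lambda>j. cterm (of_real a) n j) sums (of_real (c n) * ?w powr (- of_real (\<tau> n)))" for n
    using cterm_row_sums[of "of_real a" n] a by simp
  have rowr: "(\<lambda>j. lterm a j n) sums (2 * Re (of_real (c n) * ?w powr (- of_real (\<tau> n))))" for n
    unfolding lterm_eq by (intro sums_mult sums_Re row)
  show "summable (lterm a j)" for j using colr[of j] by (simp add: sums_iff)
  show "summable (\<lambda>j. lterm a j n)" for n using rowr[of n] by (simp add: sums_iff)
  have "(\<lambda>j. 2 * Re (dcoeff j * of_real a ^ j)) sums (2 * Re (fser ?w))"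
    by (intro sums_mult sums_Re dcoeff_sums a)
  thus "(\<lambda>j. suminf (lterm a j)) sums (2 * Re (fser ?w))" using sums_unique[OF colr] by simp
  have "norm ?w > b" using abs_Im_le_cmod[of ?w] b by simp
  hence "(\<lambda>n. 2 * Re (of_real (c n) * ?w powr (- of_real (\<tau> n)))) sums (2 * Re (fser ?w))"
    by (intro sums_mult sums_Re fser_sums)
  thus "(\<lambda>n. \<Sum>j. lterm a j n) sums (2 * Re (fser ?w))" using sums_unique[OF rowr] by simp
qed

theorem double_sums_zeta_lterm:
  assumes a: "0 < a" "a < 2 * pi"
  shows "\<exists>R. double_sums (\<lambda>j n. lterm a j n * real_zeta (\<tau> n + real j)) R"
proof -
  obtain C where C: "\<And>k::nat. \<bar>real_zeta (\<sigma> + real k) - 1\<bar> \<le> C * 2 powr (- (\<sigma> + real k))"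
    using real_zeta_minus_1_bound by blast
  let ?g = "\<lambda>j n. lterm a j n * (real_zeta (\<tau> n + real j) - 1)"
  \<comment> \<open>The decay of zeta - 1 doubles \<open>2 * pi\<close>: the lattice points that
    remain are those of norm at least \<open>4 * pi\<close>.\<close>
  let ?u = "\<lambda>n j. \<bar>c n\<bar> * (\<bar>- \<tau> n gchoose j\<bar> * a ^ j * (4 * pi) powr (- \<tau> n - real j))"
  have bd: "\<bar>?g j n\<bar> \<le> 2 * C * ?u n j" for j n
  proof -
    have "\<tau> n + real j = \<sigma> + real (2 * n + j)" by (simp add: \<tau>_def)
    hence z: "\<bar>real_zeta (\<tau> n + real j) - 1\<bar> \<le> C * 2 powr (- (\<tau> n + real j))" using C by metis
    have l: "\<bar>lterm a j n\<bar> \<le> \<bar>c n\<bar> * (\<bar>- \<tau> n gchoose j\<bar> * a ^ j * (2 * (2 * pi) powr (- (\<tau> n + real j))))"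
    proof -
      have "\<bar>2 * (2 * pi) powr (- (\<tau> n + real j)) * cos (pi * (\<tau> n + real j) / 2)\<bar> \<le> 2 * (2 * pi) powr (- (\<tau> n + real j)) * 1"
        unfolding abs_mult by (intro mult_mono) auto
      hence "\<bar>c n * (- \<tau> n gchoose j) * a ^ j\<bar> * \<bar>2 * (2 * pi) powr (- (\<tau> n + real j)) * cos (pi * (\<tau> n + real j) / 2)\<bar>
          \<le> \<bar>c n * (- \<tau> n gchoose j) * a ^ j\<bar> * (2 * (2 * pi) powr (- (\<tau> n + real j)) * 1)"
        by (intro mult_left_mono) auto
      thus ?thesis using a unfolding lterm_def by (simp add: abs_mult mult_ac)
    qed
    have "\<bar>?g j n\<bar> \<le> (\<bar>c n\<bar> * (\<bar>- \<tau> n gchoose j\<bar> * a ^ j * (2 * (2 * pi) powr (- (\<tau> n + real j))))) * (C * 2 powr (- (\<tau> n + real j)))"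
      unfolding abs_mult using a by (intro mult_mono z l) auto
    also have "(2 * pi) powr (- (\<tau> n + real j)) * 2 powr (- (\<tau> n + real j)) = (4 * pi) powr (- \<tau> n - real j)"
      using powr_mult[of "2 * pi" 2 "- (\<tau> n + real j)"] by simp
    hence "(\<bar>c n\<bar> * (\<bar>- \<tau> n gchoose j\<bar> * a ^ j * (2 * (2 * pi) powr (- (\<tau> n + real j))))) * (C * 2 powr (- (\<tau> n + real j))) = 2 * C * ?u n j"
      by (simp add: mult_ac)
    finally show ?thesis .
  qed
  \<comment> \<open>Both \<open>a\<close> and \<open>b\<close> are below \<open>2 * pi\<close>, so
    their sum is below \<open>4 * pi\<close>, which is what absolute convergence of the remainder
    requires.\<close>
  have x: "0 \<le> a" "a < 4 * pi" "4 * pi - a > b" using a b by auto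
  have row: "summable (\<lambda>j. 2 * C * ?u n j)" for n by (intro summable_mult[of "\<lambda>j. ?u n j"] abs_row_col(1) x)
  have "\<exists>s. double_sums ?g s"
  proof (rule double_sums_absI)
    show row': "summable (\<lambda>j. \<bar>?g j n\<bar>)" for n
      by (rule summable_comparison_test'[OF row]) (use bd in simp)
    show "summable (\<lambda>n. \<Sum>j. \<bar>?g j n\<bar>)"
    proof (rule summable_comparison_test')
      show "summable (\<lambda>n. 2 * C * (\<Sum>j. ?u n j))" by (intro summable_mult[of "\<lambda>n. \<Sum>j. ?u n j"] abs_row_col(2) x)
      fix n
      have "(\<Sum>j. \<bar>?g j n\<bar>) \<le> (\<Sum>j. 2 * C * ?u n j)" by (intro suminf_le bd row row')
      also have "\<dots> = 2 * C * (\<Sum>j. ?u n j)" by (intro suminf_mult abs_row_col(1) x)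
      finally show "norm (\<Sum>j. \<bar>?g j n\<bar>) \<le> 2 * C * (\<Sum>j. ?u n j)"
        using suminf_nonneg[OF row'] by simp
    qed
  qed
  then obtain s where "double_sums ?g s" by blast
  from double_sums_add[OF double_sums_lterm[OF a] this]
  have "double_sums (\<lambda>j n. lterm a j n + ?g j n) (2 * Re (fser (of_real a + 2 * of_real pi * \<i>)) + s)" .
  moreover have "lterm a j n + ?g j n = lterm a j n * real_zeta (\<tau> n + real j)" for j n by (simp add: algebra_simps)
  ultimately show ?thesis by auto
qed

end

section \<open>The differential equation below the singular point\<close>

definition hyp_coeff :: "real \<Rightarrow> nat \<Rightarrow> real" where
  "hyp_coeff \<nu> k = pochhammer (1 - \<nu>) k / pochhammer (3/2) k"

lemma hyp2F1_eq: "hyp2F1 1 (1 - \<nu>) (3/2) z = (\<Sum>k. hyp_coeff \<nu> k * z ^ k)"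
  by (simp add: hyp2F1_def eval_fps_def hyp_coeff_def pochhammer_fact[symmetric])

lemma pochhammer_three_halves_pos: "pochhammer (3/2 :: real) k > 0"
  by (intro pochhammer_pos) auto

lemma hyp_coeff_Suc: "hyp_coeff \<nu> (Suc k) * (real k + 3/2) = hyp_coeff \<nu> k * (real k + 1 - \<nu>)"
  using pochhammer_three_halves_pos[of k]
  by (simp add: hyp_coeff_def pochhammer_Suc divide_simps) (simp add: algebra_simps)

lemma summable_hyp:
  assumes z: "\<bar>z\<bar> < 1"
  shows "summable (\<lambda>k. hyp_coeff \<nu> k * z ^ k)"
proof -
  obtain \<rho> where rho: "\<bar>z\<bar> < \<rho>" "\<rho> < 1" using dense[OF z] by blast
  have "(\<lambda>k. \<bar>z\<bar> * (\<bar>real k + 1 - \<nu>\<bar> / (real k + 3/2))) \<longlonglongrightarrow> \<bar>z\<bar> * 1"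
    by (intro tendsto_mult tendsto_const) real_asymp
  hence "\<forall>\<^sub>F k in sequentially. \<bar>z\<bar> * (\<bar>real k + 1 - \<nu>\<bar> / (real k + 3/2)) < \<rho>"
    using rho by (intro order_tendstoD) auto
  then obtain N where N: "\<And>k. k \<ge> N \<Longrightarrow> \<bar>z\<bar> * (\<bar>real k + 1 - \<nu>\<bar> / (real k + 3/2)) < \<rho>"
    by (auto simp: eventually_at_top_linorder)
  show ?thesis
  proof (rule summable_ratio_test[OF rho(2), of N])
    fix k assume "k \<ge> N"
    have "\<bar>hyp_coeff \<nu> (Suc k)\<bar> = \<bar>hyp_coeff \<nu> k\<bar> * (\<bar>real k + 1 - \<nu>\<bar> / (real k + 3/2))"
    proof -
      have "hyp_coeff \<nu> (Suc k) = hyp_coeff \<nu> k * (real k + 1 - \<nu>) / (real k + 3/2)"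
        using hyp_coeff_Suc[of \<nu> k] by (simp add: eq_divide_eq)
      thus ?thesis by (simp add: abs_mult)
    qed
    hence "norm (hyp_coeff \<nu> (Suc k) * z ^ Suc k) = (\<bar>z\<bar> * (\<bar>real k + 1 - \<nu>\<bar> / (real k + 3/2))) * norm (hyp_coeff \<nu> k * z ^ k)"
      by (simp add: abs_mult)
    also have "\<dots> \<le> \<rho> * norm (hyp_coeff \<nu> k * z ^ k)"
      using N[OF \<open>k \<ge> N\<close>] by (intro mult_right_mono) auto
    finally show "norm (hyp_coeff \<nu> (Suc k) * z ^ Suc k) \<le> \<rho> * norm (hyp_coeff \<nu> k * z ^ k)" .
  qed
qed

text \<open>Since one upper parameter is 1, the factor k! cancels and the coefficients obey a
  recurrence with linear factors. Summed, it gives an equation of first order only, with the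
  inhomogeneity 1/2 coming from the constant coefficient.\<close>

lemma hyp_deriv:
  fixes \<nu> z :: real
  assumes z: "\<bar>z\<bar> < 1"
  defines "h \<equiv> hyp2F1 1 (1 - \<nu>) (3/2)"
  shows "\<exists>h'. (h has_real_derivative h') (at z) \<and> z * h' * (1 - z) = 1/2 - h z / 2 + (1 - \<nu>) * z * h z"
proof -
  let ?c = "hyp_coeff \<nu>"
  obtain r where r: "\<bar>z\<bar> < r" "r < 1" using dense[OF z] by blast
  have h: "h = (\<lambda>z. \<Sum>k. ?c k * z ^ k)" by (rule ext) (simp only: h_def hyp2F1_eq)
  define h' where "h' = (\<Sum>k. diffs ?c k * z ^ k)"
  have d: "(h has_real_derivative h') (at z)"
    unfolding h h'_def by (rule termdiffs_strong[of ?c r]) (use r summable_hyp in auto)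
  have "summable (\<lambda>k. diffs ?c k * z ^ k)"
    by (rule termdiff_converges[of z r]) (use r summable_hyp in auto)
  hence s1: "(\<lambda>k. diffs ?c k * z ^ k) sums h'" unfolding h'_def by (rule summable_sums)
  have s0: "(\<lambda>k. ?c k * z ^ k) sums h z" unfolding h by (intro summable_sums summable_hyp z)
  have s0': "(\<lambda>k. ?c (Suc k) * z ^ Suc k) sums (h z - 1)"
    using s0 by (subst sums_Suc_iff) (simp add: hyp_coeff_def)
  have s2': "(\<lambda>k. real (Suc k) * ?c (Suc k) * z ^ Suc k) sums (z * h')"
    using sums_mult[OF s1, of z] by (simp add: diffs_def mult_ac)
  have s3: "(\<lambda>k. real k * ?c k * z ^ k) sums (z * h')"
    using s2' by (subst (asm) sums_Suc_iff) simp
  have "(\<lambda>k. real (Suc k) * ?c (Suc k) * z ^ Suc k + 1/2 * (?c (Suc k) * z ^ Suc k)) sums (z * h' + 1/2 * (h z - 1))"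
    by (intro sums_add sums_mult s2' s0')
  moreover have "(\<lambda>k. z * (real k * ?c k * z ^ k + (1 - \<nu>) * (?c k * z ^ k))) sums (z * (z * h' + (1 - \<nu>) * h z))"
    by (intro sums_add sums_mult s3 s0)
  moreover have "real (Suc k) * ?c (Suc k) * z ^ Suc k + 1/2 * (?c (Suc k) * z ^ Suc k) = z * (real k * ?c k * z ^ k + (1 - \<nu>) * (?c k * z ^ k))" for k
  proof -
    have "real (Suc k) * ?c (Suc k) * z ^ Suc k + 1/2 * (?c (Suc k) * z ^ Suc k) = (?c (Suc k) * (real k + 3/2)) * z ^ Suc k"
      by (simp add: algebra_simps)
    also have "\<dots> = z * (real k * ?c k * z ^ k + (1 - \<nu>) * (?c k * z ^ k))"
      unfolding hyp_coeff_Suc by (simp add: algebra_simps)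
    finally show ?thesis .
  qed
  ultimately have "z * h' + 1/2 * (h z - 1) = z * (z * h' + (1 - \<nu>) * h z)"
    by (simp only:) (rule sums_unique2)
  hence "z * h' * (1 - z) = 1/2 - h z / 2 + (1 - \<nu>) * z * h z" by (simp add: algebra_simps diff_divide_distrib)
  with d show ?thesis by blast
qed

definition regular_part :: "real \<Rightarrow> real \<Rightarrow> real \<Rightarrow> real" where
  "regular_part \<nu> b a = - (a / b\<^sup>2 * Gamma (1 - \<nu>) * hyp2F1 1 (1 - \<nu>) (3/2) (a\<^sup>2 / b\<^sup>2))"

lemma ratio_sq_bounds:
  fixes a b :: real
  assumes "\<bar>a\<bar> < b"
  shows "0 \<le> a\<^sup>2 / b\<^sup>2" "a\<^sup>2 / b\<^sup>2 < 1"
proof -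
  have "\<bar>a\<bar>\<^sup>2 < b\<^sup>2" using assms by (intro power_strict_mono) auto
  thus "a\<^sup>2 / b\<^sup>2 < 1" using assms by (simp add: divide_less_eq)
qed auto

text \<open>The odd solution, analytic for \<open>a\<close> between \<open>- b\<close> and
  \<open>b\<close>. Every other solution differs from it by a multiple of a function that does not
  vanish at 0.\<close>

lemma regular_part_ode:
  assumes a: "\<bar>a\<bar> < b"
  shows "\<exists>p'. (regular_part \<nu> b has_real_derivative p') (at a) \<and>
     (a\<^sup>2 - b\<^sup>2) * p' - (2 * \<nu> - 1) * a * regular_part \<nu> b a = Gamma (1 - \<nu>)"
proof -
  define h where "h = hyp2F1 1 (1 - \<nu>) (3/2)"
  define z where "z = a\<^sup>2 / b\<^sup>2"
  have b: "b > 0" using a by linarith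
  have z: "\<bar>z\<bar> < 1" using ratio_sq_bounds[OF a] by (simp add: z_def)
  obtain h' where h': "(h has_real_derivative h') (at z)" "z * h' * (1 - z) = 1/2 - h z / 2 + (1 - \<nu>) * z * h z"
    using hyp_deriv[OF z] unfolding h_def by blast
  have dz: "((\<lambda>a. a\<^sup>2 / b\<^sup>2) has_real_derivative (2 * a / b\<^sup>2)) (at a)"
    using b by (auto intro!: derivative_eq_intros simp: power2_eq_square)
  have dh: "((\<lambda>a. h (a\<^sup>2 / b\<^sup>2)) has_real_derivative (h' * (2 * a / b\<^sup>2))) (at a)"
    using DERIV_chain2[OF h'(1)[unfolded z_def] dz] .
  let ?G = "Gamma (1 - \<nu>)"
  define p' where "p' = - (?G / b\<^sup>2) * (1 * h (a\<^sup>2 / b\<^sup>2) + (h' * (2 * a / b\<^sup>2)) * a)"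
  have "(regular_part \<nu> b has_real_derivative p') (at a)"
  proof -
    have "regular_part \<nu> b = (\<lambda>a. - (?G / b\<^sup>2) * (a * h (a\<^sup>2 / b\<^sup>2)))"
      by (rule ext) (simp add: regular_part_def h_def)
    thus ?thesis unfolding p'_def by (simp only:) (rule DERIV_cmult[OF DERIV_mult[OF DERIV_ident dh]])
  qed
  moreover have "(a\<^sup>2 - b\<^sup>2) * p' - (2 * \<nu> - 1) * a * regular_part \<nu> b a = ?G"
  proof -
    have az: "a * a = z * b\<^sup>2" using b by (simp add: z_def power2_eq_square)
    have p: "p' = - (?G / b\<^sup>2) * (h z + 2 * (z * h'))" using b by (simp add: p'_def z_def power2_eq_square algebra_simps)
    have "(a\<^sup>2 - b\<^sup>2) * p' = ?G * ((1 - z) * h z + 2 * (z * h' * (1 - z)))"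
    proof -
      have "a\<^sup>2 - b\<^sup>2 = - b\<^sup>2 * (1 - z)" using az by (simp add: power2_eq_square algebra_simps)
      hence "(a\<^sup>2 - b\<^sup>2) * p' = (- b\<^sup>2 * (1 - z)) * (- (?G / b\<^sup>2) * (h z + 2 * (z * h')))" by (simp only: p)
      also have "\<dots> = ?G * ((1 - z) * (h z + 2 * (z * h')))" using b by simp
      finally show ?thesis by (simp add: algebra_simps)
    qed
    moreover have "(2 * \<nu> - 1) * a * regular_part \<nu> b a = - ((2 * \<nu> - 1) * ?G * (z * h z))"
      by (simp add: regular_part_def h_def z_def power2_eq_square)
    ultimately have "(a\<^sup>2 - b\<^sup>2) * p' - (2 * \<nu> - 1) * a * regular_part \<nu> b a =
        ?G * ((1 - z) * h z + 2 * (z * h' * (1 - z)) + (2 * \<nu> - 1) * (z * h z))" by (simp add: algebra_simps)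
    also have "(1 - z) * h z + 2 * (z * h' * (1 - z)) + (2 * \<nu> - 1) * (z * h z) = 1"
      unfolding h'(2) by (simp add: algebra_simps)
    finally show ?thesis by simp
  qed
  ultimately show ?thesis by blast
qed

section \<open>Quadrature, and solutions that are regular at b\<close>

lemma DERIV_diff_sq_powr:
  assumes "\<bar>x\<bar> < (b::real)"
  shows "((\<lambda>x. (b\<^sup>2 - x\<^sup>2) powr r) has_real_derivative (- 2 * r * x * (b\<^sup>2 - x\<^sup>2) powr (r - 1))) (at x)"
proof -
  have "b\<^sup>2 - x\<^sup>2 > 0" using power_strict_mono[of "\<bar>x\<bar>" b 2] assms by auto
  thus ?thesis by (auto intro!: derivative_eq_intros simp: powr_diff)
qed

text \<open>Multiplying by \<open>(b\<^sup>2 - a\<^sup>2)\<^bsup>1/2 - \<nu>\<^esup>\<close> turns the equation into a quadrature.\<close>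

lemma ode_integrating_factor:
  fixes y :: "real \<Rightarrow> complex"
  assumes x: "0 < x" "x < b" and der: "(y has_vector_derivative y') (at x)"
    and ode: "(of_real x ^ 2 - of_real (b\<^sup>2)) * y' - of_real (2 * \<nu> - 1) * of_real x * y x = of_real G"
  shows "((\<lambda>x. of_real ((b\<^sup>2 - x\<^sup>2) powr (1/2 - \<nu>)) * y x) has_vector_derivative
      of_real (- G * (b\<^sup>2 - x\<^sup>2) powr (- 1/2 - \<nu>))) (at x)"
proof -
  have pos: "b\<^sup>2 - x\<^sup>2 > 0" using power_strict_mono[of x b 2] x by auto
  let ?P = "\<lambda>x. (b\<^sup>2 - x\<^sup>2) powr (1/2 - \<nu>)" and ?Q = "(b\<^sup>2 - x\<^sup>2) powr (- 1/2 - \<nu>)"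
  have PQ: "?P x = (b\<^sup>2 - x\<^sup>2) * ?Q"
  proof -
    have "?P x = (b\<^sup>2 - x\<^sup>2) powr (1 + (- 1/2 - \<nu>))" by simp
    also have "\<dots> = (b\<^sup>2 - x\<^sup>2) * ?Q" using pos by (simp only: powr_add powr_one)
    finally show ?thesis .
  qed
  have "(?P has_real_derivative (- 2 * (1/2 - \<nu>) * x * (b\<^sup>2 - x\<^sup>2) powr (1/2 - \<nu> - 1))) (at x)"
    using DERIV_diff_sq_powr[of x b "1/2 - \<nu>"] x by simp
  hence "(?P has_real_derivative (- 2 * (1/2 - \<nu>) * x * ?Q)) (at x)" by simp
  hence dP: "((\<lambda>x. complex_of_real (?P x)) has_vector_derivative of_real (- 2 * (1/2 - \<nu>) * x * ?Q)) (at x)"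
    by (intro has_vector_derivative_of_real) (simp add: has_real_derivative_iff_has_vector_derivative)
  have "((\<lambda>x. of_real (?P x) * y x) has_vector_derivative
      (of_real (?P x) * y' + of_real (- 2 * (1/2 - \<nu>) * x * ?Q) * y x)) (at x)"
    by (rule has_vector_derivative_mult[OF dP der])
  also have "of_real (?P x) * y' + of_real (- 2 * (1/2 - \<nu>) * x * ?Q) * y x
     = - of_real ?Q * ((of_real x ^ 2 - of_real (b\<^sup>2)) * y' - of_real (2 * \<nu> - 1) * of_real x * y x)"
    unfolding PQ by (simp add: algebra_simps)
  also have "\<dots> = of_real (- G * ?Q)" unfolding ode by simp
  finally show ?thesis .
qed

text \<open>\<open>U\<close> is open and contains \<open>b\<close>, so \<open>Y\<close> is
  holomorphic across the singular point; this excludes all but one of the solutions on (0, b). The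
  point 0 stays outside, and the condition \<open>Re w > 0\<close> also keeps the other singular
  point, \<open>- b\<close>, away.\<close>

locale bessel_ode =
  fixes \<nu> b :: real and U :: "complex set" and Y :: "complex \<Rightarrow> complex"
  assumes b: "b > 0" and half: "2 * \<nu> \<notin> \<int>"
    and U: "open U" "U \<subseteq> {w. Re w > 0}" "of_real ` {0<..b} \<subseteq> U"
    and holY: "Y holomorphic_on U"
    and ode: "\<And>w. w \<in> U \<Longrightarrow> (w\<^sup>2 - of_real (b\<^sup>2)) * deriv Y w - of_real (2 * \<nu> - 1) * w * Y w = of_real (Gamma (1 - \<nu>))"
begin

lemma in_U: "0 < x \<Longrightarrow> x \<le> b \<Longrightarrow> of_real x \<in> U"
  using U(3) by auto

lemma derY: "w \<in> U \<Longrightarrow> (Y has_field_derivative deriv Y w) (at w)"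
  using holomorphic_derivI[OF holY U(1)] by blast

lemma vderY: "0 < x \<Longrightarrow> x \<le> b \<Longrightarrow> ((\<lambda>x. Y (of_real x)) has_vector_derivative deriv Y (of_real x)) (at x)"
  by (rule has_vector_derivative_real_field[OF derY]) (rule in_U)

text \<open>After multiplication by the integrating factor, \<open>Y\<close> and the hypergeometric
  solution have the same derivative. The free constant is exposed as the limit of \<open>Y\<close>
  at 0, a quantity that is easy to follow when the order is changed.\<close>

lemma general_solution:
  obtains \<alpha> where "\<And>a. 0 < a \<Longrightarrow> a < b \<Longrightarrow> Y (of_real a) = \<alpha> * of_real ((1 - a\<^sup>2 / b\<^sup>2) powr (\<nu> - 1/2)) + of_real (regular_part \<nu> b a)"
    and "((\<lambda>a. Y (of_real a)) \<longlongrightarrow> \<alpha>) (at_right 0)"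
proof -
  let ?P = "\<lambda>x. (b\<^sup>2 - x\<^sup>2) powr (1/2 - \<nu>)"
  have "\<exists>C. \<forall>x\<in>{0<..<b}. of_real (?P x) * Y (of_real x) - of_real (?P x) * of_real (regular_part \<nu> b x) = C"
  proof (rule has_vector_derivative_zero_constant)
    fix x assume "x \<in> {0<..<b}"
    hence x: "0 < x" "x < b" by auto
    obtain p' where p': "(regular_part \<nu> b has_real_derivative p') (at x)"
      "(x\<^sup>2 - b\<^sup>2) * p' - (2 * \<nu> - 1) * x * regular_part \<nu> b x = Gamma (1 - \<nu>)"
      using regular_part_ode[of x b \<nu>] x by auto
    have d1: "((\<lambda>x. of_real (?P x) * Y (of_real x)) has_vector_derivative of_real (- Gamma (1 - \<nu>) * (b\<^sup>2 - x\<^sup>2) powr (- 1/2 - \<nu>))) (at x)"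
      by (rule ode_integrating_factor[OF x vderY[OF x(1) less_imp_le[OF x(2)]] ode[OF in_U[OF x(1) less_imp_le[OF x(2)]]]])
    have d2: "((\<lambda>x. of_real (?P x) * of_real (regular_part \<nu> b x)) has_vector_derivative complex_of_real (- Gamma (1 - \<nu>) * (b\<^sup>2 - x\<^sup>2) powr (- 1/2 - \<nu>))) (at x)"
    proof (rule ode_integrating_factor[OF x])
      show "((\<lambda>x. complex_of_real (regular_part \<nu> b x)) has_vector_derivative of_real p') (at x)"
        using p'(1) by (intro has_vector_derivative_of_real) (simp add: has_real_derivative_iff_has_vector_derivative)
      show "(of_real x ^ 2 - of_real (b\<^sup>2)) * of_real p' - of_real (2 * \<nu> - 1) * of_real x * complex_of_real (regular_part \<nu> b x) = of_real (Gamma (1 - \<nu>))"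
        unfolding p'(2)[symmetric] by simp
    qed
    show "((\<lambda>x. of_real (?P x) * Y (of_real x) - of_real (?P x) * of_real (regular_part \<nu> b x)) has_vector_derivative 0) (at x within {0<..<b})"
      using has_vector_derivative_diff[OF d1 d2] unfolding diff_self by (rule has_vector_derivative_at_within)
  qed (simp, blast)
  then obtain C where C: "\<And>x. 0 < x \<Longrightarrow> x < b \<Longrightarrow> of_real (?P x) * Y (of_real x) - of_real (?P x) * of_real (regular_part \<nu> b x) = C"
    by auto
  define \<alpha> where "\<alpha> = C * of_real (b powr (2 * \<nu> - 1))"
  have rep: "Y (of_real a) = \<alpha> * of_real ((1 - a\<^sup>2 / b\<^sup>2) powr (\<nu> - 1/2)) + of_real (regular_part \<nu> b a)" if a: "0 < a" "a < b" for a
  proof -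
    have pos: "b\<^sup>2 - a\<^sup>2 > 0" using power_strict_mono[of a b 2] a by auto
    have "b\<^sup>2 - a\<^sup>2 = b\<^sup>2 * (1 - a\<^sup>2 / b\<^sup>2)" using b by (simp add: algebra_simps)
    hence "(b\<^sup>2 - a\<^sup>2) powr (\<nu> - 1/2) = (b\<^sup>2) powr (\<nu> - 1/2) * (1 - a\<^sup>2 / b\<^sup>2) powr (\<nu> - 1/2)"
      by (simp only: powr_mult)
    also have "(b\<^sup>2) powr (\<nu> - 1/2) = b powr (2 * \<nu> - 1)"
      using b by (simp add: powr_powr algebra_simps flip: powr_numeral)
    finally have e: "(b\<^sup>2 - a\<^sup>2) powr (\<nu> - 1/2) = b powr (2 * \<nu> - 1) * (1 - a\<^sup>2 / b\<^sup>2) powr (\<nu> - 1/2)" .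
    have pp: "(b\<^sup>2 - a\<^sup>2) powr (\<nu> - 1/2) * ?P a = 1" using pos by (simp flip: powr_add)
    have g: "of_real q * (of_real p * z) = z" if "q * p = 1" for q p :: real and z :: complex
      by (simp only: mult.assoc[symmetric] of_real_mult[symmetric] that of_real_1 mult_1_left)
    have "of_real ((b\<^sup>2 - a\<^sup>2) powr (\<nu> - 1/2)) * (of_real (?P a) * (Y (of_real a) - of_real (regular_part \<nu> b a))) = Y (of_real a) - of_real (regular_part \<nu> b a)"
      by (rule g[OF pp])
    moreover have "of_real (?P a) * (Y (of_real a) - of_real (regular_part \<nu> b a)) = C"
      using C[OF a] by (simp add: right_diff_distrib)
    ultimately have "of_real ((b\<^sup>2 - a\<^sup>2) powr (\<nu> - 1/2)) * C = Y (of_real a) - of_real (regular_part \<nu> b a)"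
      by (simp only:)
    hence "Y (of_real a) = of_real ((b\<^sup>2 - a\<^sup>2) powr (\<nu> - 1/2)) * C + of_real (regular_part \<nu> b a)" by simp
    thus ?thesis unfolding e \<alpha>_def of_real_mult by (simp only: mult_ac)
  qed
  moreover have "((\<lambda>a. Y (of_real a)) \<longlongrightarrow> \<alpha>) (at_right 0)"
  proof (rule Lim_transform_eventually)
    have "isCont (regular_part \<nu> b) 0" using regular_part_ode[of 0 b \<nu>] b DERIV_isCont by auto
    hence "(regular_part \<nu> b \<longlongrightarrow> regular_part \<nu> b 0) (at_right 0)" by (simp add: isCont_def filterlim_at_split)
    moreover have "((\<lambda>a. (1 - a\<^sup>2 / b\<^sup>2) powr (\<nu> - 1/2)) \<longlongrightarrow> (1 - 0\<^sup>2 / b\<^sup>2) powr (\<nu> - 1/2)) (at_right 0)"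
      using b by (intro tendsto_intros) auto
    ultimately have "((\<lambda>a. \<alpha> * of_real ((1 - a\<^sup>2 / b\<^sup>2) powr (\<nu> - 1/2)) + of_real (regular_part \<nu> b a)) \<longlongrightarrow>
       \<alpha> * of_real ((1 - 0\<^sup>2 / b\<^sup>2) powr (\<nu> - 1/2)) + of_real (regular_part \<nu> b 0)) (at_right 0)"
      by (intro tendsto_add tendsto_mult tendsto_const tendsto_of_real)
    thus "((\<lambda>a. \<alpha> * of_real ((1 - a\<^sup>2 / b\<^sup>2) powr (\<nu> - 1/2)) + of_real (regular_part \<nu> b a)) \<longlongrightarrow> \<alpha>) (at_right 0)"
      by (simp add: regular_part_def)
    have "\<forall>\<^sub>F a in at_right 0. a \<in> {0<..<b}" using b by (rule eventually_at_right_real)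
    thus "\<forall>\<^sub>F a in at_right 0. \<alpha> * of_real ((1 - a\<^sup>2 / b\<^sup>2) powr (\<nu> - 1/2)) + of_real (regular_part \<nu> b a) = Y (of_real a)"
      by eventually_elim (simp add: rep)
  qed
  ultimately show ?thesis by (rule that)
qed

text \<open>For \<open>\<nu> < 1/2\<close> the integrating factor vanishes at \<open>b\<close>,
  where \<open>Y\<close> is finite. The quadrature over the whole interval then has no contribution
  from \<open>b\<close>, and its integral is a Beta value that determines the contribution from
  0.\<close>

lemma connection_base:
  assumes nu: "\<nu> < 1/2" and lim: "((\<lambda>a. Y (of_real a)) \<longlongrightarrow> \<alpha>) (at_right 0)"
  shows "\<alpha> = of_real (sqrt pi / (2 * b) * Gamma (1/2 - \<nu>))"
proof -
  let ?P = "\<lambda>x. complex_of_real ((b\<^sup>2 - x\<^sup>2) powr (1/2 - \<nu>))"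
  \<comment> \<open>\<open>Y\<close> carries no information at 0, so its limit is inserted there to
    obtain continuity on the closed interval.\<close>
  define W where "W = (\<lambda>x. ?P x * (if x = 0 then \<alpha> else Y (of_real x)))"
  have Pcont: "continuous_on {0..b} ?P"
  proof -
    have "continuous_on {0..b} (\<lambda>x. (b\<^sup>2 - x\<^sup>2) powr (1/2 - \<nu>))"
    proof (intro continuous_on_powr' continuous_intros ballI conjI impI)
      fix x assume "x \<in> {0..b}"
      thus "b\<^sup>2 - x\<^sup>2 \<ge> 0" by (simp add: power_mono)
    qed (use nu in auto)
    thus ?thesis by (rule continuous_on_of_real)
  qed
  have "continuous_on {0..b} (\<lambda>x. if x = 0 then \<alpha> else Y (of_real x))"
    unfolding continuous_on_eq_continuous_within
  proof
    fix x assume x: "x \<in> {0..b}"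
    show "continuous (at x within {0..b}) (\<lambda>x. if x = 0 then \<alpha> else Y (of_real x))"
    proof (cases "x = 0")
      case True
      have "((\<lambda>x. if x = 0 then \<alpha> else Y (of_real x)) \<longlongrightarrow> \<alpha>) (at_right 0)"
        by (rule Lim_transform_eventually[OF lim]) (auto simp: eventually_at_filter)
      thus ?thesis using True b by (simp add: continuous_within at_within_Icc_at_right)
    next
      case False
      hence x0: "0 < x" "x \<le> b" using x by auto
      have "isCont (\<lambda>x. Y (of_real x)) x"
        using vderY[OF x0] by (rule has_vector_derivative_continuous)
      hence "((\<lambda>x. Y (of_real x)) \<longlongrightarrow> Y (of_real x)) (at x)" by (simp add: isCont_def)
      moreover have "\<forall>\<^sub>F y in at x. Y (of_real y) = (if y = 0 then \<alpha> else Y (of_real y))"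
        using eventually_neq_at_within[of 0 x UNIV] by eventually_elim simp
      ultimately have "((\<lambda>x. if x = 0 then \<alpha> else Y (of_real x)) \<longlongrightarrow> Y (of_real x)) (at x)"
        by (rule Lim_transform_eventually)
      hence "isCont (\<lambda>x. if x = 0 then \<alpha> else Y (of_real x)) x" using x0 by (simp add: isCont_def)
      thus ?thesis by (rule continuous_at_imp_continuous_at_within)
    qed
  qed
  hence Wcont: "continuous_on {0..b} W" unfolding W_def by (intro continuous_intros Pcont)
  \<comment> \<open>The substitution \<open>x = b * sqrt s\<close> turns the integrand into that of
    the Beta function.\<close>
  define V where "V = W \<circ> (\<lambda>s. b * sqrt s)"
  have rng: "b * sqrt s \<in> {0..b}" if "s \<in> {0..1}" for s using that b by (auto simp: mult_le_cancel_left1)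
  have Vcont: "continuous_on {0..1} V" unfolding V_def
    by (intro continuous_on_compose continuous_on_subset[OF Wcont] continuous_intros) (use rng in auto)
  let ?G = "Gamma (1 - \<nu>)"
  let ?B = "\<lambda>t::real. t powr (1/2 - 1) * (1 - t) powr ((1/2 - \<nu>) - 1)"
  let ?k = "- ?G * b powr (- 2 * \<nu>) / 2"
  have der: "(V has_vector_derivative complex_of_real (?k * ?B s)) (at s)" if s: "s \<in> {0<..<1}" for s
  proof -
    have x: "0 < b * sqrt s" "b * sqrt s < b" using s b by auto
    have xs: "(b * sqrt s)\<^sup>2 = b\<^sup>2 * s" using s by (simp add: power_mult_distrib)
    have "((\<lambda>x. ?P x * Y (of_real x)) has_vector_derivative of_real (- ?G * (b\<^sup>2 - (b * sqrt s)\<^sup>2) powr (- 1/2 - \<nu>))) (at (b * sqrt s))"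
      by (rule ode_integrating_factor[OF x vderY[OF x(1) less_imp_le[OF x(2)]] ode[OF in_U[OF x(1) less_imp_le[OF x(2)]]]])
    hence "(W has_vector_derivative of_real (- ?G * (b\<^sup>2 - (b * sqrt s)\<^sup>2) powr (- 1/2 - \<nu>))) (at (b * sqrt s))"
      by (rule has_vector_derivative_transform_within_open[where S = "{0<..}"]) (use x in \<open>auto simp: W_def\<close>)
    moreover have "((\<lambda>s. b * sqrt s) has_vector_derivative (b * (inverse (sqrt s) / 2))) (at s)"
      unfolding has_real_derivative_iff_has_vector_derivative[symmetric]
      using s by (auto intro!: derivative_eq_intros)
    ultimately have "(V has_vector_derivative (b * (inverse (sqrt s) / 2)) *\<^sub>R complex_of_real (- ?G * (b\<^sup>2 - (b * sqrt s)\<^sup>2) powr (- 1/2 - \<nu>))) (at s)"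
      unfolding V_def by (intro vector_diff_chain_at)
    also have "(b * (inverse (sqrt s) / 2)) *\<^sub>R complex_of_real (- ?G * (b\<^sup>2 - (b * sqrt s)\<^sup>2) powr (- 1/2 - \<nu>)) = complex_of_real (?k * ?B s)"
    proof -
      have "b\<^sup>2 - (b * sqrt s)\<^sup>2 = b\<^sup>2 * (1 - s)" unfolding xs by (simp add: algebra_simps)
      hence "(b\<^sup>2 - (b * sqrt s)\<^sup>2) powr (- 1/2 - \<nu>) = (b\<^sup>2) powr (- 1/2 - \<nu>) * (1 - s) powr (- 1/2 - \<nu>)"
        by (simp only: powr_mult)
      moreover have "(b\<^sup>2) powr (- 1/2 - \<nu>) = b powr (- 1 + - 2 * \<nu>)"
        using b by (simp add: powr_powr algebra_simps flip: powr_numeral)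
      moreover have "b powr (- 1 + - 2 * \<nu>) = inverse b * b powr (- 2 * \<nu>)" unfolding powr_add using b by (simp add: powr_minus)
      moreover have "inverse (sqrt s) = s powr (1/2 - 1)" using s by (simp add: powr_minus powr_half_sqrt)
      moreover have "(1/2 - \<nu>) - 1 = - 1/2 - \<nu>" by simp
      ultimately show ?thesis using b by (simp only: scaleR_conv_of_real of_real_mult[symmetric]) (simp add: field_simps)
    qed
    finally show ?thesis .
  qed
  have "((\<lambda>s. complex_of_real (?k * ?B s)) has_integral (V 1 - V 0)) {0..1}"
    by (rule fundamental_theorem_of_calculus_interior[OF _ Vcont der]) auto
  moreover have "((\<lambda>s. complex_of_real (?k * ?B s)) has_integral complex_of_real (?k * Beta (1/2) (1/2 - \<nu>))) {0..1}"
    using has_integral_linear[OF has_integral_mult_right[OF has_integral_Beta_real[of "1/2" "1/2 - \<nu>"], of ?k] bounded_linear_of_real[where 'a = complex]] nu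
    by (simp add: o_def)
  ultimately have eq: "V 1 - V 0 = complex_of_real (?k * Beta (1/2) (1/2 - \<nu>))" by (rule has_integral_unique)
  have "V 1 = 0" using b nu by (simp add: V_def W_def)
  moreover have "V 0 = of_real (b * b powr (- 2 * \<nu>)) * \<alpha>"
  proof -
    have "(b\<^sup>2) powr (1/2 - \<nu>) = b powr (1 + - 2 * \<nu>)" using b by (simp add: powr_powr algebra_simps flip: powr_numeral)
    also have "\<dots> = b * b powr (- 2 * \<nu>)" unfolding powr_add using b by simp
    finally show ?thesis by (simp add: V_def W_def)
  qed
  ultimately have "of_real (b * b powr (- 2 * \<nu>)) * \<alpha> = complex_of_real (- ?k * Beta (1/2) (1/2 - \<nu>))"
    using eq by (simp add: minus_equation_iff[of _ "_ * _"]) 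
  also have "- ?k * Beta (1/2) (1/2 - \<nu>) = (b * b powr (- 2 * \<nu>)) * (sqrt pi / (2 * b) * Gamma (1/2 - \<nu>))"
  proof -
    have "?G > 0" using nu by auto
    moreover have "(1/2 :: real) + (1/2 - \<nu>) = 1 - \<nu>" by simp
    ultimately show ?thesis using b by (simp only: Beta_def Gamma_one_half_real) (simp add: field_simps)
  qed
  finally have "of_real (b * b powr (- 2 * \<nu>)) * \<alpha> = of_real (b * b powr (- 2 * \<nu>)) * complex_of_real (sqrt pi / (2 * b) * Gamma (1/2 - \<nu>))"
    by (simp only: of_real_mult)
  moreover have "of_real (b * b powr (- 2 * \<nu>)) \<noteq> (0::complex)" using b by (simp del: of_real_mult)
  ultimately show ?thesis using mult_left_cancel by blast
qed

end

text \<open>For \<open>\<nu> > 1/2\<close> the integrating factor blows up at \<open>b\<close>. The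
  order is therefore lowered: subtracting from \<open>Y\<close> a linear function that agrees with
  it at \<open>b\<close> and dividing by \<open>w\<^sup>2 - b\<^sup>2\<close> yields, up to a
  factor, a regular solution for \<open>\<nu> - 1\<close>. The claim is compatible with this because
  of the recurrence of Gamma at \<open>1/2 - \<nu>\<close>.\<close>

lemma connection_coefficient:
  assumes "bessel_ode \<nu> b U Y" and "((\<lambda>a. Y (of_real a)) \<longlongrightarrow> \<alpha>) (at_right 0)" and "\<nu> < real n + 1/2"
  shows "\<alpha> = of_real (sqrt pi / (2 * b) * Gamma (1/2 - \<nu>))"
  using assms
proof (induction n arbitrary: \<nu> Y \<alpha>)
  case 0
  then interpret bessel_ode \<nu> b U Y by simp
  show ?case by (rule connection_base) (use 0 in auto)
next
  case (Suc n)
  interpret bessel_ode \<nu> b U Y by fact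
  have nu: "\<nu> \<noteq> 1/2" "\<nu> \<noteq> 1" 
  proof -
    have "2 * \<nu> \<noteq> 1" "2 * \<nu> \<noteq> 2" using half by (metis Ints_1, metis Ints_numeral)
    thus "\<nu> \<noteq> 1/2" "\<nu> \<noteq> 1" by auto
  qed
  define G where "G = complex_of_real (Gamma (1 - \<nu>))"
  define B where "B = complex_of_real b"
  define N where "N = complex_of_real \<nu>"
  have N: "2 * N - 1 \<noteq> 0" 
  proof
    assume "2 * N - 1 = 0"
    hence "complex_of_real (2 * \<nu> - 1) = of_real 0" by (simp add: N_def)
    hence "2 * \<nu> - 1 = 0" by (simp only: of_real_eq_iff)
    thus False using nu by simp
  qed
  have B: "B \<noteq> 0" using b by (simp add: B_def)
  \<comment> \<open>At \<open>w = B\<close> the leading coefficient of the equation vanishes, which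
    forces the value \<open>Y B = \<kappa> * B\<close>.\<close>
  define \<kappa> where "\<kappa> = - G / ((2 * N - 1) * B\<^sup>2)"
  have G_eq: "G = - \<kappa> * (2 * N - 1) * B\<^sup>2" using N B by (simp add: \<kappa>_def)
  \<comment> \<open>The factor for which the new inhomogeneity becomes \<open>(1 - N) * G\<close>,
    that is, \<open>Gamma (2 - \<nu>)\<close>.\<close>
  define m where "m = (N - 1/2) * B\<^sup>2"
  have ode': "(w\<^sup>2 - B\<^sup>2) * deriv Y w - (2 * N - 1) * w * Y w = G" if "w \<in> U" for w
    using ode[OF that] by (simp add: B_def N_def G_def)
  have bU: "B \<in> U" unfolding B_def using b by (intro in_U) auto
  define Y0 where "Y0 = (\<lambda>w. Y w - \<kappa> * w)"
  have "- ((2 * N - 1) * B * Y B) = G" using ode'[OF bU] by simp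
  hence "(2 * N - 1) * B * Y B = (2 * N - 1) * B * (\<kappa> * B)" using G_eq by (simp add: power2_eq_square)
  hence "Y B = \<kappa> * B" using N B by simp
  hence Y0B: "Y0 B = 0" by (simp add: Y0_def)
  have holY0: "Y0 holomorphic_on U" unfolding Y0_def by (intro holomorphic_intros holY)
  \<comment> \<open>\<open>Y0\<close> vanishes at \<open>B\<close>, so the division by
    \<open>w - B\<close> leaves a holomorphic function; the other factor \<open>w + B\<close> has no
    zero in \<open>U\<close>.\<close>
  define Q where "Q = (\<lambda>w. if w = B then deriv Y0 B else (Y0 w - Y0 B) / (w - B))"
  have holQ: "Q holomorphic_on U" unfolding Q_def by (rule pole_lemma_open[OF holY0 U(1)])
  have Q: "(w - B) * Q w = Y0 w" for w by (simp add: Q_def Y0B)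
  have wB: "w + B \<noteq> 0" if "w \<in> U" for w
  proof
    assume "w + B = 0"
    hence "Re w = - b" by (simp add: B_def eq_neg_iff_add_eq_0 complex_eq_iff)
    moreover have "Re w > 0" using that U(2) by auto
    ultimately show False using b by simp
  qed
  define Z where "Z = (\<lambda>w. m * Q w / (w + B))"
  have holZ: "Z holomorphic_on U" unfolding Z_def using wB by (intro holomorphic_intros holQ) auto
  have Zeq: "(w\<^sup>2 - B\<^sup>2) * Z w = m * (Y w - \<kappa> * w)" if "w \<in> U" for w
  proof -
    have "(w\<^sup>2 - B\<^sup>2) * Z w = m * ((w - B) * Q w)"
      using wB[OF that] by (simp add: Z_def power2_eq_square square_diff_square_factored)
    thus ?thesis by (simp add: Q Y0_def)
  qed
  \<comment> \<open>The defect of \<open>Z\<close> in the equation for \<open>\<nu> - 1\<close>. It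
    is seen to vanish after multiplication by \<open>w\<^sup>2 - B\<^sup>2\<close>, which leaves the
    point \<open>B\<close> to continuity.\<close>
  define E where "E = (\<lambda>w. (w\<^sup>2 - B\<^sup>2) * deriv Z w - (2 * N - 3) * w * Z w - (1 - N) * G)"
  have E0: "E w = 0" if w: "w \<in> U" "w \<noteq> B" for w
  proof -
    have d1: "((\<lambda>w. (w\<^sup>2 - B\<^sup>2) * Z w) has_field_derivative (2 * w * Z w + (w\<^sup>2 - B\<^sup>2) * deriv Z w)) (at w)"
      by (rule derivative_eq_intros holomorphic_derivI[OF holZ U(1) w(1)] refl)+ (simp add: mult_ac)
    have "((\<lambda>w. m * (Y w - \<kappa> * w)) has_field_derivative (m * (deriv Y w - \<kappa>))) (at w)"
      by (rule derivative_eq_intros derY[OF w(1)] refl)+ simp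
    hence "((\<lambda>w. (w\<^sup>2 - B\<^sup>2) * Z w) has_field_derivative (m * (deriv Y w - \<kappa>))) (at w)"
      by (rule has_field_derivative_transform_within_open[OF _ U(1) w(1)]) (simp add: Zeq)
    from DERIV_unique[OF d1 this] have d: "(w\<^sup>2 - B\<^sup>2) * deriv Z w = m * (deriv Y w - \<kappa>) - 2 * w * Z w"
      by (simp add: algebra_simps)
    let ?D = "w\<^sup>2 - B\<^sup>2"
    have "w\<^sup>2 - B\<^sup>2 = (w - B) * (w + B)" by (simp add: power2_eq_square square_diff_square_factored)
    hence D: "?D \<noteq> 0" using w wB by auto
    have "?D * E w = ?D * (?D * deriv Z w) - (2 * N - 3) * w * (?D * Z w) - ?D * ((1 - N) * G)"
      by (simp add: E_def algebra_simps)
    also have "\<dots> = m * (?D * deriv Y w) - m * \<kappa> * ?D - (2 * N - 1) * w * (?D * Z w) - ?D * ((1 - N) * G)"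
      unfolding d by (simp add: algebra_simps)
    also have "?D * deriv Y w = G + (2 * N - 1) * w * Y w" using ode'[OF w(1)] by (simp add: algebra_simps)
    also have "?D * Z w = m * (Y w - \<kappa> * w)" by (rule Zeq[OF w(1)])
    also have "m * (G + (2 * N - 1) * w * Y w) - m * \<kappa> * ?D - (2 * N - 1) * w * (m * (Y w - \<kappa> * w)) - ?D * ((1 - N) * G)
       = m * (G - \<kappa> * ?D + (2 * N - 1) * \<kappa> * w\<^sup>2) - ?D * ((1 - N) * G)"
      by (simp add: algebra_simps power2_eq_square)
    also have "\<dots> = 0" unfolding m_def G_eq by (simp add: field_simps power2_eq_square)
    finally show ?thesis using D by simp
  qed
  have holE: "E holomorphic_on U" unfolding E_def
    by (intro holomorphic_intros holomorphic_deriv holZ U)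
  have EB: "E B = 0"
  proof -
    have "isCont E B" using holomorphic_on_imp_continuous_on[OF holE] U(1) bU continuous_on_eq_continuous_at by blast
    hence "(E \<longlongrightarrow> E B) (at B)" by (simp add: isCont_def)
    moreover have "\<forall>\<^sub>F w in at B. w \<in> U" using U(1) bU by (rule eventually_at_in_open')
    hence "\<forall>\<^sub>F w in at B. E w = 0"
      using eventually_neq_at_within[of B B UNIV] by eventually_elim (rule E0)
    hence "(E \<longlongrightarrow> 0) (at B)" by (rule tendsto_eventually)
    ultimately show ?thesis by (intro tendsto_unique[of "at B"]) auto
  qed
  have G2: "complex_of_real (Gamma (1 - (\<nu> - 1))) = (1 - N) * G"
  proof -
    have "1 - \<nu> \<notin> \<int>\<^sub>\<le>\<^sub>0"
    proof
      assume "1 - \<nu> \<in> \<int>\<^sub>\<le>\<^sub>0"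
      hence "1 - \<nu> \<in> \<int>" using nonpos_Ints_Int by blast
      hence "2 * (1 - (1 - \<nu>)) \<in> \<int>" by (intro Ints_mult Ints_diff) auto
      thus False using half by simp
    qed
    hence "Gamma (1 - \<nu> + 1) = (1 - \<nu>) * Gamma (1 - \<nu>)" by (rule Gamma_plus1)
    moreover have "1 - (\<nu> - 1) = 1 - \<nu> + 1" by simp
    ultimately show ?thesis by (simp add: N_def G_def)
  qed
  have "bessel_ode (\<nu> - 1) b U Z"
  proof
    show "2 * (\<nu> - 1) \<notin> \<int>"
    proof
      assume "2 * (\<nu> - 1) \<in> \<int>"
      hence "2 * (\<nu> - 1) + 2 \<in> \<int>" by (intro Ints_add) auto
      thus False using half by simp
    qed
    show "(w\<^sup>2 - of_real (b\<^sup>2)) * deriv Z w - of_real (2 * (\<nu> - 1) - 1) * w * Z w = of_real (Gamma (1 - (\<nu> - 1)))"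
      if "w \<in> U" for w
    proof -
      have "E w = 0" using E0[OF that] EB by (cases "w = B") auto
      moreover have "of_real (2 * (\<nu> - 1) - 1) = 2 * N - 3" by (simp add: N_def)
      ultimately show ?thesis unfolding G2 by (simp add: E_def B_def)
    qed
  qed (use b U holZ in auto)
  \<comment> \<open>The limit at 0 is multiplied by \<open>m / (- B\<^sup>2)\<close>, which equals
    \<open>1/2 - N\<close>.\<close>
  moreover have "((\<lambda>a. Z (of_real a)) \<longlongrightarrow> m * (\<alpha> - \<kappa> * of_real 0) / ((of_real 0)\<^sup>2 - B\<^sup>2)) (at_right 0)"
  proof (rule Lim_transform_eventually)
    show "((\<lambda>a. m * (Y (of_real a) - \<kappa> * of_real a) / ((of_real a)\<^sup>2 - B\<^sup>2)) \<longlongrightarrow> m * (\<alpha> - \<kappa> * of_real 0) / ((of_real 0)\<^sup>2 - B\<^sup>2)) (at_right 0)"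
      using B by (intro tendsto_intros Suc.prems) auto
    have "\<forall>\<^sub>F a in at_right 0. a \<in> {0<..<b}" using b by (rule eventually_at_right_real)
    thus "\<forall>\<^sub>F a in at_right 0. m * (Y (of_real a) - \<kappa> * of_real a) / ((of_real a)\<^sup>2 - B\<^sup>2) = Z (of_real a)"
    proof eventually_elim
      case (elim a)
      have aU: "of_real a \<in> U" using elim by (intro in_U) auto
      have "(of_real a)\<^sup>2 - B\<^sup>2 = complex_of_real (a\<^sup>2 - b\<^sup>2)" by (simp add: B_def)
      moreover have "a\<^sup>2 < b\<^sup>2" using elim by (intro power_strict_mono) auto
      ultimately have "(of_real a)\<^sup>2 - B\<^sup>2 \<noteq> 0" by (simp del: of_real_diff of_real_power)
      thus ?case using Zeq[OF aU] by (simp add: field_simps)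
    qed
  qed
  ultimately have "m * (\<alpha> - \<kappa> * of_real 0) / ((of_real 0)\<^sup>2 - B\<^sup>2) = of_real (sqrt pi / (2 * b) * Gamma (1/2 - (\<nu> - 1)))"
    by (rule Suc.IH) (use Suc.prems in simp)
  moreover have "m * (\<alpha> - \<kappa> * of_real 0) / ((of_real 0)\<^sup>2 - B\<^sup>2) = of_real (1/2 - \<nu>) * \<alpha>"
    using B by (simp add: m_def N_def field_simps)
  moreover have "Gamma (1/2 - (\<nu> - 1)) = (1/2 - \<nu>) * Gamma (1/2 - \<nu>)"
  proof -
    have "1/2 - \<nu> \<notin> \<int>\<^sub>\<le>\<^sub>0"
    proof
      assume "1/2 - \<nu> \<in> \<int>\<^sub>\<le>\<^sub>0"
      hence "1/2 - \<nu> \<in> \<int>" using nonpos_Ints_Int by blast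
      hence "1 - 2 * (1/2 - \<nu>) \<in> \<int>"
        using Ints_diff[OF Ints_1 Ints_mult[OF Ints_numeral]] by blast
      thus False using half by simp
    qed
    hence "Gamma (1/2 - \<nu> + 1) = (1/2 - \<nu>) * Gamma (1/2 - \<nu>)" by (rule Gamma_plus1)
    moreover have "1/2 - (\<nu> - 1) = 1/2 - \<nu> + 1" by simp
    ultimately show ?thesis by simp
  qed
  ultimately have "of_real (1/2 - \<nu>) * \<alpha> = of_real (sqrt pi / (2 * b) * ((1/2 - \<nu>) * Gamma (1/2 - \<nu>)))"
    by simp
  also have "\<dots> = of_real (1/2 - \<nu>) * of_real (sqrt pi / (2 * b) * Gamma (1/2 - \<nu>))"
    by (simp only: of_real_mult mult_ac)
  finally show ?case using nu mult_left_cancel[of "complex_of_real (1/2 - \<nu>)"]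
    by (metis eq_iff_diff_eq_0 of_real_eq_0_iff)
qed

theorem (in bessel_ode) eq_singular_terms:
  assumes "0 < a" "a < b"
  shows "Y (of_real a) = of_real (singular_terms \<nu> a b)"
proof -
  obtain \<alpha> where rep: "\<And>a. 0 < a \<Longrightarrow> a < b \<Longrightarrow> Y (of_real a) = \<alpha> * of_real ((1 - a\<^sup>2 / b\<^sup>2) powr (\<nu> - 1/2)) + of_real (regular_part \<nu> b a)"
    and lim: "((\<lambda>a. Y (of_real a)) \<longlongrightarrow> \<alpha>) (at_right 0)" using general_solution by blast
  obtain n :: nat where n: "\<nu> - 1/2 < real n" using reals_Archimedean2 by blast
  have "\<alpha> = of_real (sqrt pi / (2 * b) * Gamma (1/2 - \<nu>))"
    by (rule connection_coefficient[OF bessel_ode_axioms lim, of n]) (use n in simp)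
  thus ?thesis using rep[OF assms] by (simp add: singular_terms_def regular_part_def)
qed

section \<open>The Bessel sum\<close>

lemma real_Gamma_duplication:
  fixes z :: real
  assumes "z \<notin> \<int>\<^sub>\<le>\<^sub>0" "z + 1/2 \<notin> \<int>\<^sub>\<le>\<^sub>0"
  shows "Gamma z * Gamma (z + 1/2) = 2 powr (1 - 2 * z) * sqrt pi * Gamma (2 * z)"
proof -
  have "complex_of_real z \<notin> \<int>\<^sub>\<le>\<^sub>0" "complex_of_real z + 1/2 \<notin> \<int>\<^sub>\<le>\<^sub>0"
    using assms of_real_in_nonpos_Ints_iff[of z, where 'a = complex] of_real_in_nonpos_Ints_iff[of "z + 1/2", where 'a = complex]
    by simp_all
  from Gamma_legendre_duplication[OF this]
  have "Gamma (complex_of_real z) * Gamma (of_real (z + 1/2)) = exp (of_real ((1 - 2 * z) * ln 2)) * of_real (sqrt pi) * Gamma (of_real (2 * z))"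
    by simp
  hence "complex_of_real (Gamma z * Gamma (z + 1/2)) = complex_of_real (exp ((1 - 2 * z) * ln 2) * sqrt pi * Gamma (2 * z))"
    unfolding Gamma_complex_of_real exp_of_real by (simp only: of_real_mult)
  hence "Gamma z * Gamma (z + 1/2) = exp ((1 - 2 * z) * ln 2) * sqrt pi * Gamma (2 * z)" by (simp only: of_real_eq_iff)
  thus ?thesis by (simp add: powr_def)
qed

lemma real_Gamma_reflection:
  fixes x :: real
  shows "Gamma x * Gamma (1 - x) = pi / sin (pi * x)"
proof -
  have "Gamma (complex_of_real x) * Gamma (of_real (1 - x)) = of_real pi / sin (of_real (pi * x))"
    using Gamma_reflection_complex[of "of_real x"] by simp
  hence "complex_of_real (Gamma x * Gamma (1 - x)) = of_real (pi / sin (pi * x))"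
    unfolding Gamma_complex_of_real sin_of_real by simp
  thus ?thesis by (simp only: of_real_eq_iff)
qed

text \<open>The Gamma factor of \<open>c n\<close> turns the binomial coefficient into Gamma at
  \<open>\<tau> n + j\<close>. Hence the terms for fixed \<open>n\<close> are those of the expansion
  of the polylogarithm with exponent \<open>\<tau> n - 1\<close>.\<close>

lemma (in lattice_series) lterm_zeta_eq:
  assumes "c n = k * Gamma (\<tau> n)" "\<tau> n \<notin> \<int>\<^sub>\<le>\<^sub>0"
  shows "lterm a j n * real_zeta (\<tau> n + real j) = k * ((- a) ^ j / fact j * lipschitz_coeff (\<tau> n + real j))"
proof -
  have G: "Gamma (\<tau> n) \<noteq> 0" using assms by (simp add: Gamma_eq_zero_iff)
  have "pochhammer (\<tau> n) j * Gamma (\<tau> n) = Gamma (\<tau> n + real j)"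
    using pochhammer_Gamma[OF assms(2), of j] G by simp
  hence "c n * (- \<tau> n gchoose j) * a ^ j = k * ((- a) ^ j / fact j * Gamma (\<tau> n + real j))"
    using assms(1) by (simp add: gbinomial_pochhammer power_minus[of a] mult_ac)
  thus ?thesis by (simp add: lterm_def lipschitz_coeff_def mult_ac)
qed

lemma double_sums_odd:
  assumes ds: "double_sums f s" and even: "\<And>m n. f (2 * m) n = 0"
  shows "double_sums (\<lambda>m n. f (2 * m + 1) n) s"
proof -
  have mono: "strict_mono (\<lambda>m::nat. 2 * m + 1)" by (intro strict_monoI) simp
  have range: "j \<notin> range (\<lambda>m. 2 * m + 1) \<Longrightarrow> even j" for j :: nat
    by (metis oddE rangeI)
  have z: "f j n = 0" if "j \<notin> range (\<lambda>m. 2 * m + 1)" for j n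
    using range[OF that] even by (auto elim!: evenE)
  have r: "(\<lambda>m. g (2 * m + 1)) sums t \<longleftrightarrow> g sums t" if "\<And>j. j \<notin> range (\<lambda>m. 2 * m + 1) \<Longrightarrow> g j = 0" for g :: "nat \<Rightarrow> real" and t
    by (rule sums_mono_reindex[OF mono that])
  have *: "\<And>m. summable (\<lambda>n. f m n)" "\<And>n. summable (\<lambda>m. f m n)"
     "(\<lambda>m. \<Sum>n. f m n) sums s" "(\<lambda>n. \<Sum>m. f m n) sums s"
    using ds by (auto simp: double_sums_def)
  have "(\<lambda>m. f (2 * m + 1) n) sums (\<Sum>m. f m n)" for n
    using r[of "\<lambda>j. f j n"] z summable_sums[OF *(2)[of n]] by blast
  hence a: "summable (\<lambda>m. f (2 * m + 1) n)" "(\<Sum>m. f (2 * m + 1) n) = (\<Sum>m. f m n)" for n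
    by (auto simp: sums_iff)
  have "(\<lambda>m. \<Sum>n. f (2 * m + 1) n) sums s"
    using r[of "\<lambda>j. \<Sum>n. f j n" s] z *(3) by simp
  thus ?thesis unfolding double_sums_def using * a by simp
qed

section \<open>Coefficients of the two families\<close>

locale bessel_sum =
  fixes \<nu> b :: real
  assumes nu: "\<nu> > 0" and half: "2 * \<nu> \<notin> \<int>" and b: "0 < b" "b < 2 * pi"
begin

lemma not_int: "\<nu> \<notin> \<int>" 
  using half Ints_mult[OF Ints_numeral[of "num.Bit0 num.One"], of \<nu>] by blast

lemma sin_nz: "sin (pi * \<nu>) \<noteq> 0"
  using not_int sin_times_pi_eq_0[of \<nu>] by (simp add: mult.commute)

text \<open>Arguments of Gamma occur in the form (k + 2 nu)/2 or (k - 2 nu)/2 with an integer k; as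
  \<open>2 * \<nu>\<close> is not an integer, none of them is a pole.\<close>

lemma not_nonpos:
  assumes "2 * x = of_int k + 2 * s * \<nu>" "s = 1 \<or> s = -1"
  shows "x \<notin> \<int>\<^sub>\<le>\<^sub>0"
proof
  assume "x \<in> \<int>\<^sub>\<le>\<^sub>0"
  then obtain i where "x = of_int i" by (auto elim!: nonpos_Ints_cases)
  hence "2 * \<nu> = s * of_int (2 * i - k)" using assms by auto
  hence "2 * \<nu> \<in> \<int>" using assms(2) by auto
  thus False using half by simp
qed

text \<open>The families \<open>A\<close> and \<open>B\<close> come from the parts \<open>I\<^sub>\<nu>\<close> and \<open>I\<^sub>-\<^sub>\<nu>\<close> of \<open>K\<^sub>\<nu>\<close>: \<open>kA\<close>, \<open>kB\<close> are the
  coefficients of their power series, and \<open>cA\<close>, \<open>cB\<close> those of the singular terms that summation over the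
  lattice produces. \<open>LA a j n\<close> and \<open>LB a j n\<close> are the terms of order \<open>a\<^sup>j\<close>.\<close>

definition cA :: "nat \<Rightarrow> real" where
  "cA n = b ^ (2 * n) * Gamma (real n + 1/2) / (sqrt pi * Gamma (real n + 1 + \<nu>))"

definition cB :: "nat \<Rightarrow> real" where
  "cB n = b powr (2 * real n - 2 * \<nu>) * Gamma (real n + 1/2 - \<nu>) / (sqrt pi * fact n)"

definition kA :: "nat \<Rightarrow> real" where
  "kA n = (b / 2) ^ (2 * n) * rGamma (real n + 1 + \<nu>) / fact n"

definition kB :: "nat \<Rightarrow> real" where
  "kB n = (b / 2) powr (2 * real n - 2 * \<nu>) * rGamma (real n + 1 - \<nu>) / fact n"

text \<open>The family from I_nu has integral exponents beginning with 1, so it falls under the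
  inhomogeneous alternative and supplies the constant of the differential equation.\<close>

sublocale A: lattice_series b "\<nu> - 1/2" 1 "- (2 * \<nu>) * cA 0" cA
proof
  show "0 < b" "b < 2 * pi" by (rule b)+
  show "(2 * real n + 2 + 1 + 2 * (\<nu> - 1/2)) * cA (Suc n) = b\<^sup>2 * (2 * real n + 1) * cA n" for n
  proof -
    have "Gamma (real n + 1/2 + 1) = (real n + 1/2) * Gamma (real n + 1/2)" by (intro Gamma_plus1) (auto elim!: nonpos_Ints_cases)
    hence g: "Gamma (real (Suc n) + 1/2) = (real n + 1/2) * Gamma (real n + 1/2)" by (simp add: add_ac)
    have "Gamma (real n + 1 + \<nu> + 1) = (real n + 1 + \<nu>) * Gamma (real n + 1 + \<nu>)"
      using nu by (intro Gamma_plus1) (auto elim!: nonpos_Ints_cases)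
    hence h: "Gamma (real (Suc n) + 1 + \<nu>) = (real n + 1 + \<nu>) * Gamma (real n + 1 + \<nu>)" by (simp add: add_ac)
    have aux: "(2 * x + 2 + 1 + 2 * (\<nu> - 1/2)) * (B * ((x + 1/2) * g) / (s * ((x + 1 + \<nu>) * h))) = (2 * x + 1) * (B * g / (s * h))"
      if "x \<ge> 0" for B x g s h :: real
    proof -
      have e: "2 * x + 2 + 1 + 2 * (\<nu> - 1/2) = 2 * (x + 1 + \<nu>)" "2 * x + 1 = 2 * (x + 1/2)" by simp_all
      have nz: "x + 1 + \<nu> \<noteq> 0" using that nu by simp
      have "(2 * y) * (B * (u * g) / (s * (y * h))) = (2 * u) * (B * g / (s * h))" if "y \<noteq> 0" for u y :: real
        using that by simp
      from this[OF nz] show ?thesis unfolding e .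
    qed
    have "b ^ (2 * Suc n) = b\<^sup>2 * b ^ (2 * n)" by (simp add: power2_eq_square)
    thus ?thesis unfolding cA_def g h by (subst aux) (simp_all add: power2_eq_square)
  qed
qed (auto simp: algebra_simps)

text \<open>Here \<open>\<sigma> + 2 * \<mu> = 0\<close>, the homogeneous alternative: the series is
  the binomial series of a multiple of (w^2 - b^2)^(nu - 1/2) at infinity.\<close>

sublocale B: lattice_series b "\<nu> - 1/2" "1 - 2 * \<nu>" 0 cB
proof
  show "0 < b" "b < 2 * pi" by (rule b)+
  show "(2 * real n + 2 + (1 - 2 * \<nu>) + 2 * (\<nu> - 1/2)) * cB (Suc n) = b\<^sup>2 * (2 * real n + (1 - 2 * \<nu>)) * cB n" for n
  proof -
    have "Gamma (real n + 1/2 - \<nu> + 1) = (real n + 1/2 - \<nu>) * Gamma (real n + 1/2 - \<nu>)"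
      by (intro Gamma_plus1 not_nonpos[of _ "2 * int n + 1" "-1"]) auto
    moreover have "b powr (2 * real (Suc n) - 2 * \<nu>) = b powr (2 + (2 * real n - 2 * \<nu>))" by (simp add: algebra_simps)
    hence "b powr (2 * real (Suc n) - 2 * \<nu>) = b\<^sup>2 * b powr (2 * real n - 2 * \<nu>)"
      using b by (simp only: powr_add) simp
    moreover have "real (Suc n) + 1/2 - \<nu> = real n + 1/2 - \<nu> + 1" by simp
    ultimately have "Gamma (real (Suc n) + 1/2 - \<nu>) = (real n + 1/2 - \<nu>) * Gamma (real n + 1/2 - \<nu>)"
      and bp: "b powr (2 * real (Suc n) - 2 * \<nu>) = b\<^sup>2 * b powr (2 * real n - 2 * \<nu>)" by (simp_all only:)
    hence "cB (Suc n) = b\<^sup>2 * (real n + 1/2 - \<nu>) * cB n / real (Suc n)"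
      unfolding cB_def bp by (simp add: mult_ac del: of_nat_Suc)
    thus ?thesis by (simp add: divide_simps) (simp add: algebra_simps)
  qed
qed auto

lemma A_tau: "A.\<tau> n = 2 * real n + 1" by (simp add: A.\<tau>_def)
lemma B_tau: "B.\<tau> n = 2 * real n + 1 - 2 * \<nu>" by (simp add: B.\<tau>_def)

lemma tau_nonpos: "A.\<tau> n \<notin> \<int>\<^sub>\<le>\<^sub>0" "B.\<tau> n \<notin> \<int>\<^sub>\<le>\<^sub>0"
proof -
  show "A.\<tau> n \<notin> \<int>\<^sub>\<le>\<^sub>0" unfolding A_tau by (auto elim!: nonpos_Ints_cases)
  show "B.\<tau> n \<notin> \<int>\<^sub>\<le>\<^sub>0"
  proof
    assume "B.\<tau> n \<in> \<int>\<^sub>\<le>\<^sub>0"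
    hence "B.\<tau> n \<in> \<int>" using nonpos_Ints_Int by blast
    hence "(2 * real n + 1) - B.\<tau> n \<in> \<int>" by (intro Ints_diff) auto
    thus False using half by (simp add: B_tau)
  qed
qed

text \<open>Duplication applied to Gamma at \<open>2 * n + 1\<close> yields n!, which cancels
  against \<open>kA n\<close>, and a power of 2 that turns \<open>b / 2\<close> into
  \<open>b\<close>. The companion for \<open>cB\<close> works alike at
  \<open>2 * n + 1 - 2 * \<nu>\<close>.\<close>

lemma cA_eq: "cA n = kA n * Gamma (A.\<tau> n)"
proof -
  have "Gamma (real n + 1/2) * Gamma (real n + 1/2 + 1/2) = 2 powr (1 - 2 * (real n + 1/2)) * sqrt pi * Gamma (2 * (real n + 1/2))"
    by (intro real_Gamma_duplication) (auto elim!: nonpos_Ints_cases)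
  moreover have "real n + 1/2 + 1/2 = 1 + real n" by simp
  moreover have "Gamma (1 + real n) = fact n" by (rule Gamma_fact)
  moreover have "2 * (real n + 1/2) = A.\<tau> n" by (simp add: A_tau)
  moreover have "2 powr (1 - A.\<tau> n) = 1 / 2 ^ (2 * n)"
    using powr_realpow[of 2 "2 * n"] powr_minus_divide[of 2 "real (2 * n)"] by (simp add: A_tau)
  ultimately have *: "Gamma (real n + 1/2) * fact n = 1 / 2 ^ (2 * n) * sqrt pi * Gamma (A.\<tau> n)" by (simp only:)
  have aux: "g * f = 1 / t * s * G \<Longrightarrow> f \<noteq> 0 \<Longrightarrow> t \<noteq> 0 \<Longrightarrow> s \<noteq> 0 \<Longrightarrow> B * g / (s * H) = B / t * inverse H / f * G"
    for g f t s G B H :: real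
  proof -
    assume "g * f = 1 / t * s * G" and nz: "f \<noteq> 0" "t \<noteq> 0" "s \<noteq> 0"
    hence "g = s * G / (t * f)" by (simp add: nonzero_eq_divide_eq mult_ac)
    thus ?thesis using nz by (simp add: divide_inverse mult_ac)
  qed
  have "cA n = b ^ (2 * n) / 2 ^ (2 * n) * inverse (Gamma (real n + 1 + \<nu>)) / fact n * Gamma (A.\<tau> n)"
    unfolding cA_def by (rule aux[OF *]) auto
  thus ?thesis by (simp only: kA_def power_divide rGamma_inverse_Gamma)
qed

lemma cB_eq: "cB n = kB n * Gamma (B.\<tau> n)"
proof -
  have np: "real n + 1 - \<nu> \<notin> \<int>\<^sub>\<le>\<^sub>0" by (intro not_nonpos[of _ "2 * int n + 2" "-1"]) auto
  have "Gamma (real n + 1/2 - \<nu>) * Gamma (real n + 1/2 - \<nu> + 1/2) = 2 powr (1 - 2 * (real n + 1/2 - \<nu>)) * sqrt pi * Gamma (2 * (real n + 1/2 - \<nu>))"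
    by (intro real_Gamma_duplication not_nonpos[of "real n + 1/2 - \<nu>" "2 * int n + 1" "-1"] not_nonpos[of "real n + 1/2 - \<nu> + 1/2" "2 * int n + 2" "-1"]) auto
  moreover have "real n + 1/2 - \<nu> + 1/2 = real n + 1 - \<nu>" by simp
  moreover have "1 - 2 * (real n + 1/2 - \<nu>) = - (2 * real n - 2 * \<nu>)" by simp
  moreover have "2 * (real n + 1/2 - \<nu>) = B.\<tau> n" by (simp add: B_tau)
  ultimately have *: "Gamma (real n + 1/2 - \<nu>) * Gamma (real n + 1 - \<nu>) = 2 powr - (2 * real n - 2 * \<nu>) * sqrt pi * Gamma (B.\<tau> n)"
    by (simp only:)
  have bp: "(b / 2) powr (2 * real n - 2 * \<nu>) = b powr (2 * real n - 2 * \<nu>) * 2 powr - (2 * real n - 2 * \<nu>)"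
    using b by (simp only: powr_divide powr_minus_divide less_imp_le) simp
  have aux: "g * f = t * s * G \<Longrightarrow> f \<noteq> 0 \<Longrightarrow> s \<noteq> 0 \<Longrightarrow> H \<noteq> 0 \<Longrightarrow> B * g / (s * H) = (B * t) * inverse f / H * G"
    for g f t s G B H :: real
  proof -
    assume "g * f = t * s * G" and nz: "f \<noteq> 0" "s \<noteq> 0"
    hence "g = t * s * G / f" by (simp add: nonzero_eq_divide_eq mult_ac)
    thus ?thesis using nz by (simp add: divide_inverse mult_ac)
  qed
  have "cB n = (b powr (2 * real n - 2 * \<nu>) * 2 powr - (2 * real n - 2 * \<nu>)) * inverse (Gamma (real n + 1 - \<nu>)) / fact n * Gamma (B.\<tau> n)"
    unfolding cB_def by (rule aux[OF *]) (use np in \<open>auto simp: Gamma_eq_zero_iff\<close>)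
  thus ?thesis by (simp only: kB_def bp rGamma_inverse_Gamma)
qed

definition LA :: "real \<Rightarrow> nat \<Rightarrow> nat \<Rightarrow> real" where
  "LA a j n = kA n * ((- a) ^ j / fact j * lipschitz_coeff (2 * real n + 1 + real j))"

definition LB :: "real \<Rightarrow> nat \<Rightarrow> nat \<Rightarrow> real" where
  "LB a j n = kB n * ((- a) ^ j / fact j * lipschitz_coeff (2 * real n + 1 - 2 * \<nu> + real j))"

lemma double_sums_LA: "0 < a \<Longrightarrow> a < 2 * pi \<Longrightarrow> \<exists>R. double_sums (LA a) R"
  using A.double_sums_zeta_lterm[of a] unfolding A.lterm_zeta_eq[OF cA_eq tau_nonpos(1)]
  by (simp add: LA_def[abs_def] A_tau)

lemma double_sums_LB: "0 < a \<Longrightarrow> a < 2 * pi \<Longrightarrow> \<exists>R. double_sums (LB a) R"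
  using B.double_sums_zeta_lterm[of a] unfolding B.lterm_zeta_eq[OF cB_eq tau_nonpos(2)]
  by (simp add: LB_def[abs_def] B_tau)

definition RA :: "real \<Rightarrow> real" where "RA a = (THE R. double_sums (LA a) R)"
definition RB :: "real \<Rightarrow> real" where "RB a = (THE R. double_sums (LB a) R)"

lemma double_sums_unique: "double_sums f s \<Longrightarrow> double_sums f t \<Longrightarrow> s = t"
  unfolding double_sums_def by (blast intro: sums_unique2)

lemma double_sums_RA: "0 < a \<Longrightarrow> a < 2 * pi \<Longrightarrow> double_sums (LA a) (RA a)"
  unfolding RA_def by (rule theI') (use double_sums_LA double_sums_unique in blast)

lemma double_sums_RB: "0 < a \<Longrightarrow> a < 2 * pi \<Longrightarrow> double_sums (LB a) (RB a)"
  unfolding RB_def by (rule theI') (use double_sums_LB double_sums_unique in blast)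

text \<open>For \<open>n = 0\<close> the exponent is 0, and the constant term zeta(0) = -1/2 is
  absent from \<open>lipschitz_coeff\<close>. The compensating 1/2 is the origin of the cosecant
  term of the theorem.\<close>

lemma LA_row:
  assumes a: "0 < a" "a < 2 * pi"
  shows "(\<lambda>j. LA a j n) sums (kA n * (real_polylog_exp (2 * real n) a - Gamma (A.\<tau> n) * a powr (- A.\<tau> n) + (if n = 0 then 1/2 else 0)))"
proof -
  have "(\<lambda>j. (- a) ^ j / fact j * lipschitz_coeff (2 * real n + 1 + real j)) sums
     (real_polylog_exp (2 * real n) a - Gamma (A.\<tau> n) * a powr (- A.\<tau> n) + (if n = 0 then 1/2 else 0))"
  proof (cases "n = 0")
    case True
    thus ?thesis using real_polylog_exp_0_expansion[OF a] a by (simp add: A_tau powr_minus_divide)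
  next
    case False
    thus ?thesis using real_polylog_exp_expansion[of "2 * real n" a] a by (simp add: A_tau)
  qed
  thus ?thesis unfolding LA_def by (rule sums_mult)
qed

lemma LB_row:
  assumes a: "0 < a" "a < 2 * pi"
  shows "(\<lambda>j. LB a j n) sums (kB n * (real_polylog_exp (2 * real n - 2 * \<nu>) a - Gamma (B.\<tau> n) * a powr (- B.\<tau> n)))"
proof -
  have "2 * real n - 2 * \<nu> \<notin> \<int>"
  proof
    assume "2 * real n - 2 * \<nu> \<in> \<int>"
    hence "2 * real n - (2 * real n - 2 * \<nu>) \<in> \<int>" by (intro Ints_diff) auto
    thus False using half by simp
  qed
  hence "(\<lambda>j. (- a) ^ j / fact j * lipschitz_coeff (2 * real n - 2 * \<nu> + 1 + real j)) sums
     (real_polylog_exp (2 * real n - 2 * \<nu>) a - Gamma (2 * real n - 2 * \<nu> + 1) * a powr (- (2 * real n - 2 * \<nu>) - 1))"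
    using a by (intro real_polylog_exp_expansion) auto
  moreover have "2 * real n - 2 * \<nu> + 1 = B.\<tau> n" "- (2 * real n - 2 * \<nu>) - 1 = - B.\<tau> n" by (simp_all add: B_tau)
  ultimately have "(\<lambda>j. (- a) ^ j / fact j * lipschitz_coeff (B.\<tau> n + real j)) sums
     (real_polylog_exp (2 * real n - 2 * \<nu>) a - Gamma (B.\<tau> n) * a powr (- B.\<tau> n))" by simp
  thus ?thesis unfolding LB_def by (intro sums_mult) (simp add: B_tau)
qed

text \<open>Two duplications merge the Gamma quotient of \<open>coeff_A\<close> into a single Gamma
  value and a factorial. At an even integral argument the cosine in \<open>lipschitz_coeff\<close>
  is a sign, that of the double series up to a factor -1 that cancels against the one from the odd
  power of \<open>- a\<close>.\<close>

lemma A_term_eq: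
  "(- 1) ^ (m + n) * (coeff_A \<nu> m n * (a / (2 * pi)) ^ (2 * m + 1) * (b / (2 * pi)) ^ (2 * n)) = pi * LA a (2 * m + 1) n"
proof -
  let ?s = "2 * real m + 2 * real n + 2"
  define M where "M = real m + real n + 1"
  have d1: "Gamma M * Gamma (M + 1/2) = 2 powr (1 - 2 * M) * sqrt pi * Gamma (2 * M)"
    by (intro real_Gamma_duplication) (auto elim!: nonpos_Ints_cases simp: M_def)
  have d2: "Gamma (real m + 1) * Gamma (real m + 1 + 1/2) = 2 powr (1 - 2 * (real m + 1)) * sqrt pi * Gamma (2 * (real m + 1))"
    by (intro real_Gamma_duplication) (auto elim!: nonpos_Ints_cases)
  have f: "Gamma (real m + 1) = fact m" "Gamma (2 * (real m + 1)) = fact (2 * m + 1)"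
    using Gamma_fact[of m, where ?'a = real] Gamma_fact[of "2 * m + 1", where ?'a = real] by (simp_all add: add_ac)
  have p2: "2 powr (1 - 2 * (real m + 1)) = 1 / 2 ^ (2 * m + 1)" "2 powr (1 - 2 * M) = 1 / 2 ^ (2 * m + 2 * n + 1)"
    using powr_realpow[of 2 "2 * m + 1"] powr_realpow[of 2 "2 * m + 2 * n + 1"]
      powr_minus_divide[of 2 "real (2 * m + 1)"] powr_minus_divide[of 2 "real (2 * m + 2 * n + 1)"] by (simp_all add: M_def add_ac)
  have G32: "fact m * Gamma (real m + 3/2) = sqrt pi * fact (2 * m + 1) / 2 ^ (2 * m + 1)"
    using d2 f p2 by (simp add: add_ac)
  have GM: "Gamma M * Gamma (real m + real n + 3/2) = sqrt pi * Gamma ?s / 2 ^ (2 * m + 2 * n + 1)"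
    using d1 p2 by (simp add: M_def add_ac)
  have cosv: "cos (pi * ?s / 2) = (- 1) ^ (m + n + 1)"
    using cos_npi[of "m + n + 1"] by (simp add: algebra_simps add_divide_distrib)
  have tp: "(2 * pi) powr (- ?s) = 1 / (2 * pi) ^ (2 * m + 2 * n + 2)"
  proof -
    have "?s = real (2 * m + 2 * n + 2)" by simp
    hence "(2 * pi) powr ?s = (2 * pi) ^ (2 * m + 2 * n + 2)" by (simp only: powr_realpow[OF mult_pos_pos[OF zero_less_numeral pi_gt_zero]])
    thus ?thesis by (simp only: powr_minus_divide)
  qed
  have cA': "coeff_A \<nu> m n = Gamma ?s / (2 ^ (2 * n) * fact n * fact (2 * m + 1)) * rGamma (real n + 1 + \<nu>) * real_zeta ?s"
  proof -
    have aux: "g / (f * f' * k * l) * z = g / (f * k) / f' * inverse l * z" for g f f' k l z :: real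
      by (simp add: divide_inverse mult_ac)
    have "coeff_A \<nu> m n = (Gamma M * Gamma (real m + real n + 3/2)) / (fact m * Gamma (real m + 3/2)) / fact n * rGamma (real n + 1 + \<nu>) * real_zeta ?s"
      unfolding coeff_A_def M_def real_zeta_def rGamma_inverse_Gamma by (rule aux)
    also have "(Gamma M * Gamma (real m + real n + 3/2)) / (fact m * Gamma (real m + 3/2)) = Gamma ?s / (2 ^ (2 * n) * fact (2 * m + 1))"
    proof -
      have aux: "(s * G / (T * P)) / (s * F / P) = G / (T * F)" if "s \<noteq> 0" "P \<noteq> 0" for s G T P F :: real
        using that by (cases "T = 0"; cases "F = 0") (simp_all add: field_simps)
      have "(2::real) ^ (2 * m + 2 * n + 1) = 2 ^ (2 * n) * 2 ^ (2 * m + 1)" by (simp add: power_add)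
      thus ?thesis unfolding GM G32 by (simp only: aux[of "sqrt pi" "2 ^ (2 * m + 1)"]) (simp add: aux)
    qed
    finally show ?thesis by (simp add: mult_ac)
  qed
  have s: "2 * real n + 1 + real (2 * m + 1) = ?s" by simp
  have "LA a (2 * m + 1) n = (b / 2) ^ (2 * n) * rGamma (real n + 1 + \<nu>) / fact n * (- (a ^ (2 * m + 1)) / fact (2 * m + 1) * (2 * (1 / (2 * pi) ^ (2 * m + 2 * n + 2)) * (- 1) ^ (m + n + 1) * Gamma ?s * real_zeta ?s))"
    unfolding LA_def s lipschitz_coeff_def tp cosv kA_def by simp
  moreover have aux: "e * (G / (T * f * f') * r * z * (x / P) * (y / Q)) = pi * (y / T * r / f * (- x / f' * (2 * (1 / (P * Q * (2 * pi))) * (- e) * G * z)))"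
    for e G T f f' r z x P y Q :: real
  proof -
    have "pi * (2 * (1 / (P * Q * (2 * pi)))) = 1 / (P * Q)" by simp
    hence "pi * (y / T * r / f * (- x / f' * (2 * (1 / (P * Q * (2 * pi))) * (- e) * G * z)))
      = 1 / (P * Q) * (y / T * r / f * (x / f' * (e * G * z)))" by (simp only: mult.assoc mult.left_commute[of pi]) simp
    thus ?thesis by (simp add: mult_ac)
  qed
  have "(2 * pi) ^ (2 * m + 2 * n + 2) = (2 * pi) ^ (2 * m + 1) * (2 * pi) ^ (2 * n) * (2 * pi)" by (simp add: power_add)
  moreover have "(- 1) ^ (m + n + 1) = - ((- 1) ^ (m + n) :: real)" by simp
  ultimately show ?thesis unfolding cA' power_divide by (simp only: aux)
qed

text \<open>Two duplications again. The reciprocal of the cosecant in \<open>coeff_B\<close> is what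
  the cosine becomes after removing \<open>pi / 2 + n * pi\<close> from its argument; that shift
  also yields the sign with exponent \<open>n + 1\<close>, while the sign with exponent
  \<open>m\<close> belongs to the power of \<open>- a\<close>.\<close>

lemma B_term_eq:
  "(- 1) ^ (m + n) * (coeff_B \<nu> m n * (a / (2 * pi)) ^ m * (b / (2 * pi)) powr (2 * real n - 2 * \<nu>)) = - pi * LB a m n"
proof -
  let ?s = "2 * real n + 1 - 2 * \<nu> + real m"
  define p where "p = 2 * real n - 2 * \<nu>"
  define M where "M = real m / 2 + real n + 1/2 - \<nu>"
  have np: "?s \<notin> \<int>"
  proof
    assume "?s \<in> \<int>"
    hence "(2 * real n + 1 + real m) - ?s \<in> \<int>" by (intro Ints_diff) auto
    thus False using half by simp
  qed
  have np2: "x \<notin> \<int>\<^sub>\<le>\<^sub>0" if "2 * x = ?s + of_int k" for x k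
  proof
    assume "x \<in> \<int>\<^sub>\<le>\<^sub>0"
    hence "x \<in> \<int>" using nonpos_Ints_Int by blast
    hence "2 * x - of_int k \<in> \<int>" using Ints_diff[OF Ints_mult[OF Ints_numeral] Ints_of_int] by blast
    thus False using np that by simp
  qed
  have d1: "Gamma M * Gamma (M + 1/2) = 2 powr (1 - 2 * M) * sqrt pi * Gamma (2 * M)"
    by (intro real_Gamma_duplication np2[of M 0] np2[of "M + 1/2" 1]) (auto simp: M_def)
  have d2: "Gamma (real m / 2 + 1/2) * Gamma (real m / 2 + 1/2 + 1/2) = 2 powr (1 - 2 * (real m / 2 + 1/2)) * sqrt pi * Gamma (2 * (real m / 2 + 1/2))"
    by (intro real_Gamma_duplication) (auto elim!: nonpos_Ints_cases)
  have f: "Gamma (2 * (real m / 2 + 1/2)) = fact m"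
    using Gamma_fact[of m, where ?'a = real] by (simp add: add_ac)
  have e1: "1 - 2 * (real m / 2 + 1/2) = - real m" "1 - 2 * M = - real m + - p" "2 * M = ?s"
    by (simp_all add: M_def p_def)
  have g1: "Gamma (real m / 2 + 1/2) * Gamma (real m / 2 + 1) = 2 powr (- real m) * sqrt pi * fact m"
  proof -
    have "real m / 2 + 1/2 + 1/2 = real m / 2 + 1" by simp
    thus ?thesis using d2 unfolding f e1 by (simp only:)
  qed
  have g2: "Gamma (real m / 2 + real n + 1/2 - \<nu>) * Gamma (real m / 2 + real n + 1 - \<nu>) = 2 powr (- real m) * 2 powr (- p) * sqrt pi * Gamma ?s"
  proof -
    have "M + 1/2 = real m / 2 + real n + 1 - \<nu>" by (simp add: M_def)
    thus ?thesis using d1[unfolded e1(2) powr_add, unfolded e1(3)] by (simp only: M_def)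
  qed
  define Sn where "Sn = sin (pi * (real m / 2 - \<nu>))"
  have zs: "real m + 2 * real n + 1 - 2 * \<nu> = ?s" by simp
  have cB': "coeff_B \<nu> m n = 2 powr (- p) * Gamma ?s / (fact m * fact n) * rGamma (real n + 1 - \<nu>) * real_zeta ?s * Sn"
  proof -
    have aux: "g / (u * v * f * k) * (z / (1 / y)) = g / (u * v) / f * inverse k * (z * y)" for g u v f k z y :: real
      by (simp add: divide_inverse mult_ac)
    have "coeff_B \<nu> m n = (Gamma (real m / 2 + real n + 1/2 - \<nu>) * Gamma (real m / 2 + real n + 1 - \<nu>)) / (Gamma (real m / 2 + 1/2) * Gamma (real m / 2 + 1)) / fact n * rGamma (real n + 1 - \<nu>) * (real_zeta ?s * Sn)"
      unfolding coeff_B_def zs real_zeta_def csc_def Sn_def rGamma_inverse_Gamma by (rule aux)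
    also have "(Gamma (real m / 2 + real n + 1/2 - \<nu>) * Gamma (real m / 2 + real n + 1 - \<nu>)) / (Gamma (real m / 2 + 1/2) * Gamma (real m / 2 + 1)) = 2 powr (- p) * Gamma ?s / fact m"
      unfolding g1 g2 by simp
    finally show ?thesis by (simp add: mult_ac)
  qed
  have cosv: "cos (pi * ?s / 2) = - ((- 1) ^ n * Sn)"
  proof -
    have "pi * ?s / 2 = (pi * (real m / 2 - \<nu>) + pi / 2) + real n * pi" by (simp add: field_simps)
    also have "cos \<dots> = (- 1) ^ n * cos (pi * (real m / 2 - \<nu>) + pi / 2)"
      by (simp add: cos_add[of _ "real n * pi"] sin_npi cos_npi)
    also have "cos (pi * (real m / 2 - \<nu>) + pi / 2) = - Sn" by (simp add: Sn_def cos_add)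
    finally show ?thesis by simp
  qed
  have tp: "(2 * pi) powr (- ?s) = (2 * pi) powr (- p) / ((2 * pi) ^ m * (2 * pi))"
  proof -
    have "- ?s = - p + - real m + - 1" by (simp add: p_def)
    hence "(2 * pi) powr (- ?s) = (2 * pi) powr (- p + - real m + - 1)" by (simp only:)
    also have "\<dots> = (2 * pi) powr (- p) * (1 / (2 * pi) ^ m) * (1 / (2 * pi))"
      unfolding powr_add powr_minus_divide[of _ "real m"] powr_minus_divide[of _ 1] by (simp add: powr_realpow)
    finally show ?thesis by simp
  qed
  have bp: "(b / 2) powr p = b powr p * 2 powr (- p)" "(b / (2 * pi)) powr p = b powr p * (2 * pi) powr (- p)"
    using b by (simp_all add: powr_divide powr_minus_divide)
  have "LB a m n = (b powr p * 2 powr (- p)) * rGamma (real n + 1 - \<nu>) / fact n * ((- a) ^ m / fact m * (2 * ((2 * pi) powr (- p) / ((2 * pi) ^ m * (2 * pi))) * (- ((- 1) ^ n * Sn)) * Gamma ?s * real_zeta ?s))"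
    unfolding LB_def lipschitz_coeff_def tp cosv kB_def p_def[symmetric] bp by simp
  thus ?thesis unfolding cB' p_def[symmetric] bp
    by (simp add: power_divide power_add power_minus[of a] mult_ac)
qed

end

section \<open>The sum for a > b\<close>

lemma polylog_sum_swap:
  assumes a: "a > 0" and ev: "eventually (\<lambda>k. \<kappa> k \<ge> 0) sequentially"
    and sums: "(\<lambda>k. \<kappa> k * real_polylog_exp (p k) a) sums s"
  shows "(\<lambda>l. \<Sum>k. \<kappa> k * real (Suc l) powr p k * exp (- a * real (Suc l))) sums s"
proof -
  define f where "f k l = \<kappa> k * real (Suc l) powr p k * exp (- a * real (Suc l))" for k l
  have P: "(\<lambda>l. real (Suc l) powr q * exp (- a * real (Suc l))) sums real_polylog_exp q a" for q
    unfolding real_polylog_exp_def by (intro summable_sums summable_powr_exp a)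
  have P0: "real_polylog_exp q a \<ge> 0" for q by (rule sums_le[OF _ sums_zero P]) simp
  have abs: "(\<lambda>l. norm (f k l)) sums (\<bar>\<kappa> k\<bar> * real_polylog_exp (p k) a)" for k
    using sums_mult[OF P[of "p k"], of "\<bar>\<kappa> k\<bar>"] by (simp add: f_def abs_mult mult.assoc)
  have row: "summable (\<lambda>l. norm (f k l))" for k using abs[of k] by (simp only: sums_iff)
  \<comment> \<open>For nonnegative coefficients convergence is absolute. The finitely many
    \<open>k\<close> that may have negative coefficients, as happens for \<open>kB\<close> when
    \<open>\<nu> > 1\<close>, do not affect summability.\<close>
  have "eventually (\<lambda>k. norm (\<Sum>l. norm (f k l)) \<le> \<kappa> k * real_polylog_exp (p k) a) sequentially"
    using ev unfolding sums_unique[OF abs, symmetric] by eventually_elim (simp add: P0 abs_mult)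
  hence col: "summable (\<lambda>k. \<Sum>l. norm (f k l))"
    by (rule summable_comparison_test_ev) (use sums in \<open>simp only: sums_iff\<close>)
  have fs: "(\<Sum>l. f k l) = \<kappa> k * real_polylog_exp (p k) a" for k
    using sums_mult[OF P[of "p k"], of "\<kappa> k"] by (simp add: f_def mult.assoc sums_iff)
  have "(\<lambda>l. \<Sum>k. f k l) sums (\<Sum>k. \<Sum>l. f k l)" by (rule summable_swap(2)[OF row col])
  thus ?thesis unfolding fs using sums by (simp only: f_def sums_iff)
qed

context bessel_sum
begin

text \<open>Each row of \<open>LA\<close> is a polylogarithm minus its singular power of
  \<open>a\<close>. Since \<open>a > b\<close>, the singular powers are summable by themselves and
  give \<open>A.fser\<close>, so the polylogarithms are summable too.\<close>

lemma kA_sums: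
  assumes a: "b < a" "a < 2 * pi"
  shows "(\<lambda>k. kA k * real_polylog_exp (2 * real k) a) sums (RA a + Re (A.fser (of_real a)) - kA 0 / 2)"
    and "A.fser (of_real a) = of_real (Re (A.fser (of_real a)))"
proof -
  have a0: "0 < a" using a b by simp
  have "complex_of_real (cA k) * of_real a powr (- of_real (A.\<tau> k)) = of_real (cA k * a powr (- A.\<tau> k))" for k
  proof -
    have "complex_of_real a powr of_real (- A.\<tau> k) = of_real (a powr (- A.\<tau> k))" by (intro powr_of_real) (use a0 in simp)
    thus ?thesis by (simp only: of_real_mult of_real_minus)
  qed
  hence F: "(\<lambda>k. complex_of_real (cA k * a powr (- A.\<tau> k))) sums A.fser (of_real a)"
    using A.fser_sums[of "of_real a"] a a0 by (simp only: norm_of_real abs_of_pos)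
  have Fr: "(\<lambda>k. cA k * a powr (- A.\<tau> k)) sums Re (A.fser (of_real a))" using sums_Re[OF F] by simp
  show "A.fser (of_real a) = of_real (Re (A.fser (of_real a)))"
    by (rule sums_unique2[OF F]) (intro sums_of_real Fr)
  have row: "(\<Sum>j. LA a j k) = kA k * real_polylog_exp (2 * real k) a - cA k * a powr (- A.\<tau> k) + (if k = 0 then kA k / 2 else 0)" for k
    unfolding sums_unique[OF LA_row[OF a0 a(2), of k], symmetric] cA_eq by (simp add: algebra_simps)
  have "(\<lambda>k. \<Sum>j. LA a j k) sums RA a" using double_sums_RA[OF a0 a(2)] unfolding double_sums_def by blast
  hence "(\<lambda>k. (\<Sum>j. LA a j k) + cA k * a powr (- A.\<tau> k) - (if k = 0 then kA k / 2 else 0)) sums (RA a + Re (A.fser (of_real a)) - kA 0 / 2)"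
    by (intro sums_diff sums_add Fr sums_single)
  thus "(\<lambda>k. kA k * real_polylog_exp (2 * real k) a) sums (RA a + Re (A.fser (of_real a)) - kA 0 / 2)"
    unfolding row by simp
qed

lemma kB_sums:
  assumes a: "b < a" "a < 2 * pi"
  shows "(\<lambda>k. kB k * real_polylog_exp (2 * real k - 2 * \<nu>) a) sums (RB a + Re (B.fser (of_real a)))"
    and "B.fser (of_real a) = of_real (Re (B.fser (of_real a)))"
proof -
  have a0: "0 < a" using a b by simp
  have "complex_of_real (cB k) * of_real a powr (- of_real (B.\<tau> k)) = of_real (cB k * a powr (- B.\<tau> k))" for k
  proof -
    have "complex_of_real a powr of_real (- B.\<tau> k) = of_real (a powr (- B.\<tau> k))" by (intro powr_of_real) (use a0 in simp)
    thus ?thesis by (simp only: of_real_mult of_real_minus)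
  qed
  hence F: "(\<lambda>k. complex_of_real (cB k * a powr (- B.\<tau> k))) sums B.fser (of_real a)"
    using B.fser_sums[of "of_real a"] a a0 by (simp only: norm_of_real abs_of_pos)
  have Fr: "(\<lambda>k. cB k * a powr (- B.\<tau> k)) sums Re (B.fser (of_real a))" using sums_Re[OF F] by simp
  show "B.fser (of_real a) = of_real (Re (B.fser (of_real a)))"
    by (rule sums_unique2[OF F]) (intro sums_of_real Fr)
  have row: "(\<Sum>j. LB a j k) = kB k * real_polylog_exp (2 * real k - 2 * \<nu>) a - cB k * a powr (- B.\<tau> k)" for k
    unfolding sums_unique[OF LB_row[OF a0 a(2), of k], symmetric] cB_eq by (simp add: algebra_simps)
  have "(\<lambda>k. \<Sum>j. LB a j k) sums RB a" using double_sums_RB[OF a0 a(2)] unfolding double_sums_def by blast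
  hence "(\<lambda>k. (\<Sum>j. LB a j k) + cB k * a powr (- B.\<tau> k)) sums (RB a + Re (B.fser (of_real a)))"
    by (intro sums_add Fr)
  thus "(\<lambda>k. kB k * real_polylog_exp (2 * real k - 2 * \<nu>) a) sums (RB a + Re (B.fser (of_real a)))"
    unfolding row by simp
qed

lemma kA_pos: "kA k > 0"
  using nu b by (simp add: kA_def rGamma_inverse_Gamma)

lemma kB_eventually: "eventually (\<lambda>k. kB k \<ge> 0) sequentially"
proof -
  have "eventually (\<lambda>k. real k \<ge> \<nu>) sequentially"
    by real_asymp
  thus ?thesis
    by eventually_elim (use b in \<open>simp add: kB_def rGamma_inverse_Gamma\<close>)
qed

text \<open>Division by (bn/2)^nu reduces the powers in I_nu to exponents 2k and those in I_(-nu) to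
  2k - 2 nu. Summed over the lattice index they become polylogarithms with these exponents.\<close>

lemma lhs_term_eq:
  "lhs_term \<nu> a b (Suc l) = pi / (2 * sin (pi * \<nu>)) *
     ((\<Sum>k. kB k * real (Suc l) powr (2 * real k - 2 * \<nu>) * exp (- a * real (Suc l)))
      - (\<Sum>k. kA k * real (Suc l) powr (2 * real k) * exp (- a * real (Suc l))))"
proof -
  define y where "y = b * real (Suc l) / 2"
  define E where "E = exp (- a * real (Suc l))"
  have y: "y > 0" using b by (simp add: y_def)
  have J: "bessel_I_root \<mu> (y\<^sup>2) = y powr \<mu> * bessel_series \<mu> (y\<^sup>2)" for \<mu>
    using y by (simp add: bessel_I_root_def powr_powr flip: powr_numeral)
  have A: "kA k * real (Suc l) powr (2 * real k) * E = E * (rGamma (real k + \<nu> + 1) / fact k * (y\<^sup>2) ^ k)" for k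
  proof -
    have "real (Suc l) powr (2 * real k) = real (Suc l) ^ (2 * k)"
      using powr_realpow[of "real (Suc l)" "2 * k"] by simp
    moreover have "(y\<^sup>2) ^ k = (b / 2) ^ (2 * k) * real (Suc l) ^ (2 * k)"
    proof -
      have "y = b / 2 * real (Suc l)" by (simp add: y_def)
      thus ?thesis by (simp only: power_mult_distrib power_mult[symmetric])
    qed
    moreover have "real k + \<nu> + 1 = real k + 1 + \<nu>" by simp
    ultimately show ?thesis by (simp only: kA_def) simp
  qed
  have B: "kB k * real (Suc l) powr (2 * real k - 2 * \<nu>) * E = E * y powr (- 2 * \<nu>) * (rGamma (real k + - \<nu> + 1) / fact k * (y\<^sup>2) ^ k)" for k
  proof -
    have "y powr (2 * real k) = y ^ (2 * k)" using powr_realpow[OF y, of "2 * k"] by simp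
    hence "y powr (2 * real k - 2 * \<nu>) = y powr (- 2 * \<nu>) * (y\<^sup>2) ^ k"
      using powr_add[of y "- 2 * \<nu>" "2 * real k"] by (simp add: power_mult)
    moreover have "y powr (2 * real k - 2 * \<nu>) = (b / 2) powr (2 * real k - 2 * \<nu>) * real (Suc l) powr (2 * real k - 2 * \<nu>)"
      using powr_mult[of "b / 2" "real (Suc l)" "2 * real k - 2 * \<nu>"] b by (simp add: y_def del: of_nat_Suc)
    moreover have "real k + - \<nu> + 1 = real k + 1 - \<nu>" by simp
    ultimately have e: "(b / 2) powr (2 * real k - 2 * \<nu>) * real (Suc l) powr (2 * real k - 2 * \<nu>) = y powr (- 2 * \<nu>) * (y\<^sup>2) ^ k"
      and e': "real k + - \<nu> + 1 = real k + 1 - \<nu>" by (simp_all only:)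
    have aux: "p * q = r * s \<Longrightarrow> p * g / f * q * E = E * r * (g / f * s)" for p q r s g f :: real
    proof -
      assume "p * q = r * s"
      have "p * g / f * q * E = (p * q) * (g / f * E)" by simp
      thus ?thesis unfolding \<open>p * q = r * s\<close> by simp
    qed
    show ?thesis unfolding kB_def e' by (rule aux[OF e])
  qed
  have sA: "(\<Sum>k. kA k * real (Suc l) powr (2 * real k) * E) = E * bessel_series \<nu> (y\<^sup>2)"
    unfolding A bessel_series_def by (rule suminf_mult[OF summable_bessel_series])
  have sB: "(\<Sum>k. kB k * real (Suc l) powr (2 * real k - 2 * \<nu>) * E) = E * y powr (- 2 * \<nu>) * bessel_series (- \<nu>) (y\<^sup>2)"
    unfolding B bessel_series_def by (rule suminf_mult[OF summable_bessel_series])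
  have x: "b * real (Suc l) > 0" using b by simp
  have K: "bessel_K \<nu> (b * real (Suc l)) = pi / 2 * ((y powr (- \<nu>) * bessel_series (- \<nu>) (y\<^sup>2) - y powr \<nu> * bessel_series \<nu> (y\<^sup>2)) / sin (pi * \<nu>))"
    unfolding bessel_K_nonint[OF x not_int] y_def[symmetric] J ..
  have q: "y powr (- \<nu>) = 1 / y powr \<nu>" "y powr (- 2 * \<nu>) = 1 / y powr \<nu> * (1 / y powr \<nu>)"
    using powr_add[of y "- \<nu>" "- \<nu>"] by (simp_all add: powr_minus_divide)
  have aux: "E / p * (pi / 2 * ((1 / p * u - p * v) / s)) = pi / (2 * s) * (E * (1 / p * (1 / p)) * u - E * v)"
    if "p > 0" "s \<noteq> 0" for p s u v :: real using that by (simp add: field_simps)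
  show ?thesis unfolding lhs_term_def K E_def[symmetric] sA sB y_def[symmetric] q
    by (rule aux) (use y sin_nz in auto)
qed

definition const_term :: real where
  "const_term = pi * csc (pi * \<nu>) / (4 * Gamma (1 + \<nu>))"

definition half_csc :: real where
  "half_csc = 1 / (2 * sin (pi * \<nu>))"

definition total_sum :: "real \<Rightarrow> real" where
  "total_sum a = pi * (RA a - RB a)"

lemma lhs_sums_above:
  assumes a: "b < a" "a < 2 * pi"
  shows "(\<lambda>l. lhs_term \<nu> a b (Suc l)) sums
    (pi * half_csc * (Re (B.fser (of_real a)) - Re (A.fser (of_real a))) + const_term - half_csc * total_sum a)"
proof -
  have a0: "a > 0" using a b by simp
  have sA: "(\<lambda>l. \<Sum>k. kA k * real (Suc l) powr (2 * real k) * exp (- a * real (Suc l))) sums (RA a + Re (A.fser (of_real a)) - kA 0 / 2)"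
    by (intro polylog_sum_swap a0 kA_sums(1) a always_eventually allI less_imp_le kA_pos)
  have sB: "(\<lambda>l. \<Sum>k. kB k * real (Suc l) powr (2 * real k - 2 * \<nu>) * exp (- a * real (Suc l))) sums (RB a + Re (B.fser (of_real a)))"
    by (intro polylog_sum_swap a0 kB_sums(1) a kB_eventually)
  have "(\<lambda>l. lhs_term \<nu> a b (Suc l)) sums (pi / (2 * sin (pi * \<nu>)) * ((RB a + Re (B.fser (of_real a))) - (RA a + Re (A.fser (of_real a)) - kA 0 / 2)))"
    unfolding lhs_term_eq by (rule sums_mult[OF sums_diff[OF sB sA]])
  \<comment> \<open>The half of \<open>kA 0\<close> left over from the row \<open>n = 0\<close>
    becomes \<open>const_term\<close>.\<close>
  moreover have "kA 0 = 1 / Gamma (1 + \<nu>)" by (simp add: kA_def rGamma_inverse_Gamma inverse_eq_divide)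
  hence "const_term = pi * half_csc * (kA 0 / 2)" unfolding const_term_def csc_def half_csc_def by (simp only: times_divide_eq_left times_divide_eq_right divide_divide_eq_left mult_1_right mult_1_left)
  moreover have "pi / (2 * sin (pi * \<nu>)) = pi * half_csc" by (simp add: half_csc_def)
  moreover have "c * h * ((x + y) - (u + v - k / 2)) = c * h * (y - v) + c * h * (k / 2) - h * (c * (u - x))" for c h x y u v k :: real
    by (simp add: algebra_simps)
  ultimately show ?thesis by (simp only: total_sum_def)
qed

section \<open>Continuation in a across b\<close>

definition lhs_coeff :: "nat \<Rightarrow> real" where "lhs_coeff l = lhs_term \<nu> 0 b (Suc l)"

lemma lhs_term_eq_coeff: "lhs_term \<nu> a b (Suc l) = lhs_coeff l * exp (- a * real (Suc l))"
  by (simp add: lhs_term_def lhs_coeff_def)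

lemma lhs_coeff_bounded: "\<exists>M>0. \<forall>l. \<bar>lhs_coeff l\<bar> \<le> M"
proof -
  obtain C where C: "\<And>x. x \<ge> 2 \<Longrightarrow> \<bar>bessel_K \<nu> x\<bar> \<le> C" using bessel_K_bounded[OF nu not_int] by blast
  have "eventually (\<lambda>l. b * real (Suc l) \<ge> 2) sequentially" using b by real_asymp
  hence "eventually (\<lambda>l. norm (lhs_coeff l) \<le> norm C) sequentially"
  proof eventually_elim
    case (elim l)
    have "1 \<le> (b * real (Suc l) / 2) powr \<nu>" using elim nu by (intro ge_one_powr_ge_zero) auto
    hence "\<bar>1 / (b * real (Suc l) / 2) powr \<nu>\<bar> \<le> 1" by (simp add: divide_le_eq_1 del: of_nat_Suc)
    hence "\<bar>lhs_coeff l\<bar> \<le> 1 * \<bar>bessel_K \<nu> (b * real (Suc l))\<bar>"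
      unfolding lhs_coeff_def lhs_term_def abs_mult by (intro mult_right_mono) (auto simp del: of_nat_Suc)
    also have "\<dots> \<le> C" using C[OF elim] by simp
    finally show ?case by simp
  qed
  hence "Bseq lhs_coeff" by (rule Bseq_eventually_mono) simp
  thus ?thesis by (auto simp: Bseq_def)
qed

definition lhs_series :: "complex \<Rightarrow> complex" where
  "lhs_series w = (\<Sum>l. of_real (lhs_coeff l) * exp (- w * of_nat (Suc l)))"

lemma lhs_series_term_bound:
  assumes "\<And>l. \<bar>lhs_coeff l\<bar> \<le> M" "0 < d" "d \<le> Re w"
  shows "norm (of_real (lhs_coeff l) * exp (- w * of_nat (Suc l))) \<le> M * (real (Suc l) powr 0 * exp (- d * real (Suc l)))"
proof -
  have "exp (- (Re w * real (Suc l))) \<le> exp (- d * real (Suc l))" using assms(3) by (simp add: mult_right_mono del: of_nat_Suc)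
  hence "\<bar>lhs_coeff l\<bar> * exp (- (Re w * real (Suc l))) \<le> M * exp (- d * real (Suc l))"
    using assms(1)[of l] by (intro mult_mono) auto
  thus ?thesis by (simp add: norm_mult)
qed

lemma lhs_series_holomorphic: "lhs_series holomorphic_on {w. Re w > 0}"
  unfolding lhs_series_def[abs_def]
proof (rule holomorphic_on_suminf_local)
  show "open {w. Re w > 0}" by (rule open_halfspace_Re_gt)
  obtain M where M: "\<And>l. \<bar>lhs_coeff l\<bar> \<le> M" using lhs_coeff_bounded by blast
  fix x :: complex assume "x \<in> {w. Re w > 0}"
  hence x: "Re x > 0" by simp
  show "\<exists>d h'. 0 < d \<and> summable h' \<and> (\<forall>n. \<forall>y\<in>cball x d \<inter> {w. Re w > 0}. norm (of_real (lhs_coeff n) * exp (- y * of_nat (Suc n))) \<le> h' n)"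
  proof (intro exI conjI allI ballI)
    show "0 < Re x / 2" using x by simp
    show "summable (\<lambda>l. M * (real (Suc l) powr 0 * exp (- (Re x / 2) * real (Suc l))))"
      by (intro summable_mult summable_powr_exp) (use x in simp)
    fix n y assume "y \<in> cball x (Re x / 2) \<inter> {w. Re w > 0}"
    hence "norm (x - y) \<le> Re x / 2" by (simp add: dist_norm)
    hence "Re x / 2 \<le> Re y" using complex_Re_le_cmod[of "x - y"] by simp
    thus "norm (of_real (lhs_coeff n) * exp (- y * of_nat (Suc n))) \<le> M * (real (Suc n) powr 0 * exp (- (Re x / 2) * real (Suc n)))"
      using x by (intro lhs_series_term_bound M) auto
  qed
qed (auto intro!: holomorphic_intros)

lemma lhs_series_of_real:
  assumes a: "a > 0"
  shows "(\<lambda>l. lhs_term \<nu> a b (Suc l)) sums Re (lhs_series (of_real a))" "lhs_series (of_real a) = of_real (Re (lhs_series (of_real a)))"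
proof -
  obtain M where M: "\<And>l. \<bar>lhs_coeff l\<bar> \<le> M" using lhs_coeff_bounded by blast
  have "summable (\<lambda>l. M * (real (Suc l) powr 0 * exp (- a * real (Suc l))))"
    by (intro summable_mult summable_powr_exp a)
  hence "summable (\<lambda>l. complex_of_real (lhs_coeff l) * exp (- of_real a * of_nat (Suc l)))"
    by (rule summable_comparison_test') (use lhs_series_term_bound[OF M a, of "of_real a"] in simp)
  hence "(\<lambda>l. complex_of_real (lhs_coeff l) * exp (- of_real a * of_nat (Suc l))) sums lhs_series (of_real a)"
    unfolding lhs_series_def by (rule summable_sums)
  moreover have "complex_of_real (lhs_coeff l) * exp (- of_real a * of_nat (Suc l)) = of_real (lhs_term \<nu> a b (Suc l))" for l
  proof -
    have "exp (- complex_of_real a * of_nat (Suc l)) = exp (of_real (- a * real (Suc l)))" by simp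
    thus ?thesis unfolding lhs_term_eq_coeff exp_of_real by (simp only: of_real_mult)
  qed
  ultimately have S: "(\<lambda>l. complex_of_real (lhs_term \<nu> a b (Suc l))) sums lhs_series (of_real a)" by simp
  show Sr: "(\<lambda>l. lhs_term \<nu> a b (Suc l)) sums Re (lhs_series (of_real a))" using sums_Re[OF S] by simp
  show "lhs_series (of_real a) = of_real (Re (lhs_series (of_real a)))" by (rule sums_unique2[OF S]) (intro sums_of_real Sr)
qed

text \<open>Evaluation at 1 merely strips the power of \<open>a\<close> from the terms of order
  \<open>j\<close>.\<close>

definition total_coeff :: "nat \<Rightarrow> real" where
  "total_coeff j = pi * ((\<Sum>n. LA 1 j n) - (\<Sum>n. LB 1 j n))"

lemma LA_scale: "LA a j n = a ^ j * LA 1 j n"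
  by (simp add: LA_def power_minus[of a])

lemma LB_scale: "LB a j n = a ^ j * LB 1 j n"
  by (simp add: LB_def power_minus[of a])

text \<open>Of the two orders of summation, the one with \<open>n\<close> inside is a power series
  in \<open>a\<close>. Its convergence for all positive \<open>a < 2 * pi\<close> makes the double
  series holomorphic in the full disc.\<close>

lemma total_sum_sums:
  assumes a: "0 < a" "a < 2 * pi"
  shows "(\<lambda>j. total_coeff j * a ^ j) sums total_sum a"
proof -
  have one: "(0::real) < 1" "1 < 2 * pi" using pi_gt3 by auto
  have sA: "summable (\<lambda>n. LA 1 j n)" and sB: "summable (\<lambda>n. LB 1 j n)" for j
    using double_sums_RA[OF one] double_sums_RB[OF one] by (simp_all add: double_sums_def)
  have A: "(\<Sum>n. LA a j n) = a ^ j * (\<Sum>n. LA 1 j n)" for j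
    unfolding LA_scale[of a] by (rule suminf_mult[OF sA])
  have B: "(\<Sum>n. LB a j n) = a ^ j * (\<Sum>n. LB 1 j n)" for j
    unfolding LB_scale[of a] by (rule suminf_mult[OF sB])
  have "(\<lambda>j. \<Sum>n. LA a j n) sums RA a" "(\<lambda>j. \<Sum>n. LB a j n) sums RB a"
    using double_sums_RA[OF a] double_sums_RB[OF a] unfolding double_sums_def by blast+
  hence "(\<lambda>j. pi * ((\<Sum>n. LA a j n) - (\<Sum>n. LB a j n))) sums total_sum a"
    unfolding total_sum_def by (intro sums_mult sums_diff)
  moreover have "pi * (x * u - x * v) = pi * (u - v) * x" for x u v :: real by (simp add: algebra_simps)
  ultimately show ?thesis unfolding A B total_coeff_def by (simp only:)
qed

definition total_series :: "complex \<Rightarrow> complex" where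
  "total_series w = (\<Sum>j. of_real (total_coeff j) * w ^ j)"

lemma total_series_sums:
  assumes "norm w < 2 * pi"
  shows "(\<lambda>j. of_real (total_coeff j) * w ^ j) sums total_series w"
proof -
  obtain r where r: "norm w < r" "r < 2 * pi" using dense[OF assms] by blast
  have "r > 0" using r(1) norm_ge_zero[of w] by linarith
  hence "summable (\<lambda>j. total_coeff j * r ^ j)" using total_sum_sums[of r] r by (simp add: sums_iff)
  hence "summable (\<lambda>j. complex_of_real (total_coeff j * r ^ j))" by (rule summable_of_real)
  hence "summable (\<lambda>j. complex_of_real (total_coeff j) * of_real r ^ j)" by simp
  hence "summable (\<lambda>j. norm (complex_of_real (total_coeff j) * w ^ j))"
    by (rule powser_insidea) (use r \<open>r > 0\<close> in simp)
  thus ?thesis unfolding total_series_def by (rule summable_sums[OF summable_norm_cancel])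
qed

lemma total_series_holomorphic: "total_series holomorphic_on ball 0 (2 * pi)"
  by (rule power_series_holomorphic[where a = "\<lambda>j. of_real (total_coeff j)"]) (use total_series_sums in simp)

lemma total_series_of_real:
  assumes a: "0 < a" "a < 2 * pi"
  shows "total_series (of_real a) = of_real (total_sum a)"
proof (rule sums_unique2)
  show "(\<lambda>j. of_real (total_coeff j) * of_real a ^ j) sums total_series (of_real a)" by (rule total_series_sums) (use a in simp)
  show "(\<lambda>j. complex_of_real (total_coeff j) * of_real a ^ j) sums of_real (total_sum a)"
    using sums_of_real[OF total_sum_sums[OF a], where ?'a = complex] by simp
qed

definition half_disc :: "complex set" where "half_disc = {w. Re w > 0} \<inter> ball 0 (2 * pi)"

text \<open>Agrees with \<open>singular_terms\<close> on \<open>(0, b)\<close>, but is regular at \<open>b\<close>.\<close>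

definition corrected_series :: "complex \<Rightarrow> complex" where
  "corrected_series w = lhs_series w - of_real const_term + of_real half_csc * total_series w"

lemma open_half_disc: "open half_disc" unfolding half_disc_def by (intro open_Int open_halfspace_Re_gt open_ball)

lemma connected_half_disc: "connected half_disc"
  unfolding half_disc_def by (intro convex_connected convex_Int convex_halfspace_Re_gt convex_ball)

lemma corrected_series_holomorphic: "corrected_series holomorphic_on half_disc"
  unfolding corrected_series_def[abs_def]
  by (intro holomorphic_intros holomorphic_on_subset[OF lhs_series_holomorphic] holomorphic_on_subset[OF total_series_holomorphic]) (auto simp: half_disc_def)

lemma corrected_series_of_real:
  assumes a: "0 < a" "a < 2 * pi"
  shows "corrected_series (of_real a) = of_real (Re (corrected_series (of_real a)))"
    and "(\<lambda>l. lhs_term \<nu> a b (Suc l)) sums (Re (corrected_series (of_real a)) + const_term - half_csc * total_sum a)"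
proof -
  have Y: "corrected_series (of_real a) = of_real (Re (lhs_series (of_real a)) - const_term + half_csc * total_sum a)"
    unfolding corrected_series_def total_series_of_real[OF a] by (subst lhs_series_of_real(2)[OF a(1)]) simp
  show "corrected_series (of_real a) = of_real (Re (corrected_series (of_real a)))" unfolding Y by simp
  have "Re (lhs_series (of_real a)) = Re (corrected_series (of_real a)) + const_term - half_csc * total_sum a" unfolding Y by simp
  thus "(\<lambda>l. lhs_term \<nu> a b (Suc l)) sums (Re (corrected_series (of_real a)) + const_term - half_csc * total_sum a)"
    using lhs_series_of_real(1)[OF a(1)] by simp
qed

definition fser_combination :: "complex \<Rightarrow> complex" where
  "fser_combination w = of_real (pi * half_csc) * (B.fser w - A.fser w)"

lemma corrected_series_eq_fser_combination:
  assumes a: "b < a" "a < 2 * pi"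
  shows "corrected_series (of_real a) = fser_combination (of_real a)"
proof -
  have a0: "0 < a" using a b by simp
  have "Re (corrected_series (of_real a)) = pi * half_csc * (Re (B.fser (of_real a)) - Re (A.fser (of_real a)))"
    \<comment> \<open>Two evaluations of the same Bessel sum, one through its holomorphic extension
      and one through termwise summation.\<close>
    using sums_unique2[OF corrected_series_of_real(2)[OF a0 a(2)] lhs_sums_above[OF a]] by simp
  hence "corrected_series (of_real a) = of_real (pi * half_csc * (Re (B.fser (of_real a)) - Re (A.fser (of_real a))))"
    using corrected_series_of_real(1)[OF a0 a(2)] by simp
  hence "corrected_series (of_real a) = of_real (pi * half_csc) * (of_real (Re (B.fser (of_real a))) - of_real (Re (A.fser (of_real a))))"
    by (simp only: of_real_mult of_real_diff)
  thus ?thesis unfolding fser_combination_def by (simp only: kA_sums(2)[OF a, symmetric] kB_sums(2)[OF a, symmetric])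
qed

text \<open>The reflection formula turns the cosecant into
  \<open>Gamma \<nu> * Gamma (1 - \<nu>)\<close>; the first factor cancels with the coefficient of
  the A family.\<close>

lemma Gamma_const: "pi * half_csc * (2 * \<nu> * cA 0) = Gamma (1 - \<nu>)"
proof -
  have "cA 0 = 1 / Gamma (1 + \<nu>)" by (simp add: cA_def Gamma_one_half_real)
  moreover have "Gamma (\<nu> + 1) = \<nu> * Gamma \<nu>" using nu by (intro Gamma_plus1) (auto elim!: nonpos_Ints_cases)
  hence "Gamma (1 + \<nu>) = \<nu> * Gamma \<nu>" by (simp add: add.commute)
  moreover have "Gamma \<nu> \<noteq> 0" using Gamma_real_pos[OF nu] by simp
  moreover have "pi * half_csc = Gamma \<nu> * Gamma (1 - \<nu>) / 2"
    unfolding real_Gamma_reflection by (simp add: half_csc_def)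
  moreover have "g * g' / 2 * (2 * \<nu> * (1 / (\<nu> * g))) = g'" if "g \<noteq> 0" for g g' :: real
    using that nu by simp
  ultimately show ?thesis by (simp only:)
qed

lemma fser_combination_ode:
  assumes w: "norm w > b" "w \<notin> \<real>\<^sub>\<le>\<^sub>0"
  shows "\<exists>Z'. (fser_combination has_field_derivative Z') (at w) \<and> (w\<^sup>2 - of_real (b\<^sup>2)) * Z' - of_real (2 * \<nu> - 1) * w * fser_combination w = of_real (Gamma (1 - \<nu>))"
proof -
  obtain A' where A': "(A.fser has_field_derivative A') (at w)"
    "(w\<^sup>2 - of_real (b\<^sup>2)) * A' - 2 * of_real (\<nu> - 1/2) * w * A.fser w = of_real (- (2 * \<nu>) * cA 0)"
    using A.fser_ode[OF w] by blast
  obtain B' where B': "(B.fser has_field_derivative B') (at w)"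
    "(w\<^sup>2 - of_real (b\<^sup>2)) * B' - 2 * of_real (\<nu> - 1/2) * w * B.fser w = of_real 0"
    using B.fser_ode[OF w] by blast
  have m: "complex_of_real (2 * \<nu> - 1) = 2 * of_real (\<nu> - 1/2)" by simp
  show ?thesis
  proof (intro exI conjI)
    show "(fser_combination has_field_derivative of_real (pi * half_csc) * (B' - A')) (at w)"
      unfolding fser_combination_def[abs_def] by (intro DERIV_cmult DERIV_diff A' B')
    have alg: "u * (c * (B' - A')) - v * x * (c * (q - p)) = c * ((u * B' - v * x * q) - (u * A' - v * x * p))"
      for u c v x p q :: complex by (simp add: algebra_simps)
    have "of_real (pi * half_csc) * (of_real 0 - of_real (- (2 * \<nu>) * cA 0)) = complex_of_real (Gamma (1 - \<nu>))"
      unfolding Gamma_const[symmetric] by simp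
    thus "(w\<^sup>2 - of_real (b\<^sup>2)) * (of_real (pi * half_csc) * (B' - A')) - of_real (2 * \<nu> - 1) * w * fser_combination w = of_real (Gamma (1 - \<nu>))"
      unfolding fser_combination_def m alg A'(2) B'(2) .
  qed
qed

text \<open>The disc has the interval from \<open>b\<close> to \<open>2 * pi\<close> as diameter. It
  lies in \<open>half_disc\<close>, and its points have real part greater than \<open>b\<close>, so
  the two series at infinity converge there and the identity on the diameter carries over.\<close>

lemma corrected_series_ode_ball:
  assumes w: "w \<in> ball (of_real ((b + 2 * pi) / 2)) ((2 * pi - b) / 2)"
  shows "w \<in> half_disc" "(w\<^sup>2 - of_real (b\<^sup>2)) * deriv corrected_series w - of_real (2 * \<nu> - 1) * w * corrected_series w = of_real (Gamma (1 - \<nu>))"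
proof -
  define D :: "complex set" where "D = ball (of_real ((b + 2 * pi) / 2)) ((2 * pi - b) / 2)"
  have D: "Re z > b \<and> norm z < 2 * pi" if "z \<in> D" for z
  proof
    have n: "norm (of_real ((b + 2 * pi) / 2) - z) < (2 * pi - b) / 2" using that by (simp add: D_def dist_norm)
    have "Re (of_real ((b + 2 * pi) / 2) - z) < (2 * pi - b) / 2"
      using complex_Re_le_cmod[of "of_real ((b + 2 * pi) / 2) - z"] n by linarith
    hence "(b + 2 * pi) / 2 - Re z < (2 * pi - b) / 2" by (simp only: minus_complex.sel Re_complex_of_real)
    thus "Re z > b" by (simp add: field_simps)
    have "norm z \<le> norm (complex_of_real ((b + 2 * pi) / 2)) + norm (of_real ((b + 2 * pi) / 2) - z)"
      using norm_triangle_sub[of z "complex_of_real ((b + 2 * pi) / 2)"] by (simp only: norm_minus_commute)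
    also have "norm (complex_of_real ((b + 2 * pi) / 2)) = (b + 2 * pi) / 2" unfolding norm_of_real using b by simp
    finally show "norm z < 2 * pi" using n by (simp add: field_simps)
  qed
  have DU: "D \<subseteq> half_disc" using D b by (force simp: half_disc_def)
  show "w \<in> half_disc" using DU w by (auto simp: D_def)
  have Dw: "norm z > b \<and> z \<notin> \<real>\<^sub>\<le>\<^sub>0" if "z \<in> D" for z
    using D[OF that] complex_Re_le_cmod[of z] b by (auto simp: complex_nonpos_Reals_iff)
  have dZ: "fser_combination field_differentiable (at z)" if "z \<in> D" for z
  proof -
    have "\<exists>Z'. (fser_combination has_field_derivative Z') (at z)" using fser_combination_ode[of z] Dw[OF that] by blast
    thus ?thesis unfolding field_differentiable_def .
  qed
  have hZ: "fser_combination holomorphic_on D"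
    by (rule holomorphic_onI, rule field_differentiable_at_within, rule dZ)
  have eq: "corrected_series z - fser_combination z = 0" if "z \<in> D" for z
  proof (rule analytic_continuation[where f = "\<lambda>z. corrected_series z - fser_combination z" and S = D and U = "of_real ` {b<..<2 * pi}" and \<xi> = "of_real ((b + 2 * pi) / 2)"])
    show "(\<lambda>z. corrected_series z - fser_combination z) holomorphic_on D" by (intro holomorphic_intros hZ holomorphic_on_subset[OF corrected_series_holomorphic] DU)
    show "open D" "connected D" by (simp_all add: D_def)
    show "complex_of_real ((b + 2 * pi) / 2) \<in> D" using b by (simp add: D_def)
    show "complex_of_real ` {b<..<2 * pi} \<subseteq> D"
    proof safe
      fix x :: real assume "x \<in> {b<..<2 * pi}"
      hence "\<bar>(b + 2 * pi) / 2 - x\<bar> < (2 * pi - b) / 2" by (auto simp: abs_if field_simps)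
      thus "complex_of_real x \<in> D" unfolding D_def mem_ball dist_of_real dist_real_def .
    qed
    have "(b + 2 * pi) / 2 islimpt {b<..<2 * pi}" using b by (intro interior_limit_point) (simp add: interior_open)
    thus "complex_of_real ((b + 2 * pi) / 2) islimpt of_real ` {b<..<2 * pi}"
      by (rule islimpt_isCont_image) (simp_all only: of_real_eq_iff eventually_at_filter continuous_of_real continuous_ident, intro always_eventually allI impI)
    show "corrected_series z - fser_combination z = 0" if "z \<in> complex_of_real ` {b<..<2 * pi}" for z using that corrected_series_eq_fser_combination by auto
  qed fact
  have wD: "w \<in> D" using w by (simp add: D_def)
  obtain Z' where Z': "(fser_combination has_field_derivative Z') (at w)" "(w\<^sup>2 - of_real (b\<^sup>2)) * Z' - of_real (2 * \<nu> - 1) * w * fser_combination w = of_real (Gamma (1 - \<nu>))"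
    using fser_combination_ode[of w] Dw[OF wD] by blast
  have "(corrected_series has_field_derivative Z') (at w)"
    by (rule has_field_derivative_transform_within_open[OF Z'(1), of D]) (use eq wD in \<open>auto simp: D_def\<close>)
  hence "deriv corrected_series w = Z'" by (rule DERIV_imp_deriv)
  moreover have "corrected_series w = fser_combination w" using eq[OF wD] by simp
  ultimately show "(w\<^sup>2 - of_real (b\<^sup>2)) * deriv corrected_series w - of_real (2 * \<nu> - 1) * w * corrected_series w = of_real (Gamma (1 - \<nu>))"
    using Z'(2) by simp
qed

sublocale ode: bessel_ode \<nu> b half_disc corrected_series
proof
  show "0 < b" "2 * \<nu> \<notin> \<int>" by (rule b half)+
  show "open half_disc" by (rule open_half_disc)
  show "half_disc \<subseteq> {w. Re w > 0}" by (auto simp: half_disc_def)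
  show "of_real ` {0<..b} \<subseteq> half_disc" using b by (auto simp: half_disc_def)
  show "corrected_series holomorphic_on half_disc" by (rule corrected_series_holomorphic)
  let ?G = "\<lambda>w. (w\<^sup>2 - of_real (b\<^sup>2)) * deriv corrected_series w - of_real (2 * \<nu> - 1) * w * corrected_series w - of_real (Gamma (1 - \<nu>))"
  let ?D = "ball (complex_of_real ((b + 2 * pi) / 2)) ((2 * pi - b) / 2)"
  \<comment> \<open>The equation is itself a holomorphic identity, so it spreads from the disc to
    the right of \<open>b\<close> over all of \<open>half_disc\<close>, past the singular point and
    down to positive \<open>a < b\<close>.\<close>
  have G: "?G w = 0" if "w \<in> half_disc" for w
  proof (rule analytic_continuation_open[where f = ?G and g = "\<lambda>_. 0" and s = ?D and s' = half_disc])
    show "?G holomorphic_on half_disc"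
      by (intro holomorphic_intros corrected_series_holomorphic holomorphic_deriv open_half_disc)
    show "?D \<noteq> {}" using b by simp
    show "?D \<subseteq> half_disc" using corrected_series_ode_ball(1) by blast
    show "?G z = 0" if "z \<in> ?D" for z using corrected_series_ode_ball(2)[OF that] by simp
  qed (use that in \<open>simp_all add: open_half_disc connected_half_disc\<close>)
  show "(w\<^sup>2 - of_real (b\<^sup>2)) * deriv corrected_series w - of_real (2 * \<nu> - 1) * w * corrected_series w = of_real (Gamma (1 - \<nu>))" if "w \<in> half_disc" for w
    using G[OF that] by simp
qed

lemma lhs_sums_below:
  assumes a: "0 < a" "a < b"
  shows "(\<lambda>l. lhs_term \<nu> a b (Suc l)) sums (singular_terms \<nu> a b + const_term - half_csc * total_sum a)"
proof -
  have "Re (corrected_series (of_real a)) = singular_terms \<nu> a b" using ode.eq_singular_terms[OF a] by simp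
  thus ?thesis using corrected_series_of_real(2)[of a] a b by simp
qed

lemma lhs_sums_diagonal:
  "(\<lambda>l. lhs_term \<nu> b b (Suc l)) sums (Re (corrected_series (of_real b)) + const_term - half_csc * total_sum b)"
  using corrected_series_of_real(2)[of b] b by simp

text \<open>For \<open>\<nu> < 1/2\<close> both singular terms diverge at \<open>b\<close>; the
  limit of their combination exists because it is the value of a function that is holomorphic at
  \<open>b\<close>.\<close>

lemma singular_terms_tendsto: "((\<lambda>t. singular_terms \<nu> t b) \<longlongrightarrow> Re (corrected_series (of_real b))) (at_left b)"
proof (rule Lim_transform_eventually)
  have "isCont corrected_series (of_real b)"
    using holomorphic_on_imp_continuous_on[OF corrected_series_holomorphic] ode.in_U[OF b(1) order_refl]
    unfolding continuous_on_eq_continuous_at[OF open_half_disc] by (rule bspec)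
  hence "(corrected_series \<longlongrightarrow> corrected_series (of_real b)) (nhds (of_real b))" by (simp add: isCont_def tendsto_at_iff_tendsto_nhds)
  moreover have "filterlim (\<lambda>t. complex_of_real t) (nhds (of_real b)) (at_left b)" by (intro tendsto_intros)
  ultimately show "((\<lambda>t. Re (corrected_series (of_real t))) \<longlongrightarrow> Re (corrected_series (of_real b))) (at_left b)"
    by (intro tendsto_Re) (rule filterlim_compose)
  have "eventually (\<lambda>t. t \<in> {0<..<b}) (at_left b)" by (rule eventually_at_left_real[OF b(1)])
  thus "eventually (\<lambda>t. Re (corrected_series (of_real t)) = singular_terms \<nu> t b) (at_left b)"
    by eventually_elim (use ode.eq_singular_terms in simp)
qed

end

section \<open>The boundary case a = b\<close>

lemma summable_hyp_coeff:
  assumes "\<nu> > 1/2" "2 * \<nu> \<notin> \<int>"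
  shows "summable (\<lambda>k. \<bar>hyp_coeff \<nu> k\<bar>)"
proof (rule raabes_test_convergence)
  \<comment> \<open>Raabe's test needs nonzero terms; a vanishing Pochhammer symbol would make
    \<open>\<nu>\<close> a positive integer.\<close>
  have nz: "hyp_coeff \<nu> k \<noteq> 0" for k
  proof
    assume "hyp_coeff \<nu> k = 0"
    hence "pochhammer (1 - \<nu>) k = 0" using pochhammer_three_halves_pos[of k] by (simp add: hyp_coeff_def)
    then obtain j where "1 - \<nu> = - real j" by (auto simp: pochhammer_eq_0_iff)
    hence "2 * \<nu> = of_nat (2 * (j + 1))" by simp
    thus False using assms(2) by (metis Ints_of_nat)
  qed
  thus "eventually (\<lambda>k. \<bar>hyp_coeff \<nu> k\<bar> > 0) sequentially" by simp
  have "eventually (\<lambda>k. real k > \<nu>) sequentially" by real_asymp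
  hence ev: "eventually (\<lambda>k. real k * ((real k + 3/2) / (real k + 1 - \<nu>) - 1) = of_nat k * (\<bar>hyp_coeff \<nu> k\<bar> / \<bar>hyp_coeff \<nu> (Suc k)\<bar> - 1)) sequentially"
  proof eventually_elim
    case (elim k)
    have aux: "\<bar>x\<bar> / \<bar>y\<bar> = u / v" if "y * u = x * v" "u > 0" "v > 0" "y \<noteq> 0" for x y u v :: real
    proof -
      have "x = y * (u / v)" using that by (simp add: field_simps)
      hence "\<bar>x\<bar> = \<bar>y\<bar> * (u / v)" using that(2,3) by (simp only: abs_mult abs_divide abs_of_pos)
      thus ?thesis using that by simp
    qed
    show ?case using aux[OF hyp_coeff_Suc[of \<nu> k]] elim nz by simp
  qed
  \<comment> \<open>The quotient of consecutive terms tends to 1, so the ratio test decides nothing.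
    The Raabe limit \<open>\<nu> + 1/2\<close> exceeds 1 exactly when
    \<open>\<nu> > 1/2\<close>.\<close>
  have "(\<lambda>k. real k * ((real k + 3/2) / (real k + 1 - \<nu>) - 1)) \<longlonglongrightarrow> \<nu> + 1/2" by real_asymp
  hence "(\<lambda>k. of_nat k * (\<bar>hyp_coeff \<nu> k\<bar> / \<bar>hyp_coeff \<nu> (Suc k)\<bar> - 1)) \<longlonglongrightarrow> \<nu> + 1/2"
    using ev by (rule Lim_transform_eventually)
  hence "(\<lambda>k. ereal (of_nat k * (\<bar>hyp_coeff \<nu> k\<bar> / \<bar>hyp_coeff \<nu> (Suc k)\<bar> - 1))) \<longlonglongrightarrow> ereal (\<nu> + 1/2)"
    by (intro tendsto_intros)
  hence "liminf (\<lambda>k. ereal (of_nat k * (\<bar>hyp_coeff \<nu> k\<bar> / \<bar>hyp_coeff \<nu> (Suc k)\<bar> - 1))) = ereal (\<nu> + 1/2)"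
    by (intro lim_imp_Liminf) auto
  thus "liminf (\<lambda>k. ereal (of_nat k * (\<bar>hyp_coeff \<nu> k\<bar> / \<bar>hyp_coeff \<nu> (Suc k)\<bar> - 1))) > 1"
    using assms(1) by simp
qed

lemma singular_terms_left_continuous:
  assumes nu: "\<nu> > 1/2" "2 * \<nu> \<notin> \<int>" and b: "b > 0"
  shows "((\<lambda>t. singular_terms \<nu> t b) \<longlongrightarrow> singular_terms \<nu> b b) (at_left b)"
proof -
  have t: "((\<lambda>t. t) \<longlongrightarrow> b) (at_left b)" by (rule tendsto_ident_at)
  have z: "((\<lambda>t. t\<^sup>2 / b\<^sup>2) \<longlongrightarrow> b\<^sup>2 / b\<^sup>2) (at_left b)"
    by (intro tendsto_intros t) (use b in simp)
  have "eventually (\<lambda>t. t \<in> {0<..<b}) (at_left b)" by (rule eventually_at_left_real[OF b])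
  hence ev: "eventually (\<lambda>t. t\<^sup>2 / b\<^sup>2 \<in> {0..1}) (at_left b)"
    by eventually_elim (use b in \<open>auto simp: divide_le_eq_1 intro!: power_mono\<close>)
  \<comment> \<open>Absolute convergence at 1 gives uniform convergence on the closed interval,
    hence continuity of the hypergeometric function up to the endpoint.\<close>
  have "uniform_limit {0..1::real} (\<lambda>n z. \<Sum>k<n. hyp_coeff \<nu> k * z ^ k) (\<lambda>z. \<Sum>k. hyp_coeff \<nu> k * z ^ k) sequentially"
  proof (rule Weierstrass_m_test[OF _ summable_hyp_coeff[OF nu]])
    fix k and z :: real assume z: "z \<in> {0..1}"
    hence "\<bar>hyp_coeff \<nu> k\<bar> * z ^ k \<le> \<bar>hyp_coeff \<nu> k\<bar> * 1" by (intro mult_left_mono power_le_one) auto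
    thus "norm (hyp_coeff \<nu> k * z ^ k) \<le> \<bar>hyp_coeff \<nu> k\<bar>" using z by (simp add: abs_mult)
  qed
  hence "continuous_on {0..1} (\<lambda>z. \<Sum>k. hyp_coeff \<nu> k * z ^ k)"
    by (rule uniform_limit_theorem[rotated]) (auto intro!: always_eventually continuous_intros)
  hence "continuous_on {0..1} (hyp2F1 1 (1 - \<nu>) (3/2))" unfolding hyp2F1_eq[abs_def] .
  hence H: "((\<lambda>t. hyp2F1 1 (1 - \<nu>) (3/2) (t\<^sup>2 / b\<^sup>2)) \<longlongrightarrow> hyp2F1 1 (1 - \<nu>) (3/2) (b\<^sup>2 / b\<^sup>2)) (at_left b)"
    by (rule continuous_on_tendsto_compose[OF _ z _ ev]) (use b in simp)
  \<comment> \<open>The base tends to 0 through nonnegative values; the exponent is positive, so the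
    power is continuous there with value 0.\<close>
  have P: "((\<lambda>t. (1 - t\<^sup>2 / b\<^sup>2) powr (\<nu> - 1/2)) \<longlongrightarrow> (1 - b\<^sup>2 / b\<^sup>2) powr (\<nu> - 1/2)) (at_left b)"
  proof (rule tendsto_powr'[OF tendsto_diff[OF tendsto_const z] tendsto_const], rule disjI2, rule conjI)
    show "eventually (\<lambda>t. 0 \<le> 1 - t\<^sup>2 / b\<^sup>2) (at_left b)" using ev by eventually_elim simp
  qed (use nu in simp)
  show ?thesis unfolding singular_terms_def
    by (intro tendsto_diff tendsto_mult tendsto_divide tendsto_const t P H) (use b in simp)
qed

context bessel_sum
begin

lemma singular_terms_diagonal: "\<nu> > 1/2 \<Longrightarrow> Re (corrected_series (of_real b)) = singular_terms \<nu> b b"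
  by (rule tendsto_unique[OF _ singular_terms_tendsto singular_terms_left_continuous]) (use half b in simp_all)

lemma LA_even: "LA a (2 * m) n = 0"
proof -
  \<comment> \<open>The argument is an odd multiple of \<open>pi / 2\<close>. In terms of zeta these
    are the trivial zeros at the negative even integers, apart from \<open>m = n = 0\<close>, whose
    value -1/2 is accounted for in \<open>LA_row\<close>.\<close>
  have "cos (pi * (2 * real n + 1 + real (2 * m)) / 2) = 0"
    using cos_pi_eq_zero[of "n + m"] by (simp add: algebra_simps)
  thus ?thesis unfolding LA_def lipschitz_coeff_def by (simp only: mult_zero_right mult_zero_left)
qed

lemma double_sums_double_term:
  assumes a: "0 < a" "a < 2 * pi"
  shows "double_sums (double_term \<nu> a b) (total_sum a)"
proof -
  have "double_sums (\<lambda>m n. pi * LA a (2 * m + 1) n + - pi * LB a m n) (pi * RA a + - pi * RB a)"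
    \<comment> \<open>The index \<open>m\<close> of the A family counts only the odd powers of
      \<open>a\<close>, that of the B family counts all powers; dropping the vanishing even orders
      of \<open>LA\<close> allows the two to be added index by index.\<close>
    by (intro double_sums_add double_sums_cmult double_sums_RB a double_sums_odd double_sums_RA LA_even)
  moreover have "double_term \<nu> a b = (\<lambda>m n. pi * LA a (2 * m + 1) n + - pi * LB a m n)"
    unfolding double_term_def[abs_def] distrib_left A_term_eq B_term_eq ..
  moreover have "pi * RA a + - pi * RB a = total_sum a" by (simp add: total_sum_def algebra_simps)
  ultimately show ?thesis by (simp only:)
qed

lemma C_term_sums:
  assumes a: "0 < a" "a < 2 * pi"
  shows "summable (C_term \<nu> b m)"
    and "(- 1) ^ m * (a / (2 * pi)) ^ (2 * m + 1) * coeff_C \<nu> b m = pi * (\<Sum>n. LA a (2 * m + 1) n)"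
proof -
  define c where "c = (- 1) ^ m * (a / (2 * pi)) ^ (2 * m + 1)"
  have c: "c \<noteq> 0" using a by (simp add: c_def)
  have eq: "c * C_term \<nu> b m n = pi * LA a (2 * m + 1) n" for n
    unfolding A_term_eq[symmetric] by (simp add: c_def C_term_def power_add mult_ac)
  have "summable (LA a (2 * m + 1))" using double_sums_RA[OF a] by (simp add: double_sums_def)
  hence s: "summable (\<lambda>n. c * C_term \<nu> b m n)" "(\<Sum>n. c * C_term \<nu> b m n) = pi * (\<Sum>n. LA a (2 * m + 1) n)"
    unfolding eq by (rule summable_mult, rule suminf_mult)
  show "summable (C_term \<nu> b m)" using s(1) c by (simp add: summable_cmult_iff)
  thus "(- 1) ^ m * (a / (2 * pi)) ^ (2 * m + 1) * coeff_C \<nu> b m = pi * (\<Sum>n. LA a (2 * m + 1) n)"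
    using s(2) unfolding c_def[symmetric] coeff_C_def by (simp only: suminf_mult)
qed

lemma C_prime_term_sums:
  assumes a: "0 < a" "a < 2 * pi"
  shows "summable (C_prime_term \<nu> b m)"
    and "(- 1) ^ m * (a / (2 * pi)) ^ m * coeff_C_prime \<nu> b m = - pi * (\<Sum>n. LB a m n)"
proof -
  define c where "c = (- 1) ^ m * (a / (2 * pi)) ^ m"
  have c: "c \<noteq> 0" using a by (simp add: c_def)
  have eq: "c * C_prime_term \<nu> b m n = - pi * LB a m n" for n
    unfolding B_term_eq[symmetric] by (simp add: c_def C_prime_term_def power_add mult_ac)
  have "summable (LB a m)" using double_sums_RB[OF a] by (simp add: double_sums_def)
  hence s: "summable (\<lambda>n. c * C_prime_term \<nu> b m n)" "(\<Sum>n. c * C_prime_term \<nu> b m n) = - pi * (\<Sum>n. LB a m n)"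
    unfolding eq by (rule summable_mult, rule suminf_mult)
  show "summable (C_prime_term \<nu> b m)" using s(1) c by (simp add: summable_cmult_iff)
  thus "(- 1) ^ m * (a / (2 * pi)) ^ m * coeff_C_prime \<nu> b m = - pi * (\<Sum>n. LB a m n)"
    using s(2) unfolding c_def[symmetric] coeff_C_prime_def by (simp only: suminf_mult)
qed

lemma coeff_D_sums:
  assumes a: "0 < a" "a < 2 * pi"
  shows "(\<lambda>k. (- 1) ^ k * coeff_D \<nu> b k * (a / (2 * pi)) ^ k) sums total_sum a"
proof -
  have "(\<lambda>j. \<Sum>n. LA a j n) sums RA a" "(\<lambda>j. \<Sum>n. LB a j n) sums RB a"
    using double_sums_RA[OF a] double_sums_RB[OF a] unfolding double_sums_def by blast+
  hence "(\<lambda>j. pi * (\<Sum>n. LA a j n) + - pi * (\<Sum>n. LB a j n)) sums (pi * RA a + - pi * RB a)"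
    by (intro sums_add sums_mult)
  moreover have D: "(- 1) ^ k * coeff_D \<nu> b k * (a / (2 * pi)) ^ k = pi * (\<Sum>n. LA a k n) + - pi * (\<Sum>n. LB a k n)" for k
  proof (cases "even k")
    case True
    then obtain i where i: "k = 2 * i" by (elim evenE)
    have "(\<Sum>n. LA a k n) = 0" by (simp add: i LA_even)
    thus ?thesis using True C_prime_term_sums(2)[OF a, of k] by (simp add: coeff_D_def mult_ac)
  next
    case False
    then obtain i where i: "k = 2 * i + 1" by (elim oddE)
    \<comment> \<open>For \<open>i = 0\<close> the exponent is -1, hence the integral power.\<close>
    have "(- 1) powi (int i - 1) = - ((- 1) ^ i :: real)" by (simp add: power_int_diff)
    moreover have "k div 2 = i" by (simp add: i)
    ultimately have D: "coeff_D \<nu> b k = coeff_C_prime \<nu> b k - (- 1) ^ i * coeff_C \<nu> b i"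
      using False by (simp add: coeff_D_def)
    \<comment> \<open>The sign of the odd order \<open>k\<close> meets the minus sign in front of
      the coefficient of the A family; together they leave the sign with exponent \<open>i\<close>
      that this family has in the double series.\<close>
    have "(- 1) ^ k = (- 1 :: real)" using False by simp
    hence "(- 1) ^ k * coeff_D \<nu> b k * (a / (2 * pi)) ^ k
       = (- 1) ^ k * (a / (2 * pi)) ^ k * coeff_C_prime \<nu> b k + (- 1) ^ i * (a / (2 * pi)) ^ (2 * i + 1) * coeff_C \<nu> b i"
      unfolding D i[symmetric] by (simp add: algebra_simps)
    thus ?thesis unfolding C_term_sums(2)[OF a] C_prime_term_sums(2)[OF a] by (simp add: i)
  qed
  moreover have "pi * RA a + - pi * RB a = total_sum a" by (simp add: total_sum_def algebra_simps)
  ultimately show ?thesis unfolding D by (simp only:)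
qed

end

theorem theorem3:
  fixes a b \<nu> :: real
  assumes "a > 0" and "b > 0" and "\<nu> \<ge> 0"
    and "\<And>k::nat. \<nu> \<noteq> real k / 2"
    and "a \<le> b" and "a < 2 * pi" and "b < 2 * pi"
  shows "\<exists>R. double_sums (double_term \<nu> a b) R \<and>
      (a < b \<or> \<nu> > 1/2 \<longrightarrow>
        (\<lambda>n. lhs_term \<nu> a b (Suc n)) sums
          (singular_terms \<nu> a b + pi * csc (pi * \<nu>) / (4 * Gamma (1 + \<nu>))
            - 1 / (2 * sin (pi * \<nu>)) * R)) \<and>
      (a = b \<and> \<nu> < 1/2 \<longrightarrow>
        (\<exists>L. ((\<lambda>t. singular_terms \<nu> t b) \<longlongrightarrow> L) (at_left b) \<and>
          (\<lambda>n. lhs_term \<nu> a b (Suc n)) sums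
            (L + pi * csc (pi * \<nu>) / (4 * Gamma (1 + \<nu>))
              - 1 / (2 * sin (pi * \<nu>)) * R))) \<and>
      (\<forall>k. summable (C_term \<nu> b k) \<and> summable (C_prime_term \<nu> b k)) \<and>
      (\<lambda>k. (-1) ^ k * coeff_D \<nu> b k * (a / (2 * pi)) ^ k) sums R"
proof -
  have "\<nu> > 0" using assms(3) assms(4)[of 0] by simp
  moreover have "2 * \<nu> \<notin> \<int>"
  proof
    assume "2 * \<nu> \<in> \<int>"
    then obtain i where i: "2 * \<nu> = of_int i" by (elim Ints_cases)
    hence "real_of_int i \<ge> 0" using assms(3) by linarith
    hence "\<nu> = real (nat i) / 2" using i by simp
    thus False using assms(4) by blast
  qed
  ultimately interpret bessel_sum \<nu> b using assms by unfold_locales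
  show ?thesis
  proof (rule exI[of _ "total_sum a"], intro conjI impI allI)
    show "double_sums (double_term \<nu> a b) (total_sum a)"
      by (intro double_sums_double_term assms)
    assume "a < b \<or> \<nu> > 1/2"
    hence "(\<lambda>n. lhs_term \<nu> a b (Suc n)) sums (singular_terms \<nu> a b + const_term - half_csc * total_sum a)"
    proof (cases "a < b")
      case True
      thus ?thesis using lhs_sums_below assms by simp
    next
      case False
      hence "a = b" "\<nu> > 1/2" using assms \<open>a < b \<or> \<nu> > 1/2\<close> by auto
      thus ?thesis using lhs_sums_diagonal singular_terms_diagonal by simp
    qed
    thus "(\<lambda>n. lhs_term \<nu> a b (Suc n)) sums (singular_terms \<nu> a b + pi * csc (pi * \<nu>) / (4 * Gamma (1 + \<nu>)) - 1 / (2 * sin (pi * \<nu>)) * total_sum a)"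
      unfolding const_term_def half_csc_def .
  next
    \<comment> \<open>The second summand of \<open>singular_terms\<close> is a divergent series at
      this point, so only the limit from the left is meaningful; the sum itself is evaluated with
      the holomorphic function at \<open>b\<close>.\<close>
    assume "a = b \<and> \<nu> < 1/2"
    thus "\<exists>L. ((\<lambda>t. singular_terms \<nu> t b) \<longlongrightarrow> L) (at_left b) \<and>
          (\<lambda>n. lhs_term \<nu> a b (Suc n)) sums
            (L + pi * csc (pi * \<nu>) / (4 * Gamma (1 + \<nu>)) - 1 / (2 * sin (pi * \<nu>)) * total_sum a)"
      using singular_terms_tendsto lhs_sums_diagonal unfolding const_term_def half_csc_def by blast
  qed (intro C_term_sums(1)[of a] C_prime_term_sums(1)[of a] coeff_D_sums assms)+
qed

end
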